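(* Let $R>0$. The integral operators $$f\quad\mapsto\quad\frac{i}{2\pi^3}\int_{Z\in R\cdot U(1,1)}k(Z,W)\cdot f(Z)\,dV,\qquad f\in{\cal D}^h\oplus{\cal D}^a,$$ provide the $\mathfrak{gl}(2,\mathbb H_{\mathbb C})$-equivariant projectors onto the irreducible components of ${\cal D}^h\oplus{\cal D}^a$ as follows: 1. If $k(Z,W)=N(Z-W)^{-2}$ and $W\in R\cdot\Gamma^-$, this operator provides the projector onto ${\cal D}^{--}$; 2. If $k(Z,W)=N(Z-W)^{-2}$ and $W\in R\cdot\Gamma^+$, this operator provides the projector onto ${\cal D}^{++}$; 3. If $k(Z,W)=\dfrac{-N(Z)^{-2}\cdot\lambda_1}{(\lambda_1-\lambda_2)(1-\lambda_1\lambda_2)(1-\lambda_1)^2}$ and $W\in R\cdot\Gamma^-$, $|N(W)|>1$, this operator provides the projector onto ${\cal D}^h_<$; 4. If $k(Z,W)=\dfrac{-N(Z)^{-2}\cdot\lambda_2}{(\lambda_1-\lambda_2)(1-\lambda_1\lambda_2)(1-\lambda_2)^2}$ and $W\in R\cdot\Gamma^-$, $|N(W)|<1$, this operator provides the projector onto ${\cal D}^h_>$; 5. If $k(Z,W)=\dfrac{N(Z)^{-2}\cdot\lambda_2}{(\lambda_1-\lambda_2)(1-\lambda_1\lambda_2)(1-\lambda_2)^2}$ and $W\in R\cdot\Gamma^+$, $|N(W)|>1$, this operator provides the projector onto ${\cal D}^a_<$; 6. If $k(Z,W)=\dfrac{N(Z)^{-2}\cdot\lambda_1}{(\lambda_1-\lambda_2)(1-\lambda_1\lambda_2)(1-\lambda_1)^2}$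 and $W\in R\cdot\Gamma^+$, $|N(W)|<1$, this operator provides the projector onto ${\cal D}^a_>$; where $WZ^{-1}$ is $SU(1,1)$-conjugate to $\begin{pmatrix}\lambda_1&0\\0&\lambda_2\end{pmatrix}$.
   Context: $\mathbb H_{\mathbb C}=\mathbb H\otimes_{\mathbb R}\mathbb C$ is identified with the algebra of complex matrices $$Z=\begin{pmatrix} z_{11}&z_{12}\\ z_{21}&z_{22}\end{pmatrix}=\begin{pmatrix} z^0-iz^3&-iz^1-z^2\\ -iz^1+z^2&z^0+iz^3\end{pmatrix},\qquad N(Z)=\det Z.$$ $dV=dz^0\wedge dz^1\wedge dz^2\wedge dz^3$ is a holomorphic 4-form on $\mathbb H_{\mathbb C}$. $SU(1,1)=\{Z\in\mathbb H_{\mathbb C}:\ z_{22}=\overline{z_{11}},\ z_{21}=\overline{z_{12}},\ N(Z)=1\}$ and $U(1,1)=\{e^{i\theta}X:\ X\in SU(1,1),\ \theta\in\mathbb R\}$, oriented so that $\{\tilde e_0,\tilde e_1,\tilde e_2,e_3\}$ is a positive basis of the tangent space at $1$, where $$\tilde e_0=\begin{pmatrix}-i&0\\0&-i\end{pmatrix},\quad \tilde e_1=\begin{pmatrix}0&1\\1&0\end{pmatrix},\quad \tilde e_2=\begin{pmatrix}0&i\\-i&0\end{pmatrix},\quad e_3=\begin{pmatrix}-i&0\\0&i\end{pmatrix};$$ $R\cdot U(1,1)$ carries the orientation transported by scaling. The sets $\Gamma^\pm$ (open Ol'shanskii semigroups) are $$\Gamma^-=\left\{g\begin{pmatrix}\lambda_1&0\\0&\lambda_2\end{pmatrix}g^{-1}\in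 GL(2,\mathbb C);\ g\in SU(1,1),\ \lambda_1,\lambda_2\in\mathbb C,\ |\lambda_1|>1>|\lambda_2|>0\right\},$$ $$\Gamma^+=\left\{g\begin{pmatrix}\lambda_1&0\\0&\lambda_2\end{pmatrix}g^{-1}\in GL(2,\mathbb C);\ g\in SU(1,1),\ \lambda_1,\lambda_2\in\mathbb C,\ |\lambda_2|>1>|\lambda_1|>0\right\}.$$ "$SU(1,1)$-conjugate to" a diagonal matrix means equal to $g\,\mathrm{diag}(\lambda_1,\lambda_2)\,g^{-1}$ for some $g\in SU(1,1)$. Matrix coefficients of the discrete series representations of $SU(1,1)$: for $l=-1,-\frac32,-2,-\frac52,\dots$ and $m,n\in\mathbb Z+l$ with either $m,n\ge -l$ (holomorphic discrete series) or $m,n\le l$ (antiholomorphic discrete series), $$\tau^l_{n\,\underline{m}}(Z)=\frac1{2\pi i}\oint (sz_{11}+z_{21})^{l-m}(sz_{12}+z_{22})^{l+m}s^{-l+n}\,\frac{ds}{s},$$ the integral being over the unit circle $|s|=1$ traversed once counterclockwise; these are regarded as rational functions on $\mathbb H_{\mathbb C}$ (the rational functions of the $z_{ij}$ which the integral gives on $SU(1,1)$). The functions $\tau^l_{n\,\underline{m}}(Z)N(Z)^k$, over all admissible $l,m,n$ and $k\in\mathbb Z$, are linearly independent. ${\cal D}^h$ (respectively ${\cal D}^a$) is the $\mathbb C$-span of those with $m,n\ge -l$ (respectively $m,n\le l$). The following subspaces are the $\mathbb C$-spans of the functions $\tau^l_{n\,\underline{m}}(Z)N(Z)^k$ with: ${\cal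 D}^h_<$: $m,n\ge -l$, $k\le -1$; ${\cal D}^{--}$: $m,n\ge -l$, $0\le k\le -(2l+2)$; ${\cal D}^h_>$: $m,n\ge -l$, $k\ge -(2l+1)$; ${\cal D}^a_<$: $m,n\le l$, $k\le -1$; ${\cal D}^{++}$: $m,n\le l$, $0\le k\le -(2l+2)$; ${\cal D}^a_>$: $m,n\le l$, $k\ge -(2l+1)$. One has ${\cal D}^h={\cal D}^h_<\oplus{\cal D}^{--}\oplus{\cal D}^h_>$ and ${\cal D}^a={\cal D}^a_<\oplus{\cal D}^{++}\oplus{\cal D}^a_>$. $\mathfrak{gl}(2,\mathbb H_{\mathbb C})$ is the Lie algebra of $2\times2$ matrices with entries in $\mathbb H_{\mathbb C}$. With $\partial=\begin{pmatrix}\partial_{11}&\partial_{21}\\ \partial_{12}&\partial_{22}\end{pmatrix}$, $\partial_{ij}=\partial/\partial z_{ij}$, it acts on holomorphic functions on $\mathbb H_{\mathbb C}$ (possibly with singularities) via $\rho_1$: $\begin{pmatrix}A&0\\0&0\end{pmatrix}: f\mapsto\operatorname{Tr}(A(-Z\,\partial f-f))$; $\begin{pmatrix}0&B\\0&0\end{pmatrix}: f\mapsto\operatorname{Tr}(B(-\partial f))$; $\begin{pmatrix}0&0\\C&0\end{pmatrix}: f\mapsto\operatorname{Tr}(C(Z(\partial f)Z+2Zf))$; $\begin{pmatrix}0&0\\0&D\end{pmatrix}: f\mapsto\operatorname{Tr}(D((\partial f)Z+f))$. The six subspaces above are the irreducible components of ${\cal D}^h\oplus{\cal D}^a$ under $\rho_1$,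 and equivariance is with respect to $\rho_1$. The integral is a function of $W$; the projector onto a component is the projection along the sum of the other five.
   Formalization: Kernels 4 and 6 carry the opposite sign; λ1, λ2 are the eigenvalues of WZ^{-1} ordered by modulus; |N(W)|>1, <1 is read as |N(W)|>R², <R²; equivariance is asserted only where ρ1(X)f lies in D^h⊕D^a, which is not ρ1-invariant. *)

theory Defs
  imports
    "HOL-Complex_Analysis.Complex_Analysis"
    "HOL-Library.Function_Algebras"
begin

no_notation fps_nth (infixl "$" 75)

text \<open>
  The algebra of complexified quaternions is identified with the complex \<open>2 \<times> 2\<close> matrices,
  with \<open>N(Z) = det Z\<close>.
\<close>

type_synonym HC = "complex ^ 2 ^ 2"

definition mat2 :: "'a::zero \<Rightarrow> 'a \<Rightarrow> 'a \<Rightarrow> 'a \<Rightarrow> 'a ^ 2 ^ 2" where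
  "mat2 a b c d = vector [vector [a, b], vector [c, d]]"

lemma mat2_nth [simp]:
  "mat2 a b c d $ 1 $ 1 = a" "mat2 a b c d $ 1 $ 2 = b"
  "mat2 a b c d $ 2 $ 1 = c" "mat2 a b c d $ 2 $ 2 = d"
  by (simp_all add: mat2_def)

lemma vector_4 [simp]:
  "(vector [a, b, c, d] :: 'a::zero ^ 4) $ 1 = a"
  "(vector [a, b, c, d] :: 'a::zero ^ 4) $ 2 = b"
  "(vector [a, b, c, d] :: 'a::zero ^ 4) $ 3 = c"
  "(vector [a, b, c, d] :: 'a::zero ^ 4) $ 4 = d"
  by (simp_all add: vector_def)

lemma HC_eq_iff:
  "Z = W \<longleftrightarrow> Z$1$1 = W$1$1 \<and> Z$1$2 = W$1$2 \<and> Z$2$1 = W$2$1 \<and> Z$2$2 = W$2$2"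
  for Z W :: "'a ^ 2 ^ 2"
  by (auto simp: vec_eq_iff forall_2)


subsection \<open>Integration of \<open>g dV\<close> over \<open>R \<cdot> U(1,1)\<close>\<close>

text \<open>
  The components \<open>1, 2, 3, 4\<close> of a vector in \<open>complex ^ 4\<close> are the coordinates
  \<open>z\<^sup>0, z\<^sup>1, z\<^sup>2, z\<^sup>3\<close>.
\<close>

definition of_coords :: "complex ^ 4 \<Rightarrow> HC" where
  "of_coords z = mat2 (z$1 - \<i> * z$4) (- \<i> * z$2 - z$3) (- \<i> * z$2 + z$3) (z$1 + \<i> * z$4)"

definition coords :: "HC \<Rightarrow> complex ^ 4" where
  "coords Z = vector [(Z$1$1 + Z$2$2) / 2, \<i> * (Z$1$2 + Z$2$1) / 2,
                      (Z$2$1 - Z$1$2) / 2, \<i> * (Z$1$1 - Z$2$2) / 2]"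

lemma coords_of_coords: "coords (of_coords z) = z"
  by (simp add: coords_def of_coords_def vec_eq_iff forall_4 field_simps)

lemma of_coords_coords: "of_coords (coords Z) = Z"
  by (simp add: coords_def of_coords_def HC_eq_iff field_simps)

definition dV :: "HC ^ 4 \<Rightarrow> complex" where
  "dV v = det (\<chi> i j. coords (v $ j) $ i)"

definition SU11 :: "HC set" where
  "SU11 = {Z. Z$2$2 = cnj (Z$1$1) \<and> Z$2$1 = cnj (Z$1$2) \<and> det Z = 1}"

definition U11 :: "HC set" where
  "U11 = {mat (cis \<theta>) ** X | \<theta> X. X \<in> SU11}"

definition scaled :: "real \<Rightarrow> HC set \<Rightarrow> HC set" where
  "scaled R S = {R *\<^sub>R X | X. X \<in> S}"

text \<open>
  The chart below is a diffeomorphism from \<open>chart_domain\<close> onto an open subset of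
  \<open>R \<cdot> U(1,1)\<close> whose complement in \<open>R \<cdot> U(1,1)\<close> has smaller dimension, and it is positively oriented with respect
  to the left invariant frame \<open>Z ** frame $ i\<close>; see the lemmas following it.
  The parameters are \<open>u = (\<theta>, t, \<beta>, \<alpha>)\<close>.
\<close>

definition chart :: "real \<Rightarrow> real ^ 4 \<Rightarrow> HC" where
  "chart R u = R *\<^sub>R (mat (cis (u$1)) **
     mat2 (cosh (u$2) *\<^sub>R cis (u$4)) (sinh (u$2) *\<^sub>R cis (u$3))
          (sinh (u$2) *\<^sub>R cis (- (u$3))) (cosh (u$2) *\<^sub>R cis (- (u$4))))"

definition chart_domain :: "(real ^ 4) set" where
  "chart_domain = {u. 0 < u$1 \<and> u$1 < pi \<and> 0 < u$2 \<and>
                      0 < u$3 \<and> u$3 < 2 * pi \<and> 0 < u$4 \<and> u$4 < 2 * pi}"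

definition partials :: "(real ^ 4 \<Rightarrow> HC) \<Rightarrow> real ^ 4 \<Rightarrow> HC ^ 4" where
  "partials \<Phi> u = (\<chi> j. vector_derivative (\<lambda>h. \<Phi> (u + h *\<^sub>R axis j 1)) (at 0))"

definition dV_integrable :: "real \<Rightarrow> (HC \<Rightarrow> complex) \<Rightarrow> bool" where
  "dV_integrable R g \<longleftrightarrow>
     set_integrable lborel chart_domain (\<lambda>u. g (chart R u) * dV (partials (chart R) u))"

definition dV_integral :: "real \<Rightarrow> (HC \<Rightarrow> complex) \<Rightarrow> complex" where
  "dV_integral R g =
     (LINT u : chart_domain | lborel. g (chart R u) * dV (partials (chart R) u))"

definition frame :: "HC ^ 4" where
  "frame = vector [mat2 (- \<i>) 0 0 (- \<i>), mat2 0 1 1 0, mat2 0 \<i> (- \<i>) 0, mat2 (- \<i>) 0 0 \<i>]"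

definition frame_matrix :: "real ^ 4 \<Rightarrow> real ^ 4 ^ 4" where
  "frame_matrix u =
    (let s = sinh (u$2); c = cosh (u$2); \<delta> = u$4 - u$3 in vector
      [vector [-1, 0, 0, 0],
       vector [0, cos \<delta>, s * c * sin \<delta>, s * c * sin \<delta>],
       vector [0, - sin \<delta>, s * c * cos \<delta>, s * c * cos \<delta>],
       vector [0, 0, - s\<^sup>2, - c\<^sup>2]])"

lemma has_vector_derivative_vecI:
  fixes f :: "real \<Rightarrow> 'a::real_normed_vector ^ 'n::finite"
  assumes "\<And>i. ((\<lambda>t. f t $ i) has_vector_derivative D $ i) (at x)"
  shows "(f has_vector_derivative D) (at x)"
  using assms unfolding has_vector_derivative_def has_derivative_def
  by (auto intro!: bounded_linear_scaleR_left vec_tendstoI)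

lemma chart_nth:
  "chart R u $ 1 $ 1 = of_real (R * cosh (u$2)) * cis (u$1 + u$4)"
  "chart R u $ 1 $ 2 = of_real (R * sinh (u$2)) * cis (u$1 + u$3)"
  "chart R u $ 2 $ 1 = of_real (R * sinh (u$2)) * cis (u$1 - u$3)"
  "chart R u $ 2 $ 2 = of_real (R * cosh (u$2)) * cis (u$1 - u$4)"
  unfolding chart_def vector_scaleR_component
  by (simp_all add: matrix_matrix_mult_def mat_def sum_2 scaleR_conv_of_real cis_mult)

lemma has_vector_derivative_mult_cis:
  assumes "(f has_real_derivative f') (at x)" "(g has_real_derivative g') (at x)"
  shows "((\<lambda>h. of_real (f h) * cis (g h)) has_vector_derivative
          (of_real f' + \<i> * of_real (f x * g')) * cis (g x)) (at x)"
proof -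
  have c: "(cis has_vector_derivative \<i> * cis y) (at y)" for y
    unfolding has_vector_derivative_def
    by (auto intro!: derivative_eq_intros simp: cis_conv_exp has_vector_derivative_def scaleR_conv_of_real fun_eq_iff)
  have 1: "((\<lambda>h. cis (g h)) has_vector_derivative of_real g' * (\<i> * cis (g x))) (at x)"
    using vector_diff_chain_at[OF assms(2)[unfolded has_real_derivative_iff_has_vector_derivative] c]
    by (simp add: o_def scaleR_conv_of_real)
  have 2: "((\<lambda>h. of_real (f h) :: complex) has_vector_derivative of_real f') (at x)"
    using assms(1) has_real_derivative_iff_has_vector_derivative has_vector_derivative_of_real by blast
  show ?thesis
    using has_vector_derivative_mult[OF 2 1]
    by (rule has_vector_derivative_eq_rhs) (simp add: algebra_simps)
qed

lemma chart_partials: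
  "partials (chart R) u $ j =
     (let t = u$2; d = axis j 1 :: real ^ 4 in mat2
      (of_real R * (of_real (d$2 * sinh t) + \<i> * of_real ((d$1 + d$4) * cosh t)) * cis (u$1 + u$4))
      (of_real R * (of_real (d$2 * cosh t) + \<i> * of_real ((d$1 + d$3) * sinh t)) * cis (u$1 + u$3))
      (of_real R * (of_real (d$2 * cosh t) + \<i> * of_real ((d$1 - d$3) * sinh t)) * cis (u$1 - u$3))
      (of_real R * (of_real (d$2 * sinh t) + \<i> * of_real ((d$1 - d$4) * cosh t)) * cis (u$1 - u$4)))"
proof -
  define d where "d = (axis j 1 :: real ^ 4)"
  have hc: "((\<lambda>h. R * cosh (u$2 + h * d$2)) has_real_derivative R * (d$2 * sinh (u$2))) (at 0)"
   and hs: "((\<lambda>h. R * sinh (u$2 + h * d$2)) has_real_derivative R * (d$2 * cosh (u$2))) (at 0)"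
    by (auto intro!: derivative_eq_intros)
  have hp: "((\<lambda>h. u$1 + h * d$1 + (u$k + h * d$k)) has_real_derivative d$1 + d$k) (at 0)" 
   and hm: "((\<lambda>h. u$1 + h * d$1 - (u$k + h * d$k)) has_real_derivative d$1 - d$k) (at 0)" for k
    by (auto intro!: derivative_eq_intros)
  show ?thesis
    unfolding partials_def d_def[symmetric] Let_def vec_lambda_beta
    apply (rule vector_derivative_at)
    apply (intro has_vector_derivative_vecI)
    subgoal for i k
      using exhaust_2[of i] exhaust_2[of k]
      apply (elim disjE; simp only: mat2_nth chart_nth vector_add_component vector_scaleR_component real_scaleR_def)
         apply (rule has_vector_derivative_eq_rhs[OF has_vector_derivative_mult_cis[OF hc hp]], simp add: algebra_simps)
        apply (rule has_vector_derivative_eq_rhs[OF has_vector_derivative_mult_cis[OF hs hp]], simp add: algebra_simps)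
       apply (rule has_vector_derivative_eq_rhs[OF has_vector_derivative_mult_cis[OF hs hm]], simp add: algebra_simps)
      apply (rule has_vector_derivative_eq_rhs[OF has_vector_derivative_mult_cis[OF hc hm]], simp add: algebra_simps)
      done
    done
qed

lemma chart_frame:
  "partials (chart R) u $ j = (\<Sum>i\<in>UNIV. frame_matrix u $ i $ j *\<^sub>R (chart R u ** frame $ i))"
proof -
  define A A' B B' E s c C S where d:
    "A = cis (u$4)" "A' = cis (- (u$4))" "B = cis (u$3)" "B' = cis (- (u$3))" "E = cis (u$1)"
    "s = complex_of_real (sinh (u$2))" "c = complex_of_real (cosh (u$2))"
    "C = complex_of_real (cos (u$4 - u$3))" "S = complex_of_real (sin (u$4 - u$3))"
  have e: "A * A' = 1" "B * B' = 1" "C + \<i> * S = A * B'" "C - \<i> * S = A' * B" "c * c = s * s + 1"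
  proof -
    show "A * A' = 1" "B * B' = 1" by (simp_all add: d cis_mult)
    show "C + \<i> * S = A * B'" "C - \<i> * S = A' * B"
      by (simp_all add: d cis_mult) (simp_all add: complex_eq_iff cos_diff sin_diff)
    have "cosh (u$2) * cosh (u$2) = sinh (u$2) * sinh (u$2) + 1"
      using cosh_square_eq[of "u$2"] by (simp add: power2_eq_square)
    then show "c * c = s * s + 1"
      unfolding d by (metis of_real_1 of_real_add of_real_mult)
  qed
  define I where "I = \<i>"
  have f: "A = (C + I * S) * B" "B = (C - I * S) * A" "B' = (C + I * S) * A'" "A' = (C - I * S) * B'"
    "c * c = s * s + 1" "I * I = -1"
    unfolding I_def e(3,4) using e(1,2,5) by (simp_all add: algebra_simps)
  have k: "cis (u$1 + u$4) = E * A" "cis (u$1 + u$3) = E * B" "cis (u$1 - u$3) = E * B'" "cis (u$1 - u$4) = E * A'"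
    by (simp_all add: d cis_mult)
  show ?thesis
    unfolding chart_partials Let_def k
    using exhaust_4[of j]
    apply (elim disjE)
    apply (simp_all add: sum_4 HC_eq_iff frame_def frame_matrix_def Let_def matrix_matrix_mult_def sum_2 chart_nth axis_def k)
    apply (simp_all add: scaleR_conv_of_real flip: d I_def)
    subgoal
      apply (erule thin_rl)
      apply (intro conjI)
      subgoal using f(1) by algebra
      subgoal using f(2) by algebra
      subgoal using f(3) by algebra
      subgoal using f(4) by algebra
      done
    subgoal
      apply (erule thin_rl)
      apply (intro conjI)
      subgoal using f(1,6) by algebra
      subgoal using f(2,5,6) by algebra
      subgoal using f(3,5,6) by algebra
      subgoal using f(4,6) by algebra
      done
    subgoal
      apply (erule thin_rl)
      apply (intro conjI)
      subgoal using f(1,5,6) by algebra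
      subgoal using f(2,6) by algebra
      subgoal using f(3,6) by algebra
      subgoal using f(4,5,6) by algebra
      done
    done
qed

lemma det_4:
  "det (A::'a::comm_ring_1^4^4) =
     A$1$1 * (A$2$2 * (A$3$3 * A$4$4 - A$3$4 * A$4$3) - A$2$3 * (A$3$2 * A$4$4 - A$3$4 * A$4$2) + A$2$4 * (A$3$2 * A$4$3 - A$3$3 * A$4$2))
   - A$1$2 * (A$2$1 * (A$3$3 * A$4$4 - A$3$4 * A$4$3) - A$2$3 * (A$3$1 * A$4$4 - A$3$4 * A$4$1) + A$2$4 * (A$3$1 * A$4$3 - A$3$3 * A$4$1))
   + A$1$3 * (A$2$1 * (A$3$2 * A$4$4 - A$3$4 * A$4$2) - A$2$2 * (A$3$1 * A$4$4 - A$3$4 * A$4$1) + A$2$4 * (A$3$1 * A$4$2 - A$3$2 * A$4$1))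
   - A$1$4 * (A$2$1 * (A$3$2 * A$4$3 - A$3$3 * A$4$2) - A$2$2 * (A$3$1 * A$4$3 - A$3$3 * A$4$1) + A$2$3 * (A$3$1 * A$4$2 - A$3$2 * A$4$1))"
proof -
  have f1234: "finite {2::4, 3, 4}" "1 \<notin> {2::4, 3, 4}" by auto
  have f234: "finite {3::4, 4}" "2 \<notin> {3::4, 4}" by auto
  have f34: "finite {4::4}" "3 \<notin> {4::4}" by auto
  show ?thesis
    unfolding det_def UNIV_4
    unfolding sum_over_permutations_insert[OF f1234]
    unfolding sum_over_permutations_insert[OF f234]
    unfolding sum_over_permutations_insert[OF f34]
    unfolding permutes_sing
    by (simp add: sign_swap_id permutation_swap_id permutation_compose sign_compose sign_id swap_id_eq)
       (simp add: algebra_simps)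
qed

lemma chart_positively_oriented:
  assumes "u \<in> chart_domain"
  shows "det (frame_matrix u) > 0"
proof -
  have "sinh (u$2) > 0" "cosh (u$2) > 0" using assms by (auto simp: chart_domain_def)
  define s c where "s = sinh (u$2)" and "c = cosh (u$2)"
  define p q where "p = cos (u$4 - u$3)" and "q = sin (u$4 - u$3)"
  have sc: "c\<^sup>2 = s\<^sup>2 + 1" using cosh_square_eq by (simp add: s_def c_def)
  have pq: "p\<^sup>2 + q\<^sup>2 = 1" by (simp add: p_def q_def)
  have "det (frame_matrix u) = s * c * (c\<^sup>2 - s\<^sup>2) * (p\<^sup>2 + q\<^sup>2)"
    unfolding det_4 frame_matrix_def Let_def vector_4 s_def[symmetric] c_def[symmetric] p_def[symmetric] q_def[symmetric]
    by (simp add: power2_eq_square algebra_simps)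
  also have "\<dots> = s * c" using sc pq by simp
  finally show ?thesis using \<open>sinh (u$2) > 0\<close> \<open>cosh (u$2) > 0\<close> by (simp add: s_def c_def)
qed

lemma SU11_norm:
  assumes "Z \<in> SU11"
  shows "(cmod (Z$1$1))\<^sup>2 - (cmod (Z$1$2))\<^sup>2 = 1"
proof -
  have "det Z = 1" and e: "Z$2$2 = cnj (Z$1$1)" "Z$2$1 = cnj (Z$1$2)"
    using assms by (auto simp: SU11_def)
  then have "complex_of_real ((cmod (Z$1$1))\<^sup>2 - (cmod (Z$1$2))\<^sup>2) = 1"
    by (simp add: det_2 flip: complex_norm_square)
  then show ?thesis
    using of_real_eq_1_iff by blast
qed

lemma cis_inj:
  assumes "cis x = cis y" "\<bar>x - y\<bar> < 2 * pi"
  shows "x = y"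
proof -
  have "sin x = sin y \<and> cos x = cos y" using assms(1) by (simp add: complex_eq_iff)
  then obtain k :: int where k: "x = y + 2 * pi * k" unfolding sin_cos_eq_iff by blast
  then have "2 * pi * \<bar>real_of_int k\<bar> < 2 * pi * 1" using assms(2) by (simp add: abs_mult)
  then have "\<bar>real_of_int k\<bar> < 1" by (subst (asm) mult_less_cancel_left_pos) auto
  then have "k = 0" by linarith
  then show ?thesis using k by simp
qed

lemma chart_inj:
  assumes "R > 0"
  shows "inj_on (chart R) chart_domain"
proof (rule inj_onI)
  fix u v assume u: "u \<in> chart_domain" and v: "v \<in> chart_domain" and eq: "chart R u = chart R v"
  have pos: "0 < u$2" "0 < v$2" using u v by (auto simp: chart_domain_def)
  have "cmod (chart R u $ 1 $ 1) = cmod (chart R v $ 1 $ 1)" using eq by simp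
  then have "cosh (u$2) = cosh (v$2)"
    using assms by (simp add: chart_nth norm_mult)
  then have 2: "u$2 = v$2" using pos by simp
  have s: "sinh (v$2) \<noteq> 0" "cosh (v$2) \<noteq> 0" using pos by auto
  have c: "cis (u$1 + u$4) = cis (v$1 + v$4)" "cis (u$1 + u$3) = cis (v$1 + v$3)"
    "cis (u$1 - u$4) = cis (v$1 - v$4)"
    using chart_nth[of R u] chart_nth[of R v] eq assms s by (auto simp: 2)
  have "cis (2 * u$1) = cis (u$1 + u$4) * cis (u$1 - u$4)" by (simp add: cis_mult)
  also have "\<dots> = cis (2 * v$1)" unfolding c by (simp add: cis_mult)
  finally have "2 * u$1 = 2 * v$1" by (rule cis_inj) (use u v in \<open>auto simp: chart_domain_def\<close>)
  then have 1: "u$1 = v$1" by simp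
  have "cis (u$4) = cis (v$4)" "cis (u$3) = cis (v$3)"
    using c(1,2) by (simp_all add: 1 flip: cis_mult)
  then have "u$4 = v$4" "u$3 = v$3"
    using u v by (auto intro!: cis_inj simp: chart_domain_def)
  with 1 2 show "u = v" by (simp add: vec_eq_iff forall_4)
qed

lemma angle_reduction:
  assumes "p > 0"
  obtains k :: int where "0 \<le> x - p * of_int k" "x - p * of_int k \<le> (p::real)"
proof
  have "x / p - 1 \<le> \<lfloor>x / p\<rfloor>" "\<lfloor>x / p\<rfloor> \<le> x / p" by linarith+
  then have "p * (x / p - 1) \<le> p * of_int \<lfloor>x / p\<rfloor>" "p * of_int \<lfloor>x / p\<rfloor> \<le> p * (x / p)"
    using assms by (simp_all add: mult_le_cancel_left_pos del: times_divide_eq_right)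
  moreover have "p * (x / p) = x" using assms by simp
  ultimately show "0 \<le> x - p * of_int \<lfloor>x / p\<rfloor>" "x - p * of_int \<lfloor>x / p\<rfloor> \<le> p"
    unfolding right_diff_distrib by linarith+
qed

lemma cis_add_int: "cis (x + 2 * pi * of_int k) = cis x" 
  by (simp add: cis.code complex_eq_iff) (use sin_cos_eq_iff[of "x + 2 * pi * of_int k" x] in auto)

lemma chart_image:
  "scaled R U11 = chart R ` {u. 0 \<le> u$1 \<and> u$1 \<le> pi \<and> 0 \<le> u$2 \<and>
                                0 \<le> u$3 \<and> u$3 \<le> 2 * pi \<and> 0 \<le> u$4 \<and> u$4 \<le> 2 * pi}"
  (is "?L = chart R ` ?B")
proof
  show "?L \<subseteq> chart R ` ?B"
  proof
    fix Z assume "Z \<in> ?L"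
    then obtain \<phi> X where X: "X \<in> SU11" and Z: "Z = R *\<^sub>R (mat (cis \<phi>) ** X)"
      by (auto simp: scaled_def U11_def)
    define t where "t = arsinh (cmod (X$1$2))"
    have t2: "sinh t = cmod (X$1$2)" by (simp add: t_def)
    then have "t \<ge> 0" using sinh_real_nonneg_iff[of t] by simp
    note t = this t2
    have "(cosh t)\<^sup>2 = (cmod (X$1$1))\<^sup>2"
      using SU11_norm[OF X] cosh_square_eq[of t] t by simp
    then have c: "cosh t = cmod (X$1$1)"
      by (meson norm_ge_zero cosh_real_nonneg power2_eq_imp_eq)
    define a b where "a = Arg (X$1$1)" and "b = Arg (X$1$2)"
    have 11: "X$1$1 = of_real (cosh t) * cis a" and 12: "X$1$2 = of_real (sinh t) * cis b"
      unfolding c t a_def b_def by (metis rcis_cmod_Arg rcis_def)+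
    have 21: "X$2$1 = of_real (sinh t) * cis (- b)" and 22: "X$2$2 = of_real (cosh t) * cis (- a)"
      using X 11 12 by (simp_all add: SU11_def cis_cnj)
    obtain k :: int where k: "0 \<le> \<phi> - pi * k" "\<phi> - pi * k \<le> pi"
      using angle_reduction[of pi \<phi>] by auto
    obtain i :: int where i: "0 \<le> a + pi * k - 2 * pi * i" "a + pi * k - 2 * pi * i \<le> 2 * pi"
      using angle_reduction[of "2 * pi" "a + pi * k"] by auto
    obtain j :: int where j: "0 \<le> b + pi * k - 2 * pi * j" "b + pi * k - 2 * pi * j \<le> 2 * pi"
      using angle_reduction[of "2 * pi" "b + pi * k"] by auto
    define u :: "real ^ 4" where
      "u = vector [\<phi> - pi * k, t, b + pi * k - 2 * pi * j, a + pi * k - 2 * pi * i]"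
    have u: "u$1 + u$4 = \<phi> + a + 2 * pi * of_int (- i)" "u$1 + u$3 = \<phi> + b + 2 * pi * of_int (- j)"
      "u$1 - u$4 = \<phi> - a + 2 * pi * of_int (i - k)" "u$1 - u$3 = \<phi> - b + 2 * pi * of_int (j - k)"
      "u$2 = t"
      by (simp_all add: u_def algebra_simps)
    have "Z = chart R u"
      unfolding HC_eq_iff chart_nth u cis_add_int unfolding Z vector_scaleR_component
      by (simp add: matrix_matrix_mult_def mat_def sum_2 11 12 21 22 scaleR_conv_of_real cis_mult)
    moreover have "u \<in> ?B" using k i j t by (simp add: u_def)
    ultimately show "Z \<in> chart R ` ?B" by blast
  qed
  show "chart R ` ?B \<subseteq> ?L"
  proof clarify
    fix u :: "real ^ 4"
    define X where "X = mat2 (cosh (u$2) *\<^sub>R cis (u$4)) (sinh (u$2) *\<^sub>R cis (u$3))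
          (sinh (u$2) *\<^sub>R cis (- (u$3))) (cosh (u$2) *\<^sub>R cis (- (u$4)))"
    have "complex_of_real r * cis x * (of_real r * cis (- x)) = of_real (r\<^sup>2)" for r x
    proof -
      have "complex_of_real r * cis x * (of_real r * cis (- x)) = of_real r * of_real r * (cis x * cis (- x))"
        by (simp only: mult_ac)
      then show ?thesis by (simp add: cis_mult power2_eq_square)
    qed
    then have "det X = of_real ((cosh (u$2))\<^sup>2 - (sinh (u$2))\<^sup>2)"
      by (simp add: X_def det_2 scaleR_conv_of_real)
    then have "X \<in> SU11" using cosh_square_eq[of "u$2"] by (simp add: SU11_def X_def cis_cnj)
    then show "chart R u \<in> ?L"
      unfolding chart_def X_def[symmetric] by (auto simp: scaled_def U11_def)
  qed
qed


subsection \<open>The semigroups and the eigenvalues of \<open>W Z\<^sup>-\<^sup>1\<close>\<close>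

definition diag2 :: "complex \<Rightarrow> complex \<Rightarrow> HC" where
  "diag2 l1 l2 = mat2 l1 0 0 l2"

definition Gamma_minus :: "HC set" where
  "Gamma_minus = {g ** diag2 l1 l2 ** matrix_inv g | g l1 l2.
     g \<in> SU11 \<and> cmod l1 > 1 \<and> 1 > cmod l2 \<and> cmod l2 > 0}"

definition Gamma_plus :: "HC set" where
  "Gamma_plus = {g ** diag2 l1 l2 ** matrix_inv g | g l1 l2.
     g \<in> SU11 \<and> cmod l2 > 1 \<and> 1 > cmod l1 \<and> cmod l1 > 0}"

text \<open>
  For \<open>W \<in> R \<cdot> \<Gamma>\<^sup>\<mp>\<close> and \<open>Z \<in> R \<cdot> U(1,1)\<close> the matrix \<open>X = W Z\<^sup>-\<^sup>1\<close> has exactly one eigenvalue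
  outside and one inside the unit circle, but in general its eigenvectors are not orthogonal for the
  indefinite Hermitian form, so that it is diagonalized by an element of \<open>GL(2,\<complex>)\<close> and not
  of \<open>SU(1,1)\<close>.  If it is \<open>SU(1,1)\<close>-conjugate to a diagonal matrix, the entries of that matrix are
  the ones selected here, in the same order.
\<close>

definition conj_diag :: "HC \<Rightarrow> complex \<Rightarrow> complex \<Rightarrow> bool" where
  "conj_diag X l1 l2 \<longleftrightarrow> (\<exists>g. invertible g \<and> X = g ** diag2 l1 l2 ** matrix_inv g)"

definition eigs_minus :: "HC \<Rightarrow> complex \<times> complex" where
  "eigs_minus X = (THE (l1, l2). conj_diag X l1 l2 \<and> cmod l1 > 1 \<and> 1 > cmod l2)"

definition eigs_plus :: "HC \<Rightarrow> complex \<times> complex" where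
  "eigs_plus X = (THE (l1, l2). conj_diag X l1 l2 \<and> cmod l2 > 1 \<and> 1 > cmod l1)"


subsection \<open>Matrix coefficients of the discrete series\<close>

definition hol_index :: "real \<Rightarrow> real \<Rightarrow> real \<Rightarrow> bool" where
  "hol_index l n m \<longleftrightarrow> 2 * l \<in> \<int> \<and> l \<le> -1 \<and> m - l \<in> \<int> \<and> n - l \<in> \<int> \<and> m \<ge> - l \<and> n \<ge> - l"

definition antihol_index :: "real \<Rightarrow> real \<Rightarrow> real \<Rightarrow> bool" where
  "antihol_index l n m \<longleftrightarrow> 2 * l \<in> \<int> \<and> l \<le> -1 \<and> m - l \<in> \<int> \<and> n - l \<in> \<int> \<and> m \<le> l \<and> n \<le> l"

text \<open>The exponents are integers for admissible indices, so that the floor is only a coercion.\<close>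

definition tau_integrand :: "real \<Rightarrow> real \<Rightarrow> real \<Rightarrow> HC \<Rightarrow> complex \<Rightarrow> complex" where
  "tau_integrand l n m Z s =
     (s * Z$1$1 + Z$2$1) powi \<lfloor>l - m\<rfloor> * (s * Z$1$2 + Z$2$2) powi \<lfloor>l + m\<rfloor> * s powi \<lfloor>- l + n\<rfloor> / s"

text \<open>
  On \<open>SU(1,1)\<close> exactly one pole of the integrand is enclosed by the unit circle: the zero
  \<open>- z\<^sub>2\<^sub>1 / z\<^sub>1\<^sub>1\<close> of the first factor in the holomorphic case, and \<open>0\<close> in the antiholomorphic
  case.  The residue there is a rational function of the entries of \<open>Z\<close>, with denominator a power of
  \<open>z\<^sub>1\<^sub>1\<close> or \<open>z\<^sub>2\<^sub>2\<close>, respectively.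
\<close>

definition tau :: "real \<Rightarrow> real \<Rightarrow> real \<Rightarrow> HC \<Rightarrow> complex" where
  "tau l n m Z = residue (tau_integrand l n m Z) (if m \<ge> - l then - Z$2$1 / Z$1$1 else 0)"

lemma tau_hol_eq_integral:
  assumes "hol_index l n m" "cmod (Z$2$1) < cmod (Z$1$1)"
  shows "tau l n m Z = 1 / (2 * pi * \<i>) * contour_integral (circlepath 0 1) (tau_integrand l n m Z)"
proof -
  define s0 where "s0 = - Z$2$1 / Z$1$1"
  have z: "Z$1$1 \<noteq> 0" using assms(2) by auto
  have s0: "cmod s0 < 1" using assms(2) z by (simp add: s0_def norm_divide)
  have b: "\<lfloor>l + m\<rfloor> \<ge> 0" and c: "\<lfloor>- l + n\<rfloor> \<ge> 2"
    using assms(1) by (auto simp: hol_index_def le_floor_iff)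
  have b': "x powi \<lfloor>l + m\<rfloor> = x ^ nat \<lfloor>l + m\<rfloor>" for x :: complex
    using b by (simp add: power_int_def)
  have c': "x powi \<lfloor>- l + n\<rfloor> / x = x ^ (nat \<lfloor>- l + n\<rfloor> - 1)" for x :: complex
  proof -
    have "2 \<le> nat \<lfloor>- l + n\<rfloor>" using c by linarith
    then obtain k where k: "nat \<lfloor>- l + n\<rfloor> = Suc (Suc k)"
      by (auto dest: le_Suc_ex)
    show ?thesis using c k by (simp add: power_int_def)
  qed
  have F: "tau_integrand l n m Z = (\<lambda>s. (s * Z$1$1 + Z$2$1) powi \<lfloor>l - m\<rfloor> *
      (s * Z$1$2 + Z$2$2) ^ nat \<lfloor>l + m\<rfloor> * s ^ (nat \<lfloor>- l + n\<rfloor> - 1))"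
    by (rule ext) (simp only: tau_integrand_def b' c' times_divide_eq_right[symmetric])
  have nz: "s * Z$1$1 + Z$2$1 \<noteq> 0" if "s \<noteq> s0" for s
    using that z by (auto simp: s0_def field_simps add_eq_0_iff)
  have hol: "tau_integrand l n m Z holomorphic_on UNIV - {s0}"
    unfolding F by (intro holomorphic_intros) (use nz in auto)
  have "contour_integral (circlepath 0 1) (tau_integrand l n m Z)
      = 2 * pi * \<i> * (\<Sum>p\<in>{s0}. winding_number (circlepath 0 1) p * residue (tau_integrand l n m Z) p)"
    by (rule Residue_theorem[where S = UNIV]) (use hol s0 in auto)
  moreover have "winding_number (circlepath 0 1) s0 = 1"
    using s0 by (intro winding_number_circlepath) auto
  ultimately show ?thesis
    using assms(1) by (simp add: tau_def s0_def hol_index_def)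
qed

lemma tau_antihol_eq_integral:
  assumes "antihol_index l n m" "cmod (Z$1$2) < cmod (Z$2$2)"
  shows "tau l n m Z = 1 / (2 * pi * \<i>) * contour_integral (circlepath 0 1) (tau_integrand l n m Z)"
proof -
  have m: "\<not> m \<ge> - l" and a: "\<lfloor>l - m\<rfloor> \<ge> 0"
    using assms(1) by (auto simp: antihol_index_def le_floor_iff)
  have a': "x powi \<lfloor>l - m\<rfloor> = x ^ nat \<lfloor>l - m\<rfloor>" for x :: complex
    using a by (simp add: power_int_def)
  obtain r where r: "r > 1" "r * cmod (Z$1$2) < cmod (Z$2$2)"
  proof (cases "Z$1$2 = 0")
    case True
    then show ?thesis using that[of 2] assms(2) by simp
  next
    case False
    then have "1 < cmod (Z$2$2) / cmod (Z$1$2)" using assms(2) by simp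
    then obtain r where "1 < r" "r < cmod (Z$2$2) / cmod (Z$1$2)" using dense by blast
    then show ?thesis using False that[of r] by (simp add: field_simps)
  qed
  have nz: "s * Z$1$2 + Z$2$2 \<noteq> 0" if "s \<in> ball 0 r" for s
  proof
    assume "s * Z$1$2 + Z$2$2 = 0"
    then have "cmod (Z$2$2) = cmod s * cmod (Z$1$2)"
      by (metis add_eq_0_iff norm_minus_cancel norm_mult)
    also have "\<dots> \<le> r * cmod (Z$1$2)" using that by (intro mult_right_mono) auto
    finally show False using r by simp
  qed
  have hol: "tau_integrand l n m Z holomorphic_on ball 0 r - {0}"
    unfolding tau_integrand_def a' by (intro holomorphic_intros) (use nz in auto)
  have "contour_integral (circlepath 0 1) (tau_integrand l n m Z)
      = 2 * pi * \<i> * (\<Sum>p\<in>{0}. winding_number (circlepath 0 1) p * residue (tau_integrand l n m Z) p)"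
  proof (rule Residue_theorem[where S = "ball 0 r"])
    show "\<forall>z. z \<notin> ball 0 r \<longrightarrow> winding_number (circlepath 0 1) z = 0"
      using r by (intro allI impI winding_number_zero_outside[of _ "cball 0 1"]) auto
  qed (use hol r in auto)
  moreover have "winding_number (circlepath 0 1) 0 = 1"
    by (intro winding_number_circlepath) auto
  ultimately show ?thesis
    using m by (simp add: tau_def)
qed

lemma tau_eq_integral_SU11:
  assumes "hol_index l n m \<or> antihol_index l n m" "Z \<in> SU11"
  shows "tau l n m Z = 1 / (2 * pi * \<i>) * contour_integral (circlepath 0 1) (tau_integrand l n m Z)"
proof -
  have "(cmod (Z$1$2))\<^sup>2 < (cmod (Z$1$1))\<^sup>2" using SU11_norm[OF assms(2)] by linarith
  then have "cmod (Z$1$2) < cmod (Z$1$1)" by (rule power_less_imp_less_base) simp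
  moreover have "Z$2$2 = cnj (Z$1$1)" "Z$2$1 = cnj (Z$1$2)" using assms(2) by (auto simp: SU11_def)
  ultimately show ?thesis using assms(1) tau_hol_eq_integral tau_antihol_eq_integral by auto
qed

definition tauN :: "real \<Rightarrow> real \<Rightarrow> real \<Rightarrow> int \<Rightarrow> HC \<Rightarrow> complex" where
  "tauN l n m k Z = tau l n m Z * det Z powi k"

interpretation cfun: vector_space "\<lambda>(c::complex) (f :: HC \<Rightarrow> complex) Z. c * f Z"
  by unfold_locales (auto simp: fun_eq_iff algebra_simps)

definition Dh :: "(HC \<Rightarrow> complex) set" where
  "Dh = cfun.span {tauN l n m k | l n m k. hol_index l n m}"

definition Da :: "(HC \<Rightarrow> complex) set" where
  "Da = cfun.span {tauN l n m k | l n m k. antihol_index l n m}"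

definition Dh_less :: "(HC \<Rightarrow> complex) set" where
  "Dh_less = cfun.span {tauN l n m k | l n m k. hol_index l n m \<and> k \<le> -1}"

definition D_minus_minus :: "(HC \<Rightarrow> complex) set" where
  "D_minus_minus =
     cfun.span {tauN l n m k | l n m k. hol_index l n m \<and> 0 \<le> k \<and> of_int k \<le> - (2 * l + 2)}"

definition Dh_greater :: "(HC \<Rightarrow> complex) set" where
  "Dh_greater = cfun.span {tauN l n m k | l n m k. hol_index l n m \<and> of_int k \<ge> - (2 * l + 1)}"

definition Da_less :: "(HC \<Rightarrow> complex) set" where
  "Da_less = cfun.span {tauN l n m k | l n m k. antihol_index l n m \<and> k \<le> -1}"

definition D_plus_plus :: "(HC \<Rightarrow> complex) set" where
  "D_plus_plus =
     cfun.span {tauN l n m k | l n m k. antihol_index l n m \<and> 0 \<le> k \<and> of_int k \<le> - (2 * l + 2)}"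

definition Da_greater :: "(HC \<Rightarrow> complex) set" where
  "Da_greater = cfun.span {tauN l n m k | l n m k. antihol_index l n m \<and> of_int k \<ge> - (2 * l + 1)}"

definition D_total :: "(HC \<Rightarrow> complex) set" where
  "D_total = {f + g | f g. f \<in> Dh \<and> g \<in> Da}"

definition components :: "(HC \<Rightarrow> complex) set set" where
  "components = {Dh_less, D_minus_minus, Dh_greater, Da_less, D_plus_plus, Da_greater}"

definition projector :: "(HC \<Rightarrow> complex) set \<Rightarrow> (HC \<Rightarrow> complex) \<Rightarrow> HC \<Rightarrow> complex" where
  "projector C f = (THE p. p \<in> C \<and> f - p \<in> cfun.span (\<Union> (components - {C})))"


subsection \<open>The action \<open>\<rho>\<^sub>1\<close> and equivariance\<close>

definition pd :: "2 \<Rightarrow> 2 \<Rightarrow> (HC \<Rightarrow> complex) \<Rightarrow> HC \<Rightarrow> complex" where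
  "pd i j f Z = deriv (\<lambda>t. f (Z + (\<chi> a b. if a = i \<and> b = j then t else 0))) 0"

definition dmat :: "(HC \<Rightarrow> complex) \<Rightarrow> HC \<Rightarrow> HC" where
  "dmat f Z = mat2 (pd 1 1 f Z) (pd 2 1 f Z) (pd 1 2 f Z) (pd 2 2 f Z)"

text \<open>
  An element of \<open>gl(2, HC)\<close> is a \<open>2 \<times> 2\<close> matrix with entries \<open>A, B, C, D\<close> in \<open>HC\<close>;
  the scalar \<open>f(Z)\<close> stands for the matrix \<open>mat (f Z)\<close>.
\<close>

definition rho1 :: "HC ^ 2 ^ 2 \<Rightarrow> (HC \<Rightarrow> complex) \<Rightarrow> HC \<Rightarrow> complex" where
  "rho1 X f Z =
     trace (X$1$1 ** (- (Z ** dmat f Z) - mat (f Z)))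
   + trace (X$1$2 ** (- dmat f Z))
   + trace (X$2$1 ** (Z ** dmat f Z ** Z + mat (2 * f Z) ** Z))
   + trace (X$2$2 ** (dmat f Z ** Z + mat (f Z)))"

text \<open>
  The elements of \<open>D_total\<close> are rational functions without poles on the following open dense set;
  identities involving derivatives of such functions are identities there.
\<close>

definition regular_set :: "HC set" where
  "regular_set = {Z. Z$1$1 \<noteq> 0 \<and> Z$2$2 \<noteq> 0 \<and> det Z \<noteq> 0}"

text \<open>
  A linear map of \<open>D_total\<close> commutes with \<open>\<rho>\<^sub>1(X)\<close>.  The condition \<open>g \<in> D_total\<close> makes explicit that
  \<open>g = \<rho>\<^sub>1(X) f\<close> has to lie in the space on which \<open>P\<close> is defined.  This is not automatic:
  \<open>f = N(Z) z\<^sub>1\<^sub>1\<^sup>-\<^sup>2\<close> belongs to \<open>Dh_greater\<close>, while \<open>\<partial>\<^sub>2\<^sub>2 f = z\<^sub>1\<^sub>1\<^sup>-\<^sup>1\<close> is the matrix coefficient with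
  \<open>l = -1/2\<close>, \<open>m = n = 1/2\<close>.
\<close>

definition rho1_equivariant :: "((HC \<Rightarrow> complex) \<Rightarrow> HC \<Rightarrow> complex) \<Rightarrow> bool" where
  "rho1_equivariant P \<longleftrightarrow>
     (\<forall>X. \<forall>f\<in>D_total. \<forall>g\<in>D_total.
        (\<forall>Z\<in>regular_set. g Z = rho1 X f Z) \<longrightarrow>
        (\<forall>Z\<in>regular_set. P g Z = rho1 X (P f) Z))"


subsection \<open>The integral operators\<close>

definition kernel_operator ::
    "real \<Rightarrow> (HC \<Rightarrow> HC \<Rightarrow> complex) \<Rightarrow> (HC \<Rightarrow> complex) \<Rightarrow> HC \<Rightarrow> complex" where
  "kernel_operator R k f W = \<i> / (2 * pi ^ 3) * dV_integral R (\<lambda>Z. k Z W * f Z)"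

definition provides_projector ::
    "real \<Rightarrow> (HC \<Rightarrow> HC \<Rightarrow> complex) \<Rightarrow> HC set \<Rightarrow> (HC \<Rightarrow> complex) set \<Rightarrow> bool" where
  "provides_projector R k S C \<longleftrightarrow>
     (\<forall>f\<in>D_total. \<forall>W\<in>S. dV_integrable R (\<lambda>Z. k Z W * f Z) \<and>
                          kernel_operator R k f W = projector C f W) \<and>
     rho1_equivariant (projector C)"

end

theory Submission
  imports Defs
begin

text \<open>
  Up to normalization, the matrix coefficient with \<open>l = - a / 2\<close> is the coefficient \<open>Fc a i j\<close> of
  \<open>s\<^sup>i t\<^sup>j\<close> in \<open>(z\<^sub>1\<^sub>1 + s z\<^sub>2\<^sub>1 + t z\<^sub>1\<^sub>2 + s t z\<^sub>2\<^sub>2)\<^sup>-\<^sup>a\<close>, and in the antiholomorphic case the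
  same function of the matrix with the indices 1 and 2 exchanged.  On the group, \<open>dV / N(Z)\<^sup>2\<close> is a multiple
  of an invariant measure.  Integrating \<open>Fc a i j Z * N(Z)\<^sup>k\<close> against \<open>N(Z) / N(Z - W)\<close> for diagonal \<open>W\<close>
  is an explicit computation in polar coordinates, whose result is a multiple of the value at \<open>W\<close> if \<open>k = 0\<close>
  or \<open>k = a - 1\<close> and vanishes otherwise; conjugation by \<open>SU(1,1)\<close> gives all \<open>W\<close> in \<open>\<Gamma>\<^sup>-\<close>.  If \<open>\<mu>\<^sub>1\<close>, \<open>\<mu>\<^sub>2\<close>
  are the eigenvalues of \<open>W Z\<^sup>-\<^sup>1\<close>, then \<open>N(Z) / N(Z - c W) = 1 / ((1 - c \<mu>\<^sub>1) (1 - c \<mu>\<^sub>2))\<close>, and suitable means over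
  circles in \<open>c\<close> turn this into the kernels \<open>\<mu>\<^sub>i / ((\<mu>\<^sub>1 - \<mu>\<^sub>2) (1 - \<mu>\<^sub>i)\<^sup>2)\<close>, which pick out a single power of \<open>N\<close>.
  A geometric series in \<open>\<mu>\<^sub>1 \<mu>\<^sub>2 = N(W) / N(Z)\<close> then yields the six kernels.  Equivariance follows because every
  coefficient by which \<open>rho1\<close> would lead from one component to another contains a factor that vanishes there, while
  asymptotics along a curve show that the basis functions are independent.
\<close>

section \<open>An invariant measure on \<open>U(1,1)\<close>\<close>

lemma emeasure_image_jacobian:
  fixes g :: "real^'n::{finite,wellorder} \<Rightarrow> real^'n::_"
  assumes S: "S \<in> sets borel"
    and der: "\<And>x. x \<in> S \<Longrightarrow> (g has_derivative g' x) (at x within S)"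
    and inj: "inj_on g S"
    and J: "\<And>x. x \<in> S \<Longrightarrow> \<bar>det (matrix (g' x))\<bar> = J x"
    and [measurable]: "J \<in> borel_measurable borel"
  shows "g ` S \<in> sets lebesgue" "emeasure lebesgue (g ` S) = (\<integral>\<^sup>+x. ennreal (J x) * indicator S x \<partial>lborel)"
proof -
  have [measurable]: "S \<in> sets borel" by (rule S)
  have SL: "S \<in> sets lebesgue" using S by simp
  show L: "g ` S \<in> sets lebesgue"
    by (rule differentiable_image_in_sets_lebesgue[OF SL])
       (use der in \<open>auto simp: differentiable_on_def differentiable_def\<close>)
  have J0: "x \<in> S \<Longrightarrow> 0 \<le> J x" for x using J[of x] by (metis abs_ge_zero)
  have img: "g ` S \<in> lmeasurable \<and> measure lebesgue (g ` S) = m \<longleftrightarrow> (J has_integral m) S" for m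
    using has_measure_differentiable_image[OF SL der inj, of m] J by (simp cong: has_integral_cong)
  have hi: "(J has_integral m) S \<longleftrightarrow> ((\<lambda>x. indicator S x * J x) has_integral m) UNIV" for m
  proof -
    have "(\<lambda>x. indicator S x * J x) = (\<lambda>x. if x \<in> S then J x else 0)" by (auto split: split_indicator)
    thus ?thesis by (simp add: has_integral_restrict_UNIV)
  qed
  define I where "I = (\<integral>\<^sup>+x. ennreal (J x) * indicator S x \<partial>lborel)"
  have I': "I = (\<integral>\<^sup>+x. ennreal (indicator S x * J x) \<partial>lborel)"
    unfolding I_def by (intro nn_integral_cong) (auto split: split_indicator)
  have nn: "\<And>x. 0 \<le> indicator S x * J x" using J0 by (auto split: split_indicator)
  show "emeasure lebesgue (g ` S) = (\<integral>\<^sup>+x. ennreal (J x) * indicator S x \<partial>lborel)"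
  proof (cases "I = \<infinity>")
    case False
    then obtain r where r: "I = ennreal r" "r \<ge> 0" by (metis ennreal_cases infinity_ennreal_def)
    have "((\<lambda>x. indicator S x * J x) has_integral r) UNIV"
      by (rule nn_integral_has_integral) (use nn r I' in auto)
    hence "g ` S \<in> lmeasurable" "measure lebesgue (g ` S) = r" using img hi by auto
    thus ?thesis using r unfolding I_def[symmetric]
      by (simp add: emeasure_eq_measure2)
  next
    case True
    have "emeasure lebesgue (g ` S) = \<infinity>"
    proof (rule ccontr)
      assume "emeasure lebesgue (g ` S) \<noteq> \<infinity>"
      hence "g ` S \<in> lmeasurable" using L by (simp add: fmeasurable_def less_top[symmetric])
      then obtain m where "((\<lambda>x. indicator S x * J x) has_integral m) UNIV" using img hi by blast
      hence "I = ennreal m" unfolding I'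
        by (intro nn_integral_has_integral_lborel) (use nn in auto)
      thus False using True by simp
    qed
    thus ?thesis using True I_def by simp
  qed
qed

lemma nn_integral_jacobian:
  fixes g :: "real^'n::{finite,wellorder} \<Rightarrow> real^'n::_" and f :: "real^'n::_ \<Rightarrow> ennreal"
  assumes S: "S \<in> sets borel"
    and der: "\<And>x. x \<in> S \<Longrightarrow> (g has_derivative g' x) (at x within S)"
    and inj: "inj_on g S"
    and J: "\<And>x. x \<in> S \<Longrightarrow> \<bar>det (matrix (g' x))\<bar> = J x"
    and [measurable]: "J \<in> borel_measurable borel" "g \<in> borel_measurable borel" "f \<in> borel_measurable borel"
    and T: "T \<in> sets borel" "AE y in lebesgue. y \<in> T \<longleftrightarrow> y \<in> g ` S"
  shows "(\<integral>\<^sup>+x. ennreal (J x) * indicator S x * f (g x) \<partial>lborel) = (\<integral>\<^sup>+y. indicator T y * f y \<partial>lborel)"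
proof -
  have [measurable]: "S \<in> sets borel" "T \<in> sets borel" by fact+
  have eq: "distr (density lborel (\<lambda>x. ennreal (J x) * indicator S x)) borel g = density lborel (indicator T)"
  proof (rule measure_eqI)
    fix A assume "A \<in> sets (distr (density lborel (\<lambda>x. ennreal (J x) * indicator S x)) borel g)"
    hence [measurable]: "A \<in> sets borel" by simp
    have S': "S \<inter> g -` A \<in> sets borel"
      using measurable_sets_borel[of g borel A] by auto
    have gS: "g ` (S \<inter> g -` A) = g ` S \<inter> A" by auto
    have "emeasure (distr (density lborel (\<lambda>x. ennreal (J x) * indicator S x)) borel g) A
        = (\<integral>\<^sup>+x. ennreal (J x) * indicator S x * indicator (g -` A) x \<partial>lborel)"
    proof -
      have "g -` A \<in> sets borel" by (rule measurable_sets_borel[of g borel A]) simp_all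
      thus ?thesis by (simp add: emeasure_distr emeasure_density)
    qed
    also have "\<dots> = (\<integral>\<^sup>+x. ennreal (J x) * indicator (S \<inter> g -` A) x \<partial>lborel)"
      by (intro nn_integral_cong) (auto split: split_indicator)
    also have "\<dots> = emeasure lebesgue (g ` (S \<inter> g -` A))"
      by (rule emeasure_image_jacobian(2)[OF S', where g'=g', symmetric])
         (use der inj J in \<open>auto intro: has_derivative_subset inj_on_subset\<close>)
    also have "\<dots> = emeasure lebesgue (T \<inter> A)"
    proof (rule emeasure_eq_AE)
      show "AE x in lebesgue. (x \<in> g ` (S \<inter> g -` A)) = (x \<in> T \<inter> A)"
        unfolding gS using T(2) by eventually_elim auto
      show "g ` (S \<inter> g -` A) \<in> sets lebesgue"
        by (rule emeasure_image_jacobian(1)[OF S', where g'=g' and J=J])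
           (use der inj J in \<open>auto intro: has_derivative_subset inj_on_subset\<close>)
    qed simp
    also have "\<dots> = emeasure (density lborel (indicator T)) A"
      by (simp add: emeasure_density Int_def emeasure_restrict_space flip: indicator_inter_arith)
    finally show "emeasure (distr (density lborel (\<lambda>x. ennreal (J x) * indicator S x)) borel g) A = emeasure (density lborel (indicator T)) A" .
  qed simp
  have "(\<integral>\<^sup>+x. ennreal (J x) * indicator S x * f (g x) \<partial>lborel) = (\<integral>\<^sup>+y. f y \<partial>distr (density lborel (\<lambda>x. ennreal (J x) * indicator S x)) borel g)"
    by (simp add: nn_integral_distr nn_integral_density)
  also have "\<dots> = (\<integral>\<^sup>+y. indicator T y * f y \<partial>lborel)"
    unfolding eq by (simp add: nn_integral_density)
  finally show ?thesis .
qed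

definition mk4 :: "real \<times> real \<times> real \<times> real \<Rightarrow> real ^ 4" where
  "mk4 w = (case w of (a, b, c, d) \<Rightarrow> vector [a, b, c, d])"

lemma mk4_nth [simp]:
  "mk4 (a, b, c, d) $ 1 = a" "mk4 (a, b, c, d) $ 2 = b" "mk4 (a, b, c, d) $ 3 = c" "mk4 (a, b, c, d) $ 4 = d"
  by (simp_all add: mk4_def)

lemma continuous_mk4: "continuous_on UNIV mk4"
proof -
  have "continuous_on UNIV (\<lambda>w. mk4 w $ i)" for i
    using exhaust_4[of i] by (elim disjE; simp add: mk4_def case_prod_unfold; intro continuous_intros)
  hence "continuous_on UNIV (\<lambda>w. \<chi> i. mk4 w $ i)"
    by (intro continuous_on_vec_lambda)
  thus ?thesis by simp
qed

lemma mk4_measurable [measurable]: "mk4 \<in> borel_measurable borel"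
  by (rule borel_measurable_continuous_onI[OF continuous_mk4])

lemma Basis_real4: "(Basis :: (real^4) set) = {axis 1 1, axis 2 1, axis 3 1, axis 4 1}"
  unfolding Basis_vec_def by (auto simp: UNIV_4)

lemma box_Pair_eq: "box (a, b) (c, d) = box a c \<times> box b d"
  for a c :: "'a::euclidean_space" and b d :: "'b::euclidean_space"
  by (force simp: box_def Basis_prod_def)

lemma emeasure_lborel_Times:
  assumes "A \<in> sets borel" "B \<in> sets borel"
  shows "emeasure (lborel :: ('a::euclidean_space \<times> 'b::euclidean_space) measure) (A \<times> B)
    = emeasure lborel A * emeasure lborel B"
  unfolding lborel_prod[symmetric] using assms by (simp add: lborel.emeasure_pair_measure_Times)

lemma lborel_mk4: "(lborel :: (real^4) measure) = distr lborel borel mk4"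
proof (rule lborel_eqI)
  fix l u :: "real^4" assume le: "\<And>b. b \<in> Basis \<Longrightarrow> l \<bullet> b \<le> u \<bullet> b"
  have le': "l $ i \<le> u $ i" for i using le[of "axis i 1"] by (simp add: inner_axis)
  have "mk4 -` box l u = box (l$1, l$2, l$3, l$4) (u$1, u$2, u$3, u$4)"
    by (auto simp: mem_box_cart forall_4 box_Pair_eq) 
  hence "emeasure (distr lborel borel mk4) (box l u) = emeasure lborel (box (l$1, l$2, l$3, l$4) (u$1, u$2, u$3, u$4))"
    by (simp add: emeasure_distr)
  also have "\<dots> = (u$1 - l$1) * ((u$2 - l$2) * ((u$3 - l$3) * (u$4 - l$4)))"
    using le' unfolding box_Pair_eq
    by (simp add: emeasure_lborel_Times ennreal_mult borel_open open_Times)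
  also have "\<dots> = (\<Prod>b\<in>Basis. (u - l) \<bullet> b)"
  proof -
    have "distinct [axis 1 1, axis 2 1, axis 3 1, axis 4 1 :: real^4]"
      by (simp add: axis_eq_axis)
    thus ?thesis unfolding Basis_real4 by (simp add: inner_axis)
  qed
  finally show "emeasure (distr lborel borel mk4) (box l u) = (\<Prod>b\<in>Basis. (u - l) \<bullet> b)" .
qed simp

lemma nn_integral_mk4:
  assumes [measurable]: "f \<in> borel_measurable borel"
  shows "(\<integral>\<^sup>+u. f u \<partial>(lborel :: (real^4) measure)) = (\<integral>\<^sup>+x. \<integral>\<^sup>+w. f (mk4 (x, w)) \<partial>lborel \<partial>lborel)"
proof -
  have "(\<integral>\<^sup>+u. f u \<partial>(lborel :: (real^4) measure)) = (\<integral>\<^sup>+v. f (mk4 v) \<partial>lborel)"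
    by (subst lborel_mk4) (simp add: nn_integral_distr)
  also have "\<dots> = (\<integral>\<^sup>+x. \<integral>\<^sup>+w. f (mk4 (x, w)) \<partial>lborel \<partial>lborel)"
  proof -
    have "(\<lambda>v. f (mk4 v)) \<in> borel_measurable (lborel \<Otimes>\<^sub>M lborel)"
      by (simp add: lborel_prod)
    from lborel.nn_integral_fst[OF this] show ?thesis by (simp add: lborel_prod)
  qed
  finally show ?thesis .
qed

lemma lborel_distr_linear:
  fixes L :: "real^'n::{finite,wellorder} \<Rightarrow> real^'n::_"
  assumes "linear L" "\<bar>det (matrix L)\<bar> = 1"
  shows "distr lborel borel L = lborel"
proof -
  have inv: "inj L" using assms det_nz_iff_inj[of L] by auto
  have Lm[measurable]: "L \<in> borel_measurable borel"
    by (intro borel_measurable_continuous_onI linear_continuous_on linear_conv_bounded_linear[THEN iffD1] assms)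
  have sj: "surj L" using inv assms(1) linear_injective_imp_surjective by blast
  show ?thesis
  proof (rule measure_eqI)
    fix A assume "A \<in> sets (distr lborel borel L)"
    hence [measurable]: "A \<in> sets borel" by simp
    have "emeasure (distr lborel borel L) A = (\<integral>\<^sup>+x. ennreal 1 * indicator UNIV x * indicator A (L x) \<partial>lborel)"
    proof -
      have "emeasure (distr lborel borel L) A = (\<integral>\<^sup>+x. indicator A x \<partial>distr lborel borel L)" by simp
      also have "\<dots> = (\<integral>\<^sup>+x. indicator A (L x) \<partial>lborel)" by (subst nn_integral_distr) auto
      finally show ?thesis by simp
    qed
    also have "\<dots> = (\<integral>\<^sup>+y. indicator UNIV y * indicator A y \<partial>lborel)"
      by (rule nn_integral_jacobian[where g'="\<lambda>_. L"])
         (use assms inv sj in \<open>auto intro: linear_imp_has_derivative\<close>)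
    finally show "emeasure (distr lborel borel L) A = emeasure lborel A" by simp
  qed simp
qed

lemma mat_mult_nth [simp]:
  "((A :: 'a::comm_semiring_1 ^ 2 ^ 2) ** B) $ i $ j = A $ i $ 1 * B $ 1 $ j + A $ i $ 2 * B $ 2 $ j"
  by (simp add: matrix_matrix_mult_def sum_2)

lemma mat_nth2 [simp]:
  "(mat c :: 'a::comm_semiring_1 ^ 2 ^ 2) $ 1 $ 1 = c" "(mat c :: 'a ^ 2 ^ 2) $ 1 $ 2 = 0"
  "(mat c :: 'a ^ 2 ^ 2) $ 2 $ 1 = 0" "(mat c :: 'a ^ 2 ^ 2) $ 2 $ 2 = c"
  by (simp_all add: mat_def)

lemma borel_measurable_entry [measurable]:
  "(\<lambda>Z :: HC. Z $ i $ j) \<in> borel_measurable borel"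
  by (intro borel_measurable_continuous_onI continuous_intros)

lemma borel_measurable_det [measurable]: "(det :: HC \<Rightarrow> complex) \<in> borel_measurable borel"
  by (intro borel_measurable_continuous_onI) (simp add: det_2 continuous_intros)

lemma borel_measurable_HC:
  assumes "\<And>i j. (\<lambda>x. f x $ i $ j) \<in> borel_measurable M"
  shows "(f :: _ \<Rightarrow> HC) \<in> borel_measurable M"
proof (rule borel_measurable_euclidean_space[THEN iffD2], intro ballI)
  fix b :: HC assume "b \<in> Basis"
  then obtain i j c where b: "b = axis i (axis j c)" unfolding Basis_vec_def by auto
  show "(\<lambda>x. f x \<bullet> b) \<in> borel_measurable M"
    unfolding b inner_axis using assms[of i j] by simp
qed

definition hyp_emb :: "real ^ 4 \<Rightarrow> HC" where
  "hyp_emb v = mat2 (Complex (v$1) (v$2)) (Complex (v$3) (v$4)) (Complex (v$3) (- v$4)) (Complex (v$1) (- v$2))"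

definition hyp_q :: "real ^ 4 \<Rightarrow> real" where
  "hyp_q v = (v$1)\<^sup>2 + (v$2)\<^sup>2 - (v$3)\<^sup>2 - (v$4)\<^sup>2"

definition shell :: "(real ^ 4) set" where
  "shell = {v. 1 < hyp_q v \<and> hyp_q v < 4}"

definition hyp_nrm :: "real ^ 4 \<Rightarrow> HC" where
  "hyp_nrm v = mat (of_real (1 / sqrt (hyp_q v))) ** hyp_emb v"

definition polar :: "real ^ 4 \<Rightarrow> real ^ 4" where
  "polar u = vector [u$1 * cosh (u$2) * cos (u$4), u$1 * cosh (u$2) * sin (u$4),
                     u$1 * sinh (u$2) * cos (u$3), u$1 * sinh (u$2) * sin (u$3)]"

definition polar_dom :: "(real ^ 4) set" where
  "polar_dom = {u. 1 < u$1 \<and> u$1 < 2 \<and> 0 < u$2 \<and> 0 < u$3 \<and> u$3 < 2 * pi \<and> 0 < u$4 \<and> u$4 < 2 * pi}"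

definition polar_jac :: "real ^ 4 \<Rightarrow> real ^ 4 ^ 4" where
  "polar_jac u = (let r = u$1; s = sinh (u$2); c = cosh (u$2) in vector
     [vector [c * cos (u$4), r * s * cos (u$4), 0, - (r * c * sin (u$4))],
      vector [c * sin (u$4), r * s * sin (u$4), 0, r * c * cos (u$4)],
      vector [s * cos (u$3), r * c * cos (u$3), - (r * s * sin (u$3)), 0],
      vector [s * sin (u$3), r * c * sin (u$3), r * s * cos (u$3), 0]])"

lemma has_derivative_real4:
  fixes f :: "'a::real_normed_vector \<Rightarrow> real ^ 4"
  assumes "\<And>i. ((\<lambda>x. f x $ i) has_derivative (\<lambda>h. f' h $ i)) (at u within S)"
  shows "(f has_derivative f') (at u within S)"
  unfolding has_derivative_componentwise_within[of f]
  using assms by (auto simp: Basis_real4 inner_axis)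

lemma polar_has_derivative: "(polar has_derivative (\<lambda>h. polar_jac u *v h)) (at u within S)"
proof (rule has_derivative_real4)
  have n: "((\<lambda>u. u $ k) has_derivative (\<lambda>h. h $ k)) (at u within S)" for k :: 4 and u :: "real^4"
    by (intro bounded_linear_imp_has_derivative bounded_linear_vec_nth)
  have ch: "((\<lambda>x. cosh (x $ 2)) has_derivative (\<lambda>h. h $ 2 * sinh (u $ 2))) (at u within S)"
    by (rule DERIV_compose_FDERIV[OF _ n]) (auto intro!: derivative_eq_intros)
  have sh: "((\<lambda>x. sinh (x $ 2)) has_derivative (\<lambda>h. h $ 2 * cosh (u $ 2))) (at u within S)"
    by (rule DERIV_compose_FDERIV[OF _ n]) (auto intro!: derivative_eq_intros)
  fix i :: 4
  show "((\<lambda>x. polar x $ i) has_derivative (\<lambda>h. (polar_jac u *v h) $ i)) (at u within S)"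
    using exhaust_4[of i]
    by (elim disjE; simp add: polar_def polar_jac_def Let_def matrix_vector_mult_def sum_4)
       (auto intro!: derivative_eq_intros n ch sh simp: fun_eq_iff algebra_simps)
qed

lemma polar_det: "\<bar>det (polar_jac u)\<bar> = \<bar>(u$1) ^ 3 * sinh (u$2) * cosh (u$2)\<bar>"
proof -
  define s c where "s = sinh (u$2)" and "c = cosh (u$2)"
  define p q p' q' where "p = cos (u$4)" and "q = sin (u$4)" and "p' = cos (u$3)" and "q' = sin (u$3)"
  have sc: "c\<^sup>2 = s\<^sup>2 + 1" using cosh_square_eq by (simp add: s_def c_def)
  have pq: "p\<^sup>2 + q\<^sup>2 = 1" "p'\<^sup>2 + q'\<^sup>2 = 1" by (simp_all add: p_def q_def p'_def q'_def)
  have "det (polar_jac u) = - ((u$1) ^ 3 * s * c * (c\<^sup>2 - s\<^sup>2) * (p\<^sup>2 + q\<^sup>2) * (p'\<^sup>2 + q'\<^sup>2)) \<or>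
        det (polar_jac u) = (u$1) ^ 3 * s * c * (c\<^sup>2 - s\<^sup>2) * (p\<^sup>2 + q\<^sup>2) * (p'\<^sup>2 + q'\<^sup>2)"
    unfolding det_4 polar_jac_def Let_def vector_4 s_def[symmetric] c_def[symmetric] p_def[symmetric] q_def[symmetric] p'_def[symmetric] q'_def[symmetric]
    apply (rule disjI2)
    by (simp add: power2_eq_square power3_eq_cube algebra_simps)
  thus ?thesis using sc pq by (auto simp: s_def c_def)
qed

lemma polar_sq:
  "(polar u $ 1)\<^sup>2 + (polar u $ 2)\<^sup>2 = (u$1)\<^sup>2 * (cosh (u$2))\<^sup>2"
  "(polar u $ 3)\<^sup>2 + (polar u $ 4)\<^sup>2 = (u$1)\<^sup>2 * (sinh (u$2))\<^sup>2"
  by (simp_all add: polar_def power_mult_distrib flip: distrib_left)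

lemma polar_q: "hyp_q (polar u) = (u$1)\<^sup>2"
  using polar_sq[of u] cosh_square_eq[of "u$2"] by (simp add: hyp_q_def algebra_simps)

lemma polar_inj: "inj_on polar polar_dom"
proof (rule inj_onI)
  fix u v assume u: "u \<in> polar_dom" and v: "v \<in> polar_dom" and eq: "polar u = polar v"
  have 1: "u$1 = v$1"
    using polar_q[of u] polar_q[of v] eq u v by (simp add: polar_dom_def)
  have pos: "0 < u$2" "0 < v$2" "0 < v$1" using u v by (auto simp: polar_dom_def)
  have "(cosh (u$2))\<^sup>2 = (cosh (v$2))\<^sup>2"
    using polar_sq(1)[of u] polar_sq(1)[of v] eq 1 pos by simp
  hence "cosh (u$2) = cosh (v$2)" by simp
  hence 2: "u$2 = v$2" using pos by simp
  have s: "sinh (v$2) \<noteq> 0" "cosh (v$2) \<noteq> 0" "v$1 \<noteq> 0" using pos by auto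
  have c: "polar u $ k = polar v $ k" for k using eq by simp
  have "cis (u$4) = cis (v$4)" "cis (u$3) = cis (v$3)"
    using c[of 1] c[of 2] c[of 3] c[of 4] s by (simp_all add: polar_def 1 2 complex_eq_iff)
  hence "u$4 = v$4" "u$3 = v$3"
    using u v by (auto intro!: cis_inj simp: polar_dom_def)
  with 1 2 show "u = v" by (simp add: vec_eq_iff forall_4)
qed

lemma polar_image:
  "polar ` polar_dom \<subseteq> shell"
  "v \<in> shell \<Longrightarrow> v$2 \<noteq> 0 \<Longrightarrow> v$4 \<noteq> 0 \<Longrightarrow> v \<in> polar ` polar_dom"
proof -
  show "polar ` polar_dom \<subseteq> shell"
  proof clarify
    fix u assume u: "u \<in> polar_dom"
    hence "1\<^sup>2 < (u$1)\<^sup>2" "(u$1)\<^sup>2 < 2\<^sup>2"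
      by (intro power_strict_mono; simp add: polar_dom_def)+
    thus "polar u \<in> shell" by (simp add: shell_def polar_q)
  qed
  assume v: "v \<in> shell" and n: "v$2 \<noteq> 0" "v$4 \<noteq> 0"
  define r where "r = sqrt (hyp_q v)"
  have q: "1 < hyp_q v" "hyp_q v < 4" using v by (auto simp: shell_def)
  have r: "r\<^sup>2 = hyp_q v" "1 < r" "r < 2"
    using q real_sqrt_less_mono[of "hyp_q v" 4] by (auto simp: r_def)
  define a b where "a = Complex (v$1) (v$2)" and "b = Complex (v$3) (v$4)"
  define t where "t = arsinh (cmod b / r)"
  have st: "sinh t = cmod b / r" by (simp add: t_def)
  have b0: "b \<noteq> 0" using n by (auto simp: b_def complex_eq_iff)
  hence "0 < sinh t" using st r by simp
  hence t0: "0 < t" by simp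
  have rs: "r * sinh t = cmod b" using st r by simp
  have "(r * cosh t)\<^sup>2 = r\<^sup>2 + (r * sinh t)\<^sup>2" by (simp add: power_mult_distrib cosh_square_eq algebra_simps)
  also have "\<dots> = (cmod a)\<^sup>2" unfolding rs r(1) by (simp add: hyp_q_def a_def b_def cmod_power2)
  finally have rc: "r * cosh t = cmod a"
    using r by (auto simp: power2_eq_iff_nonneg)
  define u :: "real^4" where "u = vector [r, t, Arg2pi b, Arg2pi a]"
  have A: "z = complex_of_real (cmod z) * cis (Arg2pi z)" for z
    using Arg2pi[of z] by (simp add: cis_conv_exp is_Arg_def)
  have An: "Arg2pi z \<noteq> 0" if "Im z \<noteq> 0" for z
    using A[of z] that by (metis Im_complex_of_real cis_zero mult.right_neutral)
  have "polar u = v"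
    using arg_cong[OF A[of a], of Re] arg_cong[OF A[of a], of Im] arg_cong[OF A[of b], of Re] arg_cong[OF A[of b], of Im]
    by (simp add: vec_eq_iff forall_4 polar_def u_def rs rc) (simp add: a_def b_def)
  moreover have "u \<in> polar_dom"
    using r t0 Arg2pi[of a] Arg2pi[of b] An[of a] An[of b] n
    by (auto simp: polar_dom_def u_def a_def b_def less_le)
  ultimately show "v \<in> polar ` polar_dom" by blast
qed

lemma AE_coordinate: "AE v in lebesgue. (v :: real^'n) $ k \<noteq> 0"
proof -
  have "negligible {v :: real^'n. v $ k = 0}" by (rule negligible_standard_hyperplane_cart)
  thus ?thesis by (simp add: eventually_ae_filter negligible_iff_null_sets) blast
qed

lemma continuous_hyp_q: "continuous_on A hyp_q"
  unfolding hyp_q_def by (intro continuous_intros)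

lemma hyp_q_measurable [measurable]: "hyp_q \<in> borel_measurable borel"
  by (rule borel_measurable_continuous_onI[OF continuous_hyp_q])

lemma shell_borel [measurable]: "shell \<in> sets borel"
  unfolding shell_def by measurable

lemma polar_dom_borel [measurable]: "polar_dom \<in> sets borel"
  unfolding polar_dom_def by measurable

lemma chart_domain_borel [measurable]: "chart_domain \<in> sets borel"
  unfolding chart_domain_def by measurable

lemma polar_measurable [measurable]: "polar \<in> borel_measurable borel"
proof -
  have "polar \<in> borel_measurable borel \<longleftrightarrow> continuous_on UNIV polar \<or> polar \<in> borel_measurable borel"
    using borel_measurable_continuous_onI by blast
  moreover have "continuous_on UNIV polar"
    using has_derivative_continuous[OF polar_has_derivative]
    by (auto simp: continuous_on_eq_continuous_within)
  ultimately show ?thesis by blast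
qed

lemma hyp_nrm_measurable [measurable]: "hyp_nrm \<in> borel_measurable borel"
proof (rule borel_measurable_HC)
  have C: "(\<lambda>x. Complex (f x) (g x)) \<in> borel_measurable borel" 
    if [measurable]: "f \<in> borel_measurable borel" "g \<in> borel_measurable borel" for f g :: "real^4 \<Rightarrow> real"
    unfolding Complex_eq by measurable
  fix i j :: 2
  show "(\<lambda>x. hyp_nrm x $ i $ j) \<in> borel_measurable borel"
    using exhaust_2[of i] exhaust_2[of j]
    by (elim disjE; simp add: hyp_nrm_def hyp_emb_def; intro borel_measurable_divide borel_measurable_times borel_measurable_const C; measurable)
qed

lemma cosh_measurable [measurable]: "(cosh :: real \<Rightarrow> real) \<in> borel_measurable borel"
  and sinh_measurable [measurable]: "(sinh :: real \<Rightarrow> real) \<in> borel_measurable borel"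
  by (intro borel_measurable_continuous_onI continuous_intros)+

lemma chart_measurable [measurable]: "chart R \<in> borel_measurable borel"
proof (rule borel_measurable_HC)
  fix i j :: 2
  have [measurable]: "cis \<in> borel_measurable borel" 
    by (intro borel_measurable_continuous_onI continuous_intros)
  show "(\<lambda>x. chart R x $ i $ j) \<in> borel_measurable borel"
    using exhaust_2[of i] exhaust_2[of j]
    by (elim disjE; simp add: chart_nth; measurable)
qed

definition dom3 :: "(real \<times> real \<times> real) set" where
  "dom3 = {(t, b, a). 0 < t \<and> 0 < b \<and> b < 2 * pi \<and> 0 < a \<and> a < 2 * pi}"

lemma dom3_borel [measurable]: "dom3 \<in> sets borel"
proof -
  have "dom3 = {0<..} \<times> {0<..<2*pi} \<times> {0<..<2*pi}" by (auto simp: dom3_def)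
  moreover have "open \<dots>" by (intro open_Times) auto
  ultimately show ?thesis by simp
qed

lemma fst_borel3 [measurable]: "(fst :: real \<times> real \<times> real \<Rightarrow> real) \<in> borel_measurable borel"
  by (intro borel_measurable_continuous_onI continuous_intros)

definition SU_nn :: "(HC \<Rightarrow> ennreal) \<Rightarrow> ennreal" where
  "SU_nn G = (\<integral>\<^sup>+w. ennreal (sinh (fst w) * cosh (fst w)) * indicator dom3 w * G (chart 1 (mk4 (0, w))) \<partial>lborel)"

lemma hyp_nrm_polar:
  assumes "0 < u$1"
  shows "hyp_nrm (polar u) = chart 1 (vector [0, u$2, u$3, u$4])"
proof -
  have "sqrt (hyp_q (polar u)) = u$1" using assms by (simp add: polar_q)
  thus ?thesis using assms
    by (simp add: HC_eq_iff hyp_nrm_def hyp_emb_def chart_nth polar_def complex_eq_iff)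
qed

lemma nn_integral_cube: "(\<integral>\<^sup>+x. ennreal (x ^ 3) * indicator {1<..<2} x \<partial>lborel) = ennreal (15/4)"
proof -
  have "(\<integral>\<^sup>+x. ennreal (x ^ 3) * indicator {1<..<2} x \<partial>lborel) = (\<integral>\<^sup>+x. ennreal (x ^ 3) * indicator {1..2} x \<partial>lborel)"
    by (intro nn_integral_cong_AE)
       (use AE_lborel_singleton[of "1::real"] AE_lborel_singleton[of "2::real"] in \<open>eventually_elim, auto split: split_indicator\<close>)
  also have "\<dots> = ennreal (2 ^ 4 / 4 - 1 ^ 4 / 4)"
    by (rule nn_integral_FTC_Icc) (auto intro!: derivative_eq_intros simp: power3_eq_cube)
  finally show ?thesis by simp
qed

lemma SU_nn_shell:
  assumes [measurable]: "G \<in> borel_measurable borel"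
  shows "ennreal (15/4) * SU_nn G = (\<integral>\<^sup>+v. indicator shell v * G (hyp_nrm v) \<partial>lborel)"
proof -
  have "(\<integral>\<^sup>+v. indicator shell v * G (hyp_nrm v) \<partial>lborel)
    = (\<integral>\<^sup>+u. ennreal ((u$1) ^ 3 * sinh (u$2) * cosh (u$2)) * indicator polar_dom u * G (hyp_nrm (polar u)) \<partial>lborel)"
  proof (rule nn_integral_jacobian[symmetric, where g'="\<lambda>u h. polar_jac u *v h"])
    show "AE v in lebesgue. (v \<in> shell) = (v \<in> polar ` polar_dom)"
      using AE_coordinate[of 2] AE_coordinate[of 4]
      by eventually_elim (use polar_image in blast)
    show "\<bar>det (matrix ((*v) (polar_jac x)))\<bar> = x $ 1 ^ 3 * sinh (x $ 2) * cosh (x $ 2)" if "x \<in> polar_dom" for x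
      using that polar_det[of x] by (simp add: matrix_of_matrix_vector_mul polar_dom_def abs_mult)
  qed (auto intro: polar_has_derivative polar_inj)
  also have "\<dots> = (\<integral>\<^sup>+x. \<integral>\<^sup>+w. ennreal (x ^ 3) * indicator {1<..<2} x * (ennreal (sinh (fst w) * cosh (fst w)) * indicator dom3 w * G (chart 1 (mk4 (0, w)))) \<partial>lborel \<partial>lborel)"
    apply (subst nn_integral_mk4, measurable)
    apply (intro nn_integral_cong)
    subgoal for x w
      by (cases w) (auto simp: dom3_def polar_dom_def hyp_nrm_polar mk4_def ennreal_mult mult_ac split: split_indicator)
    done
  also have "\<dots> = (\<integral>\<^sup>+x. ennreal (x ^ 3) * indicator {1<..<2} x * SU_nn G \<partial>lborel)"
    unfolding SU_nn_def by (intro nn_integral_cong nn_integral_cmult) measurable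
  also have "\<dots> = ennreal (15/4) * SU_nn G"
    by (subst nn_integral_multc) (auto simp: nn_integral_cube)
  finally show ?thesis ..
qed

definition haar :: "HC measure" where
  "haar = distr (density lborel (\<lambda>u. ennreal (sinh (u$2) * cosh (u$2) / (2 * pi ^ 3)) * indicator chart_domain u)) borel (chart 1)"

lemma sets_haar [simp, measurable_cong]: "sets haar = sets borel"
  and space_haar [simp]: "space haar = UNIV"
  by (simp_all add: haar_def)

lemma nn_integral_haar:
  assumes [measurable]: "F \<in> borel_measurable borel"
  shows "(\<integral>\<^sup>+Z. F Z \<partial>haar) = (\<integral>\<^sup>+x. ennreal (1 / (2 * pi ^ 3)) * indicator {0<..<pi} x * SU_nn (\<lambda>Z. F (mat (cis x) ** Z)) \<partial>lborel)"
proof -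
  have ch: "chart 1 (mk4 (x, w)) = mat (cis x) ** chart 1 (mk4 (0, w))" for x w
    by (cases w) (simp add: HC_eq_iff chart_nth cis_mult mk4_def[symmetric] algebra_simps)
  have e: "ennreal (cosh a * sinh a / (2 * pi ^ 3)) = ennreal (1 / (2 * pi ^ 3)) * ennreal (cosh a * sinh a)"
    if "0 < a" for a :: real
    using that by (subst ennreal_mult[symmetric]) auto
  have mm: "(\<lambda>Z. mat (cis x) ** Z) \<in> borel_measurable (borel :: HC measure)" for x
    by (rule borel_measurable_HC) (simp add: mat_mult_nth, measurable)
  have "(\<integral>\<^sup>+Z. F Z \<partial>haar) = (\<integral>\<^sup>+u. ennreal (sinh (u$2) * cosh (u$2) / (2 * pi ^ 3)) * indicator chart_domain u * F (chart 1 u) \<partial>lborel)"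
    unfolding haar_def by (simp add: nn_integral_distr nn_integral_density)
  also have "\<dots> = (\<integral>\<^sup>+x. \<integral>\<^sup>+w. ennreal (1 / (2 * pi ^ 3)) * indicator {0<..<pi} x * (ennreal (sinh (fst w) * cosh (fst w)) * indicator dom3 w * F (mat (cis x) ** chart 1 (mk4 (0, w)))) \<partial>lborel \<partial>lborel)"
    apply (subst nn_integral_mk4, measurable)
    apply (intro nn_integral_cong)
    subgoal for x w
      by (cases w) (auto simp: dom3_def chart_domain_def ch[of x] e mult_ac split: split_indicator)
    done
  also have "\<dots> = (\<integral>\<^sup>+x. ennreal (1 / (2 * pi ^ 3)) * indicator {0<..<pi} x * SU_nn (\<lambda>Z. F (mat (cis x) ** Z)) \<partial>lborel)"
    unfolding SU_nn_def 
  proof (intro nn_integral_cong nn_integral_cmult)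
    fix x :: real
    note mm[of x, measurable]
    show "(\<lambda>w. ennreal (sinh (fst w) * cosh (fst w)) * indicator dom3 w * F (mat (cis x) ** chart 1 (mk4 (0, w)))) \<in> borel_measurable lborel"
      by measurable
  qed
  finally show ?thesis .
qed

lemma haar_invariant:
  fixes T :: "HC \<Rightarrow> HC"
  assumes L: "linear L" "\<bar>det (matrix L)\<bar> = 1"
    and T: "\<And>v. T (hyp_emb v) = hyp_emb (L v)" "\<And>v. hyp_q (L v) = hyp_q v"
    and Tm: "\<And>c Z. T (mat c ** Z) = mat c ** T Z"
    and [measurable]: "T \<in> borel_measurable borel"
  shows "distr haar borel T = haar"
proof -
  have Lm[measurable]: "L \<in> borel_measurable borel"
    by (intro borel_measurable_continuous_onI linear_continuous_on linear_conv_bounded_linear[THEN iffD1] L)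
  have tau_norm: "T (hyp_nrm v) = hyp_nrm (L v)" for v
    by (simp add: hyp_nrm_def Tm T)
  have SU: "SU_nn (\<lambda>Z. G (T Z)) = SU_nn G" if [measurable]: "G \<in> borel_measurable borel" for G
  proof -
    have "ennreal (15/4) * SU_nn (\<lambda>Z. G (T Z)) = (\<integral>\<^sup>+v. indicator shell v * G (T (hyp_nrm v)) \<partial>lborel)"
      by (rule SU_nn_shell) measurable
    also have "\<dots> = (\<integral>\<^sup>+v. indicator shell (L v) * G (hyp_nrm (L v)) \<partial>lborel)"
      by (simp add: tau_norm T shell_def indicator_def)
    also have "\<dots> = (\<integral>\<^sup>+v. indicator shell v * G (hyp_nrm v) \<partial>distr lborel borel L)"
      by (simp add: nn_integral_distr)
    also have "\<dots> = ennreal (15/4) * SU_nn G"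
      by (simp add: lborel_distr_linear[OF L] SU_nn_shell)
    finally show ?thesis
      by (simp add: ennreal_mult_cancel_left)
  qed
  show ?thesis
  proof (rule measure_eqI)
    fix A assume "A \<in> sets (distr haar borel T)"
    hence [measurable]: "A \<in> sets borel" by simp
    have mm[measurable]: "(\<lambda>Z. mat (cis x) ** Z) \<in> borel_measurable (borel :: HC measure)" for x
      by (rule borel_measurable_HC) (simp add: mat_mult_nth, measurable)
    have "emeasure (distr haar borel T) A = (\<integral>\<^sup>+Z. indicator A Z \<partial>distr haar borel T)" by simp
    also have "\<dots> = (\<integral>\<^sup>+Z. indicator A (T Z) \<partial>haar)" by (subst nn_integral_distr) auto
    also have "\<dots> = (\<integral>\<^sup>+Z. indicator A Z \<partial>haar)"
    proof -
      have "SU_nn (\<lambda>Z. indicator A (mat (cis x) ** T Z)) = SU_nn (\<lambda>Z. indicator A (mat (cis x) ** Z))" for x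
        by (rule SU[of "\<lambda>Z. indicator A (mat (cis x) ** Z)"]) measurable
      thus ?thesis
        by (subst (1 2) nn_integral_haar) (auto simp: Tm)
    qed
    finally show "emeasure (distr haar borel T) A = emeasure haar A" by simp
  qed simp
qed

lemma lborel_integral_product:
  fixes f :: "'a::euclidean_space \<Rightarrow> complex" and g :: "'b::euclidean_space \<Rightarrow> complex"
  assumes f: "integrable lborel f" and g: "integrable lborel g"
  shows "integrable lborel (\<lambda>z. f (fst z) * g (snd z))"
    and "integral\<^sup>L lborel (\<lambda>z. f (fst z) * g (snd z)) = integral\<^sup>L lborel f * integral\<^sup>L lborel g"
proof -
  have [measurable]: "f \<in> borel_measurable lborel" "g \<in> borel_measurable lborel" using f g by auto
  have I: "integrable (lborel \<Otimes>\<^sub>M lborel) (\<lambda>z. f (fst z) * g (snd z))"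
  proof (rule lborel_pair.Fubini_integrable)
    show "integrable lborel (\<lambda>x. \<integral>y. norm (f (fst (x, y)) * g (snd (x, y))) \<partial>lborel)"
      using f g by (simp add: norm_mult)
    show "AE x in lborel. integrable lborel (\<lambda>y. f (fst (x, y)) * g (snd (x, y)))"
      using g by simp
  qed simp
  thus "integrable lborel (\<lambda>z. f (fst z) * g (snd z))" by (simp add: lborel_prod)
  have "integral\<^sup>L (lborel \<Otimes>\<^sub>M lborel) (\<lambda>z. f (fst z) * g (snd z)) = (\<integral>x. \<integral>y. f x * g y \<partial>lborel \<partial>lborel)"
    using lborel_pair.integral_fst'[OF I] by simp
  thus "integral\<^sup>L lborel (\<lambda>z. f (fst z) * g (snd z)) = integral\<^sup>L lborel f * integral\<^sup>L lborel g"
    by (simp add: lborel_prod)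
qed

lemma cis_integral:
  assumes "b = 2 * pi \<or> (b = pi \<and> even n)"
  shows "integrable lborel (\<lambda>x. indicator {0<..<b} x *\<^sub>R cis (of_int n * x))"
    and "(\<integral>x. indicator {0<..<b} x *\<^sub>R cis (of_int n * x) \<partial>lborel) = (if n = 0 then of_real b else 0)"
proof -
  have b: "0 < b" using assms by auto
  have ae: "AE x in lborel. indicator {0<..<b} x *\<^sub>R cis (of_int n * x) = indicator {0..b} x *\<^sub>R cis (of_int n * x)"
    using AE_lborel_singleton[of "0::real"] AE_lborel_singleton[of b]
    by eventually_elim (auto split: split_indicator)
  have cm: "(\<lambda>x. cis (of_int n * x)) \<in> borel_measurable borel"
    by (intro borel_measurable_continuous_onI continuous_intros)
  note cm[measurable]
  have cont: "continuous_on {0..b} (\<lambda>x. cis (of_int n * x))" by (intro continuous_intros)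
  have hb: "has_bochner_integral lborel (\<lambda>x. indicator {0..b} x *\<^sub>R cis (of_int n * x)) (if n = 0 then of_real b else 0)"
  proof (cases "n = 0")
    case True
    have "has_bochner_integral lborel (\<lambda>x. indicator {0..b} x *\<^sub>R (1::complex)) (of_real b)"
    proof -
      have "has_bochner_integral lborel (indicator {0..b} :: real \<Rightarrow> real) b"
        using has_bochner_integral_real_indicator[of "{0..b}" lborel] b by simp
      from has_bochner_integral_of_real[OF this] show ?thesis by (simp add: scaleR_conv_of_real)
    qed
    thus ?thesis using True by simp
  next
    case False
    define F where "F = (\<lambda>x. cis (of_int n * x) / (\<i> * of_int n))"
    have "has_bochner_integral lborel (\<lambda>x. indicator {0..b} x *\<^sub>R cis (of_int n * x)) (F b - F 0)"
    proof (rule has_bochner_integral_FTC_Icc)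
      fix x assume "0 \<le> x" "x \<le> b"
      have "((\<lambda>x. cis (of_int n * x)) has_vector_derivative (\<i> * of_real (of_int n)) * cis (of_int n * x)) (at x within {0..b})"
        using has_vector_derivative_mult_cis[of "\<lambda>_. 1" 0 x "\<lambda>x. of_int n * x" "of_int n"]
        by (auto intro!: derivative_eq_intros intro: has_vector_derivative_at_within)
      from has_vector_derivative_divide[OF this, of "\<i> * of_int n"]
      show "(F has_vector_derivative cis (of_int n * x)) (at x within {0..b})"
        unfolding F_def using False by simp
    qed (use b cont in auto)
    moreover have "cis (of_int n * b) = 1"
    proof -
      obtain k where "of_int n * b = 2 * pi * of_int k"
        using assms by (elim disjE) (auto elim!: evenE intro: that)
      thus ?thesis using cis_add_int[of 0 k] by simp
    qed
    ultimately show ?thesis using False by (simp add: F_def)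
  qed
  have "integrable lborel (\<lambda>x. indicator {0..b} x *\<^sub>R cis (of_int n * x))" using hb by (auto simp: has_bochner_integral_iff)
  thus "integrable lborel (\<lambda>x. indicator {0<..<b} x *\<^sub>R cis (of_int n * x))"
    by (subst integrable_cong_AE[OF _ _ ae]) auto
  show "(\<integral>x. indicator {0<..<b} x *\<^sub>R cis (of_int n * x) \<partial>lborel) = (if n = 0 then of_real b else 0)"
    by (subst integral_cong_AE[OF _ _ ae]) (use hb in \<open>auto simp: has_bochner_integral_iff\<close>)
qed

lemma radial_integral:
  assumes "M \<ge> 1"
  shows "has_bochner_integral lborel (\<lambda>t. indicator {0<..} t * (sinh t * cosh t * (1 / cosh t) ^ (M + 2))) (1 / real M)"
proof -
  have pos: "cosh t > 0" for t :: real by simp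
  have ae: "AE x::real in lborel. indicator {0<..} x * (sinh x * cosh x * (1 / cosh x) ^ (M + 2)) = indicator {0..} x * (sinh x * cosh x * (1 / cosh x) ^ (M + 2))"
    using AE_lborel_singleton[of "0::real"] by eventually_elim (auto split: split_indicator)
  have nn: "(\<integral>\<^sup>+x. ennreal (sinh x * cosh x * (1 / cosh x) ^ (M + 2)) * indicator {0..} x \<partial>lborel) = ennreal (0 - (- ((1 / cosh 0) ^ M) / M))"
  proof (rule nn_integral_FTC_atLeast)
    fix x :: real assume "0 \<le> x"
    have "((\<lambda>x. - ((1 / cosh x) ^ M) / M) has_real_derivative (1 / cosh x) ^ (M - 1) * (sinh x / (cosh x)\<^sup>2)) (at x)"
      using assms pos[of x] by (auto intro!: derivative_eq_intros simp: power2_eq_square)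
    also have "(1 / cosh x) ^ (M - 1) * (sinh x / (cosh x)\<^sup>2) = sinh x * cosh x * (1 / cosh x) ^ (M + 2)"
    proof -
      obtain k where "M = Suc k" using assms by (cases M) auto
      thus ?thesis using pos[of x] by (simp add: power2_eq_square field_simps)
    qed
    finally show "((\<lambda>x. - ((1 / cosh x) ^ M) / M) has_real_derivative sinh x * cosh x * (1 / cosh x) ^ (M + 2)) (at x)" .
    show "0 \<le> sinh x * cosh x * (1 / cosh x) ^ (M + 2)" using \<open>0 \<le> x\<close> by simp
  next
    have "filterlim (cosh :: real \<Rightarrow> real) at_top at_top" by (rule cosh_real_at_top)
    hence "((\<lambda>x::real. 1 / cosh x) \<longlongrightarrow> 0) at_top"
      using tendsto_inverse_0_at_top[of cosh at_top] by (simp add: inverse_eq_divide)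
    hence "((\<lambda>x::real. - ((1 / cosh x) ^ M) / M) \<longlongrightarrow> - (0 ^ M) / real M) at_top"
      by (intro tendsto_intros) (use assms in auto)
    thus "((\<lambda>x::real. - ((1 / cosh x) ^ M) / M) \<longlongrightarrow> 0) at_top" using assms by (simp add: power_0_left)
  qed simp
  have "has_bochner_integral lborel (\<lambda>t. indicator {0..} t * (sinh t * cosh t * (1 / cosh t) ^ (M + 2))) (1 / real M)"
  proof (rule has_bochner_integral_nn_integral)
    have "(\<integral>\<^sup>+x. ennreal (indicator {0..} x * (sinh x * cosh x * (1 / cosh x) ^ (M + 2))) \<partial>lborel) = (\<integral>\<^sup>+x. ennreal (sinh x * cosh x * (1 / cosh x) ^ (M + 2)) * indicator {0..} x \<partial>lborel)"
      by (intro nn_integral_cong) (auto split: split_indicator)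
    thus "(\<integral>\<^sup>+x. ennreal (indicator {0..} x * (sinh x * cosh x * (1 / cosh x) ^ (M + 2))) \<partial>lborel) = ennreal (1 / real M)"
      unfolding nn using assms by simp
  qed (auto split: split_indicator)
  moreover have "has_bochner_integral lborel (\<lambda>t. indicator {0<..} t * (sinh t * cosh t * (1 / cosh t) ^ (M + 2))) (1 / real M) =
      has_bochner_integral lborel (\<lambda>t. indicator {0..} t * (sinh t * cosh t * (1 / cosh t) ^ (M + 2))) (1 / real M)"
    by (rule has_bochner_integral_cong_AE[OF _ _ ae]) auto
  ultimately show ?thesis by simp
qed

lemma haar_eq_density:
  "haar = distr (density lborel (\<lambda>u. ennreal (indicator chart_domain u * (sinh (u$2) * cosh (u$2) / (2 * pi ^ 3))))) borel (chart 1)"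
  unfolding haar_def by (intro arg_cong[of _ _ "\<lambda>x. distr x borel (chart 1)"] arg_cong[of _ _ "density lborel"])
    (auto simp: fun_eq_iff split: split_indicator)

lemma haar_chart:
  fixes F :: "HC \<Rightarrow> complex"
  assumes [measurable]: "F \<in> borel_measurable borel"
  shows "integrable haar F \<longleftrightarrow> integrable lborel (\<lambda>u. indicator chart_domain u *\<^sub>R (of_real (sinh (u$2) * cosh (u$2) / (2 * pi ^ 3)) * F (chart 1 u)))"
    and "integral\<^sup>L haar F = (\<integral>u. indicator chart_domain u *\<^sub>R (of_real (sinh (u$2) * cosh (u$2) / (2 * pi ^ 3)) * F (chart 1 u)) \<partial>lborel)"
proof -
  have nn: "0 \<le> indicator chart_domain u * (sinh (u$2) * cosh (u$2) / (2 * pi ^ 3))" for u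
    by (auto split: split_indicator simp: chart_domain_def)
  show "integrable haar F \<longleftrightarrow> integrable lborel (\<lambda>u. indicator chart_domain u *\<^sub>R (of_real (sinh (u$2) * cosh (u$2) / (2 * pi ^ 3)) * F (chart 1 u)))"
    unfolding haar_eq_density
    by (subst integrable_distr_eq, measurable, subst integrable_density)
       (use nn in \<open>auto simp: scaleR_conv_of_real mult_ac intro!: arg_cong[of _ _ "integrable lborel"]\<close>)
  show "integral\<^sup>L haar F = (\<integral>u. indicator chart_domain u *\<^sub>R (of_real (sinh (u$2) * cosh (u$2) / (2 * pi ^ 3)) * F (chart 1 u)) \<partial>lborel)"
    unfolding haar_eq_density
    by (subst integral_distr, measurable, subst integral_density)
       (use nn in \<open>auto simp: scaleR_conv_of_real mult_ac intro!: Bochner_Integration.integral_cong\<close>)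
qed

lemma haar_product:
  fixes F :: "HC \<Rightarrow> complex" and h :: "real \<Rightarrow> complex" and p r s :: int
  assumes [measurable]: "F \<in> borel_measurable borel"
    and F: "\<And>u. u \<in> chart_domain \<Longrightarrow> F (chart 1 u) = cis (of_int p * u$1) * cis (of_int r * u$3) * cis (of_int s * u$4) * h (u$2)"
    and h: "has_bochner_integral lborel (\<lambda>t. indicator {0<..} t *\<^sub>R (of_real (sinh t * cosh t) * h t)) I"
  shows "integrable haar F"
    and "even (p + s) \<or> r \<noteq> 0 \<Longrightarrow> integral\<^sup>L haar F = (if p = 0 \<and> r = 0 \<and> s = 0 then 2 * I else 0)"
proof -
  define f1 where "f1 x = indicator {0<..<pi} x *\<^sub>R cis (of_int p * x)" for x
  define f2 where "f2 t = indicator {0<..} t *\<^sub>R (of_real (sinh t * cosh t) * h t)" for t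
  define f3 where "f3 x = indicator {0<..<2*pi} x *\<^sub>R cis (of_int r * x)" for x
  define f4 where "f4 x = indicator {0<..<2*pi} x *\<^sub>R cis (of_int s * x)" for x
  have cm: "(\<lambda>x. cis (of_int p * x)) \<in> borel_measurable borel"
    by (intro borel_measurable_continuous_onI continuous_intros)
  note cm[measurable]
  have "integrable lborel f1" unfolding f1_def
    by (rule Bochner_Integration.integrable_bound[where f="\<lambda>x. indicator {0<..<pi} x :: real"])
       (auto split: split_indicator simp: emeasure_lborel_Ioo intro!: integrable_real_indicator)
  hence i: "integrable lborel f1" "integrable lborel f2" "integrable lborel f3" "integrable lborel f4"
    using h unfolding f2_def f3_def f4_def by (auto intro!: cis_integral simp: has_bochner_integral_iff)
  define G where "G u = indicator chart_domain u *\<^sub>R (of_real (sinh (u$2) * cosh (u$2) / (2 * pi ^ 3)) * F (chart 1 u))" for u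
  have G: "G (mk4 z) = of_real (1 / (2 * pi ^ 3)) * (f1 (fst z) * ((\<lambda>w. f2 (fst w) * ((\<lambda>v. f3 (fst v) * f4 (snd v)) (snd w))) (snd z)))" for z
  proof -
    obtain x t b a where z: "z = (x, t, b, a)" by (cases z) auto
    show ?thesis unfolding G_def z f1_def f2_def f3_def f4_def
      by (cases "mk4 (x, t, b, a) \<in> chart_domain")
         (auto simp: F, auto simp: chart_domain_def scaleR_conv_of_real split: split_indicator)
  qed
  have Gm[measurable]: "G \<in> borel_measurable borel" unfolding G_def by measurable
  note i34 = lborel_integral_product[OF i(3,4)]
  note i2 = lborel_integral_product[OF i(2) i34(1)]
  note i1 = lborel_integral_product[OF i(1) i2(1)]
  have "integrable lborel (\<lambda>z. G (mk4 z))"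
    unfolding G by (rule integrable_mult_right[OF i1(1)])
  hence "integrable lborel G"
    by (subst lborel_mk4) (simp add: integrable_distr_eq)
  thus "integrable haar F" unfolding G_def using haar_chart(1)[of F] by simp
  have "integral\<^sup>L haar F = (\<integral>u. G u \<partial>lborel)" unfolding G_def by (rule haar_chart) simp
  also have "\<dots> = (\<integral>z. G (mk4 z) \<partial>lborel)"
    by (subst lborel_mk4) (simp add: integral_distr)
  also have "\<dots> = of_real (1 / (2 * pi ^ 3)) * (integral\<^sup>L lborel f1 * (integral\<^sup>L lborel f2 * (integral\<^sup>L lborel f3 * integral\<^sup>L lborel f4)))"
    unfolding G integral_mult_right_zero i1(2) i2(2) i34(2) ..
  finally have eq: "integral\<^sup>L haar F = of_real (1 / (2 * pi ^ 3)) * (integral\<^sup>L lborel f1 * (integral\<^sup>L lborel f2 * (integral\<^sup>L lborel f3 * integral\<^sup>L lborel f4)))" .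
  have 4: "integral\<^sup>L lborel f4 = (if s = 0 then of_real (2 * pi) else 0)"
    and 3: "integral\<^sup>L lborel f3 = (if r = 0 then of_real (2 * pi) else 0)"
    and 2: "integral\<^sup>L lborel f2 = I"
    using cis_integral(2)[of "2 * pi" s] cis_integral(2)[of "2 * pi" r] h
    unfolding f2_def f3_def f4_def by (auto simp: has_bochner_integral_iff)
  assume ev: "even (p + s) \<or> r \<noteq> 0"
  show "integral\<^sup>L haar F = (if p = 0 \<and> r = 0 \<and> s = 0 then 2 * I else 0)"
  proof (cases "s = 0 \<and> r = 0")
    case True
    hence "integral\<^sup>L lborel f1 = (if p = 0 then of_real pi else 0)"
      using cis_integral(2)[of pi p] ev unfolding f1_def by auto
    thus ?thesis unfolding eq 2 3 4 using True by (auto simp: power3_eq_cube)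
  next
    case False
    thus ?thesis unfolding eq 3 4 by auto
  qed
qed

lemma matrix_inv_22:
  fixes g :: HC
  assumes "det g \<noteq> 0"
  shows "matrix_inv g = mat2 (g$2$2 / det g) (- g$1$2 / det g) (- g$2$1 / det g) (g$1$1 / det g)" (is "_ = ?h")
proof -
  have d: "g$1$1 * g$2$2 - g$1$2 * g$2$1 \<noteq> 0" using assms by (simp add: det_2)
  have "g ** ?h = mat 1" "?h ** g = mat 1"
    using d by (simp_all add: HC_eq_iff det_2 mat_mult_nth add_divide_distrib[symmetric] diff_divide_distrib[symmetric] mult_ac)
  note gh = this
  hence "\<exists>h. g ** h = mat 1 \<and> h ** g = mat 1" by blast
  hence "matrix_inv g ** g = mat 1"
    unfolding matrix_inv_def by (rule someI2_ex) simp
  hence "matrix_inv g ** (g ** ?h) = ?h"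
    by (simp only: matrix_mul_assoc matrix_mul_lid)
  thus ?thesis by (simp only: gh(1) matrix_mul_rid)
qed

definition UU :: "HC set" where
  "UU = {Z. cmod (det Z) = 1 \<and> Z$2$2 = det Z * cnj (Z$1$1) \<and> Z$2$1 = det Z * cnj (Z$1$2)}"

lemma UU_D:
  assumes "Z \<in> UU"
  shows "cmod (det Z) = 1" "det Z \<noteq> 0" "Z$2$2 = det Z * cnj (Z$1$1)" "Z$2$1 = det Z * cnj (Z$1$2)"
    "(cmod (Z$1$2))\<^sup>2 = (cmod (Z$1$1))\<^sup>2 - 1" "cmod (Z$2$2) = cmod (Z$1$1)" "cmod (Z$2$1) = cmod (Z$1$2)"
    "1 \<le> cmod (Z$1$1)" "cmod (Z$1$2) < cmod (Z$1$1)"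
    "Z$1$1 \<noteq> 0" "Z$2$2 \<noteq> 0"
proof -
  show 1: "cmod (det Z) = 1" and 3: "Z$2$2 = det Z * cnj (Z$1$1)" and 4: "Z$2$1 = det Z * cnj (Z$1$2)"
    using assms by (auto simp: UU_def)
  thus 2: "det Z \<noteq> 0" by auto
  have "det Z = det Z * (Z$1$1 * cnj (Z$1$1) - Z$1$2 * cnj (Z$1$2))"
    by (subst (1) det_2) (simp add: 3 4 algebra_simps)
  hence "Z$1$1 * cnj (Z$1$1) - Z$1$2 * cnj (Z$1$2) = 1" using 2 by simp
  hence "complex_of_real ((cmod (Z$1$1))\<^sup>2 - (cmod (Z$1$2))\<^sup>2) = 1"
    by (simp flip: complex_norm_square)
  hence 5: "(cmod (Z$1$1))\<^sup>2 - (cmod (Z$1$2))\<^sup>2 = 1" using of_real_eq_1_iff by blast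
  thus "(cmod (Z$1$2))\<^sup>2 = (cmod (Z$1$1))\<^sup>2 - 1" by simp
  show 6: "cmod (Z$2$2) = cmod (Z$1$1)" unfolding 3 norm_mult 1 by simp
  show "cmod (Z$2$1) = cmod (Z$1$2)" unfolding 4 norm_mult 1 by simp
  have "1\<^sup>2 \<le> (cmod (Z$1$1))\<^sup>2" using 5 by (simp add: algebra_simps)
  thus 7: "1 \<le> cmod (Z$1$1)" by (rule power2_le_imp_le) simp
  have "(cmod (Z$1$2))\<^sup>2 < (cmod (Z$1$1))\<^sup>2" using 5 by linarith
  thus "cmod (Z$1$2) < cmod (Z$1$1)" by (rule power_less_imp_less_base) simp
  show "Z$1$1 \<noteq> 0" "Z$2$2 \<noteq> 0" using 6 7 by auto
qed

lemma chart_UU: "chart 1 u \<in> UU"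
  and cmod_chart: "0 < u$2 \<Longrightarrow> cmod (chart 1 u $ 1 $ 1) = cosh (u$2)"
proof -
  have "det (chart R u) = of_real (R\<^sup>2) * cis (2 * u$1)" for R
  proof -
    have e: "cis (u$1 + x) * cis (u$1 - x) = cis (2 * u$1)" for x by (simp add: cis_mult)
    have "det (chart R u) = of_real ((R * cosh (u$2))\<^sup>2) * (cis (u$1 + u$4) * cis (u$1 - u$4))
       - of_real ((R * sinh (u$2))\<^sup>2) * (cis (u$1 + u$3) * cis (u$1 - u$3))"
      by (simp add: det_2 chart_nth power2_eq_square mult_ac)
    also have "\<dots> = of_real ((R * cosh (u$2))\<^sup>2 - (R * sinh (u$2))\<^sup>2) * cis (2 * u$1)"
      unfolding e by (simp add: algebra_simps)
    also have "(R * cosh (u$2))\<^sup>2 - (R * sinh (u$2))\<^sup>2 = R\<^sup>2"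
      by (simp add: power_mult_distrib cosh_square_eq algebra_simps)
    finally show ?thesis .
  qed
  from this[of 1] show "chart 1 u \<in> UU"
    by (simp add: UU_def norm_mult chart_nth cis_cnj cis_mult mult_ac)
  show "0 < u$2 \<Longrightarrow> cmod (chart 1 u $ 1 $ 1) = cosh (u$2)" by (simp add: chart_nth norm_mult)
qed

lemma det_chart: "det (chart R u) = of_real (R\<^sup>2) * cis (2 * u$1)"
proof -
  have e: "cis (u$1 + x) * cis (u$1 - x) = cis (2 * u$1)" for x by (simp add: cis_mult)
  have "det (chart R u) = of_real ((R * cosh (u$2))\<^sup>2) * (cis (u$1 + u$4) * cis (u$1 - u$4))
     - of_real ((R * sinh (u$2))\<^sup>2) * (cis (u$1 + u$3) * cis (u$1 - u$3))"
    by (simp add: det_2 chart_nth power2_eq_square mult_ac)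
  also have "\<dots> = of_real ((R * cosh (u$2))\<^sup>2 - (R * sinh (u$2))\<^sup>2) * cis (2 * u$1)"
    unfolding e by (simp add: algebra_simps)
  also have "(R * cosh (u$2))\<^sup>2 - (R * sinh (u$2))\<^sup>2 = R\<^sup>2"
    by (simp add: power_mult_distrib cosh_square_eq algebra_simps)
  finally show ?thesis .
qed

lemma UU_borel [measurable]: "UU \<in> sets borel"
proof -
  have "closed UU" unfolding UU_def
    by (intro closed_Collect_conj closed_Collect_eq continuous_intros; simp add: det_2; intro continuous_intros)
  thus ?thesis by simp
qed

lemma AE_haar: "AE Z in haar. Z \<in> UU"
  unfolding haar_def by (subst AE_distr_iff) (auto simp: chart_UU)

lemma SU11_D:
  assumes "g \<in> SU11"
  shows "g$2$2 = cnj (g$1$1)" "g$2$1 = cnj (g$1$2)" "det g = 1"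
    "matrix_inv g = mat2 (cnj (g$1$1)) (- g$1$2) (- cnj (g$1$2)) (g$1$1)" "matrix_inv g \<in> SU11"
    "g ** matrix_inv g = mat 1" "matrix_inv g ** g = mat 1"
proof -
  show 1: "g$2$2 = cnj (g$1$1)" "g$2$1 = cnj (g$1$2)" "det g = 1" using assms by (auto simp: SU11_def)
  show 2: "matrix_inv g = mat2 (cnj (g$1$1)) (- g$1$2) (- cnj (g$1$2)) (g$1$1)"
    using matrix_inv_22[of g] 1 by simp
  have d: "g$1$1 * cnj (g$1$1) - g$1$2 * cnj (g$1$2) = 1" using 1 by (simp add: det_2)
  thus "matrix_inv g \<in> SU11" unfolding 2 SU11_def by (simp add: det_2 mult_ac)
  show "g ** matrix_inv g = mat 1" "matrix_inv g ** g = mat 1"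
    unfolding 2 using d by (simp_all add: HC_eq_iff 1 mult_ac) 
qed

lemma SU11_mult_UU:
  assumes "g \<in> SU11" "Z \<in> UU"
  shows "g ** Z \<in> UU" "Z ** g \<in> UU"
proof -
  have "det Z * cnj (det Z) = 1" using UU_D(1)[OF assms(2)] by (simp flip: complex_norm_square)
  hence d: "det Z * (cnj (det Z) * x) = x" for x by (simp flip: mult.assoc)
  show "g ** Z \<in> UU" "Z ** g \<in> UU"
    using SU11_D(1-3)[OF assms(1)] UU_D(1,3,4)[OF assms(2)]
    by (simp_all add: UU_def det_mul algebra_simps d)
qed

definition conjg :: "HC \<Rightarrow> HC \<Rightarrow> HC" where "conjg g Z = g ** Z ** matrix_inv g"

lemma conjg_UU: "g \<in> SU11 \<Longrightarrow> Z \<in> UU \<Longrightarrow> conjg g Z \<in> UU"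
  unfolding conjg_def by (intro SU11_mult_UU SU11_D)

lemma matrix_mult_measurable [measurable]:
  fixes f g :: "'a \<Rightarrow> HC"
  assumes [measurable]: "f \<in> borel_measurable M" "g \<in> borel_measurable M"
  shows "(\<lambda>x. f x ** g x :: HC) \<in> borel_measurable M"
proof (rule borel_measurable_HC)
  have e[measurable]: "(\<lambda>x. f x $ i $ j) \<in> borel_measurable M" "(\<lambda>x. g x $ i $ j) \<in> borel_measurable M" for i j
    using measurable_compose[OF assms(1) borel_measurable_entry] measurable_compose[OF assms(2) borel_measurable_entry] by auto
  fix i j :: 2 show "(\<lambda>x. (f x ** g x) $ i $ j) \<in> borel_measurable M"
    by (simp add: mat_mult_nth)
qed

lemma conjg_measurable [measurable]: "conjg g \<in> borel_measurable borel"
  unfolding conjg_def by measurable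

definition swp :: "HC \<Rightarrow> HC" where "swp Z = mat2 (Z$2$2) (Z$2$1) (Z$1$2) (Z$1$1)"

lemma swp_nth [simp]: "swp Z $ 1 $ 1 = Z$2$2" "swp Z $ 1 $ 2 = Z$2$1" "swp Z $ 2 $ 1 = Z$1$2" "swp Z $ 2 $ 2 = Z$1$1"
  by (simp_all add: swp_def)

lemma det_swp [simp]: "det (swp Z) = det Z" by (simp add: det_2 mult_ac)

lemma swp_swp [simp]: "swp (swp Z) = Z" by (simp add: HC_eq_iff)

lemma swp_mult: "swp (A ** B) = swp A ** swp B" by (simp add: HC_eq_iff add.commute)

lemma swp_measurable [measurable]: "swp \<in> borel_measurable borel"
proof (rule borel_measurable_HC)
  fix i j :: 2
  show "(\<lambda>x. swp x $ i $ j) \<in> borel_measurable borel"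
    using exhaust_2[of i] exhaust_2[of j] by (elim disjE; simp; measurable)
qed

lemma swp_UU: "Z \<in> UU \<Longrightarrow> swp Z \<in> UU"
proof -
  assume Z: "Z \<in> UU"
  have "det Z * cnj (det Z) = 1" using UU_D(1)[OF Z] by (simp flip: complex_norm_square)
  hence d: "det Z * (cnj (det Z) * x) = x" for x by (simp flip: mult.assoc)
  show ?thesis using UU_D(1,3,4)[OF Z] by (simp add: UU_def d)
qed

lemma haar_left:
  assumes "g \<in> SU11"
  shows "distr haar borel (\<lambda>Z. g ** Z) = haar"
proof -
  define p q r s where "p = Re (g$1$1)" and "q = Im (g$1$1)" and "r = Re (g$1$2)" and "s = Im (g$1$2)"
  have g: "g$1$1 = Complex p q" "g$1$2 = Complex r s" "g$2$1 = Complex r (- s)" "g$2$2 = Complex p (- q)"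
    using SU11_D(1,2)[OF assms] by (simp_all add: complex_eq_iff p_def q_def r_def s_def)
  have n: "p\<^sup>2 + q\<^sup>2 - r\<^sup>2 - s\<^sup>2 = 1"
    using SU11_norm[OF assms] by (simp add: g cmod_power2)
  define A :: "real^4^4" where "A = vector [vector [p, - q, r, s], vector [q, p, s, - r], vector [r, s, p, - q], vector [s, - r, q, p]]"
  have dA: "det A = (p\<^sup>2 + q\<^sup>2 - r\<^sup>2 - s\<^sup>2)\<^sup>2"
    unfolding det_4 A_def by (simp add: power2_eq_square algebra_simps)
  show ?thesis
  proof (rule haar_invariant[where L = "\<lambda>v. A *v v"])
    show "g ** hyp_emb v = hyp_emb (A *v v)" for v
      by (simp add: HC_eq_iff hyp_emb_def g A_def matrix_vector_mult_def sum_4 complex_eq_iff algebra_simps)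
    show "hyp_q (A *v v) = hyp_q v" for v
    proof -
      have "hyp_q (A *v v) = (p\<^sup>2 + q\<^sup>2 - r\<^sup>2 - s\<^sup>2) * hyp_q v"
        by (simp add: hyp_q_def A_def matrix_vector_mult_def sum_4 power2_eq_square algebra_simps)
      thus ?thesis by (simp add: n)
    qed
    show "g ** (mat c ** Z) = mat c ** (g ** Z)" for c and Z :: HC
      by (simp add: HC_eq_iff algebra_simps)
  qed (auto simp: dA n matrix_of_matrix_vector_mul)
qed

lemma haar_right:
  assumes "g \<in> SU11"
  shows "distr haar borel (\<lambda>Z. Z ** g) = haar"
proof -
  define p q r s where "p = Re (g$1$1)" and "q = Im (g$1$1)" and "r = Re (g$1$2)" and "s = Im (g$1$2)"
  have g: "g$1$1 = Complex p q" "g$1$2 = Complex r s" "g$2$1 = Complex r (- s)" "g$2$2 = Complex p (- q)"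
    using SU11_D(1,2)[OF assms] by (simp_all add: complex_eq_iff p_def q_def r_def s_def)
  have n: "p\<^sup>2 + q\<^sup>2 - r\<^sup>2 - s\<^sup>2 = 1"
    using SU11_norm[OF assms] by (simp add: g cmod_power2)
  define A :: "real^4^4" where "A = vector [vector [p, - q, r, s], vector [q, p, - s, r], vector [r, - s, p, q], vector [s, r, - q, p]]"
  have dA: "det A = (p\<^sup>2 + q\<^sup>2 - r\<^sup>2 - s\<^sup>2)\<^sup>2"
    unfolding det_4 A_def by (simp add: power2_eq_square algebra_simps)
  show ?thesis
  proof (rule haar_invariant[where L = "\<lambda>v. A *v v"])
    show "hyp_emb v ** g = hyp_emb (A *v v)" for v
      by (simp add: HC_eq_iff hyp_emb_def g A_def matrix_vector_mult_def sum_4 complex_eq_iff algebra_simps)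
    show "hyp_q (A *v v) = hyp_q v" for v
    proof -
      have "hyp_q (A *v v) = (p\<^sup>2 + q\<^sup>2 - r\<^sup>2 - s\<^sup>2) * hyp_q v"
        by (simp add: hyp_q_def A_def matrix_vector_mult_def sum_4 power2_eq_square algebra_simps)
      thus ?thesis by (simp add: n)
    qed
    show "mat c ** Z ** g = mat c ** (Z ** g)" for c and Z :: HC
      by (simp add: HC_eq_iff algebra_simps)
  qed (auto simp: dA n matrix_of_matrix_vector_mul)
qed

lemma haar_conjg:
  assumes "g \<in> SU11"
  shows "distr haar borel (conjg g) = haar"
proof -
  have "distr haar borel (conjg g) = distr (distr haar borel (\<lambda>Z. g ** Z)) borel (\<lambda>Z. Z ** matrix_inv g)"
    by (subst distr_distr) (auto simp: conjg_def[abs_def] o_def)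
  thus ?thesis using haar_left[OF assms] haar_right[OF SU11_D(5)[OF assms]] by simp
qed

lemma haar_swp: "distr haar borel swp = haar"
proof -
  define A :: "real^4^4" where "A = vector [vector [1, 0, 0, 0], vector [0, - 1, 0, 0], vector [0, 0, 1, 0], vector [0, 0, 0, - 1]]"
  have dA: "det A = 1"
    unfolding det_4 A_def by simp
  show ?thesis
  proof (rule haar_invariant[where L = "\<lambda>v. A *v v"])
    show "swp (hyp_emb v) = hyp_emb (A *v v)" for v
      by (simp add: HC_eq_iff hyp_emb_def A_def matrix_vector_mult_def sum_4)
    show "hyp_q (A *v v) = hyp_q v" for v
      by (simp add: hyp_q_def A_def matrix_vector_mult_def sum_4)
    show "swp (mat c ** Z) = mat c ** swp Z" for c and Z :: HC
      by (simp add: HC_eq_iff)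
  qed (auto simp: dA matrix_of_matrix_vector_mul)
qed

lemma haar_transform:
  fixes f :: "HC \<Rightarrow> complex"
  assumes T: "distr haar borel T = haar" and [measurable]: "T \<in> borel_measurable borel" "f \<in> borel_measurable borel"
  shows "integrable haar (\<lambda>Z. f (T Z)) \<longleftrightarrow> integrable haar f" "integral\<^sup>L haar (\<lambda>Z. f (T Z)) = integral\<^sup>L haar f"
  by (subst (2) T[symmetric], simp add: integrable_distr_eq integral_distr)+

lemma dV_partials_chart:
  "dV (partials (chart R) u) = - \<i> * of_real (R ^ 4 * (sinh (u$2) * cosh (u$2))) * cis (2 * u$1) ^ 2"
proof -
  define s c where "s = complex_of_real (sinh (u$2))" and "c = complex_of_real (cosh (u$2))"
  define A B B' A' where "A = cis (u$1 + u$4)" and "B = cis (u$1 + u$3)" and "B' = cis (u$1 - u$3)" and "A' = cis (u$1 - u$4)"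
  have AB: "A * A' = cis (2 * u$1)" "B * B' = cis (2 * u$1)" by (simp_all add: A_def A'_def B_def B'_def cis_mult)
  have "cosh (u$2) * cosh (u$2) = sinh (u$2) * sinh (u$2) + 1"
    using cosh_square_eq[of "u$2"] by (simp add: power2_eq_square)
  hence sc: "c * c = s * s + 1"
    unfolding s_def c_def by (metis of_real_1 of_real_add of_real_mult)
  define V :: "complex^4^4" where "V = vector
    [vector [\<i> * c * A, s * A, 0, \<i> * c * A], vector [\<i> * s * B, c * B, \<i> * s * B, 0],
     vector [\<i> * s * B', c * B', - \<i> * s * B', 0], vector [\<i> * c * A', s * A', 0, - \<i> * c * A']]"
  define C :: "complex^4^4" where "C = vector
    [vector [1/2, 0, 0, 1/2], vector [0, \<i>/2, \<i>/2, 0], vector [0, -1/2, 1/2, 0], vector [\<i>/2, 0, 0, - \<i>/2]]"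
  have e: "(\<chi> i j. coords (partials (chart R) u $ j) $ i) = C ** (mat (of_real R) ** V)"
    unfolding vec_eq_iff forall_4 chart_partials Let_def
    by (simp add: matrix_matrix_mult_def sum_4 coords_def C_def V_def axis_def mat_def if_distrib[of "\<lambda>x. x * _"] A_def B_def A'_def B'_def s_def c_def field_simps)
  have dC: "det C = 1 / 4"
    unfolding det_4 C_def by simp
  have "det V = (A * A') * (B * B') * (- 4 * \<i> * s * c * (c * c - s * s))"
    unfolding det_4 V_def by (simp add: algebra_simps)
  hence dV: "det V = - 4 * \<i> * s * c * cis (2 * u$1) ^ 2"
    unfolding AB by (simp add: sc power2_eq_square mult_ac)
  have "det (mat (of_real R) :: complex^4^4) = of_real R ^ 4"
    unfolding det_4 by (simp add: mat_def numeral_eq_Suc)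
  thus ?thesis
    unfolding dV_def e det_mul dC dV by (simp add: s_def c_def)
qed

lemma dV_haar:
  fixes g h :: "HC \<Rightarrow> complex"
  assumes [measurable]: "h \<in> borel_measurable borel" and h: "integrable haar h"
    and R: "R > 0"
    and eq: "\<And>Z. Z \<in> UU \<Longrightarrow> of_real (R ^ 4) * det Z ^ 2 * g (R *\<^sub>R Z) = h Z"
  shows "dV_integrable R g" "\<i> / (2 * pi ^ 3) * dV_integral R g = integral\<^sup>L haar h"
proof -
  have ch: "chart R u = R *\<^sub>R chart 1 u" for u by (simp add: chart_def)
  have e: "indicator chart_domain u *\<^sub>R (g (chart R u) * dV (partials (chart R) u)) =
     (- 2 * \<i> * pi ^ 3) * (indicator chart_domain u *\<^sub>R (of_real (sinh (u$2) * cosh (u$2) / (2 * pi ^ 3)) * h (chart 1 u)))" for u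
    using eq[OF chart_UU[of u]] unfolding det_chart dV_partials_chart ch[of u]
    by (simp add: scaleR_conv_of_real power2_eq_square mult_ac flip: eq[OF chart_UU[of u]])
       (simp add: det_chart mult_ac)
  have "integrable lborel (\<lambda>u. indicator chart_domain u *\<^sub>R (of_real (sinh (u$2) * cosh (u$2) / (2 * pi ^ 3)) * h (chart 1 u)))"
    using h haar_chart(1)[of h] by simp
  thus "dV_integrable R g" unfolding dV_integrable_def set_integrable_def e
    by (rule integrable_mult_right)
  show "\<i> / (2 * pi ^ 3) * dV_integral R g = integral\<^sup>L haar h"
    unfolding dV_integral_def set_lebesgue_integral_def e integral_mult_right_zero haar_chart(2)[OF assms(1)]
    by simp
qed

lemma haar_majorant: "integrable haar (\<lambda>Z. (1 / cmod (Z$1$1)) ^ 3)"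
proof -
  define F where "F Z = complex_of_real ((1 / cmod (Z$1$1)) ^ 3)" for Z :: HC
  have [measurable]: "F \<in> borel_measurable borel" unfolding F_def by measurable
  have "integrable haar F"
  proof (rule haar_product(1))
    show "F (chart 1 u) = cis (of_int 0 * u$1) * cis (of_int 0 * u$3) * cis (of_int 0 * u$4) * of_real ((1 / cosh (u$2)) ^ 3)" 
      if "u \<in> chart_domain" for u
      using that by (simp add: F_def cmod_chart chart_domain_def)
    show "has_bochner_integral lborel (\<lambda>t. indicator {0<..} t *\<^sub>R (of_real (sinh t * cosh t) * of_real ((1 / cosh t) ^ 3))) (complex_of_real 1)"
    proof -
      have "(\<lambda>t. indicator {0<..} t *\<^sub>R (of_real (sinh t * cosh t) * of_real ((1 / cosh t) ^ 3)))
         = (\<lambda>t. complex_of_real (indicator {0<..} t * (sinh t * cosh t * (1 / cosh t) ^ 3)))"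
        by (simp add: fun_eq_iff scaleR_conv_of_real)
      moreover have "1 + 2 = (3::nat)" by simp
      ultimately show ?thesis
        using has_bochner_integral_of_real[OF radial_integral[OF order_refl]] by (simp only: of_nat_1 div_by_1)
    qed
  qed simp
  hence "integrable haar (\<lambda>Z. Re (F Z))" by simp
  thus ?thesis by (simp add: F_def)
qed

lemma integral_sums:
  fixes h :: "nat \<Rightarrow> 'a \<Rightarrow> complex"
  assumes [measurable]: "\<And>n. h n \<in> borel_measurable M" "H \<in> borel_measurable M"
    and G: "integrable M G" and B: "summable B"
    and bd: "AE x in M. \<forall>n. norm (h n x) \<le> B n * G x"
    and s: "AE x in M. (\<lambda>n. h n x) sums H x"
  shows "integrable M H" "(\<lambda>n. integral\<^sup>L M (h n)) sums integral\<^sup>L M H" "integrable M (h n)"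
proof -
  have i: "integrable M (h n)" for n
    using bd by (intro Bochner_Integration.integrable_bound[OF integrable_mult_right[OF G, of "B n"]])
       (auto elim!: eventually_mono intro: order_trans[OF _ abs_ge_self])
  thus "integrable M (h n)" .
  have sn: "AE x in M. summable (\<lambda>n. norm (h n x))"
    using bd
  proof eventually_elim
    case (elim x)
    show ?case
      by (rule summable_comparison_test[OF _ summable_mult2[OF B, of "G x"]]) (use elim in auto)
  qed
  have si: "summable (\<lambda>n. \<integral>x. norm (h n x) \<partial>M)"
  proof (rule summable_comparison_test[OF _ summable_mult2[OF B, of "integral\<^sup>L M G"]], intro exI allI impI)
    fix n
    have "(\<integral>x. norm (h n x) \<partial>M) \<le> (\<integral>x. B n * G x \<partial>M)"
      using bd i G by (intro integral_mono_AE) auto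
    thus "norm (\<integral>x. norm (h n x) \<partial>M) \<le> B n * integral\<^sup>L M G" by simp
  qed
  have e: "AE x in M. (\<Sum>n. h n x) = H x" using s by (auto elim!: eventually_mono simp: sums_iff)
  show "integrable M H"
    using integrable_suminf[OF i sn si] e
    by (subst integrable_cong_AE[where g="\<lambda>x. \<Sum>n. h n x"]) (auto elim: eventually_mono)
  show "(\<lambda>n. integral\<^sup>L M (h n)) sums integral\<^sup>L M H"
    using sums_integral[OF i sn si] e
    by (subst integral_cong_AE[where g="\<lambda>x. \<Sum>n. h n x"]) (auto elim: eventually_mono)
qed

section \<open>Matrix coefficients as Taylor coefficients\<close>

definition pol1 :: "HC \<Rightarrow> complex fps" where "pol1 Z = fps_const (Z$1$1) + fps_const (Z$2$1) * fps_X"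
definition pol2 :: "HC \<Rightarrow> complex fps" where "pol2 Z = fps_const (Z$1$2) + fps_const (Z$2$2) * fps_X"

definition Fg :: "nat \<Rightarrow> nat \<Rightarrow> HC \<Rightarrow> complex fps" where
  "Fg a j Z = fps_const ((- of_nat a) gchoose j) * (pol2 Z ^ j * inverse (pol1 Z) ^ (a + j))"

definition Fc :: "nat \<Rightarrow> int \<Rightarrow> int \<Rightarrow> HC \<Rightarrow> complex" where
  "Fc a i j Z = (if i < 0 \<or> j < 0 then 0 else fps_nth (Fg a (nat j) Z) (nat i))"

lemma pol1_inverse: "Z$1$1 \<noteq> 0 \<Longrightarrow> pol1 Z * inverse (pol1 Z) = 1"
  by (rule inverse_mult_eq_1') (simp add: pol1_def)

lemma gchoose_rec:
  fixes x :: complex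
  shows "(x gchoose Suc j) = ((x + 1) gchoose Suc j) - (x gchoose j)"
  using gbinomial_Suc_Suc[of x j] by (simp add: algebra_simps)

lemma Fg_rec:
  assumes "Z$1$1 \<noteq> 0"
  shows "pol1 Z * Fg (Suc a) 0 Z = Fg a 0 Z"
    and "pol1 Z * Fg (Suc a) (Suc j) Z + pol2 Z * Fg (Suc a) j Z = Fg a (Suc j) Z"
proof -
  note inv = pol1_inverse[OF assms]
  have iv: "pol1 Z * (inverse (pol1 Z) * x) = x" for x
    by (simp only: mult.assoc[symmetric] inv mult_1_left)
  show "pol1 Z * Fg (Suc a) 0 Z = Fg a 0 Z"
    by (simp add: Fg_def iv)
  define u v where "u = pol2 Z" and "v = inverse (pol1 Z)"
  have "pol1 Z * Fg (Suc a) (Suc j) Z = fps_const ((- of_nat (Suc a)) gchoose Suc j) * (u ^ Suc j * v ^ (a + Suc j))"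
  proof -
    have "pol1 Z * Fg (Suc a) (Suc j) Z = fps_const ((- of_nat (Suc a)) gchoose Suc j) * (u ^ Suc j * (pol1 Z * v ^ (Suc a + Suc j)))"
      unfolding Fg_def u_def[symmetric] v_def[symmetric] by (simp only: mult_ac)
    also have "pol1 Z * v ^ (Suc a + Suc j) = v ^ (a + Suc j)"
      using iv[of "v ^ (a + Suc j)"] by (simp only: v_def[symmetric] add_Suc power_Suc)
    finally show ?thesis .
  qed
  moreover have "pol2 Z * Fg (Suc a) j Z = fps_const ((- of_nat (Suc a)) gchoose j) * (u ^ Suc j * v ^ (a + Suc j))"
    unfolding Fg_def u_def[symmetric] v_def[symmetric] by (simp add: mult_ac)
  moreover have "((- of_nat (Suc a)) gchoose Suc j) + ((- of_nat (Suc a)) gchoose j) = ((- of_nat a) gchoose Suc j :: complex)"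
    using gchoose_rec[of "- of_nat (Suc a)" j] by simp
  ultimately show "pol1 Z * Fg (Suc a) (Suc j) Z + pol2 Z * Fg (Suc a) j Z = Fg a (Suc j) Z"
    unfolding Fg_def[of a] u_def[symmetric] v_def[symmetric]
    by (simp only: distrib_right[symmetric] fps_const_add)
qed

lemma pol_mult_nth:
  "fps_nth (pol1 Z * f) 0 = Z$1$1 * fps_nth f 0" "fps_nth (pol1 Z * f) (Suc n) = Z$1$1 * fps_nth f (Suc n) + Z$2$1 * fps_nth f n"
  "fps_nth (pol1 Z) 0 = Z$1$1" "fps_nth (pol2 Z) 0 = Z$1$2" "fps_nth (pol2 Z * f) 0 = Z$1$2 * fps_nth f 0" "fps_nth (pol2 Z * f) (Suc n) = Z$1$2 * fps_nth f (Suc n) + Z$2$2 * fps_nth f n"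
  by (simp_all add: pol1_def pol2_def distrib_right mult.assoc)

lemma nat_1_int: "nat (1 + int k) = Suc k" by simp

lemma Fc_neg: "i < 0 \<or> j < 0 \<Longrightarrow> Fc a i j Z = 0"
  by (simp add: Fc_def)

lemma gchoose_0: "((0::complex) gchoose n) = (if n = 0 then 1 else 0)"
  by (cases n) (simp_all add: gbinomial_0)

lemma Fc_0: "Fc 0 i j Z = (if i = 0 \<and> j = 0 then 1 else 0)"
  by (auto simp: Fc_def Fg_def gchoose_0)

lemma Fc_rec:
  assumes "Z$1$1 \<noteq> 0"
  shows "Z$1$1 * Fc (Suc a) i j Z + Z$2$1 * Fc (Suc a) (i - 1) j Z + Z$1$2 * Fc (Suc a) i (j - 1) Z
     + Z$2$2 * Fc (Suc a) (i - 1) (j - 1) Z = Fc a i j Z"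
proof (cases "i < 0 \<or> j < 0")
  case False
  then obtain m n where ij: "i = int m" "j = int n" by (metis int_eq_iff not_le)
  have d: "nat (int (Suc k) - 1) = k" for k by simp
  show ?thesis
  proof (cases n)
    case 0
    thus ?thesis using arg_cong[OF Fg_rec(1)[OF assms, of a], of "\<lambda>f. fps_nth f m"]
      by (cases m) (auto simp: Fc_def ij pol_mult_nth nat_1_int)
  next
    case (Suc k)
    thus ?thesis using arg_cong[OF Fg_rec(2)[OF assms, of a k], of "\<lambda>f. fps_nth f m"]
      by (cases m) (auto simp: Fc_def ij pol_mult_nth nat_1_int algebra_simps)
  qed
qed (auto simp: Fc_neg)

lemma Fc_Suc:
  assumes "Z$1$1 \<noteq> 0"
  shows "Fc (Suc a) i j Z = (Fc a i j Z - Z$2$1 * Fc (Suc a) (i - 1) j Z - Z$1$2 * Fc (Suc a) i (j - 1) Z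
     - Z$2$2 * Fc (Suc a) (i - 1) (j - 1) Z) / Z$1$1"
  using Fc_rec[OF assms, of a i j] assms by (simp add: field_simps)

lemma Fc_induct [case_names neg zero step]:
  assumes neg: "\<And>a i j. i < 0 \<or> j < 0 \<Longrightarrow> P a i j"
    and zero: "\<And>i j. P 0 i j"
    and step: "\<And>a i j. 0 \<le> i \<Longrightarrow> 0 \<le> j \<Longrightarrow> P a i j \<Longrightarrow> P (Suc a) (i - 1) j \<Longrightarrow> P (Suc a) i (j - 1) \<Longrightarrow>
      P (Suc a) (i - 1) (j - 1) \<Longrightarrow> P (Suc a) i j"
  shows "P a (i :: int) (j :: int)"
proof (induction a arbitrary: i j)
  case 0
  thus ?case by (rule zero)
next
  case (Suc a i j)
  show ?case
  proof (induction "nat (i + j)" arbitrary: i j rule: less_induct)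
    case (less i j)
    show ?case
    proof (cases "i < 0 \<or> j < 0")
      case False
      have lower: "P (Suc a) k l" if "k + l < i + j" for k l
      proof (cases "k < 0 \<or> l < 0")
        case True
        thus ?thesis by (rule neg)
      next
        case False
        hence "nat (k + l) < nat (i + j)" using that by linarith
        thus ?thesis by (rule less)
      qed
      have "P a i j" by (rule Suc.IH)
      moreover have "P (Suc a) (i - 1) j" "P (Suc a) i (j - 1)" "P (Suc a) (i - 1) (j - 1)"
        using lower[of "i - 1" j] lower[of i "j - 1"] lower[of "i - 1" "j - 1"] by simp_all
      moreover have "0 \<le> i" "0 \<le> j" using False by simp_all
      ultimately show ?thesis by (rule step[rotated 2])
    qed (rule neg)
  qed
qed

lemma Fc_T:
  assumes "Z$1$1 \<noteq> 0"
  shows "(of_int j + 1) * Fc a i (j + 1) Z = - of_nat a * (Z$1$2 * Fc (Suc a) i j Z + Z$2$2 * Fc (Suc a) (i - 1) j Z)"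
proof (cases "i < 0 \<or> j < 0")
  case True
  thus ?thesis by (cases "j = -1") (auto simp: Fc_neg)
next
  case False
  then obtain m n where ij: "i = int m" "j = int n" by (metis int_eq_iff not_le)
  have c: "(of_nat n + 1) * ((- of_nat a) gchoose Suc n :: complex) = - of_nat a * ((- of_nat (Suc a)) gchoose n)"
  proof -
    have "of_nat (Suc n) * ((- of_nat a) gchoose Suc n :: complex) = - of_nat a * ((- of_nat a - 1) gchoose n)"
      by (rule gbinomial_absorption)
    moreover have "(- of_nat a - 1 :: complex) = - of_nat (Suc a)" by simp
    ultimately show ?thesis by (simp only: of_nat_Suc add.commute[of 1])
  qed
  have "fps_const (of_nat n + 1) * Fg a (Suc n) Z = fps_const (- of_nat a) * (pol2 Z * Fg (Suc a) n Z)"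
    unfolding Fg_def using arg_cong[OF c, of fps_const]
    by (simp only: fps_const_mult[symmetric] power_Suc add_Suc add_Suc_right) (simp add: mult_ac)
  from arg_cong[OF this, of "\<lambda>f. fps_nth f m"] show ?thesis
    unfolding fps_mult_left_const_nth
    by (cases m) (auto simp: Fc_def ij pol_mult_nth nat_add_distrib)
qed

lemma Fc_S:
  assumes z: "Z$1$1 \<noteq> 0"
  shows "(of_int i + 1) * Fc a (i + 1) j Z = - of_nat a * (Z$2$1 * Fc (Suc a) i j Z + Z$2$2 * Fc (Suc a) i (j - 1) Z)"
proof (induction a i j rule: Fc_induct)
  case (neg a i j)
  thus ?case by (cases "i = -1") (auto simp: Fc_neg)
next
  case (zero i j)
  thus ?case by (cases "i = -1") (auto simp: Fc_0)
next
  case (step a i j)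
  define x where "x = Z$1$1 * ((of_int i + 1) * Fc (Suc a) (i + 1) j Z)"
  have 1: "Z$1$1 * Fc (Suc a) (i + 1) j Z = Fc a (i + 1) j Z - Z$2$1 * Fc (Suc a) i j Z - Z$1$2 * Fc (Suc a) (i + 1) (j - 1) Z
     - Z$2$2 * Fc (Suc a) i (j - 1) Z"
    using Fc_rec[OF z, of a "i + 1" j] by (simp add: algebra_simps)
  have 2: "Z$1$1 * Fc (Suc (Suc a)) i j Z = Fc (Suc a) i j Z - Z$2$1 * Fc (Suc (Suc a)) (i - 1) j Z - Z$1$2 * Fc (Suc (Suc a)) i (j - 1) Z
     - Z$2$2 * Fc (Suc (Suc a)) (i - 1) (j - 1) Z"
    "Z$1$1 * Fc (Suc (Suc a)) i (j - 1) Z = Fc (Suc a) i (j - 1) Z - Z$2$1 * Fc (Suc (Suc a)) (i - 1) (j - 1) Z - Z$1$2 * Fc (Suc (Suc a)) i (j - 2) Z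
     - Z$2$2 * Fc (Suc (Suc a)) (i - 1) (j - 2) Z"
    using Fc_rec[OF z, of "Suc a" i j] Fc_rec[OF z, of "Suc a" i "j - 1"] by (simp_all add: algebra_simps)
  have h: "of_int i * Fc (Suc a) i j Z = - of_nat (Suc a) * (Z$2$1 * Fc (Suc (Suc a)) (i - 1) j Z + Z$2$2 * Fc (Suc (Suc a)) (i - 1) (j - 1) Z)"
    "of_int i * Fc (Suc a) i (j - 1) Z = - of_nat (Suc a) * (Z$2$1 * Fc (Suc (Suc a)) (i - 1) (j - 1) Z + Z$2$2 * Fc (Suc (Suc a)) (i - 1) (j - 2) Z)"
    using step.IH(2,4) by simp_all
  have "Z$1$1 * ((of_int i + 1) * Fc (Suc a) (i + 1) j Z) =
        Z$1$1 * (- of_nat (Suc a) * (Z$2$1 * Fc (Suc (Suc a)) i j Z + Z$2$2 * Fc (Suc (Suc a)) i (j - 1) Z))"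
  proof -
    have 3: "(of_int i + 1) * Fc (Suc a) (i + 1) (j - 1) Z = - of_nat (Suc a) * (Z$2$1 * Fc (Suc (Suc a)) i (j - 1) Z + Z$2$2 * Fc (Suc (Suc a)) i (j - 2) Z)"
      using step.IH(3) by simp
    have "Z$1$1 * ((of_int i + 1) * Fc (Suc a) (i + 1) j Z) = (of_int i + 1) * (Z$1$1 * Fc (Suc a) (i + 1) j Z)"
      by (simp only: mult_ac)
    also have "\<dots> = (of_int i + 1) * Fc a (i + 1) j Z - Z$2$1 * Fc (Suc a) i j Z - Z$2$2 * Fc (Suc a) i (j - 1) Z
        - Z$2$1 * (of_int i * Fc (Suc a) i j Z) - Z$2$2 * (of_int i * Fc (Suc a) i (j - 1) Z)
        - Z$1$2 * ((of_int i + 1) * Fc (Suc a) (i + 1) (j - 1) Z)"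
      unfolding 1 by (simp add: algebra_simps)
    also have "\<dots> = - of_nat (Suc a) * (Z$2$1 * (Z$1$1 * Fc (Suc (Suc a)) i j Z) + Z$2$2 * (Z$1$1 * Fc (Suc (Suc a)) i (j - 1) Z))"
      unfolding h 3 step.IH(1) 2 of_nat_Suc by (simp add: algebra_simps)
    finally show ?thesis by (simp only: mult_ac distrib_left)
  qed
  thus ?case using z by simp
qed

lemma Fc_M22:
  assumes z: "Z$1$1 \<noteq> 0" and a: "a \<noteq> 0"
  shows "Z$2$2 * Fc (Suc a) i j Z = (of_int i + 1) * (of_int j + 1) / of_nat a ^ 2 * Fc a (i + 1) (j + 1) Z
    + (of_nat a + 1) / of_nat a * (det Z * Fc (Suc (Suc a)) i j Z)"
proof -
  have r: "Z$1$1 * Fc (Suc (Suc a)) i j Z + Z$2$1 * Fc (Suc (Suc a)) (i - 1) j Z + Z$1$2 * Fc (Suc (Suc a)) i (j - 1) Z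
     + Z$2$2 * Fc (Suc (Suc a)) (i - 1) (j - 1) Z = Fc (Suc a) i j Z" by (rule Fc_rec[OF z])
  have t0: "of_int j * Fc (Suc a) i j Z = - (of_nat a + 1) * (Z$1$2 * Fc (Suc (Suc a)) i (j - 1) Z + Z$2$2 * Fc (Suc (Suc a)) (i - 1) (j - 1) Z)"
    using Fc_T[OF z, of "j - 1" "Suc a" i] by (simp add: algebra_simps)
  have t1: "(of_int j + 1) * Fc (Suc a) i (j + 1) Z = - (of_nat a + 1) * (Z$1$2 * Fc (Suc (Suc a)) i j Z + Z$2$2 * Fc (Suc (Suc a)) (i - 1) j Z)"
    using Fc_T[OF z, of j "Suc a" i] by (simp add: algebra_simps)
  have s: "(of_int i + 1) * Fc a (i + 1) (j + 1) Z = - of_nat a * (Z$2$1 * Fc (Suc a) i (j + 1) Z + Z$2$2 * Fc (Suc a) i j Z)"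
    using Fc_S[OF z, of i a "j + 1"] by simp
  have k: "(of_nat a + 1) * (Z$1$1 * Fc (Suc (Suc a)) i j Z + Z$2$1 * Fc (Suc (Suc a)) (i - 1) j Z) = (of_nat a + 1 + of_int j) * Fc (Suc a) i j Z"
  proof -
    have "(of_nat a + 1 + of_int j) * Fc (Suc a) i j Z = (of_nat a + 1) * Fc (Suc a) i j Z + of_int j * Fc (Suc a) i j Z"
      by (simp add: algebra_simps)
    also have "\<dots> = (of_nat a + 1) * (Z$1$1 * Fc (Suc (Suc a)) i j Z + Z$2$1 * Fc (Suc (Suc a)) (i - 1) j Z)"
      unfolding t0 by (subst r[symmetric]) (simp add: algebra_simps)
    finally show ?thesis ..
  qed
  have "of_nat a * (of_nat a * (Z$2$2 * Fc (Suc a) i j Z)) = (of_int i + 1) * (of_int j + 1) * Fc a (i + 1) (j + 1) Z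
    + of_nat a * ((of_nat a + 1) * (det Z * Fc (Suc (Suc a)) i j Z))"
  proof -
    have "(of_int i + 1) * (of_int j + 1) * Fc a (i + 1) (j + 1) Z
      = - of_nat a * (Z$2$1 * ((of_int j + 1) * Fc (Suc a) i (j + 1) Z) + Z$2$2 * ((of_int j + 1) * Fc (Suc a) i j Z))"
    proof -
      have "(of_int i + 1) * (of_int j + 1) * Fc a (i + 1) (j + 1) Z = (of_int j + 1) * ((of_int i + 1) * Fc a (i + 1) (j + 1) Z)"
        by (simp only: mult_ac)
      thus ?thesis unfolding s by (simp add: algebra_simps)
    qed
    also have "\<dots> = of_nat a * (Z$2$2 * ((of_nat a + 1) * (Z$1$1 * Fc (Suc (Suc a)) i j Z + Z$2$1 * Fc (Suc (Suc a)) (i - 1) j Z)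
        - (of_int j + 1) * Fc (Suc a) i j Z)) - of_nat a * ((of_nat a + 1) * (det Z * Fc (Suc (Suc a)) i j Z))"
      unfolding t1 det_2 by (simp add: algebra_simps)
    also have "\<dots> = of_nat a * (of_nat a * (Z$2$2 * Fc (Suc a) i j Z)) - of_nat a * ((of_nat a + 1) * (det Z * Fc (Suc (Suc a)) i j Z))"
      unfolding k by (simp add: algebra_simps)
    finally show ?thesis by simp
  qed
  thus ?thesis using a by (simp add: field_simps power2_eq_square)
qed

lemma Fc_M21:
  assumes z: "Z$1$1 \<noteq> 0" and a: "a \<noteq> 0"
  shows "Z$2$1 * Fc (Suc a) i j Z = - (of_int i + 1) * (of_int j + of_nat a) / of_nat a ^ 2 * Fc a (i + 1) j Z
    - (of_nat a + 1) / of_nat a * (det Z * Fc (Suc (Suc a)) i (j - 1) Z)"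
proof -
  have "Z$2$2 * Fc (Suc a) i (j - 1) Z = (of_int i + 1) * of_int j / of_nat a ^ 2 * Fc a (i + 1) j Z
    + (of_nat a + 1) / of_nat a * (det Z * Fc (Suc (Suc a)) i (j - 1) Z)"
    using Fc_M22[OF assms, of i "j - 1"] by simp
  moreover have "(of_int i + 1) * Fc a (i + 1) j Z = - of_nat a * (Z$2$1 * Fc (Suc a) i j Z + Z$2$2 * Fc (Suc a) i (j - 1) Z)"
    by (rule Fc_S[OF z])
  ultimately show ?thesis using a by (simp add: field_simps power2_eq_square) algebra
qed

lemma Fc_M12:
  assumes z: "Z$1$1 \<noteq> 0" and a: "a \<noteq> 0"
  shows "Z$1$2 * Fc (Suc a) i j Z = - (of_int j + 1) * (of_int i + of_nat a) / of_nat a ^ 2 * Fc a i (j + 1) Z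
    - (of_nat a + 1) / of_nat a * (det Z * Fc (Suc (Suc a)) (i - 1) j Z)"
proof -
  have "Z$2$2 * Fc (Suc a) (i - 1) j Z = of_int i * (of_int j + 1) / of_nat a ^ 2 * Fc a i (j + 1) Z
    + (of_nat a + 1) / of_nat a * (det Z * Fc (Suc (Suc a)) (i - 1) j Z)"
    using Fc_M22[OF assms, of "i - 1" j] by simp
  moreover have "(of_int j + 1) * Fc a i (j + 1) Z = - of_nat a * (Z$1$2 * Fc (Suc a) i j Z + Z$2$2 * Fc (Suc a) (i - 1) j Z)"
    by (rule Fc_T[OF z])
  ultimately show ?thesis using a by (simp add: field_simps power2_eq_square) algebra
qed

lemma Fc_M11:
  assumes z: "Z$1$1 \<noteq> 0" and a: "a \<noteq> 0"
  shows "Z$1$1 * Fc (Suc a) i j Z = (of_int i + of_nat a) * (of_int j + of_nat a) / of_nat a ^ 2 * Fc a i j Z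
    + (of_nat a + 1) / of_nat a * (det Z * Fc (Suc (Suc a)) (i - 1) (j - 1) Z)"
proof -
  have r: "Z$1$1 * Fc (Suc a) i j Z = Fc a i j Z - Z$2$1 * Fc (Suc a) (i - 1) j Z - Z$1$2 * Fc (Suc a) i (j - 1) Z
     - Z$2$2 * Fc (Suc a) (i - 1) (j - 1) Z" using Fc_rec[OF z, of a i j] by (simp add: algebra_simps)
  have e: "Z$2$1 * Fc (Suc a) (i - 1) j Z = - of_int i * (of_int j + of_nat a) / of_nat a ^ 2 * Fc a i j Z
      - (of_nat a + 1) / of_nat a * (det Z * Fc (Suc (Suc a)) (i - 1) (j - 1) Z)"
    "Z$1$2 * Fc (Suc a) i (j - 1) Z = - of_int j * (of_int i + of_nat a) / of_nat a ^ 2 * Fc a i j Z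
      - (of_nat a + 1) / of_nat a * (det Z * Fc (Suc (Suc a)) (i - 1) (j - 1) Z)"
    "Z$2$2 * Fc (Suc a) (i - 1) (j - 1) Z = of_int i * of_int j / of_nat a ^ 2 * Fc a i j Z
      + (of_nat a + 1) / of_nat a * (det Z * Fc (Suc (Suc a)) (i - 1) (j - 1) Z)"
    using Fc_M21[OF assms, of "i - 1" j] Fc_M12[OF assms, of i "j - 1"] Fc_M22[OF assms, of "i - 1" "j - 1"]
    by simp_all
  show ?thesis unfolding r e using a by (simp add: field_simps power2_eq_square)
qed

lemma deriv_alg:
  fixes z11 z12 z21 z22 :: complex
  assumes "z11 \<noteq> 0" "numer = z11 * F11" "F11 = z11 * G11 + z21 * G01 + z12 * G10 + z22 * G00"
    "F01 = z11 * G01 + z21 * Gm1 + z12 * G00 + z22 * Gm0" "F10 = z11 * G10 + z21 * G00 + z12 * G1m + z22 * G0m"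
    "F00 = z11 * G00 + z21 * Gm0 + z12 * G0m + z22 * Gmm" "m = n + 1"
  shows "((- n * (E11 * F11 + E21 * F01 + E12 * F10 + E22 * F00)
     - (E21 * F01 + - m * (E11 * G01 + E21 * Gm1 + E12 * G00 + E22 * Gm0) * z21)
     - (E12 * F10 + - m * (E11 * G10 + E21 * G00 + E12 * G1m + E22 * G0m) * z12)
     - (E22 * F00 + - m * (E11 * G00 + E21 * Gm0 + E12 * G0m + E22 * Gmm) * z22)) * z11 - numer * E11) / (z11 * z11)
     = - m * (E11 * G11 + E21 * G01 + E12 * G10 + E22 * G00)"
proof -
  have "(- n * (E11 * F11 + E21 * F01 + E12 * F10 + E22 * F00)
     - (E21 * F01 + - m * (E11 * G01 + E21 * Gm1 + E12 * G00 + E22 * Gm0) * z21)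
     - (E12 * F10 + - m * (E11 * G10 + E21 * G00 + E12 * G1m + E22 * G0m) * z12)
     - (E22 * F00 + - m * (E11 * G00 + E21 * Gm0 + E12 * G0m + E22 * Gmm) * z22)) * z11 - numer * E11
    = - m * (E11 * G11 + E21 * G01 + E12 * G10 + E22 * G00) * (z11 * z11)"
    unfolding assms(2-7) by (simp add: algebra_simps)
  thus ?thesis using assms(1) by (simp only: nonzero_mult_div_cancel_right mult_eq_0_iff de_Morgan_disj simp_thms)
qed

lemma Fc_has_derivative:
  assumes Z: "\<And>p q. ((\<lambda>t. Zf t $ p $ q) has_field_derivative E $ p $ q) (at t)"
    and z: "Zf t $ 1 $ 1 \<noteq> 0"
  shows "((\<lambda>t. Fc a i j (Zf t)) has_field_derivative - of_nat a *
     (E$1$1 * Fc (Suc a) i j (Zf t) + E$2$1 * Fc (Suc a) (i - 1) j (Zf t) + E$1$2 * Fc (Suc a) i (j - 1) (Zf t)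
      + E$2$2 * Fc (Suc a) (i - 1) (j - 1) (Zf t))) (at t)"
proof (induction a i j rule: Fc_induct)
  case (neg a i j)
  hence "(i < 0 \<or> j < 0) \<and> (i - 1 < 0 \<or> j < 0) \<and> (i < 0 \<or> j - 1 < 0) \<and> (i - 1 < 0 \<or> j - 1 < 0)" by auto
  thus ?case by (simp add: Fc_neg)
next
  case (zero i j)
  thus ?case by (simp add: Fc_0)
next
  case (step a i j)
  have ev: "eventually (\<lambda>x. Zf x $ 1 $ 1 \<noteq> 0) (nhds t)"
  proof -
    have "isCont (\<lambda>x. Zf x $ 1 $ 1) t" using Z[of 1 1] by (rule DERIV_isCont)
    hence "((\<lambda>x. Zf x $ 1 $ 1) \<longlongrightarrow> Zf t $ 1 $ 1) (nhds t)" by (simp add: isCont_def tendsto_nhds_iff)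
    thus ?thesis using z by (rule tendsto_imp_eventually_ne)
  qed
  have eq: "eventually (\<lambda>x. Fc (Suc a) i j (Zf x) = (Fc a i j (Zf x) - Zf x$2$1 * Fc (Suc a) (i - 1) j (Zf x) - Zf x$1$2 * Fc (Suc a) i (j - 1) (Zf x)
     - Zf x$2$2 * Fc (Suc a) (i - 1) (j - 1) (Zf x)) / Zf x$1$1) (nhds t)"
    using ev by eventually_elim (rule Fc_Suc)
  note r = Fc_rec[OF z, of "Suc a"] Fc_rec[OF z, of a]
  have num: "Fc a i j (Zf t) - Zf t$2$1 * Fc (Suc a) (i - 1) j (Zf t) - Zf t$1$2 * Fc (Suc a) i (j - 1) (Zf t)
     - Zf t$2$2 * Fc (Suc a) (i - 1) (j - 1) (Zf t) = Zf t$1$1 * Fc (Suc a) i j (Zf t)"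
    using Fc_rec[OF z, of a i j] by (simp add: algebra_simps)
  show ?case
    apply (subst DERIV_cong_ev[OF refl eq refl])
    apply (rule DERIV_cong)
     apply (rule DERIV_divide DERIV_diff DERIV_mult step.IH Z z)+
    apply (rule deriv_alg[where n="of_nat a"])
    apply (rule z)
    apply (rule num)
    apply (rule r[symmetric])
    apply (rule r[symmetric])
    apply (rule r[symmetric])
    apply (rule r[symmetric])
    apply simp
    done
qed

lemma Fc_homogeneous:
  assumes z: "Z$1$1 \<noteq> 0" and pqr: "p \<noteq> 0" "q \<noteq> 0" "r \<noteq> 0"
    and Y: "Y$1$1 = p * Z$1$1" "Y$1$2 = p * r * Z$1$2" "Y$2$1 = p * q * Z$2$1" "Y$2$2 = p * q * r * Z$2$2"
  shows "Fc a i j Y = p powi (- int a) * q powi i * r powi j * Fc a i j Z"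
proof (induction a i j rule: Fc_induct)
  case (neg a i j)
  thus ?case by (simp add: Fc_neg)
next
  case (zero i j)
  thus ?case by (simp add: Fc_0)
next
  case (step a i j)
  have y: "Y$1$1 \<noteq> 0" using z pqr Y by simp
  have q1: "q powi (i - 1) = q powi i / q" "r powi (j - 1) = r powi j / r" using pqr by (simp_all add: power_int_diff)
  have p1: "p powi (- int (Suc a)) = p powi (- int a) / p"
  proof -
    have e: "- int (Suc a) = - int a - 1" by simp
    have "p powi (- int a - 1) = p powi (- int a) / p" using power_int_diff[of p "- int a" 1] pqr by simp
    thus ?thesis by (simp only: e)
  qed
  show ?case
    unfolding Fc_Suc[OF y, of a i j] Fc_Suc[OF z, of a i j] step.IH Y q1 p1
    using pqr z by (simp add: field_simps)
qed

lemma Fc_11_zero: "Z$1$1 = 0 \<Longrightarrow> Fc (Suc a) i j Z = 0"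
proof -
  assume "Z$1$1 = 0"
  hence "fps_nth (pol1 Z) 0 = 0" by (simp add: pol1_def)
  hence z: "inverse (pol1 Z) = 0" by (simp add: fps_inverse_eq_0_iff)
  show ?thesis by (simp only: Fc_def Fg_def z) simp
qed

lemma Fc_measurable [measurable]: "Fc a i j \<in> borel_measurable borel"
proof (induction a i j rule: Fc_induct)
  case (neg a i j)
  hence "Fc a i j = (\<lambda>Z. 0)" by (auto simp: Fc_neg)
  thus ?case by simp
next
  case (zero i j)
  thus ?case by (simp add: Fc_0[abs_def])
next
  case (step a i j)
  note step.IH[measurable]
  have "Fc (Suc a) i j = (\<lambda>Z. if Z$1$1 = 0 then 0 else (Fc a i j Z - Z$2$1 * Fc (Suc a) (i - 1) j Z - Z$1$2 * Fc (Suc a) i (j - 1) Z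
     - Z$2$2 * Fc (Suc a) (i - 1) (j - 1) Z) / Z$1$1)"
    by (rule ext) (simp add: Fc_11_zero Fc_Suc[where a=a and i=i and j=j])
  thus ?case by simp
qed

lemma shift_sum_le:
  fixes f :: "int \<Rightarrow> real"
  assumes "f (-1) = 0" "\<And>n. 0 \<le> f n" "0 \<le> S"
  shows "(\<Sum>n<m. f (int n - 1) * S ^ n) \<le> S * (\<Sum>n<m. f (int n) * S ^ n)"
proof (cases m)
  case (Suc k)
  have "(\<Sum>n<Suc k. f (int n - 1) * S ^ n) = S * (\<Sum>n<k. f (int n) * S ^ n)"
    by (simp add: sum.lessThan_Suc_shift assms sum_distrib_left mult_ac del: sum.lessThan_Suc)
  also have "\<dots> \<le> S * (\<Sum>n<Suc k. f (int n) * S ^ n)"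
    using assms by (intro mult_left_mono) auto
  finally show ?thesis using Suc by simp
qed simp

lemma Fc_bound:
  fixes K \<rho> S :: real
  assumes K: "0 \<le> K" "0 \<le> \<rho>" "0 \<le> S" "\<rho> * S < 1"
  shows "\<exists>C\<ge>0. \<forall>Z m. Z$1$1 \<noteq> 0 \<longrightarrow> cmod (Z$2$1) \<le> \<rho> * cmod (Z$1$1) \<longrightarrow> cmod (Z$1$2) \<le> K * cmod (Z$1$1) \<longrightarrow>
    cmod (Z$2$2) \<le> K * cmod (Z$1$1) \<longrightarrow> (\<Sum>n<m. cmod (Fc a (int n) j Z) * S ^ n) \<le> C / cmod (Z$1$1) ^ a"
proof (induction a arbitrary: j)
  case 0
  show ?case
  proof (intro exI[of _ 1] conjI allI impI)
    fix Z :: HC and m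
    have "(\<Sum>n<m. cmod (Fc 0 (int n) j Z) * S ^ n) \<le> (\<Sum>n<m. if n = 0 then 1 else 0)"
      by (intro sum_mono) (auto simp: Fc_0)
    also have "\<dots> \<le> 1" by simp
    finally show "(\<Sum>n<m. cmod (Fc 0 (int n) j Z) * S ^ n) \<le> 1 / cmod (Z$1$1) ^ 0" by simp
  qed simp
next
  case (Suc a j)
  show ?case
  proof (cases "j < 0")
    case True
    thus ?thesis by (intro exI[of _ 0]) (simp add: Fc_neg)
  next
    case False
    then obtain k where j: "j = int k" by (metis int_eq_iff not_le)
    show ?thesis unfolding j
    proof (induction k)
      have main: "\<exists>C\<ge>0. \<forall>Z m. Z$1$1 \<noteq> 0 \<longrightarrow> cmod (Z$2$1) \<le> \<rho> * cmod (Z$1$1) \<longrightarrow> cmod (Z$1$2) \<le> K * cmod (Z$1$1) \<longrightarrow>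
        cmod (Z$2$2) \<le> K * cmod (Z$1$1) \<longrightarrow> (\<Sum>n<m. cmod (Fc (Suc a) (int n) j Z) * S ^ n) \<le> C / cmod (Z$1$1) ^ Suc a"
        if C': "C' \<ge> 0" "\<And>Z m. Z$1$1 \<noteq> 0 \<Longrightarrow> cmod (Z$2$1) \<le> \<rho> * cmod (Z$1$1) \<Longrightarrow> cmod (Z$1$2) \<le> K * cmod (Z$1$1) \<Longrightarrow>
        cmod (Z$2$2) \<le> K * cmod (Z$1$1) \<Longrightarrow> (\<Sum>n<m. cmod (Fc (Suc a) (int n) (j - 1) Z) * S ^ n) \<le> C' / cmod (Z$1$1) ^ Suc a" for j C'
      proof -
        obtain Ca where Ca: "Ca \<ge> 0" "\<And>Z m. Z$1$1 \<noteq> 0 \<Longrightarrow> cmod (Z$2$1) \<le> \<rho> * cmod (Z$1$1) \<Longrightarrow> cmod (Z$1$2) \<le> K * cmod (Z$1$1) \<Longrightarrow>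
          cmod (Z$2$2) \<le> K * cmod (Z$1$1) \<Longrightarrow> (\<Sum>n<m. cmod (Fc a (int n) j Z) * S ^ n) \<le> Ca / cmod (Z$1$1) ^ a"
          using Suc.IH[of j] by blast
        define C where "C = (Ca + K * (1 + S) * C') / (1 - \<rho> * S)"
        show ?thesis
        proof (intro exI[of _ C] conjI allI impI)
          show "0 \<le> C" using K Ca(1) C'(1) by (simp add: C_def)
          fix Z :: HC and m
          assume Z: "Z$1$1 \<noteq> 0" "cmod (Z$2$1) \<le> \<rho> * cmod (Z$1$1)" "cmod (Z$1$2) \<le> K * cmod (Z$1$1)"
            "cmod (Z$2$2) \<le> K * cmod (Z$1$1)"
          define z where "z = cmod (Z$1$1)"
          have z: "z > 0" using Z by (simp add: z_def)
          define f g where "f n = cmod (Fc (Suc a) n j Z)" and "g n = cmod (Fc (Suc a) n (j - 1) Z)" for n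
          define B B' where "B = (\<Sum>n<m. f (int n) * S ^ n)" and "B' = (\<Sum>n<m. g (int n) * S ^ n)"
          have fg: "f (-1) = 0" "g (-1) = 0" "\<And>n. 0 \<le> f n" "\<And>n. 0 \<le> g n" by (simp_all add: f_def g_def Fc_neg)
          have pt: "z * f n \<le> cmod (Fc a n j Z) + \<rho> * z * f (n - 1) + K * z * g n + K * z * g (n - 1)" for n
          proof -
            have "z * f n = cmod (Z$1$1 * Fc (Suc a) n j Z)" by (simp add: z_def f_def norm_mult)
            also have "Z$1$1 * Fc (Suc a) n j Z = Fc a n j Z - Z$2$1 * Fc (Suc a) (n - 1) j Z - Z$1$2 * Fc (Suc a) n (j - 1) Z
               - Z$2$2 * Fc (Suc a) (n - 1) (j - 1) Z" using Fc_rec[OF Z(1), of a n j] by (simp add: algebra_simps)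
            also have "cmod \<dots> \<le> cmod (Fc a n j Z) + cmod (Z$2$1 * Fc (Suc a) (n - 1) j Z) + cmod (Z$1$2 * Fc (Suc a) n (j - 1) Z)
               + cmod (Z$2$2 * Fc (Suc a) (n - 1) (j - 1) Z)"
              by (smt (verit) norm_triangle_ineq4)
            also have "\<dots> \<le> cmod (Fc a n j Z) + \<rho> * z * f (n - 1) + K * z * g n + K * z * g (n - 1)"
              unfolding norm_mult f_def g_def z_def using Z by (intro add_mono mult_right_mono order_refl) auto
            finally show ?thesis .
          qed
          have "z * B = (\<Sum>n<m. z * f (int n) * S ^ n)" by (simp add: B_def sum_distrib_left mult_ac)
          also have "\<dots> \<le> (\<Sum>n<m. (cmod (Fc a (int n) j Z) + \<rho> * z * f (int n - 1) + K * z * g (int n) + K * z * g (int n - 1)) * S ^ n)"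
            using pt K by (intro sum_mono mult_right_mono) auto
          also have "\<dots> = (\<Sum>n<m. cmod (Fc a (int n) j Z) * S ^ n) + \<rho> * z * (\<Sum>n<m. f (int n - 1) * S ^ n) + K * z * B'
             + K * z * (\<Sum>n<m. g (int n - 1) * S ^ n)"
            by (simp add: B'_def algebra_simps sum.distrib sum_distrib_left)
          also have "\<dots> \<le> Ca / z ^ a + \<rho> * z * (S * B) + K * z * B' + K * z * (S * B')"
            unfolding B_def B'_def z_def
            by (intro add_mono mult_left_mono shift_sum_le Ca(2) Z fg K order_refl mult_nonneg_nonneg) auto
          finally have "z * B * (1 - \<rho> * S) \<le> Ca / z ^ a + z * (K * (1 + S) * B')" by (simp add: algebra_simps)
          also have "\<dots> \<le> Ca / z ^ a + z * (K * (1 + S) * (C' / z ^ Suc a))"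
            unfolding B'_def g_def z_def using K
            by (intro add_mono mult_left_mono C'(2) Z order_refl mult_nonneg_nonneg) auto
          also have "\<dots> = z * ((Ca + K * (1 + S) * C') / z ^ Suc a)" using z by (simp add: field_simps)
          finally have "z * (B * (1 - \<rho> * S)) \<le> z * ((Ca + K * (1 + S) * C') / z ^ Suc a)"
            by (simp only: mult.assoc)
          hence "B * (1 - \<rho> * S) \<le> (Ca + K * (1 + S) * C') / z ^ Suc a"
            using z by (rule mult_left_le_imp_le)
          hence "B \<le> C / z ^ Suc a"
          proof -
            have "0 < 1 - \<rho> * S" using K(4) by simp
            with \<open>B * (1 - \<rho> * S) \<le> _\<close> have "B \<le> (Ca + K * (1 + S) * C') / z ^ Suc a / (1 - \<rho> * S)"
              by (simp only: pos_le_divide_eq)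
            thus ?thesis unfolding C_def by (simp only: divide_divide_eq_left mult.commute)
          qed
          thus "(\<Sum>n<m. cmod (Fc (Suc a) (int n) j Z) * S ^ n) \<le> C / cmod (Z$1$1) ^ Suc a"
            by (simp only: B_def f_def z_def)
        qed
      qed
      {
        case 0
        show ?case by (rule main[of 0]) (auto simp: Fc_neg)
      next
        case (Suc k)
        then obtain C' where "C' \<ge> 0" "\<And>Z m. Z$1$1 \<noteq> 0 \<Longrightarrow> cmod (Z$2$1) \<le> \<rho> * cmod (Z$1$1) \<Longrightarrow> cmod (Z$1$2) \<le> K * cmod (Z$1$1) \<Longrightarrow>
        cmod (Z$2$2) \<le> K * cmod (Z$1$1) \<Longrightarrow> (\<Sum>n<m. cmod (Fc (Suc a) (int n) (int k) Z) * S ^ n) \<le> C' / cmod (Z$1$1) ^ Suc a"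
          by blast
        thus ?case by (intro main[of C']) auto
      }
    qed
  qed
qed

lemma Fc_summable:
  assumes Z: "Z$1$1 \<noteq> 0" and s: "cmod (Z$2$1) * cmod s < cmod (Z$1$1)"
  shows "summable (\<lambda>n. cmod (Fc a (int n) j Z * s ^ n))"
proof -
  define z where "z = cmod (Z$1$1)"
  have z: "z > 0" using Z by (simp add: z_def)
  obtain C where "\<And>m. (\<Sum>n<m. cmod (Fc a (int n) j Z) * cmod s ^ n) \<le> C / z ^ a"
    using Fc_bound[of "(cmod (Z$1$2) + cmod (Z$2$2)) / z" "cmod (Z$2$1) / z" "cmod s" a j] Z s z
    unfolding z_def by (force simp: field_simps)
  thus ?thesis
    by (intro summableI_nonneg_bounded[where x="C / z ^ a"]) (auto simp: norm_mult norm_power)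
qed

definition Gser :: "nat \<Rightarrow> nat \<Rightarrow> complex \<Rightarrow> HC \<Rightarrow> complex" where
  "Gser a j s Z = ((- of_nat a) gchoose j) * (Z$1$2 + Z$2$2 * s) ^ j / (Z$1$1 + Z$2$1 * s) ^ (a + j)"

lemma sums_shift_int:
  fixes f :: "int \<Rightarrow> complex"
  assumes "(\<lambda>n. f (int n) * s ^ n) sums A" "f (-1) = 0"
  shows "(\<lambda>n. f (int n - 1) * s ^ n) sums (s * A)"
proof -
  have "(\<lambda>n. s * (f (int n) * s ^ n)) sums (s * A)" by (rule sums_mult[OF assms(1)])
  hence "(\<lambda>n. f (int (Suc n) - 1) * s ^ Suc n) sums (s * A)" by (simp add: mult_ac)
  from sums_Suc[OF this] show ?thesis using assms(2) by simp
qed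

lemma Fc_sums:
  assumes Z: "Z$1$1 \<noteq> 0" and s: "cmod (Z$2$1) * cmod s < cmod (Z$1$1)"
  shows "(\<lambda>n. Fc a (int n) (int j) Z * s ^ n) sums Gser a j s Z"
proof -
  have p0: "Z$1$1 + Z$2$1 * s \<noteq> 0"
  proof
    assume "Z$1$1 + Z$2$1 * s = 0"
    hence "cmod (Z$1$1) = cmod (Z$2$1) * cmod s" by (metis add_eq_0_iff norm_minus_cancel norm_mult)
    thus False using s by simp
  qed
  define A where "A a j = (\<Sum>n. Fc a (int n) j Z * s ^ n)" for a j
  have sA: "(\<lambda>n. Fc a (int n) j Z * s ^ n) sums A a j" for a j
    unfolding A_def by (rule summable_sums[OF summable_norm_cancel[OF Fc_summable[OF assms]]])
  have rec: "(Z$1$1 + Z$2$1 * s) * A (Suc a) j + (Z$1$2 + Z$2$2 * s) * A (Suc a) (j - 1) = A a j" for a j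
  proof -
    have "(\<lambda>n. Z$1$1 * (Fc (Suc a) (int n) j Z * s ^ n) + Z$2$1 * (Fc (Suc a) (int n - 1) j Z * s ^ n) +
        Z$1$2 * (Fc (Suc a) (int n) (j - 1) Z * s ^ n) + Z$2$2 * (Fc (Suc a) (int n - 1) (j - 1) Z * s ^ n))
      sums (Z$1$1 * A (Suc a) j + Z$2$1 * (s * A (Suc a) j) + Z$1$2 * A (Suc a) (j - 1) + Z$2$2 * (s * A (Suc a) (j - 1)))"
      by (intro sums_add sums_mult sA sums_shift_int[OF sA]) (simp_all add: Fc_neg)
    also have "(\<lambda>n. Z$1$1 * (Fc (Suc a) (int n) j Z * s ^ n) + Z$2$1 * (Fc (Suc a) (int n - 1) j Z * s ^ n) +
        Z$1$2 * (Fc (Suc a) (int n) (j - 1) Z * s ^ n) + Z$2$2 * (Fc (Suc a) (int n - 1) (j - 1) Z * s ^ n))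
      = (\<lambda>n. Fc a (int n) j Z * s ^ n)"
    proof (rule ext)
      fix n
      have "Z$1$1 * (Fc (Suc a) (int n) j Z * s ^ n) + Z$2$1 * (Fc (Suc a) (int n - 1) j Z * s ^ n) +
        Z$1$2 * (Fc (Suc a) (int n) (j - 1) Z * s ^ n) + Z$2$2 * (Fc (Suc a) (int n - 1) (j - 1) Z * s ^ n)
        = (Z$1$1 * Fc (Suc a) (int n) j Z + Z$2$1 * Fc (Suc a) (int n - 1) j Z +
        Z$1$2 * Fc (Suc a) (int n) (j - 1) Z + Z$2$2 * Fc (Suc a) (int n - 1) (j - 1) Z) * s ^ n"
        by (simp add: algebra_simps)
      thus "Z$1$1 * (Fc (Suc a) (int n) j Z * s ^ n) + Z$2$1 * (Fc (Suc a) (int n - 1) j Z * s ^ n) +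
        Z$1$2 * (Fc (Suc a) (int n) (j - 1) Z * s ^ n) + Z$2$2 * (Fc (Suc a) (int n - 1) (j - 1) Z * s ^ n)
        = Fc a (int n) j Z * s ^ n" by (simp only: Fc_rec[OF Z])
    qed
    finally show ?thesis using sA[of a j] sums_unique2 by (fastforce simp: algebra_simps)
  qed
  have A0: "A 0 j = (if j = 0 then 1 else 0)" for j
  proof -
    have "(\<lambda>n. Fc 0 (int n) j Z * s ^ n) sums (\<Sum>n\<in>{0}. Fc 0 (int n) j Z * s ^ n)"
      by (rule sums_finite) (auto simp: Fc_0)
    thus ?thesis using sA[of 0 j] sums_unique2 by (fastforce simp: Fc_0)
  qed
  have "A a (int j) = Gser a j s Z"
  proof (induction a arbitrary: j)
    case 0
    thus ?case by (auto simp: A0 Gser_def gchoose_0)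
  next
    case (Suc a j)
    note IHa = Suc.IH
    show ?case
    proof (induction j)
      case 0
      have "A (Suc a) (-1) = 0" unfolding A_def by (simp add: Fc_neg)
      hence "(Z$1$1 + Z$2$1 * s) * A (Suc a) 0 = 1 / (Z$1$1 + Z$2$1 * s) ^ a"
        using rec[of a 0] IHa[of 0] by (simp add: Gser_def)
      hence "A (Suc a) 0 = 1 / (Z$1$1 + Z$2$1 * s) ^ a / (Z$1$1 + Z$2$1 * s)"
        using p0 by (metis nonzero_mult_div_cancel_left)
      thus ?case by (simp add: Gser_def mult.commute)
    next
      case (Suc j)
      have "(Z$1$1 + Z$2$1 * s) * A (Suc a) (int (Suc j)) = Gser a (Suc j) s Z - (Z$1$2 + Z$2$2 * s) * Gser (Suc a) j s Z"
        using rec[of a "int (Suc j)"] Suc.IH IHa[of "Suc j"] by (simp add: algebra_simps)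
      also have "\<dots> = (Z$1$1 + Z$2$1 * s) * Gser (Suc a) (Suc j) s Z"
      proof -
        define u v where "u = Z$1$2 + Z$2$2 * s" and "v = Z$1$1 + Z$2$1 * s"
        have v: "v \<noteq> 0" using p0 by (simp add: v_def)
        have c: "((- of_nat (Suc a)) gchoose Suc j) = ((- of_nat a) gchoose Suc j) - ((- of_nat (Suc a)) gchoose j :: complex)"
          using gchoose_rec[of "- of_nat (Suc a)" j] by simp
        show ?thesis unfolding Gser_def u_def[symmetric] v_def[symmetric] c using v
          by (simp add: field_simps)
      qed
      finally show ?case using p0 by simp
    qed
  qed
  thus ?thesis using sA[of a "int j"] by simp
qed

lemma Gser_sums:
  assumes p: "Z$1$1 + Z$2$1 * s \<noteq> 0" and t: "cmod (t * (Z$1$2 + Z$2$2 * s)) < cmod (Z$1$1 + Z$2$1 * s)"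
  shows "(\<lambda>j. Gser a j s Z * t ^ j) sums (1 / (Z$1$1 + Z$2$1 * s + t * (Z$1$2 + Z$2$2 * s)) ^ a)"
proof -
  define u v where "u = Z$1$2 + Z$2$2 * s" and "v = Z$1$1 + Z$2$1 * s"
  define x where "x = t * u / v"
  have v: "v \<noteq> 0" using p by (simp add: v_def)
  have x: "cmod x < 1" using t v by (simp add: x_def u_def v_def norm_divide)
  have x0: "1 + x \<noteq> 0"
    using x by (metis add_eq_0_iff less_irrefl norm_minus_cancel norm_one)
  have "(\<lambda>n. ((- of_nat a) gchoose n) * x ^ n) sums (1 + x) powr (- of_nat a)"
    by (rule gen_binomial_complex[OF x])
  also have "(1 + x) powr (- of_nat a) = 1 / (1 + x) ^ a"
    using x0 by (simp add: powr_minus powr_nat' inverse_eq_divide)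
  finally have "(\<lambda>n. (1 / v ^ a) * (((- of_nat a) gchoose n) * x ^ n)) sums ((1 / v ^ a) * (1 / (1 + x) ^ a))"
    by (rule sums_mult)
  also have "(\<lambda>n. (1 / v ^ a) * (((- of_nat a) gchoose n) * x ^ n)) = (\<lambda>j. Gser a j s Z * t ^ j)"
    unfolding Gser_def u_def[symmetric] v_def[symmetric] x_def
    by (simp add: fun_eq_iff power_divide power_mult_distrib power_add mult_ac)
  also have "(1 / v ^ a) * (1 / (1 + x) ^ a) = 1 / (v * (1 + x)) ^ a" by (simp add: power_mult_distrib)
  also have "v * (1 + x) = v + t * u" using v by (simp add: x_def field_simps)
  finally show ?thesis by (simp add: u_def v_def)
qed

lemma gchoose_summable:
  assumes "0 \<le> r" "r < (1::real)"
  shows "summable (\<lambda>j. cmod ((- of_nat a) gchoose j) * r ^ j)"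
proof -
  obtain R where R: "r < R" "R < 1" using assms dense by blast
  have "summable (\<lambda>n. ((- of_nat a) gchoose n) * complex_of_real R ^ n)"
    using gen_binomial_complex[of "of_real R" "- of_nat a"] R assms by (auto simp: sums_iff)
  hence "summable (\<lambda>n. cmod (((- of_nat a) gchoose n) * of_real r ^ n))"
    using R assms by (intro powser_insidea[of _ "of_real R"]) auto
  thus ?thesis using assms by (simp add: norm_mult norm_power)
qed

lemma inverse_linear_power_nth:
  fixes z y :: complex
  assumes z: "z \<noteq> 0"
  shows "fps_nth (inverse (fps_const z + fps_const y * fps_X) ^ Suc M) n = of_nat ((M + n) choose n) * (- y) ^ n / z ^ (Suc M + n)"
proof -
  define P where "P = fps_const z + fps_const y * fps_X"
  define T where "T M = Abs_fps (\<lambda>n. of_nat ((M + n) choose n) * (- y) ^ n / z ^ (Suc M + n))" for M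
  have Pn: "fps_nth (P * f) 0 = z * fps_nth f 0" "fps_nth (P * f) (Suc n) = z * fps_nth f (Suc n) + y * fps_nth f n" for f n
    by (simp_all add: P_def distrib_right mult.assoc)
  have inv: "inverse P * P = 1"
    by (rule inverse_mult_eq_1) (simp add: P_def z)
  have T0: "P * T 0 = 1"
  proof (rule fps_ext)
    fix n show "fps_nth (P * T 0) n = fps_nth 1 n"
      using z by (cases n) (simp_all only: Pn, simp_all add: T_def field_simps)
  qed
  have S: "P * T (Suc M) = T M" for M
  proof (rule fps_ext)
    fix n show "fps_nth (P * T (Suc M)) n = fps_nth (T M) n"
    proof (cases n)
      case 0
      thus ?thesis using z by (simp only: Pn) (simp add: T_def)
    next
      case (Suc k)
      have "(Suc (M + Suc k)) choose Suc k = ((M + Suc k) choose k) + ((M + Suc k) choose Suc k)" by simp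
      hence c: "(of_nat ((Suc M + Suc k) choose Suc k) :: complex) = of_nat ((Suc M + k) choose k) + of_nat ((M + Suc k) choose Suc k)"
        by (simp del: binomial_Suc_Suc)
      show ?thesis unfolding Suc using z
        by (simp only: Pn) (simp only: T_def fps_nth_Abs_fps c, simp add: field_simps)
    qed
  qed
  have "inverse P ^ Suc M = T M" for M
  proof (induction M)
    case 0
    have "inverse P = inverse P * (P * T 0)" by (simp add: T0)
    also have "\<dots> = T 0" by (simp only: mult.assoc[symmetric] inv mult_1_left)
    finally show ?case by simp
  next
    case (Suc M)
    have "inverse P ^ Suc (Suc M) = inverse P * (P * T (Suc M))" using Suc S by simp
    thus ?case by (simp only: mult.assoc[symmetric] inv mult_1_left)
  qed
  thus ?thesis unfolding P_def[symmetric] by (simp add: T_def)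
qed

lemma linear_power_nth:
  fixes x y :: complex
  shows "fps_nth ((fps_const x + fps_const y * fps_X) ^ j) k = of_nat (j choose k) * y ^ k * x ^ (j - k)"
proof -
  have "(fps_const x + fps_const y * fps_X) ^ j = (\<Sum>k\<le>j. of_nat (j choose k) * (fps_const y * fps_X) ^ k * fps_const x ^ (j - k))"
    by (subst add.commute) (rule binomial_ring)
  also have "\<dots> = (\<Sum>k\<le>j. fps_const (of_nat (j choose k) * y ^ k * x ^ (j - k)) * fps_X ^ k)"
    by (intro sum.cong refl) (simp add: power_mult_distrib fps_of_nat[symmetric] fps_const_power mult_ac flip: fps_const_mult)
  finally have "fps_nth ((fps_const x + fps_const y * fps_X) ^ j) k = (\<Sum>l\<le>j. of_nat (j choose l) * y ^ l * x ^ (j - l) * (if k = l then 1 else 0))"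
    by (simp add: fps_sum_nth fps_X_power_nth)
  also have "\<dots> = of_nat (j choose k) * y ^ k * x ^ (j - k)"
  proof -
    have "(\<Sum>l\<le>j. of_nat (j choose l) * y ^ l * x ^ (j - l) * (if k = l then 1 else 0))
      = (\<Sum>l\<le>j. if k = l then of_nat (j choose l) * y ^ l * x ^ (j - l) else 0)"
      by (intro sum.cong) auto
    thus ?thesis by (simp add: sum.delta' binomial_eq_0)
  qed
  finally show ?thesis .
qed

lemma Fc_explicit:
  assumes "Z$1$1 \<noteq> 0" "a \<ge> 1"
  shows "Fc a (int i) (int j) Z = ((- of_nat a) gchoose j) * (\<Sum>k\<le>i. of_nat (j choose k) * Z$2$2 ^ k * Z$1$2 ^ (j - k) *
    (of_nat ((a + j - 1 + (i - k)) choose (i - k)) * (- Z$2$1) ^ (i - k) / Z$1$1 ^ (a + j + (i - k))))"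
proof -
  have S: "a + j = Suc (a + j - 1)" using assms by simp
  have "fps_nth (inverse (pol1 Z) ^ (a + j)) n = of_nat ((a + j - 1 + n) choose n) * (- Z$2$1) ^ n / Z$1$1 ^ (a + j + n)" for n
    unfolding pol1_def by (subst S, subst inverse_linear_power_nth) (use assms in auto)
  thus ?thesis
    by (simp add: Fc_def Fg_def fps_mult_nth[of "pol2 Z ^ j"])
       (simp add: pol2_def linear_power_nth atLeast0AtMost)
qed

section \<open>Radial integrals\<close>

lemma alt_sum_prod:
  fixes y :: "nat \<Rightarrow> real"
  assumes "finite L" "card L \<le> n"
  shows "(\<Sum>h\<le>n. (-1) ^ h * real (n choose h) * (\<Prod>l\<in>L. y l + real h)) = (if card L = n then (-1) ^ n * fact n else 0)"
  using assms
proof (induction L arbitrary: n y rule: finite_induct)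
  case empty
  show ?case
  proof (cases "n = 0")
    case False
    thus ?thesis using choose_alternating_sum[of n, where ?'a=real] by simp
  qed simp
next
  case (insert x L)
  obtain m where n: "n = Suc m" using insert by (cases n) auto
  define g where "g h = (\<Prod>l\<in>L. y l + real h)" for h
  have "(\<Sum>h\<le>n. (-1) ^ h * real (n choose h) * (\<Prod>l\<in>insert x L. y l + real h)) =
     (\<Sum>h\<le>n. y x * ((-1) ^ h * real (n choose h) * g h) + (-1) ^ h * (real h * real (n choose h)) * g h)"
    using insert by (intro sum.cong) (auto simp: g_def algebra_simps)
  also have "\<dots> = y x * (\<Sum>h\<le>n. (-1) ^ h * real (n choose h) * g h) + (\<Sum>h\<le>n. (-1) ^ h * (real h * real (n choose h)) * g h)"
    by (simp add: sum.distrib sum_distrib_left)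
  also have "(\<Sum>h\<le>n. (-1) ^ h * real (n choose h) * g h) = 0"
    using insert unfolding g_def by (subst insert.IH) auto
  also have "(\<Sum>h\<le>n. (-1) ^ h * (real h * real (n choose h)) * g h) = - real n * (\<Sum>h\<le>m. (-1) ^ h * real (m choose h) * g (Suc h))"
  proof -
    have e: "real (Suc h) * real (Suc m choose Suc h) = real n * real (m choose h)" for h
      unfolding n using Suc_times_binomial[of h m] by (metis of_nat_mult)
    show ?thesis
      unfolding n by (subst sum.atMost_Suc_shift) (simp del: binomial_Suc_Suc of_nat_Suc add: e n sum_distrib_left sum_negf[symmetric] mult_ac)
  qed
  also have "(\<Sum>h\<le>m. (-1) ^ h * real (m choose h) * g (Suc h)) = (\<Sum>h\<le>m. (-1) ^ h * real (m choose h) * (\<Prod>l\<in>L. (y l + 1) + real h))"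
    by (simp add: g_def add_ac)
  also have "\<dots> = (if card L = m then (-1) ^ m * fact m else 0)"
    using insert n by (intro insert.IH) auto
  finally have e: "(\<Sum>h\<le>n. (-1) ^ h * real (n choose h) * (\<Prod>l\<in>insert x L. y l + real h)) =
    y x * 0 + - real n * (if card L = m then (-1) ^ m * fact m else 0)" .
  show ?case unfolding e using insert(1,2) n by (auto simp: algebra_simps)
qed

definition RI :: "(real \<Rightarrow> real) \<Rightarrow> real \<Rightarrow> bool" where
  "RI P I \<longleftrightarrow> has_bochner_integral lborel (\<lambda>t. indicator {0<..} t * (sinh t * cosh t * (1 / cosh t) ^ 2 * P (1 / cosh t))) I"

lemma RI_cmult: "RI P I \<Longrightarrow> RI (\<lambda>q. c * P q) (c * I)"
proof -
  assume "RI P I"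
  hence "has_bochner_integral lborel (\<lambda>t. c * (indicator {0<..} t * (sinh t * cosh t * (1 / cosh t) ^ 2 * P (1 / cosh t)))) (c * I)"
    unfolding RI_def by (intro has_bochner_integral_mult_right)
  moreover have "(\<lambda>t. c * (indicator {0<..} t * (sinh t * cosh t * (1 / cosh t) ^ 2 * P (1 / cosh t)))) =
    (\<lambda>t. indicator {0<..} t * (sinh t * cosh t * (1 / cosh t) ^ 2 * (c * P (1 / cosh t))))"
    by (simp add: fun_eq_iff)
  ultimately show ?thesis unfolding RI_def by simp
qed

lemma RI_diff: "RI P I \<Longrightarrow> RI Q J \<Longrightarrow> RI (\<lambda>q. P q - Q q) (I - J)"
  unfolding RI_def by (drule (1) has_bochner_integral_diff) (simp add: algebra_simps)

lemma RI_sum: "(\<And>k. k \<in> K \<Longrightarrow> RI (P k) (I k)) \<Longrightarrow> RI (\<lambda>q. \<Sum>k\<in>K. P k q) (\<Sum>k\<in>K. I k)"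
  unfolding RI_def sum_distrib_left by (rule has_bochner_integral_sum)

lemma RI_power: "M \<ge> 1 \<Longrightarrow> RI (\<lambda>q. q ^ M) (1 / real M)"
proof -
  assume M: "M \<ge> 1"
  have "(\<lambda>t. indicator {0<..} t * (sinh t * cosh t * (1 / cosh t) ^ (M + 2))) =
    (\<lambda>t::real. indicator {0<..} t * (sinh t * cosh t * (1 / cosh t) ^ 2 * (1 / cosh t) ^ M))"
    by (simp only: power_add fun_eq_iff mult_ac simp_thms)
  with radial_integral[OF M] show ?thesis unfolding RI_def by (simp only:)
qed

lemma RI_beta: "x \<ge> 1 \<Longrightarrow> RI (\<lambda>q. q ^ (2 * x) * (1 - q\<^sup>2) ^ h) (fact h / (2 * pochhammer (real x) (Suc h)))"
proof (induction h arbitrary: x)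
  case 0
  thus ?case using RI_power[of "2 * x"] by simp
next
  case (Suc h)
  have p: "pochhammer (real x + 1) h > 0" by (rule pochhammer_pos) simp
  have "RI (\<lambda>q. q ^ (2 * x) * (1 - q\<^sup>2) ^ h - q ^ (2 * Suc x) * (1 - q\<^sup>2) ^ h)
     (fact h / (2 * pochhammer (real x) (Suc h)) - fact h / (2 * pochhammer (real (Suc x)) (Suc h)))"
    by (intro RI_diff Suc.IH) (use Suc.prems in auto)
  also have "(\<lambda>q::real. q ^ (2 * x) * (1 - q\<^sup>2) ^ h - q ^ (2 * Suc x) * (1 - q\<^sup>2) ^ h) = (\<lambda>q. q ^ (2 * x) * (1 - q\<^sup>2) ^ Suc h)"
    by (simp add: fun_eq_iff algebra_simps power2_eq_square)
  also have "fact h / (2 * pochhammer (real x) (Suc h)) - fact h / (2 * pochhammer (real (Suc x)) (Suc h))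
    = fact (Suc h) / (2 * pochhammer (real x) (Suc (Suc h)))"
  proof -
    define P where "P = pochhammer (real x + 1) h"
    have 1: "pochhammer (real x) (Suc h) = real x * P" by (simp add: P_def pochhammer_rec)
    have 2: "pochhammer (real (Suc x)) (Suc h) = P * (real x + 1 + real h)"
      by (simp add: P_def pochhammer_Suc add_ac)
    have 3: "pochhammer (real x) (Suc (Suc h)) = real x * (P * (real x + 1 + real h))"
      using 2 by (simp add: pochhammer_rec[of "real x" "Suc h"] add_ac)
    have P: "P > 0" using p by (simp add: P_def)
    define w where "w = real x + 1 + real h"
    have w: "w > 0" "fact (Suc h) = (w - real x) * fact h" by (simp_all add: w_def)
    show ?thesis unfolding 1 2 3 w_def[symmetric] w(2) using w(1) P Suc.prems by (simp add: field_simps)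
  qed
  finally show ?case .
qed

abbreviation (input) ralt :: "nat \<Rightarrow> nat \<Rightarrow> nat \<Rightarrow> real" where
  "ralt d i h \<equiv> (-1) ^ h * real (i choose h) * real ((d + i + h) choose h)"

abbreviation (input) aalt :: "nat \<Rightarrow> nat \<Rightarrow> nat \<Rightarrow> real" where
  "aalt A B k \<equiv> (-1) ^ k * real (B choose k) * real ((A + B - k) choose B)"

definition rho :: "nat \<Rightarrow> nat \<Rightarrow> real \<Rightarrow> real" where
  "rho d i q = (\<Sum>h\<le>i. ralt d i h * (q ^ d * (1 - q\<^sup>2) ^ h))"

definition Rad :: "nat \<Rightarrow> nat \<Rightarrow> real \<Rightarrow> real" where
  "Rad A B q = (\<Sum>k\<le>min A B. aalt A B k * q ^ (A + B - 2 * k))"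

lemma fact_ratio: "j \<le> i \<Longrightarrow> (fact (x + i) :: real) / fact (x + j) = (\<Prod>l\<in>{Suc j..i}. real (x + l))"
proof (induction i)
  case (Suc i)
  show ?case
  proof (cases "j = Suc i")
    case False
    hence "j \<le> i" using Suc by simp
    thus ?thesis using Suc.IH by (simp add: prod.nat_ivl_Suc' field_simps)
  qed simp
qed simp

lemma RI_rho_power:
  assumes d: "d \<ge> 1" and j: "j \<le> i"
  shows "RI (\<lambda>q. rho d i q * q ^ (d + 2 * j)) (if j = 0 then (-1) ^ i * fact i * fact (d - 1) / (2 * fact (d + i)) else 0)"
proof -
  have dj: "d + j \<ge> 1" using d by simp
  have "RI (\<lambda>q. \<Sum>h\<le>i. (ralt d i h) * (q ^ (2 * (d + j)) * (1 - q\<^sup>2) ^ h))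
     (\<Sum>h\<le>i. (ralt d i h) * (fact h / (2 * pochhammer (real (d + j)) (Suc h))))"
    using dj by (intro RI_sum RI_cmult RI_beta)
  also have "(\<lambda>q::real. \<Sum>h\<le>i. (ralt d i h) * (q ^ (2 * (d + j)) * (1 - q\<^sup>2) ^ h))
    = (\<lambda>q. rho d i q * q ^ (d + 2 * j))"
  proof
    fix q :: real
    have "q ^ (2 * (d + j)) = q ^ d * q ^ (d + 2 * j)"
      by (simp only: power_add[symmetric]) (rule arg_cong[of _ _ "(^) q"], simp)
    thus "(\<Sum>h\<le>i. (ralt d i h) * (q ^ (2 * (d + j)) * (1 - q\<^sup>2) ^ h))
      = rho d i q * q ^ (d + 2 * j)"
      unfolding rho_def sum_distrib_right by (intro sum.cong refl) (simp only: mult_ac)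
  qed
  also have "(\<Sum>h\<le>i. (ralt d i h) * (fact h / (2 * pochhammer (real (d + j)) (Suc h))))
    = (\<Sum>h\<le>i. fact (d + j - 1) / (2 * fact (d + i)) * ((-1) ^ h * real (i choose h) * (\<Prod>l\<in>{Suc j..i}. real (d + l) + real h)))"
  proof (intro sum.cong refl)
    fix h
    have b: "real ((d + i + h) choose h) = fact (d + i + h) / (fact h * fact (d + i))"
      using binomial_fact[of h "d + i + h", where ?'a=real] by simp
    have p: "pochhammer (real (d + j)) (Suc h) = fact (d + j + h) / fact (d + j - 1)"
    proof -
      have "(fact (d + j - 1 + Suc h) :: real) = fact (d + j - 1) * pochhammer (real (d + j - 1) + 1) (Suc h)"
        by (simp only: pochhammer_fact pochhammer_product' add.commute[of 1])
      moreover have "d + j - 1 + Suc h = d + j + h" "real (d + j - 1) + 1 = real (d + j)" using dj by auto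
      ultimately have "(fact (d + j + h) :: real) = fact (d + j - 1) * pochhammer (real (d + j)) (Suc h)" by (simp only:)
      moreover have "(fact (d + j - 1) :: real) \<noteq> 0" by simp
      ultimately show ?thesis by (metis nonzero_mult_div_cancel_left)
    qed
    have f: "(fact (d + i + h) :: real) = fact (d + j + h) * (\<Prod>l\<in>{Suc j..i}. real (d + l) + real h)"
      using fact_ratio[OF j, of "d + h"] by (simp add: add_ac field_simps)
    show "ralt d i h * (fact h / (2 * pochhammer (real (d + j)) (Suc h)))
      = fact (d + j - 1) / (2 * fact (d + i)) * ((-1) ^ h * real (i choose h) * (\<Prod>l\<in>{Suc j..i}. real (d + l) + real h))"
      unfolding b p f by (simp add: mult_ac)
  qed
  also have "\<dots> = fact (d + j - 1) / (2 * fact (d + i)) * (if card {Suc j..i} = i then (-1) ^ i * fact i else 0)"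
    unfolding sum_distrib_left[symmetric] by (subst alt_sum_prod) auto
  also have "\<dots> = (if j = 0 then (-1) ^ i * fact i * fact (d - 1) / (2 * fact (d + i)) else 0)"
    using j by auto
  finally show ?thesis .
qed

lemma Rad_sym: "Rad A B q = Rad B A q"
proof -
  have "real (B choose k) * real ((A + B - k) choose B) = real (A choose k) * real ((A + B - k) choose A)" if "k \<le> A" "k \<le> B" for k
  proof -
    have "A + B - k - B = A - k" "A + B - k - A = B - k" using that by auto
    thus ?thesis using that by (simp add: binomial_fact field_simps)
  qed
  thus ?thesis unfolding Rad_def by (simp add: min.commute add.commute mult.assoc)
qed

lemma rho_expand: "\<exists>c. \<forall>q. rho d i q = (\<Sum>j\<le>i. c j * q ^ (d + 2 * j))"
proof -
  define b where "b h = ralt d i h" for h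
  have e: "(1 - q\<^sup>2) ^ h = (\<Sum>l\<le>i. real (h choose l) * (-1) ^ l * q ^ (2 * l))" if "h \<le> i" for q :: real and h
  proof -
    have "(1 - q\<^sup>2) ^ h = (- (q\<^sup>2) + 1) ^ h" by (simp add: algebra_simps)
    also have "\<dots> = (\<Sum>l\<le>h. real (h choose l) * (-(q\<^sup>2)) ^ l)" by (subst binomial_ring) simp
    also have "\<dots> = (\<Sum>l\<le>h. real (h choose l) * (-1) ^ l * q ^ (2 * l))"
      by (intro sum.cong refl) (simp add: power_minus[of "q\<^sup>2"] power_mult)
    also have "\<dots> = (\<Sum>l\<le>i. real (h choose l) * (-1) ^ l * q ^ (2 * l))"
      by (rule sum.mono_neutral_left) (use that in \<open>auto simp: binomial_eq_0\<close>)
    finally show ?thesis .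
  qed
  have "rho d i q = (\<Sum>l\<le>i. (\<Sum>h\<le>i. b h * real (h choose l) * (-1) ^ l) * q ^ (d + 2 * l))" for q
  proof -
    have "rho d i q = (\<Sum>h\<le>i. \<Sum>l\<le>i. b h * real (h choose l) * (-1) ^ l * q ^ (d + 2 * l))"
      unfolding rho_def
    proof (intro sum.cong refl)
      fix h assume "h \<in> {..i}"
      hence h: "h \<le> i" by simp
      show "ralt d i h * (q ^ d * (1 - q\<^sup>2) ^ h)
        = (\<Sum>l\<le>i. b h * real (h choose l) * (-1) ^ l * q ^ (d + 2 * l))"
        unfolding e[OF h] b_def[symmetric] sum_distrib_left
        by (intro sum.cong refl) (simp only: power_add mult_ac)
    qed
    thus ?thesis by (subst (asm) sum.swap) (simp add: sum_distrib_right)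
  qed
  thus ?thesis by (intro exI[of _ "\<lambda>l. \<Sum>h\<le>i. b h * real (h choose l) * (-1) ^ l"]) simp
qed

lemma RI_Rad_power:
  assumes BA: "B \<le> A" and y: "A < y" "y \<le> A + B"
  shows "RI (\<lambda>q. q ^ (2 * y - (A + B)) * Rad A B q) 0"
proof -
  have k: "B \<ge> 1" using y by simp
  have yy: "2 * y - (A + B) + (A + B - 2 * k) = 2 * (y - k)" if "k \<le> B" for k using that y BA by auto
  have "RI (\<lambda>q. \<Sum>k\<le>B. (aalt A B k) * q ^ (2 * (y - k)))
    (\<Sum>k\<le>B. (aalt A B k) * (1 / real (2 * (y - k))))"
    using y BA by (intro RI_sum RI_cmult RI_power) auto
  also have "(\<lambda>q::real. \<Sum>k\<le>B. (aalt A B k) * q ^ (2 * (y - k))) = (\<lambda>q. q ^ (2 * y - (A + B)) * Rad A B q)"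
  proof
    fix q :: real
    have pw: "q ^ (2 * (y - k)) = q ^ (2 * y - (A + B)) * q ^ (A + B - 2 * k)" if "k \<le> B" for k
      by (simp only: yy[OF that, symmetric] power_add)
    show "(\<Sum>k\<le>B. (aalt A B k) * q ^ (2 * (y - k))) = q ^ (2 * y - (A + B)) * Rad A B q"
      unfolding Rad_def min_absorb2[OF BA] sum_distrib_left
      by (intro sum.cong refl) (simp add: pw)
  qed
  also have "(\<Sum>k\<le>B. (aalt A B k) * (1 / real (2 * (y - k))))
    = (\<Sum>k\<le>B. ((-1) ^ (B - 1) / (2 * fact B)) * ((-1) ^ k * real (B choose k) * (\<Prod>l\<in>{1..B} - {y - A}. - real (A + l) + real k)))"
  proof (intro sum.cong refl)
    fix k assume "k \<in> {..B}"
    hence kB: "k \<le> B" by simp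
    have "real ((A + B - k) choose B) = fact (A - k + B) / fact (A - k + 0) / fact B"
      using binomial_fact[of B "A + B - k", where ?'a=real] kB BA by (simp add: field_simps)
    also have "\<dots> = (\<Prod>l\<in>{1..B}. real (A - k + l)) / fact B"
      by (subst fact_ratio) auto
    also have "(\<Prod>l\<in>{1..B}. real (A - k + l)) = real (y - k) * (\<Prod>l\<in>{1..B} - {y - A}. real (A - k + l))"
      using y kB BA by (subst prod.remove[of _ "y - A"]) (auto simp: of_nat_diff)
    also have "(\<Prod>l\<in>{1..B} - {y - A}. real (A - k + l)) = (\<Prod>l\<in>{1..B} - {y - A}. (-1) * (- real (A + l) + real k))"
      using kB BA by (intro prod.cong refl) (simp add: of_nat_diff)
    also have "\<dots> = (-1) ^ (B - 1) * (\<Prod>l\<in>{1..B} - {y - A}. - real (A + l) + real k)"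
    proof -
      have "card ({1..B} - {y - A}) = B - 1" using y by (subst card_Diff_singleton) auto
      thus ?thesis by (simp only: prod.distrib prod_constant)
    qed
    finally have e: "real ((A + B - k) choose B) = real (y - k) * ((-1) ^ (B - 1) * (\<Prod>l\<in>{1..B} - {y - A}. - real (A + l) + real k)) / fact B" .
    define w P where "w = real (y - k)" and "P = (\<Prod>l\<in>{1..B} - {y - A}. - real (A + l) + real k)"
    have w: "w > 0" "real (2 * (y - k)) = 2 * w" using y kB BA by (simp_all add: w_def)
    show "(aalt A B k) * (1 / real (2 * (y - k))) =
      ((-1) ^ (B - 1) / (2 * fact B)) * ((-1) ^ k * real (B choose k) * (\<Prod>l\<in>{1..B} - {y - A}. - real (A + l) + real k))"
      unfolding e w(2) P_def[symmetric] w_def[symmetric] using w(1) by (simp add: mult_ac)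
  qed
  also have "\<dots> = 0"
  proof -
    have "card ({1..B} - {y - A}) = B - 1" using y by (subst card_Diff_singleton) auto
    thus ?thesis unfolding sum_distrib_left[symmetric] using k by (subst alt_sum_prod) auto
  qed
  finally show ?thesis .
qed

lemma RI_rho_Rad:
  assumes d: "d \<ge> 1" and AB: "A + B = 2 * i + d"
  shows "RI (\<lambda>q. rho d i q * Rad A B q) (if A = i \<or> B = i then 1 / (2 * real d) else 0)"
proof (cases "min A B \<le> i")
  case True
  define r where "r k = aalt A B k" for k
  define v where "v = (-1) ^ i * fact i * fact (d - 1) / (2 * fact (d + i) :: real)"
  have "RI (\<lambda>q. \<Sum>k\<le>min A B. r k * (rho d i q * q ^ (d + 2 * (i - k)))) (\<Sum>k\<le>min A B. r k * (if i - k = 0 then v else 0))"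
    unfolding v_def using d by (intro RI_sum RI_cmult RI_rho_power) auto
  also have "(\<lambda>q. \<Sum>k\<le>min A B. r k * (rho d i q * q ^ (d + 2 * (i - k)))) = (\<lambda>q. rho d i q * Rad A B q)"
  proof
    fix q
    have "A + B - 2 * k = d + 2 * (i - k)" if "k \<le> min A B" for k using that AB True by auto
    thus "(\<Sum>k\<le>min A B. r k * (rho d i q * q ^ (d + 2 * (i - k)))) = rho d i q * Rad A B q"
      by (simp add: Rad_def sum_distrib_left r_def mult_ac)
  qed
  also have "(\<Sum>k\<le>min A B. r k * (if i - k = 0 then v else 0)) = (\<Sum>k\<le>min A B. if k = i then r i * v else 0)"
    using True by (intro sum.cong) auto
  also have "\<dots> = (if A = i \<or> B = i then 1 / (2 * real d) else 0)"
  proof (cases "A = i \<or> B = i")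
    case T: True
    have "r i * v = 1 / (2 * real d)"
    proof -
      have c: "(B choose i) * ((A + B - i) choose B) = (d + i) choose i"
        using T AB d by (auto simp: add.commute binomial_symmetric[of i "i + d"])
      have "r i = (-1) ^ i * real ((d + i) choose i)"
        unfolding r_def c[symmetric] by simp
      also have "real ((d + i) choose i) = fact (d + i) / (fact i * fact d)"
        using binomial_fact[of i "d + i", where ?'a=real] by simp
      finally have "r i * v = (-1) ^ i * (-1) ^ i * (fact (d - 1) / (2 * fact d))" by (simp add: v_def)
      also have "(-1::real) ^ i * (-1) ^ i = 1" by (simp flip: power_mult_distrib)
      also have "(fact d :: real) = real d * fact (d - 1)" using d by (simp add: fact_reduce)
      finally show ?thesis by simp
    qed
    moreover have "i \<le> min A B" using T AB by auto
    ultimately show ?thesis using T by simp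
  next
    case F: False
    hence "\<not> i \<le> min A B" using True by auto
    thus ?thesis using F by auto
  qed
  finally show ?thesis .
next
  case False
  obtain c where c: "\<And>q. rho d i q = (\<Sum>j\<le>i. c j * q ^ (d + 2 * j))" using rho_expand by blast
  have z: "RI (\<lambda>q. q ^ (d + 2 * j) * Rad A B q) 0" if "j \<le> i" for j
  proof -
    have e: "d + 2 * j = 2 * (i + d + j) - (A + B)" using AB by simp
    show ?thesis
    proof (cases "B \<le> A")
      case True
      show ?thesis unfolding e by (rule RI_Rad_power) (use True False AB that in auto)
    next
      case F: False
      show ?thesis unfolding e Rad_sym[of A B] add.commute[of A B] by (rule RI_Rad_power) (use F False AB that in auto)
    qed
  qed
  have "RI (\<lambda>q. \<Sum>j\<le>i. c j * (q ^ (d + 2 * j) * Rad A B q)) (\<Sum>j\<le>i. c j * 0)"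
    by (intro RI_sum RI_cmult z) auto
  moreover have "(\<lambda>q. \<Sum>j\<le>i. c j * (q ^ (d + 2 * j) * Rad A B q)) = (\<lambda>q. rho d i q * Rad A B q)"
    by (simp add: fun_eq_iff c sum_distrib_right mult.assoc)
  moreover have "\<not> (A = i \<or> B = i)" using False by auto
  ultimately show ?thesis by simp
qed

lemma Fc_hyp:
  assumes t: "0 < t"
  shows "Fc (Suc d) (int i) (int i) (mat2 (of_real (cosh t)) (of_real (sinh t)) (of_real (sinh t)) (of_real (cosh t)))
    = ((- of_nat (Suc d)) gchoose i) * of_real ((1 / cosh t) * rho d i (1 / cosh t))"
proof -
  define c s where "c = cosh t" and "s = sinh t"
  have c: "c \<noteq> 0" by (simp add: c_def)
  have q: "1 - (1 / c)\<^sup>2 = (s / c)\<^sup>2"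
  proof -
    have "c\<^sup>2 - 1 = s\<^sup>2" using cosh_square_eq[of t] by (simp add: c_def s_def)
    moreover have "1 - (1 / c)\<^sup>2 = (c\<^sup>2 - 1) / c\<^sup>2" using c by (simp add: power_divide diff_divide_distrib)
    ultimately show ?thesis by (simp add: power_divide)
  qed
  have "(\<Sum>k\<le>i. of_nat (i choose k) * complex_of_real c ^ k * of_real s ^ (i - k) *
    (of_nat ((Suc d + i - 1 + (i - k)) choose (i - k)) * (- of_real s) ^ (i - k) / of_real c ^ (Suc d + i + (i - k))))
   = of_real (\<Sum>k\<le>i. real (i choose k) * c ^ k * s ^ (i - k) *
    (real ((Suc d + i - 1 + (i - k)) choose (i - k)) * (- s) ^ (i - k) / c ^ (Suc d + i + (i - k))))"
    by simp
  also have "(\<Sum>k\<le>i. real (i choose k) * c ^ k * s ^ (i - k) *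
    (real ((Suc d + i - 1 + (i - k)) choose (i - k)) * (- s) ^ (i - k) / c ^ (Suc d + i + (i - k))))
    = (\<Sum>h\<le>i. real (i choose (i - h)) * c ^ (i - h) * s ^ h *
    (real ((Suc d + i - 1 + h) choose h) * (- s) ^ h / c ^ (Suc d + i + h)))"
    unfolding atMost_atLeast0 by (subst sum.atLeastAtMost_rev) simp
  also have "\<dots> = (1 / c) * rho d i (1 / c)"
    unfolding rho_def q sum_distrib_left
  proof (intro sum.cong refl)
    fix h assume "h \<in> {..i}"
    hence h: "h \<le> i" by simp
    have "c ^ (i - h) / c ^ (Suc d + i + h) = 1 / (c ^ Suc d * c ^ (2 * h))"
    proof -
      have "c ^ (Suc d + i + h) = c ^ (i - h) * (c ^ Suc d * c ^ (2 * h))"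
        using h by (simp only: power_add[symmetric]) (rule arg_cong[of _ _ "(^) c"], simp)
      thus ?thesis using c by simp
    qed
    moreover have "s ^ h * (- s) ^ h = (-1) ^ h * s ^ (2 * h)"
      by (subst power_minus) (simp add: power_mult power2_eq_square power_mult_distrib)
    moreover have "i choose (i - h) = i choose h" using h by (metis binomial_symmetric)
    moreover have "real (i choose (i - h)) * c ^ (i - h) * s ^ h *
      (real ((Suc d + i - 1 + h) choose h) * (- s) ^ h / c ^ (Suc d + i + h)) =
      real (i choose (i - h)) * real ((Suc d + i - 1 + h) choose h) * (s ^ h * (- s) ^ h) * (c ^ (i - h) / c ^ (Suc d + i + h))"
      by simp
    ultimately have "real (i choose (i - h)) * c ^ (i - h) * s ^ h *
      (real ((Suc d + i - 1 + h) choose h) * (- s) ^ h / c ^ (Suc d + i + h)) =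
      real (i choose h) * real ((d + i + h) choose h) * ((-1) ^ h * s ^ (2 * h)) * (1 / (c ^ Suc d * c ^ (2 * h)))"
      by (simp only: add_Suc diff_Suc_1)
    thus "real (i choose (i - h)) * c ^ (i - h) * s ^ h *
      (real ((Suc d + i - 1 + h) choose h) * (- s) ^ h / c ^ (Suc d + i + h)) =
      1 / c * (ralt d i h * ((1 / c) ^ d * ((s / c)\<^sup>2) ^ h))"
    proof -
      have "((1 / c) ^ d * ((s / c)\<^sup>2) ^ h) * (1 / c) = s ^ (2 * h) * (1 / (c ^ Suc d * c ^ (2 * h)))"
        by (simp add: power_divide power_mult)
      moreover have "1 / c * (X * Y) = X * (Y * (1 / c))" for X Y :: real by simp
      ultimately have "1 / c * (ralt d i h * ((1 / c) ^ d * ((s / c)\<^sup>2) ^ h))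
        = ralt d i h * (s ^ (2 * h) * (1 / (c ^ Suc d * c ^ (2 * h))))"
        by (simp only:)
      with \<open>_ = real (i choose h) * real ((d + i + h) choose h) * ((-1) ^ h * s ^ (2 * h)) * (1 / (c ^ Suc d * c ^ (2 * h)))\<close>
      show ?thesis by (simp only: mult_ac)
    qed
  qed
  finally show ?thesis
    using Fc_explicit[of "mat2 (of_real c) (of_real s) (of_real s) (of_real c)" "Suc d" i i] c
    by (simp only: c_def s_def mat2_nth) simp
qed

definition Zq :: "real \<Rightarrow> HC" where "Zq q = mat2 1 (- of_real q) (- of_real q) 1"

lemma Fc_Zq: "Fc 1 (int A) (int B) (Zq q) = of_real (Rad A B q)"
proof -
  have g: "((- 1 :: complex) gchoose B) = (-1) ^ B"
    using gbinomial_minus[of "1::complex" B] binomial_gbinomial[of B B, where ?'a=complex] by simp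
  have "Fc 1 (int A) (int B) (Zq q) = (-1) ^ B * of_real (\<Sum>k\<le>A. real (B choose k) * (- q) ^ (B - k) * (real ((B + (A - k)) choose (A - k)) * q ^ (A - k)))"
    using Fc_explicit[of "Zq q" 1 A B] g by (simp add: Zq_def)
  also have "(\<Sum>k\<le>A. real (B choose k) * (- q) ^ (B - k) * (real ((B + (A - k)) choose (A - k)) * q ^ (A - k)))
    = (\<Sum>k\<le>min A B. real (B choose k) * (- q) ^ (B - k) * (real ((B + (A - k)) choose (A - k)) * q ^ (A - k)))"
    by (rule sum.mono_neutral_right) (auto simp: binomial_eq_0)
  also have "\<dots> = (\<Sum>k\<le>min A B. (-1) ^ B * (aalt A B k * q ^ (A + B - 2 * k)))"
  proof (intro sum.cong refl)
    fix k assume "k \<in> {..min A B}"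
    hence k: "k \<le> A" "k \<le> B" by auto
    have 1: "(B + (A - k)) choose (A - k) = (A + B - k) choose B"
      using k binomial_symmetric[of B "A + B - k"] by (simp add: add.commute)
    have 2: "A + B - 2 * k = (B - k) + (A - k)" using k by simp
    have 3: "(- q) ^ (B - k) = (-1) ^ B * (-1) ^ k * q ^ (B - k)"
    proof -
      have "(-1::real) ^ (B - k) = (-1) ^ (B - k) * ((-1) ^ k * (-1) ^ k)" by (simp flip: power_mult_distrib)
      also have "\<dots> = (-1) ^ (B - k + k) * (-1) ^ k" by (simp only: power_add mult.assoc)
      also have "\<dots> = (-1) ^ B * (-1) ^ k" using k by simp
      finally show ?thesis by (subst power_minus) simp
    qed
    show "real (B choose k) * (- q) ^ (B - k) * (real ((B + (A - k)) choose (A - k)) * q ^ (A - k)) =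
      (-1) ^ B * (aalt A B k * q ^ (A + B - 2 * k))"
      unfolding 1 2 3 by (simp add: power_add mult_ac)
  qed
  also have "(-1) ^ B * complex_of_real \<dots> = of_real (Rad A B q)"
  proof -
    have "(-1::complex) ^ B * ((-1) ^ B * x) = x" for x by (simp add: mult.assoc[symmetric] flip: power_mult_distrib)
    thus ?thesis by (simp add: Rad_def sum_distrib_left[symmetric])
  qed
  finally show ?thesis .
qed

definition kap :: "HC \<Rightarrow> HC \<Rightarrow> complex" where "kap W Z = det Z / det (Z - W)"

abbreviation rq :: "HC \<Rightarrow> real" where "rq Z \<equiv> 1 / cmod (Z$1$1)"

abbreviation (input) cq :: "HC \<Rightarrow> complex" where "cq Z \<equiv> of_real (rq Z)"

lemma rq_UU: "Z \<in> UU \<Longrightarrow> 0 < rq Z" "Z \<in> UU \<Longrightarrow> rq Z \<le> 1"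
  using UU_D(8) by (force, force simp: divide_le_eq_1)

lemma Fc_UU_bound: "\<exists>C\<ge>0. \<forall>Z\<in>UU. cmod (Fc a i j Z) \<le> C * rq Z ^ a"
proof (cases "i < 0")
  case True
  thus ?thesis by (intro exI[of _ 0]) (simp add: Fc_neg)
next
  case False
  then obtain n where i: "i = int n" by (metis int_eq_iff not_le)
  obtain C where C: "C \<ge> 0" "\<And>Z m. Z$1$1 \<noteq> 0 \<Longrightarrow> cmod (Z$2$1) \<le> 1 * cmod (Z$1$1) \<Longrightarrow> cmod (Z$1$2) \<le> 1 * cmod (Z$1$1) \<Longrightarrow>
    cmod (Z$2$2) \<le> 1 * cmod (Z$1$1) \<Longrightarrow> (\<Sum>n<m. cmod (Fc a (int n) j Z) * (1/2) ^ n) \<le> C / cmod (Z$1$1) ^ a"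
    using Fc_bound[of 1 1 "1/2" a j] by auto
  show ?thesis
  proof (intro exI[of _ "C * 2 ^ n"] conjI ballI)
    show "0 \<le> C * 2 ^ n" using C by simp
    fix Z assume Z: "Z \<in> UU"
    have "cmod (Fc a (int n) j Z) * (1/2) ^ n \<le> (\<Sum>n<Suc n. cmod (Fc a (int n) j Z) * (1/2) ^ n)"
      by (simp add: sum_nonneg)
    also have "\<dots> \<le> C / cmod (Z$1$1) ^ a" by (rule C(2)) (use UU_D[OF Z] in auto)
    finally show "cmod (Fc a i j Z) \<le> C * 2 ^ n * rq Z ^ a"
      by (simp add: i field_simps)
  qed
qed

lemma Rad_bound:
  assumes "0 < \<xi>" "\<xi> < 1"
  shows "\<exists>b. summable b \<and> (\<forall>A q. 0 \<le> q \<longrightarrow> q \<le> 1 \<longrightarrow> \<bar>Rad A B q\<bar> * \<xi> ^ A \<le> b A)"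
proof -
  obtain x where x: "\<xi> < x" "x < 1" using assms dense by blast
  obtain C where C: "C \<ge> 0" "\<And>Z m. Z$1$1 \<noteq> 0 \<Longrightarrow> cmod (Z$2$1) \<le> 1 * cmod (Z$1$1) \<Longrightarrow> cmod (Z$1$2) \<le> 1 * cmod (Z$1$1) \<Longrightarrow>
    cmod (Z$2$2) \<le> 1 * cmod (Z$1$1) \<Longrightarrow> (\<Sum>n<m. cmod (Fc 1 (int n) (int B) Z) * x ^ n) \<le> C / cmod (Z$1$1) ^ 1"
    using Fc_bound[of 1 1 x 1 "int B"] x assms by auto
  show ?thesis
  proof (intro exI[of _ "\<lambda>A. C * (\<xi> / x) ^ A"] conjI allI impI)
    show "summable (\<lambda>A. C * (\<xi> / x) ^ A)"
      using x assms by (intro summable_mult summable_geometric) (simp add: divide_less_eq)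
    fix A :: nat and q :: real assume q: "0 \<le> q" "q \<le> 1"
    have "\<bar>Rad A B q\<bar> * x ^ A = cmod (Fc 1 (int A) (int B) (Zq q)) * x ^ A" by (simp only: Fc_Zq norm_of_real)
    also have "\<dots> \<le> (\<Sum>n<Suc A. cmod (Fc 1 (int n) (int B) (Zq q)) * x ^ n)"
      using x assms by (simp add: sum_nonneg)
    also have "\<dots> \<le> C / cmod (Zq q$1$1) ^ 1" by (rule C(2)) (use q in \<open>auto simp: Zq_def\<close>)
    also have "\<dots> = C" by (simp add: Zq_def)
    finally have "\<bar>Rad A B q\<bar> * x ^ A * (\<xi> / x) ^ A \<le> C * (\<xi> / x) ^ A"
      using x assms by (intro mult_right_mono) auto
    thus "\<bar>Rad A B q\<bar> * \<xi> ^ A \<le> C * (\<xi> / x) ^ A"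
      using x assms by (simp add: power_divide)
  qed
qed

lemma mobius_le:
  fixes X :: complex
  assumes "cmod X \<le> 1" "0 \<le> q" "q \<le> 1"
  shows "cmod (X - of_real q) \<le> cmod (1 - of_real q * X)"
proof -
  have "(cmod X)\<^sup>2 \<le> 1" "q\<^sup>2 \<le> 1" using assms by (simp_all add: power_le_one)
  hence "0 \<le> (1 - q\<^sup>2) * (1 - (cmod X)\<^sup>2)" by simp
  also have "\<dots> = (cmod (1 - of_real q * X))\<^sup>2 - (cmod (X - of_real q))\<^sup>2"
    unfolding cmod_power2 by (simp add: power2_eq_square algebra_simps)
  finally have "(cmod (X - of_real q))\<^sup>2 \<le> (cmod (1 - of_real q * X))\<^sup>2" by simp
  thus ?thesis by (rule power2_le_imp_le) simp
qed

lemma kernel_denom_bound: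
  fixes X V :: complex
  assumes X: "cmod X = \<xi>" "\<xi> < 1" and V: "cmod V = \<eta>" "\<eta> < 1" and q: "0 \<le> q" "q \<le> 1"
  shows "(1 - \<xi>) * (1 - \<eta>) \<le> cmod (1 - of_real q * X - of_real q * V + X * V)"
    "1 - \<xi> \<le> cmod (1 - of_real q * X)"
proof -
  have "cmod (of_real q * X) \<le> 1 * \<xi>" unfolding norm_mult X(1) using q X by (intro mult_right_mono) auto
  thus 1: "1 - \<xi> \<le> cmod (1 - of_real q * X)" using norm_triangle_ineq2[of 1 "of_real q * X"] by simp
  have "(1 - \<xi>) * (1 - \<eta>) \<le> cmod (1 - of_real q * X) * (1 - \<eta>)" using 1 V by (intro mult_right_mono) auto
  also have "\<dots> \<le> cmod (1 - of_real q * X) - cmod (V * (X - of_real q))"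
  proof -
    have "\<eta> * cmod (X - of_real q) \<le> \<eta> * cmod (1 - of_real q * X)"
      using mobius_le[of X q] X V q by (intro mult_left_mono) auto
    thus ?thesis unfolding norm_mult V(1) by (simp add: algebra_simps)
  qed
  also have "\<dots> \<le> cmod (1 - of_real q * X + V * (X - of_real q))" by (rule norm_diff_ineq)
  also have "1 - of_real q * X + V * (X - of_real q) = 1 - of_real q * X - of_real q * V + X * V" by (simp add: algebra_simps)
  finally show "(1 - \<xi>) * (1 - \<eta>) \<le> cmod (1 - of_real q * X - of_real q * V + X * V)" .
qed

lemma kernel_expand:
  fixes X V f K :: "HC \<Rightarrow> complex"
  assumes m[measurable]: "X \<in> borel_measurable borel" "V \<in> borel_measurable borel" "f \<in> borel_measurable borel" "K \<in> borel_measurable borel"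
    and X: "\<And>Z. Z \<in> UU \<Longrightarrow> cmod (X Z) = \<xi>" "0 < \<xi>" "\<xi> < 1" and V: "\<And>Z. Z \<in> UU \<Longrightarrow> cmod (V Z) = \<eta>" "0 < \<eta>" "\<eta> < 1"
    and f: "\<And>Z. Z \<in> UU \<Longrightarrow> cmod (f Z) \<le> C * rq Z ^ 2" "0 \<le> C"
    and K: "\<And>Z. Z \<in> UU \<Longrightarrow> K Z = - (cq Z * X Z) / (1 - cq Z * X Z - cq Z * V Z + X Z * V Z)"
  shows "integrable haar (\<lambda>Z. f Z * K Z)"
    and "\<exists>S. (\<forall>B. (\<lambda>A. \<integral>Z. f Z * (- (cq Z * X Z)) * V Z ^ B * of_real (Rad A B (rq Z)) * X Z ^ A \<partial>haar) sums S B) \<and>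
      S sums (\<integral>Z. f Z * K Z \<partial>haar)"
proof -
  define G where "G Z = C * rq Z ^ 3" for Z :: HC
  have G: "integrable haar G" unfolding G_def using haar_majorant by simp
  have Gm[measurable]: "(\<lambda>Z. Gser 1 B (X Z) (Zq (rq Z))) \<in> borel_measurable haar" for B
    unfolding Gser_def Zq_def mat2_nth by measurable
  have Km[measurable]: "(\<lambda>Z. f Z * K Z) \<in> borel_measurable haar" by measurable
  define h where "h B Z = f Z * (- (cq Z * X Z)) * (Gser 1 B (X Z) (Zq (rq Z)) * V Z ^ B)" for B Z
  have hm[measurable]: "h B \<in> borel_measurable haar" for B unfolding h_def by measurable
  have fX: "cmod (f Z * (- (cq Z * X Z))) \<le> G Z" if Z: "Z \<in> UU" for Z
  proof -
    have "cmod (f Z * (- (cq Z * X Z))) = cmod (f Z) * (rq Z * \<xi>)"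
      using X(1)[OF Z] by (simp add: norm_mult norm_divide)
    also have "\<dots> \<le> (C * rq Z ^ 2) * (rq Z * 1)"
      using f(1)[OF Z] f(2) X(2,3) rq_UU[OF Z] by (intro mult_mono) auto
    also have "\<dots> = G Z" by (simp add: G_def power2_eq_square power3_eq_cube)
    finally show ?thesis .
  qed
  have G0: "G Z \<ge> 0" for Z using f(2) by (simp add: G_def)
  have gb: "cmod (Gser 1 B (X Z) (Zq (rq Z))) \<le> 1 / (1 - \<xi>)" if Z: "Z \<in> UU" for B Z
  proof -
    have q: "0 \<le> rq Z" "rq Z \<le> 1" using rq_UU[OF Z] by auto
    define w p where "w = X Z - cq Z" and "p = 1 - cq Z * X Z"
    have wp: "cmod w \<le> cmod p" unfolding w_def p_def using X(1)[OF Z] X(3) q by (intro mobius_le) auto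
    have p: "1 - \<xi> \<le> cmod p" unfolding p_def by (rule kernel_denom_bound(2)[OF X(1)[OF Z] X(3) V(1)[OF Z] V(3) q])
    hence p0: "cmod p > 0" using X(3) by linarith
    have g: "cmod ((- 1 :: complex) gchoose B) = 1"
      using gbinomial_minus[of "1::complex" B] binomial_gbinomial[of B B, where ?'a=complex] by (simp add: norm_mult norm_power)
    have "Gser 1 B (X Z) (Zq (rq Z)) = ((-1) gchoose B) * w ^ B / p ^ (1 + B)"
      by (simp add: Gser_def Zq_def w_def p_def)
    hence "cmod (Gser 1 B (X Z) (Zq (rq Z))) = cmod w ^ B / (cmod p * cmod p ^ B)"
      by (simp add: norm_mult norm_divide norm_power g)
    also have "\<dots> \<le> cmod p ^ B / (cmod p * cmod p ^ B)"
      using wp p0 by (intro divide_right_mono power_mono) auto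
    also have "\<dots> = 1 / cmod p" using p0 by simp
    also have "\<dots> \<le> 1 / (1 - \<xi>)" using p X(3) by (intro divide_left_mono mult_pos_pos) (use p0 in auto)
    finally show ?thesis .
  qed
  have hb: "AE Z in haar. \<forall>B. norm (h B Z) \<le> (\<eta> ^ B / (1 - \<xi>)) * G Z"
    using AE_haar
  proof eventually_elim
    case (elim Z)
    show ?case
    proof
      fix B
      have "norm (h B Z) = cmod (f Z * (- (cq Z * X Z))) * (cmod (Gser 1 B (X Z) (Zq (rq Z))) * \<eta> ^ B)"
        unfolding h_def norm_mult norm_power V(1)[OF elim] ..
      also have "\<dots> \<le> G Z * (1 / (1 - \<xi>) * \<eta> ^ B)"
        using fX[OF elim] gb[OF elim, of B] G0 V(2) X(3) by (intro mult_mono) auto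
      finally show "norm (h B Z) \<le> (\<eta> ^ B / (1 - \<xi>)) * G Z" by (simp add: mult_ac)
    qed
  qed
  have hs: "AE Z in haar. (\<lambda>B. h B Z) sums (f Z * K Z)"
    using AE_haar
  proof eventually_elim
    case (elim Z)
    have q: "0 \<le> rq Z" "rq Z \<le> 1" using rq_UU[OF elim] by auto
    have p: "1 - \<xi> \<le> cmod (1 - cq Z * X Z)" by (rule kernel_denom_bound(2)[OF X(1)[OF elim] X(3) V(1)[OF elim] V(3) q])
    have "cmod (V Z * (X Z - cq Z)) < cmod (1 - cq Z * X Z)"
    proof -
      have "cmod (V Z * (X Z - cq Z)) \<le> \<eta> * cmod (1 - cq Z * X Z)"
        unfolding norm_mult V(1)[OF elim] using mobius_le[of "X Z" "rq Z"] X(1)[OF elim] X(3) V(2) q by (intro mult_left_mono) auto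
      also have "\<dots> < 1 * cmod (1 - cq Z * X Z)" using V(3) p X(3) by (intro mult_strict_right_mono) auto
      finally show ?thesis by simp
    qed
    hence "(\<lambda>j. Gser 1 j (X Z) (Zq (rq Z)) * V Z ^ j) sums (1 / (1 - cq Z * X Z + V Z * (X Z - cq Z)) ^ 1)"
    proof -
      assume lt: "cmod (V Z * (X Z - cq Z)) < cmod (1 - cq Z * X Z)"
      have e: "Zq (rq Z)$1$1 + Zq (rq Z)$2$1 * X Z = 1 - cq Z * X Z" "Zq (rq Z)$1$2 + Zq (rq Z)$2$2 * X Z = X Z - cq Z"
        by (simp_all add: Zq_def)
      have "1 - cq Z * X Z \<noteq> 0" using p X(3) by auto
      from Gser_sums[of "Zq (rq Z)" "X Z" "V Z" 1, unfolded e, OF this lt] show ?thesis .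
    qed
    from sums_mult[OF this, of "f Z * (- (cq Z * X Z))"]
    show ?case unfolding h_def K[OF elim] by (simp add: algebra_simps)
  qed
  have sB: "summable (\<lambda>B. \<eta> ^ B / (1 - \<xi>))"
    using V by (intro summable_divide summable_geometric) auto
  show "integrable haar (\<lambda>Z. f Z * K Z)"
    by (rule integral_sums(1)[OF hm Km G sB hb hs])
  have 1: "(\<lambda>B. integral\<^sup>L haar (h B)) sums (\<integral>Z. f Z * K Z \<partial>haar)"
    by (rule integral_sums(2)[OF hm Km G sB hb hs])
  have 2: "(\<lambda>A. \<integral>Z. f Z * (- (cq Z * X Z)) * V Z ^ B * of_real (Rad A B (rq Z)) * X Z ^ A \<partial>haar) sums (integral\<^sup>L haar (h B))" for B
  proof -
    obtain b where b: "summable b" "\<And>A q. 0 \<le> q \<Longrightarrow> q \<le> 1 \<Longrightarrow> \<bar>Rad A B q\<bar> * \<xi> ^ A \<le> b A"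
      using Rad_bound[OF X(2,3), of B] by blast
    show ?thesis
    proof (rule integral_sums(2)[OF _ hm G b(1)])
      show "(\<lambda>Z. f Z * (- (cq Z * X Z)) * V Z ^ B * of_real (Rad A B (rq Z)) * X Z ^ A) \<in> borel_measurable haar" for A
        unfolding Rad_def by measurable
      show "AE Z in haar. \<forall>A. norm (f Z * (- (cq Z * X Z)) * V Z ^ B * of_real (Rad A B (rq Z)) * X Z ^ A) \<le> b A * G Z"
        using AE_haar
      proof eventually_elim
        case (elim Z)
        show ?case
        proof
          fix A
          have "norm (f Z * (- (cq Z * X Z)) * V Z ^ B * of_real (Rad A B (rq Z)) * X Z ^ A)
            = cmod (f Z * (- (cq Z * X Z))) * (\<eta> ^ B * (\<bar>Rad A B (rq Z)\<bar> * \<xi> ^ A))"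
            by (simp only: norm_mult norm_power V(1)[OF elim] X(1)[OF elim] norm_of_real mult.assoc)
          also have "\<dots> \<le> G Z * (1 * b A)"
            using fX[OF elim] G0 V(2,3) X(2) b(2)[of "rq Z" A] rq_UU[OF elim]
            by (intro mult_mono) (auto simp: power_le_one)
          finally show "norm (f Z * (- (cq Z * X Z)) * V Z ^ B * of_real (Rad A B (rq Z)) * X Z ^ A) \<le> b A * G Z"
            by (simp add: mult.commute)
        qed
      qed
      show "AE Z in haar. (\<lambda>A. f Z * (- (cq Z * X Z)) * V Z ^ B * of_real (Rad A B (rq Z)) * X Z ^ A) sums h B Z"
        using AE_haar
      proof eventually_elim
        case (elim Z)
        have q: "0 \<le> rq Z" "rq Z \<le> 1" using rq_UU[OF elim] by auto
        have "rq Z * \<xi> \<le> 1 * \<xi>" using q X(2) by (intro mult_right_mono) auto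
        hence "(\<lambda>n. Fc 1 (int n) (int B) (Zq (rq Z)) * X Z ^ n) sums Gser 1 B (X Z) (Zq (rq Z))"
          using X(1)[OF elim] X(3) q by (intro Fc_sums) (auto simp: Zq_def norm_mult norm_divide)
        from sums_mult[OF this, of "f Z * (- (cq Z * X Z)) * V Z ^ B"]
        show ?case unfolding h_def Fc_Zq by (simp add: mult_ac)
      qed
    qed
  qed
  show "\<exists>S. (\<forall>B. (\<lambda>A. \<integral>Z. f Z * (- (cq Z * X Z)) * V Z ^ B * of_real (Rad A B (rq Z)) * X Z ^ A \<partial>haar) sums S B) \<and>
      S sums (\<integral>Z. f Z * K Z \<partial>haar)"
    using 1 2 by (intro exI[of _ "\<lambda>B. integral\<^sup>L haar (h B)"] conjI allI)
qed

lemma chart_hyp: "chart 1 (vector [0, t, 0, 0]) = mat2 (of_real (cosh t)) (of_real (sinh t)) (of_real (sinh t)) (of_real (cosh t))"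
  by (simp add: HC_eq_iff chart_nth)

lemma hyp_measurable [measurable]:
  "(\<lambda>t. mat2 (complex_of_real (cosh t)) (of_real (sinh t)) (of_real (sinh t)) (of_real (cosh t))) \<in> borel_measurable borel"
proof (rule borel_measurable_HC)
  fix i j :: 2
  show "(\<lambda>t. mat2 (complex_of_real (cosh t)) (of_real (sinh t)) (of_real (sinh t)) (of_real (cosh t)) $ i $ j) \<in> borel_measurable borel"
    using exhaust_2[of i] exhaust_2[of j] by (elim disjE; simp; measurable)
qed

lemma Fc_chart:
  assumes "u \<in> chart_domain"
  shows "Fc a (int i) (int j) (chart 1 u) = cis (of_int (- int a) * u$1) * cis (of_int (int j - int i) * u$3) * cis (of_int (- int a - int i - int j) * u$4) *
    Fc a (int i) (int j) (mat2 (of_real (cosh (u$2))) (of_real (sinh (u$2))) (of_real (sinh (u$2))) (of_real (cosh (u$2))))"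
proof -
  have t: "cosh (u$2) \<noteq> 0" by simp
  have "Fc a (int i) (int j) (chart 1 u) = cis (u$1 + u$4) powi (- int a) * cis (- u$3 - u$4) powi int i * cis (u$3 - u$4) powi int j *
    Fc a (int i) (int j) (mat2 (of_real (cosh (u$2))) (of_real (sinh (u$2))) (of_real (sinh (u$2))) (of_real (cosh (u$2))))"
    by (rule Fc_homogeneous) (simp_all add: chart_nth cis_mult mult_ac)
  also have "cis (u$1 + u$4) powi (- int a) * cis (- u$3 - u$4) powi int i * cis (u$3 - u$4) powi int j
    = cis (of_int (- int a) * u$1) * cis (of_int (int j - int i) * u$3) * cis (of_int (- int a - int i - int j) * u$4)"
    by (simp only: cis_power_int cis_mult) (rule arg_cong[of _ _ cis], simp add: algebra_simps)
  finally show ?thesis .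
qed

lemma term_integral:
  fixes u v k :: int and i j A B :: nat
  assumes d: "d \<ge> 1"
  defines "T \<equiv> \<lambda>Z. Fc (Suc d) (int i) (int j) Z * det Z powi k * (cq Z * (Z$1$1 * cq Z) powi u * (Z$2$2 * cq Z) powi v * of_real (Rad A B (rq Z)))"
  shows "\<not> (i = j \<and> u + v + 2 * k = int d + 1 \<and> u - v = int d + 1 + 2 * int i) \<Longrightarrow> integral\<^sup>L haar T = 0"
    and "i = j \<Longrightarrow> u + v + 2 * k = int d + 1 \<Longrightarrow> u - v = int d + 1 + 2 * int i \<Longrightarrow> A + B = 2 * i + d \<Longrightarrow>
      integral\<^sup>L haar T = ((- of_nat (Suc d)) gchoose i) * (if A = i \<or> B = i then 1 / of_nat d else 0)"
proof -
  have pm: "(\<lambda>Z. f Z powi n) \<in> borel_measurable borel" if "f \<in> borel_measurable borel" for f :: "HC \<Rightarrow> complex" and n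
    using that unfolding power_int_def by (cases "n \<ge> 0") auto
  have Tm[measurable]: "T \<in> borel_measurable borel"
    unfolding T_def Rad_def by (intro borel_measurable_times pm; measurable)
  define H where "H t = mat2 (complex_of_real (cosh t)) (of_real (sinh t)) (of_real (sinh t)) (of_real (cosh t))" for t
  have Hm[measurable]: "H \<in> borel_measurable borel" unfolding H_def by measurable
  define h where "h t = Fc (Suc d) (int i) (int j) (H t) * of_real ((1 / cosh t) * Rad A B (1 / cosh t))" for t
  have hm[measurable]: "h \<in> borel_measurable borel" unfolding h_def Rad_def by measurable
  have Tch: "T (chart 1 x) = cis (of_int (u + v + 2 * k - int d - 1) * x$1) * cis (of_int (int j - int i) * x$3) *
    cis (of_int (u - v - int d - 1 - int i - int j) * x$4) * h (x$2)" if x: "x \<in> chart_domain" for x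
  proof -
    have t: "0 < x$2" using x by (simp add: chart_domain_def)
    have r: "rq (chart 1 x) = 1 / cosh (x$2)" using t by (simp add: cmod_chart)
    have z: "chart 1 x$1$1 * of_real (1 / cosh (x$2)) = cis (x$1 + x$4)" "chart 1 x$2$2 * of_real (1 / cosh (x$2)) = cis (x$1 - x$4)"
      by (simp_all add: chart_nth)
    have c: "cis (of_int (- int (Suc d)) * x$1) * cis (of_int (int j - int i) * x$3) * cis (of_int (- int (Suc d) - int i - int j) * x$4) *
       cis (of_int k * (2 * x$1)) * (cis (of_int u * (x$1 + x$4)) * cis (of_int v * (x$1 - x$4))) =
       cis (of_int (u + v + 2 * k - int d - 1) * x$1) * cis (of_int (int j - int i) * x$3) * cis (of_int (u - v - int d - 1 - int i - int j) * x$4)"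
      by (simp only: cis_mult) (rule arg_cong[of _ _ cis], simp add: algebra_simps)
    have "T (chart 1 x) = (cis (of_int (- int (Suc d)) * x$1) * cis (of_int (int j - int i) * x$3) * cis (of_int (- int (Suc d) - int i - int j) * x$4) *
       cis (of_int k * (2 * x$1)) * (cis (of_int u * (x$1 + x$4)) * cis (of_int v * (x$1 - x$4)))) * h (x$2)"
      unfolding T_def r z Fc_chart[OF x] det_chart h_def H_def[symmetric] by (simp add: cis_power_int mult_ac)
    thus ?thesis unfolding c .
  qed
  obtain C where C: "C \<ge> 0" "\<And>Z. Z \<in> UU \<Longrightarrow> cmod (Fc (Suc d) (int i) (int j) Z) \<le> C * rq Z ^ Suc d"
    using Fc_UU_bound by blast
  obtain b where b: "\<And>A q. 0 \<le> q \<Longrightarrow> q \<le> 1 \<Longrightarrow> \<bar>Rad A B q\<bar> * (1/2) ^ A \<le> b A"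
    using Rad_bound[of "1/2" B] by auto
  have hb: "cmod (h t) \<le> (C * (b A * 2 ^ A)) * (1 / cosh t) ^ 3" if "0 < t" for t
  proof -
    define q where "q = 1 / cosh t"
    have q: "0 < q" "q \<le> 1" using cosh_real_ge_1[of t] by (auto simp: q_def divide_le_eq_1)
    have H: "H t \<in> UU" "rq (H t) = q" unfolding H_def chart_hyp[symmetric] using chart_UU that by (auto simp: cmod_chart q_def)
    have R: "\<bar>Rad A B q\<bar> \<le> b A * 2 ^ A" using b[of q A] q by (simp add: field_simps power_divide)
    have bA: "0 \<le> b A" using b[of q A] q by (meson abs_ge_zero less_imp_le mult_nonneg_nonneg order_trans zero_le_power zero_le_divide_1_iff zero_le_numeral)
    have "cmod (h t) = cmod (Fc (Suc d) (int i) (int j) (H t)) * (q * \<bar>Rad A B q\<bar>)"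
      using q by (simp add: h_def norm_mult norm_divide q_def)
    also have "\<dots> \<le> (C * q ^ Suc d) * (q * (b A * 2 ^ A))"
      using C(2)[OF H(1)] C(1) R q unfolding H(2) by (intro mult_mono mult_nonneg_nonneg) auto
    also have "\<dots> \<le> (C * q ^ 2) * (q * (b A * 2 ^ A))"
      using C(1) R bA q d by (intro mult_right_mono mult_left_mono power_decreasing mult_nonneg_nonneg) auto
    also have "\<dots> = (C * (b A * 2 ^ A)) * q ^ 3" by (simp add: power2_eq_square power3_eq_cube mult_ac)
    finally show ?thesis by (simp add: q_def)
  qed
  have hi: "integrable lborel (\<lambda>t. indicator {0<..} t *\<^sub>R (of_real (sinh t * cosh t) * h t))"
  proof (rule Bochner_Integration.integrable_bound)
    have "RI (\<lambda>q. (C * (b A * 2 ^ A)) * q ^ 1) ((C * (b A * 2 ^ A)) * (1 / real 1))" by (intro RI_cmult RI_power) simp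
    thus "integrable lborel (\<lambda>t. indicator {0<..} t * (sinh t * cosh t * (1 / cosh t) ^ 2 * ((C * (b A * 2 ^ A)) * (1 / cosh t) ^ 1)))"
      unfolding RI_def has_bochner_integral_iff by blast
    show "AE t in lborel. norm (indicator {0<..} t *\<^sub>R (of_real (sinh t * cosh t) * h t))
      \<le> norm (indicator {0<..} t * (sinh t * cosh t * (1 / cosh t) ^ 2 * ((C * (b A * 2 ^ A)) * (1 / cosh t) ^ 1)))"
    proof (rule AE_I2)
      fix t :: real
      show "norm (indicator {0<..} t *\<^sub>R (of_real (sinh t * cosh t) * h t))
        \<le> norm (indicator {0<..} t * (sinh t * cosh t * (1 / cosh t) ^ 2 * ((C * (b A * 2 ^ A)) * (1 / cosh t) ^ 1)))"
      proof (cases "0 < t")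
        case True
        hence sc: "0 \<le> sinh t * cosh t" by simp
        have "norm (indicator {0<..} t *\<^sub>R (of_real (sinh t * cosh t) * h t)) = (sinh t * cosh t) * cmod (h t)"
          using True sc by (simp add: norm_mult)
        also have "\<dots> \<le> (sinh t * cosh t) * ((C * (b A * 2 ^ A)) * (1 / cosh t) ^ 3)"
          using hb[OF True] sc by (rule mult_left_mono)
        also have "\<dots> = indicator {0<..} t * (sinh t * cosh t * (1 / cosh t) ^ 2 * ((C * (b A * 2 ^ A)) * (1 / cosh t) ^ 1))"
          using True by (simp add: power2_eq_square power3_eq_cube)
        also have "\<dots> \<le> norm \<dots>" by simp
        finally show ?thesis .
      qed simp
    qed
  qed measurable
  define I where "I = (\<integral>t. indicator {0<..} t *\<^sub>R (of_real (sinh t * cosh t) * h t) \<partial>lborel)"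
  have HI: "has_bochner_integral lborel (\<lambda>t. indicator {0<..} t *\<^sub>R (of_real (sinh t * cosh t) * h t)) I"
    unfolding I_def by (rule has_bochner_integral_integrable[OF hi])
  have ev: "even ((u + v + 2 * k - int d - 1) + (u - v - int d - 1 - int i - int j))" if "i = j"
    using that by simp
  note prod = haar_product[OF Tm Tch HI]
  {
    assume n: "\<not> (i = j \<and> u + v + 2 * k = int d + 1 \<and> u - v = int d + 1 + 2 * int i)"
    show "integral\<^sup>L haar T = 0"
    proof (cases "i = j")
      case True
      thus ?thesis using prod(2) ev n by auto
    next
      case False
      thus ?thesis using prod(2) by auto
    qed
  }
  assume a: "i = j" "u + v + 2 * k = int d + 1" "u - v = int d + 1 + 2 * int i" "A + B = 2 * i + d"
  have "integral\<^sup>L haar T = 2 * I" using prod(2) ev a by auto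
  moreover have "I = ((- of_nat (Suc d)) gchoose i) * of_real (if A = i \<or> B = i then 1 / (2 * real d) else 0)"
  proof -
    define c where "c = ((- of_nat (Suc d)) gchoose i :: complex)"
    have "has_bochner_integral lborel (\<lambda>t. c * of_real (indicator {0<..} t * (sinh t * cosh t * (1 / cosh t) ^ 2 * (rho d i (1 / cosh t) * Rad A B (1 / cosh t)))))
       (c * of_real (if A = i \<or> B = i then 1 / (2 * real d) else 0))"
      using RI_rho_Rad[OF d a(4)] unfolding RI_def
      by (intro has_bochner_integral_mult_right has_bochner_integral_of_real)
    moreover have "(\<lambda>t. c * of_real (indicator {0<..} t * (sinh t * cosh t * (1 / cosh t) ^ 2 * (rho d i (1 / cosh t) * Rad A B (1 / cosh t)))))
      = (\<lambda>t. indicator {0<..} t *\<^sub>R (of_real (sinh t * cosh t) * h t))"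
    proof
      fix t :: real
      show "c * of_real (indicator {0<..} t * (sinh t * cosh t * (1 / cosh t) ^ 2 * (rho d i (1 / cosh t) * Rad A B (1 / cosh t))))
        = indicator {0<..} t *\<^sub>R (of_real (sinh t * cosh t) * h t)"
        by (cases "0 < t") (simp_all add: h_def H_def Fc_hyp a(1)[symmetric] c_def power2_eq_square)
    qed
    ultimately have "has_bochner_integral lborel (\<lambda>t. indicator {0<..} t *\<^sub>R (of_real (sinh t * cosh t) * h t)) (c * of_real (if A = i \<or> B = i then 1 / (2 * real d) else 0))"
      by simp
    from has_bochner_integral_eq[OF HI this] show ?thesis by (simp add: c_def)
  qed
  ultimately show "integral\<^sup>L haar T = ((- of_nat (Suc d)) gchoose i) * (if A = i \<or> B = i then 1 / of_nat d else 0)"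
    by (simp add: if_distrib)
qed

section \<open>The reproducing property of \<open>det Z / det (Z - W)\<close>\<close>

lemma det_diff: "det (Z - W :: HC) = (Z$1$1 - W$1$1) * (Z$2$2 - W$2$2) - (Z$1$2 - W$1$2) * (Z$2$1 - W$2$1)"
  by (simp add: det_2)

lemma kap_measurable [measurable]: "kap W \<in> borel_measurable borel"
  unfolding kap_def det_diff by measurable

lemma powi_measurable [measurable]:
  fixes f :: "'a \<Rightarrow> complex"
  assumes "f \<in> borel_measurable M"
  shows "(\<lambda>x. f x powi n) \<in> borel_measurable M"
  using assms unfolding power_int_def by (cases "n \<ge> 0") auto

lemma norm_det_powi: "Z \<in> UU \<Longrightarrow> cmod (det Z powi k) = 1"
  using UU_D(1)[of Z] by (simp add: norm_power_int)

lemma diag2_nth [simp]: "diag2 a b $ 1 $ 1 = a" "diag2 a b $ 1 $ 2 = 0" "diag2 a b $ 2 $ 1 = 0" "diag2 a b $ 2 $ 2 = b"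
  by (simp_all add: diag2_def)

lemma det_diag2 [simp]: "det (diag2 a b) = a * b" by (simp add: det_2)

lemma UU_det_rq:
  assumes "Z \<in> UU"
  shows "det Z = (Z$1$1 * cq Z) * (Z$2$2 * cq Z)"
proof -
  have "Z$1$1 * Z$2$2 = det Z * (Z$1$1 * cnj (Z$1$1))" using UU_D(3)[OF assms] by simp
  also have "\<dots> = det Z * of_real ((cmod (Z$1$1))\<^sup>2)" by (simp only: complex_norm_square)
  finally have "Z$1$1 * Z$2$2 = det Z * of_real ((cmod (Z$1$1))\<^sup>2)" .
  thus ?thesis using UU_D(10)[OF assms] by (simp add: power2_eq_square field_simps)
qed

lemma kap_diag_minus:
  assumes Z: "Z \<in> UU" and l: "l1 \<noteq> 0" "l2 \<noteq> 0"
  defines "q \<equiv> cq Z"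
  defines "X \<equiv> Z$1$1 * q / l1" and "V \<equiv> l2 / (Z$2$2 * q)"
  shows "kap (diag2 l1 l2) Z = - (q * X) / (1 - q * X - q * V + X * V)"
proof -
  have q0: "q \<noteq> 0" using UU_D(10)[OF Z] by (simp add: q_def)
  define x y where "x = Z$1$1 * q" and "y = Z$2$2 * q"
  have xy: "x \<noteq> 0" "y \<noteq> 0" using UU_D(10,11)[OF Z] q0 by (simp_all add: x_def y_def)
  have z: "Z$1$1 = x / q" "Z$2$2 = y / q" using q0 by (simp_all add: x_def y_def)
  have N: "det Z = x * y" using UU_det_rq[OF Z] by (simp add: x_def y_def q_def)
  have "det (Z - diag2 l1 l2) = det Z - l2 * Z$1$1 - l1 * Z$2$2 + l1 * l2"
    unfolding det_diff by (simp add: det_2 algebra_simps)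
  also have "\<dots> = x * y - l2 * (x / q) - l1 * (y / q) + l1 * l2" unfolding N z ..
  also have "\<dots> = - (l1 * y / q) * (1 - q * X - q * V + X * V)"
    unfolding X_def V_def x_def[symmetric] y_def[symmetric] using q0 xy l by (simp add: field_simps)
  finally have d: "det (Z - diag2 l1 l2) = - (l1 * y / q) * (1 - q * X - q * V + X * V)" .
  have n: "det Z = (l1 * y / q) * (q * X)" unfolding N X_def x_def[symmetric] using q0 l by (simp add: field_simps)
  have c: "l1 * y / q \<noteq> 0" using l xy q0 by simp
  have "c * n / (- c * m) = - n / m" if "c \<noteq> 0" for c n m :: complex using that by simp
  from this[OF c] show ?thesis unfolding kap_def d n .
qed

lemma kap_diag_plus:
  assumes Z: "Z \<in> UU" and l: "l1 \<noteq> 0" "l2 \<noteq> 0"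
  defines "q \<equiv> cq Z"
  defines "X \<equiv> Z$2$2 * q / l2" and "V \<equiv> l1 / (Z$1$1 * q)"
  shows "kap (diag2 l1 l2) Z = - (q * X) / (1 - q * X - q * V + X * V)"
proof -
  have r: "rq (swp Z) = rq Z" using UU_D(6)[OF Z] by simp
  have "kap (diag2 l1 l2) Z = kap (diag2 l2 l1) (swp Z)" unfolding kap_def det_diff by (simp add: mult_ac)
  thus ?thesis
    using kap_diag_minus[OF swp_UU[OF Z] l(2,1)] unfolding r q_def X_def V_def by simp
qed

lemma norm_entry_rq:
  assumes "Z \<in> UU"
  shows "cmod (Z$1$1 * cq Z) = 1" "cmod (Z$2$2 * cq Z) = 1"
  using UU_D(6,10)[OF assms] by (simp_all add: norm_mult norm_divide)

lemma kap_diag_bound: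
  assumes Z: "Z \<in> UU" and l: "l1 \<noteq> 0" "l2 \<noteq> 0" "(cmod l1 > 1 \<and> cmod l2 < 1) \<or> (cmod l1 < 1 \<and> cmod l2 > 1)"
  defines "\<xi> \<equiv> 1 / max (cmod l1) (cmod l2)" and "\<eta> \<equiv> min (cmod l1) (cmod l2)"
  shows "cmod (kap (diag2 l1 l2) Z) \<le> 1 / ((1 - \<xi>) * (1 - \<eta>)) * rq Z"
proof -
  have main: "cmod (- (cq Z * X) / (1 - cq Z * X - cq Z * V + X * V)) \<le> 1 / ((1 - \<xi>) * (1 - \<eta>)) * rq Z"
    if X: "cmod X = \<xi>" "\<xi> < 1" and V: "cmod V = \<eta>" "\<eta> < 1" for X V
  proof -
    define D where "D = cmod (1 - cq Z * X - cq Z * V + X * V)"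
    have D: "(1 - \<xi>) * (1 - \<eta>) \<le> D"
      unfolding D_def by (rule kernel_denom_bound(1)[OF X V]) (use rq_UU[OF Z] in auto)
    have p: "0 < (1 - \<xi>) * (1 - \<eta>)" using X V by simp
    have "cmod (- (cq Z * X) / (1 - cq Z * X - cq Z * V + X * V)) = rq Z * \<xi> / D"
      unfolding D_def[symmetric] norm_divide norm_minus_cancel norm_mult X(1) norm_of_real using rq_UU[OF Z] by (simp only: abs_of_pos)
    also have "\<dots> \<le> rq Z * 1 / ((1 - \<xi>) * (1 - \<eta>))"
      using D p X rq_UU[OF Z] by (intro frac_le mult_left_mono mult_nonneg_nonneg) auto
    also have "\<dots> = 1 / ((1 - \<xi>) * (1 - \<eta>)) * rq Z" by simp
    finally show ?thesis .
  qed
  from l(3) show ?thesis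
  proof
    assume a: "cmod l1 > 1 \<and> cmod l2 < 1"
    hence "\<xi> = 1 / cmod l1" "\<eta> = cmod l2" by (auto simp: \<xi>_def \<eta>_def max_def min_def)
    thus ?thesis
      unfolding kap_diag_minus[OF Z l(1,2)] using a l(1,2) norm_entry_rq[OF Z]
      by (intro main) (simp_all only: norm_divide, auto)
  next
    assume a: "cmod l1 < 1 \<and> cmod l2 > 1"
    hence "\<xi> = 1 / cmod l2" "\<eta> = cmod l1" by (auto simp: \<xi>_def \<eta>_def max_def min_def)
    thus ?thesis
      unfolding kap_diag_plus[OF Z l(1,2)] using a l(1,2) norm_entry_rq[OF Z]
      by (intro main) (simp_all only: norm_divide, auto)
  qed
qed

lemma double_sums_single:
  fixes c :: "nat \<Rightarrow> nat \<Rightarrow> complex"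
  assumes "\<And>B. (\<lambda>A. c A B) sums S B" "S sums T"
  shows "(\<And>A B. (A, B) \<noteq> (A0, B0) \<Longrightarrow> c A B = 0) \<Longrightarrow> T = c A0 B0"
proof -
  assume z: "\<And>A B. (A, B) \<noteq> (A0, B0) \<Longrightarrow> c A B = 0"
  have "S B = (if B = B0 then c A0 B0 else 0)" for B
  proof -
    have "(\<lambda>A. c A B) = (\<lambda>A. if A = A0 then (if B = B0 then c A0 B0 else 0) else 0)"
      using z by (auto simp: fun_eq_iff)
    thus ?thesis using assms(1)[of B] sums_single[of A0 "\<lambda>_. if B = B0 then c A0 B0 else 0"] sums_unique2 by fastforce
  qed
  hence "S = (\<lambda>B. if B = B0 then c A0 B0 else 0)" by (simp add: fun_eq_iff)
  thus ?thesis using assms(2) sums_single[of B0 "\<lambda>_. c A0 B0"] sums_unique2 by fastforce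
qed

lemma Fc_diag:
  assumes "l1 \<noteq> 0" "a \<ge> 1"
  shows "Fc a (int i) (int j) (diag2 l1 l2) = (if i = j then ((- of_nat a) gchoose i) * l2 ^ i / l1 ^ (a + i) else 0)"
proof -
  have "Fc a (int i) (int j) (diag2 l1 l2) = ((- of_nat a) gchoose j) * (\<Sum>k\<le>i. if k = i then (if i = j then l2 ^ i / l1 ^ (a + j) else 0) else 0)"
    unfolding Fc_explicit[of "diag2 l1 l2", unfolded diag2_nth, OF assms]
    by (intro arg_cong[of _ _ "\<lambda>x. _ * x"] sum.cong refl) (auto simp: power_0_left binomial_eq_0)
  thus ?thesis by simp
qed

abbreviation (input) fterm :: "nat \<Rightarrow> nat \<Rightarrow> nat \<Rightarrow> int \<Rightarrow> HC \<Rightarrow> complex" where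
  "fterm d i j k Z \<equiv> Fc (Suc d) (int i) (int j) Z * det Z powi k"

lemma phi_UU_bound: "d \<ge> 1 \<Longrightarrow> \<exists>C\<ge>0. \<forall>Z\<in>UU. cmod (Fc (Suc d) i j Z * det Z powi k) \<le> C * rq Z ^ 2"
proof -
  assume d: "d \<ge> 1"
  obtain C where C: "C \<ge> 0" "\<And>Z. Z \<in> UU \<Longrightarrow> cmod (Fc (Suc d) i j Z) \<le> C * rq Z ^ Suc d" using Fc_UU_bound by blast
  show ?thesis
  proof (intro exI[of _ C] conjI ballI C(1))
    fix Z assume Z: "Z \<in> UU"
    have "cmod (Fc (Suc d) i j Z * det Z powi k) = cmod (Fc (Suc d) i j Z)" by (simp add: norm_mult norm_det_powi[OF Z])
    also have "\<dots> \<le> C * rq Z ^ Suc d" by (rule C(2)[OF Z])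
    also have "\<dots> \<le> C * rq Z ^ 2" using d C(1) rq_UU[OF Z] by (intro mult_left_mono power_decreasing) auto
    finally show "cmod (Fc (Suc d) i j Z * det Z powi k) \<le> C * rq Z ^ 2" .
  qed
qed

lemma E_diag_minus:
  assumes d: "d \<ge> 1" and l: "cmod l1 > 1" "cmod l2 < 1" "l2 \<noteq> 0"
  shows "(\<integral>Z. fterm d i j k Z * kap (diag2 l1 l2) Z \<partial>haar)
    = (if k = 0 \<or> k = int d then - 1 / of_nat d else 0) * (fterm d i j k (diag2 l1 l2))"
proof -
  have l0: "l1 \<noteq> 0" using l by auto
  define f where "f Z = fterm d i j k Z" for Z
  define X where "X Z = Z$1$1 * cq Z / l1" for Z :: HC
  define V where "V Z = l2 / (Z$2$2 * cq Z)" for Z :: HC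
  obtain C where C: "C \<ge> 0" "\<And>Z. Z \<in> UU \<Longrightarrow> cmod (f Z) \<le> C * rq Z ^ 2" using phi_UU_bound[OF d] unfolding f_def by blast
  have [measurable]: "f \<in> borel_measurable borel" "X \<in> borel_measurable borel" "V \<in> borel_measurable borel"
    unfolding f_def X_def V_def by measurable
  obtain S where S: "\<And>B. (\<lambda>A. \<integral>Z. f Z * (- (cq Z * X Z)) * V Z ^ B * of_real (Rad A B (rq Z)) * X Z ^ A \<partial>haar) sums S B"
    "S sums (\<integral>Z. f Z * kap (diag2 l1 l2) Z \<partial>haar)"
  proof -
    have "\<exists>S. (\<forall>B. (\<lambda>A. \<integral>Z. f Z * (- (cq Z * X Z)) * V Z ^ B * of_real (Rad A B (rq Z)) * X Z ^ A \<partial>haar) sums S B) \<and>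
      S sums (\<integral>Z. f Z * kap (diag2 l1 l2) Z \<partial>haar)"
    proof (rule kernel_expand(2)[where \<xi>="1 / cmod l1" and \<eta>="cmod l2" and C=C])
      show "cmod (X Z) = 1 / cmod l1" if "Z \<in> UU" for Z unfolding X_def norm_divide norm_entry_rq[OF that] ..
      show "cmod (V Z) = cmod l2" if "Z \<in> UU" for Z unfolding V_def norm_divide norm_entry_rq[OF that] by simp
      show "kap (diag2 l1 l2) Z = - (cq Z * X Z) / (1 - cq Z * X Z - cq Z * V Z + X Z * V Z)" if "Z \<in> UU" for Z
        unfolding X_def V_def by (rule kap_diag_minus[OF that l0 l(3)])
    qed (use l C l0 in auto)
    thus ?thesis using that by blast
  qed
  define c where "c A B = (\<integral>Z. f Z * (- (cq Z * X Z)) * V Z ^ B * of_real (Rad A B (rq Z)) * X Z ^ A \<partial>haar)" for A B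
  define T where "T A B Z = fterm d i j k Z * (cq Z * (Z$1$1 * cq Z) powi int (Suc A) * (Z$2$2 * cq Z) powi (- int B) * of_real (Rad A B (rq Z)))" for A B and Z :: HC
  have c: "c A B = - (l2 ^ B / l1 ^ Suc A) * integral\<^sup>L haar (T A B)" for A B
  proof -
    have "f Z * (- (cq Z * X Z)) * V Z ^ B * of_real (Rad A B (rq Z)) * X Z ^ A = - (l2 ^ B / l1 ^ Suc A) * T A B Z" for Z
    proof -
      have "F * N * (- (q * (x / l1))) * (l2 / y) ^ B * r * (x / l1) ^ A
        = - (l2 ^ B / l1 ^ Suc A) * (F * N * (q * x ^ Suc A * inverse (y ^ B) * r))" for F N q x y r :: complex
        by (simp add: divide_inverse power_mult_distrib power_inverse)
      thus ?thesis
        unfolding T_def f_def X_def V_def power_int_minus power_int_of_nat.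
    qed
    thus ?thesis unfolding c_def by (simp only: integral_mult_right_zero)
  qed
  have T0: "integral\<^sup>L haar (T A B) = 0" if "\<not> (i = j \<and> int (Suc A) + (- int B) + 2 * k = int d + 1 \<and> int (Suc A) - (- int B) = int d + 1 + 2 * int i)" for A B
    unfolding T_def by (rule term_integral(1)[OF d that])
  have goal: "(\<integral>Z. f Z * kap (diag2 l1 l2) Z \<partial>haar) = (if k = 0 \<or> k = int d then - 1 / of_nat d else 0) * (fterm d i j k (diag2 l1 l2))"
  proof (cases "i = j \<and> 0 \<le> int d + int i - k \<and> 0 \<le> int i + k")
    case True
    define A0 B0 where "A0 = nat (int d + int i - k)" and "B0 = nat (int i + k)"
    have AB: "int A0 = int d + int i - k" "int B0 = int i + k" using True by (simp_all add: A0_def B0_def)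
    have "(\<integral>Z. f Z * kap (diag2 l1 l2) Z \<partial>haar) = c A0 B0"
    proof (rule double_sums_single[OF S(1)[folded c_def] S(2)])
      fix A B assume "(A, B) \<noteq> (A0, B0)"
      hence "\<not> (i = j \<and> int (Suc A) + (- int B) + 2 * k = int d + 1 \<and> int (Suc A) - (- int B) = int d + 1 + 2 * int i)"
        using AB by auto
      thus "c A B = 0" unfolding c by (simp add: T0)
    qed
    also have "c A0 B0 = - (l2 ^ B0 / l1 ^ Suc A0) * (((- of_nat (Suc d)) gchoose i) * (if A0 = i \<or> B0 = i then 1 / of_nat d else 0))"
      unfolding c T_def by (subst term_integral(2)[OF d]) (use AB True in auto)
    also have "\<dots> = (if k = 0 \<or> k = int d then - 1 / of_nat d else 0) * (((- of_nat (Suc d)) gchoose i) * (l2 ^ B0 / l1 ^ Suc A0))"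
      using AB by auto
    also have "l2 ^ B0 / l1 ^ Suc A0 = l2 ^ i / l1 ^ (Suc d + i) * (l1 * l2) powi k"
    proof -
      have "l2 ^ B0 / l1 ^ Suc A0 = l2 powi (int i + k) * l1 powi (- (int (Suc d + i)) + k)"
      proof -
        have "l2 ^ B0 = l2 powi (int i + k)" unfolding AB(2)[symmetric] by (rule power_int_of_nat[symmetric])
        moreover have e: "- (int (Suc d + i)) + k = - int (Suc A0)" using AB by simp
        moreover have "1 / l1 ^ Suc A0 = l1 powi (- int (Suc A0))" by (simp only: power_int_minus power_int_of_nat inverse_eq_divide)
        ultimately show ?thesis by (metis times_divide_eq_right mult.right_neutral)
      qed
      also have "\<dots> = (l2 powi int i * l2 powi k) * (l1 powi (- int (Suc d + i)) * l1 powi k)"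
        by (simp only: power_int_add l0 l(3) simp_thms)
      also have "\<dots> = l2 ^ i / l1 ^ (Suc d + i) * (l1 * l2) powi k"
        by (simp only: power_int_mult_distrib power_int_minus power_int_of_nat divide_inverse mult_ac)
      finally show ?thesis .
    qed
    finally show ?thesis using True l0 by (simp add: Fc_diag mult_ac)
  next
    case False
    have "(\<integral>Z. f Z * kap (diag2 l1 l2) Z \<partial>haar) = c 0 0"
    proof (rule double_sums_single[OF S(1)[folded c_def] S(2)])
      fix A B assume "(A, B) \<noteq> (0::nat, 0::nat)"
      have "\<not> (i = j \<and> int (Suc A) + (- int B) + 2 * k = int d + 1 \<and> int (Suc A) - (- int B) = int d + 1 + 2 * int i)"
        using False by auto
      thus "c A B = 0" unfolding c by (simp add: T0)
    qed
    also have "c 0 0 = 0"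
    proof -
      have "\<not> (i = j \<and> int (Suc 0) + (- int 0) + 2 * k = int d + 1 \<and> int (Suc 0) - (- int 0) = int d + 1 + 2 * int i)"
        using False by auto
      from T0[OF this] show ?thesis unfolding c by simp
    qed
    finally show ?thesis
      using False l0 by (auto simp: Fc_diag)
  qed
  thus ?thesis unfolding f_def .
qed

lemma E_diag_plus:
  assumes d: "d \<ge> 1" and l: "cmod l1 < 1" "cmod l2 > 1" "l1 \<noteq> 0"
  shows "(\<integral>Z. fterm d i j k Z * kap (diag2 l1 l2) Z \<partial>haar) = 0"
proof -
  have l0: "l2 \<noteq> 0" using l by auto
  define f where "f Z = fterm d i j k Z" for Z
  define X where "X Z = Z$2$2 * cq Z / l2" for Z :: HC
  define V where "V Z = l1 / (Z$1$1 * cq Z)" for Z :: HC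
  obtain C where C: "C \<ge> 0" "\<And>Z. Z \<in> UU \<Longrightarrow> cmod (f Z) \<le> C * rq Z ^ 2" using phi_UU_bound[OF d] unfolding f_def by blast
  have [measurable]: "f \<in> borel_measurable borel" "X \<in> borel_measurable borel" "V \<in> borel_measurable borel"
    unfolding f_def X_def V_def by measurable
  obtain S where S: "\<And>B. (\<lambda>A. \<integral>Z. f Z * (- (cq Z * X Z)) * V Z ^ B * of_real (Rad A B (rq Z)) * X Z ^ A \<partial>haar) sums S B"
    "S sums (\<integral>Z. f Z * kap (diag2 l1 l2) Z \<partial>haar)"
  proof -
    have "\<exists>S. (\<forall>B. (\<lambda>A. \<integral>Z. f Z * (- (cq Z * X Z)) * V Z ^ B * of_real (Rad A B (rq Z)) * X Z ^ A \<partial>haar) sums S B) \<and>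
      S sums (\<integral>Z. f Z * kap (diag2 l1 l2) Z \<partial>haar)"
    proof (rule kernel_expand(2)[where \<xi>="1 / cmod l2" and \<eta>="cmod l1" and C=C])
      show "cmod (X Z) = 1 / cmod l2" if "Z \<in> UU" for Z unfolding X_def norm_divide norm_entry_rq[OF that] ..
      show "cmod (V Z) = cmod l1" if "Z \<in> UU" for Z unfolding V_def norm_divide norm_entry_rq[OF that] by simp
      show "kap (diag2 l1 l2) Z = - (cq Z * X Z) / (1 - cq Z * X Z - cq Z * V Z + X Z * V Z)" if "Z \<in> UU" for Z
        unfolding X_def V_def by (rule kap_diag_plus[OF that l(3) l0])
    qed (use l C l0 in auto)
    thus ?thesis using that by blast
  qed
  define c where "c A B = (\<integral>Z. f Z * (- (cq Z * X Z)) * V Z ^ B * of_real (Rad A B (rq Z)) * X Z ^ A \<partial>haar)" for A B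
  define T where "T A B Z = fterm d i j k Z * (cq Z * (Z$1$1 * cq Z) powi (- int B) * (Z$2$2 * cq Z) powi int (Suc A) * of_real (Rad A B (rq Z)))" for A B and Z :: HC
  have c: "c A B = 0" for A B
  proof -
    have "f Z * (- (cq Z * X Z)) * V Z ^ B * of_real (Rad A B (rq Z)) * X Z ^ A = - (l1 ^ B / l2 ^ Suc A) * T A B Z" for Z
    proof -
      have "F * N * (- (q * (x / l2))) * (l1 / y) ^ B * r * (x / l2) ^ A
        = - (l1 ^ B / l2 ^ Suc A) * (F * N * (q * inverse (y ^ B) * x ^ Suc A * r))" for F N q x y r :: complex
        by (simp add: divide_inverse power_mult_distrib power_inverse)
      thus ?thesis
        unfolding T_def f_def X_def V_def power_int_minus power_int_of_nat .
    qed
    hence "c A B = - (l1 ^ B / l2 ^ Suc A) * integral\<^sup>L haar (T A B)" unfolding c_def by (simp only: integral_mult_right_zero)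
    also have "integral\<^sup>L haar (T A B) = 0"
      unfolding T_def by (rule term_integral(1)[OF d]) auto
    finally show ?thesis by simp
  qed
  have "(\<integral>Z. f Z * kap (diag2 l1 l2) Z \<partial>haar) = c 0 0"
    by (rule double_sums_single[OF S(1)[folded c_def] S(2)]) (rule c)
  thus ?thesis unfolding c f_def .
qed

definition gfun :: "complex \<Rightarrow> complex \<Rightarrow> nat \<Rightarrow> HC \<Rightarrow> complex" where
  "gfun s t a Z = 1 / (Z$1$1 + Z$2$1 * s + t * (Z$1$2 + Z$2$2 * s)) ^ a"

lemma disc_action:
  fixes \<alpha> \<beta> s :: complex
  assumes "cmod \<beta> < cmod \<alpha>" "cmod s < 1"
  shows "cmod (\<beta> + s * cnj \<alpha>) < cmod (\<alpha> + s * cnj \<beta>)"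
proof -
  have "(cmod \<beta>)\<^sup>2 < (cmod \<alpha>)\<^sup>2" "(cmod s)\<^sup>2 < 1" using assms by (simp_all add: power_strict_mono abs_square_less_1)
  hence "0 < ((cmod \<alpha>)\<^sup>2 - (cmod \<beta>)\<^sup>2) * (1 - (cmod s)\<^sup>2)" by simp
  also have "\<dots> = (cmod (\<alpha> + s * cnj \<beta>))\<^sup>2 - (cmod (\<beta> + s * cnj \<alpha>))\<^sup>2"
    unfolding cmod_power2 by (simp add: power2_eq_square algebra_simps)
  finally have "(cmod (\<beta> + s * cnj \<alpha>))\<^sup>2 < (cmod (\<alpha> + s * cnj \<beta>))\<^sup>2" by simp
  thus ?thesis by (rule power_less_imp_less_base) simp
qed

lemma SU11_less: "g \<in> SU11 \<Longrightarrow> cmod (g$1$2) < cmod (g$1$1)"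
proof -
  assume "g \<in> SU11"
  hence "(cmod (g$1$2))\<^sup>2 < (cmod (g$1$1))\<^sup>2" using SU11_norm[of g] by linarith
  thus ?thesis by (rule power_less_imp_less_base) simp
qed

lemma conjg_nth:
  assumes "g \<in> SU11"
  shows "conjg g Z $ p $ q = (g$p$1 * Z$1$1 + g$p$2 * Z$2$1) * matrix_inv g $ 1 $ q + (g$p$1 * Z$1$2 + g$p$2 * Z$2$2) * matrix_inv g $ 2 $ q"
  unfolding conjg_def by (simp add: matrix_matrix_mult_def sum_2)

lemma SU11_inv:
  assumes "g \<in> SU11"
  shows "matrix_inv g = mat2 (g$2$2) (- g$1$2) (- g$2$1) (g$1$1)"
  using matrix_inv_22[of g] assms by (simp add: SU11_def)

lemma gfun_conjg:
  assumes g: "g \<in> SU11" and st: "cmod s < 1" "cmod t < 1"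
  obtains s' t' c where "cmod s' < 1" "cmod t' < 1" "\<And>a Z. gfun s t a (conjg g Z) = gfun s' t' a Z / c ^ a"
proof -
  define r1 r2 c1 c2 where "r1 = g$1$1 + s * g$2$1" and "r2 = g$1$2 + s * g$2$2"
    and "c1 = g$2$2 - g$1$2 * t" and "c2 = - g$2$1 + g$1$1 * t"
  have e: "g$2$2 = cnj (g$1$1)" "g$2$1 = cnj (g$1$2)" using g by (simp_all add: SU11_def)
  have r: "cmod r2 < cmod r1" unfolding r1_def r2_def e by (rule disc_action[OF SU11_less[OF g] st(1)])
  have "cmod (- cnj (g$1$2) + t * cnj (cnj (g$1$1))) < cmod (cnj (g$1$1) + t * cnj (- cnj (g$1$2)))"
    by (rule disc_action) (use SU11_less[OF g] st in simp_all)
  hence c: "cmod c2 < cmod c1" unfolding c1_def c2_def e by (simp add: mult.commute)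
  have n: "r1 \<noteq> 0" "c1 \<noteq> 0" using r c by auto
  show ?thesis
  proof (rule that)
    show "cmod (r2 / r1) < 1" "cmod (c2 / c1) < 1" using r c n by (simp_all add: norm_divide)
    fix a Z
    have "conjg g Z $ 1 $ 1 + conjg g Z $ 2 $ 1 * s + t * (conjg g Z $ 1 $ 2 + conjg g Z $ 2 $ 2 * s)
      = r1 * c1 * (Z$1$1 + Z$2$1 * (r2 / r1) + (c2 / c1) * (Z$1$2 + Z$2$2 * (r2 / r1)))"
    proof -
      have "r1 * c1 * (Z$1$1 + Z$2$1 * (r2 / r1) + (c2 / c1) * (Z$1$2 + Z$2$2 * (r2 / r1)))
        = r1 * c1 * Z$1$1 + r2 * c1 * Z$2$1 + r1 * c2 * Z$1$2 + r2 * c2 * Z$2$2"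
        using n by (simp add: algebra_simps)
      also have "\<dots> = conjg g Z $ 1 $ 1 + conjg g Z $ 2 $ 1 * s + t * (conjg g Z $ 1 $ 2 + conjg g Z $ 2 $ 2 * s)"
        unfolding conjg_nth[OF g] SU11_inv[OF g] mat2_nth r1_def r2_def c1_def c2_def by (simp add: algebra_simps)
      finally show ?thesis ..
    qed
    thus "gfun s t a (conjg g Z) = gfun (r2 / r1) (c2 / c1) a Z / (r1 * c1) ^ a"
      unfolding gfun_def by (simp add: power_mult_distrib)
  qed
qed

lemma det_SU11_inv:
  assumes "g \<in> SU11"
  shows "det (matrix_inv g) = 1"
proof -
  have "g$1$1 * g$2$2 - g$1$2 * g$2$1 = 1" using SU11_D(3)[OF assms] by (simp add: det_2)
  thus ?thesis unfolding SU11_inv[OF assms] det_2 mat2_nth by (simp add: mult.commute)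
qed

lemma det_conjg: "g \<in> SU11 \<Longrightarrow> det (conjg g Z) = det Z"
  by (simp add: conjg_def det_mul SU11_D(3) det_SU11_inv)

lemma conjg_diff: "conjg g (Z - W) = conjg g Z - conjg g W"
  unfolding conjg_def by (simp add: HC_eq_iff algebra_simps)

lemma kap_conjg: "g \<in> SU11 \<Longrightarrow> kap (conjg g W) (conjg g Z) = kap W Z"
  unfolding kap_def by (simp add: det_conjg flip: conjg_diff)

lemma SU11_matrix_inv:
  assumes "g \<in> SU11"
  shows "matrix_inv g \<in> SU11"
proof -
  have "matrix_inv g $ 2 $ 2 = cnj (matrix_inv g $ 1 $ 1)" "matrix_inv g $ 2 $ 1 = cnj (matrix_inv g $ 1 $ 2)"
    unfolding SU11_inv[OF assms] mat2_nth SU11_D(1)[OF assms] SU11_D(2)[OF assms] by simp_all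
  thus ?thesis unfolding SU11_def using det_SU11_inv[OF assms] by blast
qed

lemma conjg_inv:
  assumes "g \<in> SU11"
  shows "conjg g (conjg (matrix_inv g) Z) = Z"
proof -
  have d: "g$1$1 * g$2$2 - g$1$2 * g$2$1 = 1" using SU11_D(3)[OF assms] by (simp add: det_2)
  have i: "matrix_inv (matrix_inv g) = g" using SU11_inv[OF SU11_matrix_inv[OF assms]] by (simp add: SU11_inv[OF assms] HC_eq_iff)
  have 1: "g ** matrix_inv g = mat 1" using d by (simp add: SU11_inv[OF assms] HC_eq_iff mat_def mult.commute)
  have "conjg g (conjg (matrix_inv g) Z) = (g ** matrix_inv g) ** Z ** (g ** matrix_inv g)"
    unfolding conjg_def i by (simp only: matrix_mul_assoc)
  thus ?thesis unfolding 1 by simp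
qed

lemma UU_entries: "Z \<in> UU \<Longrightarrow> cmod (Z$1$2) \<le> cmod (Z$1$1)" "Z \<in> UU \<Longrightarrow> cmod (Z$2$1) \<le> cmod (Z$1$1)" "Z \<in> UU \<Longrightarrow> cmod (Z$2$2) \<le> cmod (Z$1$1)"
  using UU_D(6,7,9)[of Z] by auto

lemma conjg_11_le:
  assumes g: "g \<in> SU11" and Z: "Z \<in> UU"
  shows "cmod (conjg g Z $ 1 $ 1) \<le> (cmod (g$1$1) + cmod (g$1$2))\<^sup>2 * cmod (Z$1$1)"
proof -
  have n: "cmod (g$2$2) = cmod (g$1$1)" "cmod (g$2$1) = cmod (g$1$2)" using g by (simp_all add: SU11_def)
  have 1: "cmod (g$1$1 * x + g$1$2 * y) \<le> (cmod (g$1$1) + cmod (g$1$2)) * cmod (Z$1$1)"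
    if "cmod x \<le> cmod (Z$1$1)" "cmod y \<le> cmod (Z$1$1)" for x y
  proof -
    have "cmod (g$1$1 * x + g$1$2 * y) \<le> cmod (g$1$1) * cmod x + cmod (g$1$2) * cmod y"
      by (metis norm_mult norm_triangle_ineq)
    also have "\<dots> \<le> cmod (g$1$1) * cmod (Z$1$1) + cmod (g$1$2) * cmod (Z$1$1)"
      using that by (intro add_mono mult_left_mono) auto
    finally show ?thesis by (simp add: algebra_simps)
  qed
  have "cmod (conjg g Z $ 1 $ 1) \<le> cmod (g$1$1 * Z$1$1 + g$1$2 * Z$2$1) * cmod (g$2$2) + cmod (g$1$1 * Z$1$2 + g$1$2 * Z$2$2) * cmod (g$2$1)"
    unfolding conjg_nth[OF g] SU11_inv[OF g] mat2_nth by (rule order_trans[OF norm_triangle_ineq]) (simp add: norm_mult)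
  also have "\<dots> \<le> ((cmod (g$1$1) + cmod (g$1$2)) * cmod (Z$1$1)) * cmod (g$2$2) + ((cmod (g$1$1) + cmod (g$1$2)) * cmod (Z$1$1)) * cmod (g$2$1)"
    using UU_entries[OF Z] by (intro add_mono mult_right_mono 1) auto
  finally show ?thesis unfolding n by (simp add: power2_eq_square algebra_simps)
qed

lemma kap_conjg_bound:
  assumes g: "g \<in> SU11" and Z: "Z \<in> UU" and l: "l1 \<noteq> 0" "l2 \<noteq> 0" "(cmod l1 > 1 \<and> cmod l2 < 1) \<or> (cmod l1 < 1 \<and> cmod l2 > 1)"
  defines "\<xi> \<equiv> 1 / max (cmod l1) (cmod l2)" and "\<eta> \<equiv> min (cmod l1) (cmod l2)"
  shows "cmod (kap (conjg g (diag2 l1 l2)) Z) \<le> (cmod (g$1$1) + cmod (g$1$2))\<^sup>2 / ((1 - \<xi>) * (1 - \<eta>)) * rq Z"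
proof -
  define Y where "Y = conjg (matrix_inv g) Z"
  have Y: "Y \<in> UU" "conjg g Y = Z" using conjg_UU[OF SU11_matrix_inv[OF g] Z] conjg_inv[OF g] by (simp_all add: Y_def)
  have "\<xi> < 1" "\<eta> < 1" using l by (auto simp: \<xi>_def \<eta>_def max_def)
  hence p: "0 < (1 - \<xi>) * (1 - \<eta>)" by simp
  have "cmod (kap (conjg g (diag2 l1 l2)) Z) = cmod (kap (diag2 l1 l2) Y)" using kap_conjg[OF g] Y by metis
  also have "\<dots> \<le> 1 / ((1 - \<xi>) * (1 - \<eta>)) * rq Y" unfolding \<xi>_def \<eta>_def by (rule kap_diag_bound[OF Y(1) l])
  also have "\<dots> \<le> 1 / ((1 - \<xi>) * (1 - \<eta>)) * ((cmod (g$1$1) + cmod (g$1$2))\<^sup>2 * rq Z)"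
  proof (intro mult_left_mono)
    show "rq Y \<le> (cmod (g$1$1) + cmod (g$1$2))\<^sup>2 * rq Z"
    proof -
      have "1 / y \<le> A * (1 / x)" if "x \<le> A * y" "1 \<le> y" "1 \<le> x" for A x y :: real
      proof -
        have "x / (x * y) \<le> A * y / (x * y)" using that by (intro divide_right_mono) auto
        thus ?thesis using that by simp
      qed
      thus ?thesis using conjg_11_le[OF g Y(1)] UU_D(8)[OF Y(1)] UU_D(8)[OF Z] unfolding Y(2) by blast
    qed
  qed (use p in simp)
  finally show ?thesis by simp
qed

lemma gfun_integral_series:
  assumes a: "a \<ge> 2" and K[measurable]: "K \<in> borel_measurable borel" and KQ: "\<And>Z. Z \<in> UU \<Longrightarrow> cmod (K Z) \<le> Q * rq Z"
    and st: "cmod s < 1" "cmod t < 1"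
  shows "\<exists>S. (\<forall>j. (\<lambda>i. (\<integral>Z. Fc a (int i) (int j) Z * det Z powi k * K Z \<partial>haar) * s ^ i) sums S j)
    \<and> (\<lambda>j. S j * t ^ j) sums (\<integral>Z. gfun s t a Z * det Z powi k * K Z \<partial>haar)"
proof -
  define G where "G Z = rq Z ^ 3" for Z :: HC
  have G: "integrable haar G" unfolding G_def by (rule haar_majorant)
  have pw: "rq Z ^ a * (Q' * rq Z) \<le> Q' * G Z" if "Z \<in> UU" "Q' \<ge> 0" for Z Q'
  proof -
    have "rq Z ^ a * rq Z = rq Z ^ Suc a" by simp
    also have "\<dots> \<le> rq Z ^ 3" using rq_UU[OF that(1)] a by (intro power_decreasing) auto
    finally have "Q' * (rq Z ^ a * rq Z) \<le> Q' * rq Z ^ 3" using that by (intro mult_left_mono) auto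
    thus ?thesis unfolding G_def by (simp only: mult_ac)
  qed
  have mat1: "mat 1 \<in> UU" by (simp add: UU_def mat_def det_2)
  have Q0: "Q \<ge> 0" using order_trans[OF norm_ge_zero KQ[OF mat1]] by (simp add: mat_def)
  have zz: "cmod (Z$2$1) * cmod s < cmod (Z$1$1)" "(1 - cmod s) * cmod (Z$1$1) \<le> cmod (Z$1$1 + Z$2$1 * s)"
    "cmod (Z$1$2 + Z$2$2 * s) \<le> cmod (Z$1$1 + Z$2$1 * s)" if "Z \<in> UU" for Z
  proof -
    have "cmod (Z$2$1) * cmod s \<le> cmod (Z$1$1) * cmod s" using UU_entries[OF that] by (intro mult_right_mono) auto
    also have "\<dots> < cmod (Z$1$1)" using mult_strict_left_mono[OF st(1), of "cmod (Z$1$1)"] UU_D(8,10)[OF that] by simp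
    finally show "cmod (Z$2$1) * cmod s < cmod (Z$1$1)" .
    have "cmod (Z$1$1) - cmod (Z$2$1 * s) \<le> cmod (Z$1$1 + Z$2$1 * s)" by (rule norm_diff_ineq)
    moreover have "cmod (Z$2$1 * s) \<le> cmod (Z$1$1) * cmod s" unfolding norm_mult using UU_entries[OF that] by (intro mult_right_mono) auto
    ultimately show "(1 - cmod s) * cmod (Z$1$1) \<le> cmod (Z$1$1 + Z$2$1 * s)" by (simp add: algebra_simps)
    have "cmod (cnj (det Z)) * cmod (Z$1$2 + Z$2$2 * s) = cmod (cnj (det Z) * Z$1$2 + s * (cnj (det Z) * Z$2$2))"
      unfolding norm_mult[symmetric] by (simp add: algebra_simps)
    have m: "cmod (Z$1$2 + s * cnj (Z$1$1)) \<le> cmod (Z$1$1 + s * cnj (Z$1$2))" if "cmod s < 1" for s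
      using disc_action[OF UU_D(9)[OF \<open>Z \<in> UU\<close>] that] by simp
    have "cmod (s * det Z) < 1" using st UU_D(1)[OF that] by (simp add: norm_mult)
    from m[OF this] show "cmod (Z$1$2 + Z$2$2 * s) \<le> cmod (Z$1$1 + Z$2$1 * s)"
      unfolding UU_D(3,4)[OF that] by (simp add: mult_ac)
  qed
  define x where "x = (1 + cmod s) / 2"
  have x: "cmod s < x" "x < 1" "0 < x" using st by (auto simp: x_def add_pos_nonneg)
  have 1: "(\<lambda>i. (\<integral>Z. Fc a (int i) (int j) Z * det Z powi k * K Z \<partial>haar) * s ^ i) sums (\<integral>Z. Gser a j s Z * det Z powi k * K Z \<partial>haar)" for j
  proof -
    obtain C where C: "C \<ge> 0" "\<And>Z m. Z$1$1 \<noteq> 0 \<Longrightarrow> cmod (Z$2$1) \<le> 1 * cmod (Z$1$1) \<Longrightarrow> cmod (Z$1$2) \<le> 1 * cmod (Z$1$1) \<Longrightarrow>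
      cmod (Z$2$2) \<le> 1 * cmod (Z$1$1) \<Longrightarrow> (\<Sum>n<m. cmod (Fc a (int n) (int j) Z) * x ^ n) \<le> C / cmod (Z$1$1) ^ a"
      using Fc_bound[of 1 1 x a "int j"] x by auto
    have "(\<lambda>i. \<integral>Z. Fc a (int i) (int j) Z * s ^ i * det Z powi k * K Z \<partial>haar) sums (\<integral>Z. Gser a j s Z * det Z powi k * K Z \<partial>haar)"
    proof (rule integral_sums(2)[where B="\<lambda>i. (cmod s / x) ^ i" and G="\<lambda>Z. C * Q * G Z"])
      show "integrable haar (\<lambda>Z. C * Q * G Z)" using G by simp
      show "summable (\<lambda>i. (cmod s / x) ^ i)" using x by (intro summable_geometric) simp
      show "AE Z in haar. \<forall>n. cmod (Fc a (int n) (int j) Z * s ^ n * det Z powi k * K Z) \<le> (cmod s / x) ^ n * (C * Q * G Z)"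
        using AE_haar
      proof eventually_elim
        case (elim Z)
        show ?case
        proof
          fix n
          have "cmod (Fc a (int n) (int j) Z) * x ^ n \<le> (\<Sum>m<Suc n. cmod (Fc a (int m) (int j) Z) * x ^ m)"
            using x by (simp add: sum_nonneg)
          also have "\<dots> \<le> C / cmod (Z$1$1) ^ a" by (rule C(2)) (use UU_D(10)[OF elim] UU_entries[OF elim] in auto)
          finally have "cmod (Fc a (int n) (int j) Z) * x ^ n \<le> C * rq Z ^ a" by (simp add: power_divide)
          hence "cmod (Fc a (int n) (int j) Z) \<le> C * rq Z ^ a / x ^ n" by (simp only: pos_le_divide_eq[OF zero_less_power[OF x(3)]])
          hence "cmod (Fc a (int n) (int j) Z) * cmod s ^ n * cmod (K Z) \<le> C * rq Z ^ a / x ^ n * cmod s ^ n * (Q * rq Z)"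
            using KQ[OF elim] C(1) x by (intro mult_mono mult_right_mono) auto
          also have "\<dots> = (cmod s / x) ^ n * (C * (rq Z ^ a * (Q * rq Z)))"
          proof -
            have "C * p / y * w * (Q * q) = w / y * (C * (p * (Q * q)))" for p y w q :: real by simp
            thus ?thesis unfolding power_divide[of "cmod s"] .
          qed
          also have "\<dots> \<le> (cmod s / x) ^ n * (C * (Q * G Z))"
            using pw[OF elim Q0] C x by (intro mult_left_mono) auto
          finally show "cmod (Fc a (int n) (int j) Z * s ^ n * det Z powi k * K Z) \<le> (cmod s / x) ^ n * (C * Q * G Z)"
            by (simp only: norm_mult norm_power norm_det_powi[OF elim] mult_1_right mult.assoc)
        qed
      qed
      show "AE Z in haar. (\<lambda>i. Fc a (int i) (int j) Z * s ^ i * det Z powi k * K Z) sums (Gser a j s Z * det Z powi k * K Z)"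
        using AE_haar
      proof eventually_elim
        case (elim Z)
        show ?case by (intro sums_mult2 Fc_sums) (use UU_D(10)[OF elim] zz[OF elim] in auto)
      qed
    qed (unfold Gser_def, measurable)
    moreover have "(\<integral>Z. Fc a (int i) (int j) Z * s ^ i * det Z powi k * K Z \<partial>haar) = (\<integral>Z. Fc a (int i) (int j) Z * det Z powi k * K Z \<partial>haar) * s ^ i" for i
      by (subst integral_mult_left_zero[symmetric]) (simp only: mult_ac)
    ultimately show ?thesis by simp
  qed
  have 2: "(\<lambda>j. (\<integral>Z. Gser a j s Z * det Z powi k * K Z \<partial>haar) * t ^ j) sums (\<integral>Z. gfun s t a Z * det Z powi k * K Z \<partial>haar)"
  proof -
    have "(\<lambda>j. \<integral>Z. Gser a j s Z * t ^ j * det Z powi k * K Z \<partial>haar) sums (\<integral>Z. gfun s t a Z * det Z powi k * K Z \<partial>haar)"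
    proof (rule integral_sums(2)[where B="\<lambda>j. cmod ((- of_nat a) gchoose j) * cmod t ^ j" and G="\<lambda>Z. 1 / (1 - cmod s) ^ a * Q * G Z"])
      show "integrable haar (\<lambda>Z. 1 / (1 - cmod s) ^ a * Q * G Z)" using G by simp
      show "summable (\<lambda>j. cmod ((- of_nat a) gchoose j) * cmod t ^ j)" by (rule gchoose_summable) (use st in auto)
      show "AE Z in haar. \<forall>j. cmod (Gser a j s Z * t ^ j * det Z powi k * K Z) \<le> cmod ((- of_nat a) gchoose j) * cmod t ^ j * (1 / (1 - cmod s) ^ a * Q * G Z)"
        using AE_haar
      proof eventually_elim
        case (elim Z)
        define u v where "u = cmod (Z$1$2 + Z$2$2 * s)" and "v = cmod (Z$1$1 + Z$2$1 * s)"
        have uv: "u \<le> v" "(1 - cmod s) * cmod (Z$1$1) \<le> v" using zz[OF elim] by (simp_all add: u_def v_def)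
        have z1: "0 < (1 - cmod s) * cmod (Z$1$1)" using st UU_D(8)[OF elim] by (intro mult_pos_pos) auto
        hence v0: "0 < v" using uv by linarith
        show ?case
        proof
          fix j
          have "u ^ j / v ^ (a + j) = (u / v) ^ j * (1 / v ^ a)" using v0 by (simp add: power_add power_divide)
          also have "\<dots> \<le> 1 * (1 / ((1 - cmod s) * cmod (Z$1$1)) ^ a)"
            using uv v0 z1 by (intro mult_mono power_le_one frac_le power_mono) (auto simp: u_def)
          also have "\<dots> = 1 / (1 - cmod s) ^ a * rq Z ^ a" by (simp add: power_mult_distrib power_divide)
          finally have b: "u ^ j / v ^ (a + j) \<le> 1 / (1 - cmod s) ^ a * rq Z ^ a" .
          have "cmod (Gser a j s Z * t ^ j * det Z powi k * K Z) = cmod ((- of_nat a) gchoose j) * cmod t ^ j * (u ^ j / v ^ (a + j) * cmod (K Z))"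
            unfolding Gser_def u_def v_def by (simp add: norm_mult norm_divide norm_power norm_det_powi[OF elim])
          also have "\<dots> \<le> cmod ((- of_nat a) gchoose j) * cmod t ^ j * (1 / (1 - cmod s) ^ a * rq Z ^ a * (Q * rq Z))"
            using b KQ[OF elim] st by (intro mult_left_mono mult_mono) auto
          also have "\<dots> \<le> cmod ((- of_nat a) gchoose j) * cmod t ^ j * (1 / (1 - cmod s) ^ a * (Q * G Z))"
            unfolding mult.assoc using pw[OF elim Q0] st by (intro mult_left_mono) auto
          finally show "cmod (Gser a j s Z * t ^ j * det Z powi k * K Z) \<le> cmod ((- of_nat a) gchoose j) * cmod t ^ j * (1 / (1 - cmod s) ^ a * Q * G Z)"
            by (simp only: mult.assoc)
        qed
      qed
      show "AE Z in haar. (\<lambda>j. Gser a j s Z * t ^ j * det Z powi k * K Z) sums (gfun s t a Z * det Z powi k * K Z)"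
        using AE_haar
      proof eventually_elim
        case (elim Z)
        have p: "0 < cmod (Z$1$1 + Z$2$1 * s)"
        proof -
          have "0 < (1 - cmod s) * cmod (Z$1$1)" using st UU_D(8)[OF elim] by (intro mult_pos_pos) auto
          thus ?thesis using zz(2)[OF elim] by linarith
        qed
        have "cmod t * cmod (Z$1$2 + Z$2$2 * s) \<le> cmod t * cmod (Z$1$1 + Z$2$1 * s)" using zz(3)[OF elim] by (intro mult_left_mono) auto
        also have "\<dots> < 1 * cmod (Z$1$1 + Z$2$1 * s)" using p st by (intro mult_strict_right_mono) auto
        finally show ?case unfolding gfun_def by (intro sums_mult2 Gser_sums) (use p in \<open>auto simp: norm_mult\<close>)
      qed
    qed (unfold Gser_def gfun_def, measurable)
    moreover have "(\<integral>Z. Gser a j s Z * t ^ j * det Z powi k * K Z \<partial>haar) = (\<integral>Z. Gser a j s Z * det Z powi k * K Z \<partial>haar) * t ^ j" for j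
      by (subst integral_mult_left_zero[symmetric]) (simp only: mult_ac)
    ultimately show ?thesis by simp
  qed
  show ?thesis by (intro exI[of _ "\<lambda>j. \<integral>Z. Gser a j s Z * det Z powi k * K Z \<partial>haar"] conjI allI 1 2)
qed

lemma powser_unique:
  fixes a b :: "nat \<Rightarrow> complex"
  assumes "0 < r" "\<And>t. cmod t < r \<Longrightarrow> (\<lambda>n. a n * t ^ n) sums f t" "\<And>t. cmod t < r \<Longrightarrow> (\<lambda>n. b n * t ^ n) sums f t"
  shows "a n = b n"
proof (rule ccontr)
  define c where "c n = a n - b n" for n
  assume "a n \<noteq> b n"
  hence n: "c n \<noteq> 0" by (simp add: c_def)
  define m where "m = (LEAST m. c m \<noteq> 0)"
  have m: "c m \<noteq> 0" unfolding m_def by (rule LeastI[of "\<lambda>m. c m \<noteq> 0", OF n])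
  have m2: "c k = 0" if "k < m" for k using not_less_Least[OF that[unfolded m_def]] by simp
  have s0: "(\<lambda>n. c n * t ^ n) sums 0" if "cmod t < r" for t
    using sums_diff[OF assms(2)[OF that] assms(3)[OF that]] by (simp add: c_def algebra_simps)
  have s: "(\<lambda>n. c (n + m) * t ^ n) sums 0" if "cmod t < r" "t \<noteq> 0" for t
  proof -
    have "(\<lambda>n. c (n + m) * t ^ (n + m)) sums (0 - (\<Sum>i<m. c i * t ^ i))" using s0[OF that(1)] sums_iff_shift[of "\<lambda>n. c n * t ^ n" m "0 - (\<Sum>i<m. c i * t ^ i)"] by simp
    hence "(\<lambda>n. c (n + m) * t ^ n * t ^ m) sums 0" using m2 by (simp add: power_add mult_ac)
    from sums_mult2[OF this, of "inverse (t ^ m)"] show ?thesis using that by (simp add: mult.assoc)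
  qed
  define F :: "complex \<Rightarrow> complex" where "F t = (if t = 0 then c m else 0)" for t
  have F: "(\<lambda>n. c (n + m) * t ^ n) sums F t" if "cmod t < r" for t
    using s[OF that] powser_sums_zero[of "\<lambda>n. c (n + m)"] by (auto simp: F_def)
  have "(F \<longlongrightarrow> c (0 + m)) (at 0)" by (rule powser_limit_0[OF assms(1) F])
  moreover have "(F \<longlongrightarrow> 0) (at 0)"
    by (rule Lim_transform_eventually[OF tendsto_const]) (auto simp: F_def eventually_at_filter)
  ultimately have "c m = 0" using LIM_unique[of F "c (0 + m)" 0 0] by simp
  thus False using m by simp
qed

lemma gfun_integral_eq:
  assumes a: "a \<ge> 2" and K: "K \<in> borel_measurable borel" "\<And>Z. Z \<in> UU \<Longrightarrow> cmod (K Z) \<le> Q * rq Z"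
    and st: "cmod s < 1" "cmod t < 1"
    and co: "\<And>i j. (\<integral>Z. Fc a (int i) (int j) Z * det Z powi k * K Z \<partial>haar) = \<epsilon> * (Fc a (int i) (int j) D * det D powi k)"
    and D: "\<epsilon> \<noteq> 0 \<Longrightarrow> D$1$1 \<noteq> 0 \<and> cmod (D$2$1) * cmod s < cmod (D$1$1) \<and> cmod (t * (D$1$2 + D$2$2 * s)) < cmod (D$1$1 + D$2$1 * s)"
  shows "(\<integral>Z. gfun s t a Z * det Z powi k * K Z \<partial>haar) = \<epsilon> * (gfun s t a D * det D powi k)"
proof -
  obtain S where S: "\<And>j. (\<lambda>i. (\<integral>Z. Fc a (int i) (int j) Z * det Z powi k * K Z \<partial>haar) * s ^ i) sums S j"
    "(\<lambda>j. S j * t ^ j) sums (\<integral>Z. gfun s t a Z * det Z powi k * K Z \<partial>haar)"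
    using gfun_integral_series[OF a K st, of k] by blast
  show ?thesis
  proof (cases "\<epsilon> = 0")
    case True
    hence "S j = 0" for j using sums_unique2[OF S(1)[of j]] sums_zero by (simp add: co)
    thus ?thesis using sums_unique2[OF S(2)] sums_zero True by simp
  next
    case False
    note D = D[OF False]
    have "S j = \<epsilon> * det D powi k * Gser a j s D" for j
    proof (rule sums_unique2[OF S(1)[of j]])
      show "(\<lambda>i. (\<integral>Z. Fc a (int i) (int j) Z * det Z powi k * K Z \<partial>haar) * s ^ i) sums (\<epsilon> * det D powi k * Gser a j s D)"
        unfolding co using sums_mult[OF Fc_sums[of D s a j], of "\<epsilon> * det D powi k"] D by (simp add: mult_ac)
    qed
    hence "(\<lambda>j. (\<epsilon> * det D powi k) * (Gser a j s D * t ^ j)) sums (\<integral>Z. gfun s t a Z * det Z powi k * K Z \<partial>haar)"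
      using S(2) by (simp add: mult_ac)
    moreover have "(\<lambda>j. (\<epsilon> * det D powi k) * (Gser a j s D * t ^ j)) sums ((\<epsilon> * det D powi k) * gfun s t a D)"
      unfolding gfun_def by (intro sums_mult Gser_sums) (use D in auto)
    ultimately have "(\<integral>Z. gfun s t a Z * det Z powi k * K Z \<partial>haar) = (\<epsilon> * det D powi k) * gfun s t a D" by (rule sums_unique2)
    thus ?thesis by (simp add: mult_ac)
  qed
qed

text \<open>
  The generating functions of the coefficients are permuted up to scalars by \<open>SU(1,1)\<close>-conjugation,
  which reduces the reproducing property to diagonal \<open>W\<close>.
\<close>

lemma E_conj:
  assumes g: "g \<in> SU11" and a: "a \<ge> 2"
    and KD: "\<And>Z. Z \<in> UU \<Longrightarrow> cmod (kap D Z) \<le> Q * rq Z" and KW: "\<And>Z. Z \<in> UU \<Longrightarrow> cmod (kap (conjg g D) Z) \<le> Q * rq Z"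
    and co: "\<And>i j. (\<integral>Z. Fc a (int i) (int j) Z * det Z powi k * kap D Z \<partial>haar) = \<epsilon> * (Fc a (int i) (int j) D * det D powi k)"
    and D: "\<epsilon> \<noteq> 0 \<Longrightarrow> D$1$1 \<noteq> 0 \<and> D$1$2 = 0 \<and> D$2$1 = 0 \<and> cmod (D$2$2) \<le> cmod (D$1$1) \<and> conjg g D $ 1 $ 1 \<noteq> 0"
  shows "(\<integral>Z. Fc a (int i) (int j) Z * det Z powi k * kap (conjg g D) Z \<partial>haar)
    = \<epsilon> * (Fc a (int i) (int j) (conjg g D) * det (conjg g D) powi k)"
proof -
  define W where "W = conjg g D"
  define I where "I i j = (\<integral>Z. Fc a (int i) (int j) Z * det Z powi k * kap W Z \<partial>haar)" for i j
  have main: "(\<integral>Z. gfun s t a Z * det Z powi k * kap W Z \<partial>haar) = \<epsilon> * (gfun s t a W * det W powi k)"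
    if st: "cmod s < 1" "cmod t < 1" for s t
  proof -
    obtain s' t' c where c: "cmod s' < 1" "cmod t' < 1" "\<And>a Z. gfun s t a (conjg g Z) = gfun s' t' a Z / c ^ a"
      using gfun_conjg[OF g st] by blast
    have m: "(\<lambda>Z. gfun s t a Z * det Z powi k * kap W Z) \<in> borel_measurable borel" unfolding gfun_def by measurable
    have "(\<integral>Z. gfun s t a Z * det Z powi k * kap W Z \<partial>haar) = (\<integral>Z. gfun s t a (conjg g Z) * det (conjg g Z) powi k * kap W (conjg g Z) \<partial>haar)"
      using haar_transform(2)[OF haar_conjg[OF g] conjg_measurable m] by simp
    also have "\<dots> = (\<integral>Z. 1 / c ^ a * (gfun s' t' a Z * det Z powi k * kap D Z) \<partial>haar)"
      unfolding W_def c(3) det_conjg[OF g] kap_conjg[OF g] by simp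
    also have "\<dots> = 1 / c ^ a * (\<integral>Z. gfun s' t' a Z * det Z powi k * kap D Z \<partial>haar)" by (rule integral_mult_right_zero)
    also have "(\<integral>Z. gfun s' t' a Z * det Z powi k * kap D Z \<partial>haar) = \<epsilon> * (gfun s' t' a D * det D powi k)"
    proof (rule gfun_integral_eq[OF a kap_measurable KD c(1,2) co])
      assume e: "\<epsilon> \<noteq> 0"
      have "cmod (t' * (D$2$2 * s')) = (cmod t' * cmod s') * cmod (D$2$2)" by (simp add: norm_mult)
      also have "\<dots> \<le> (cmod t' * cmod s') * cmod (D$1$1)" using D[OF e] by (intro mult_left_mono) auto
      also have "\<dots> < 1 * cmod (D$1$1)"
      proof (rule mult_strict_right_mono)
        have "cmod t' * cmod s' \<le> cmod t' * 1" using c by (intro mult_left_mono) auto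
        thus "cmod t' * cmod s' < 1" using c by simp
      qed (use D[OF e] in simp)
      finally show "D$1$1 \<noteq> 0 \<and> cmod (D$2$1) * cmod s' < cmod (D$1$1) \<and> cmod (t' * (D$1$2 + D$2$2 * s')) < cmod (D$1$1 + D$2$1 * s')"
        using D[OF e] by simp
    qed
    finally show ?thesis unfolding W_def c(3) det_conjg[OF g] by simp
  qed
  define M r where "M = cmod (W$1$1) + cmod (W$1$2) + cmod (W$2$1) + cmod (W$2$2)"
    and "r = (if \<epsilon> = 0 then 1 else min 1 (cmod (W$1$1) / (4 * M)))"
  have Wn: "\<epsilon> \<noteq> 0 \<Longrightarrow> 0 < cmod (W$1$1)" using D by (auto simp: W_def)
  have M: "\<epsilon> \<noteq> 0 \<Longrightarrow> 0 < M" using Wn by (simp add: M_def add_pos_nonneg)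
  have r: "0 < r" "r \<le> 1" using Wn M by (auto simp: r_def)
  have small: "cmod (W$2$1) * cmod s < cmod (W$1$1)" "W$1$1 + W$2$1 * s \<noteq> 0" "cmod (t * (W$1$2 + W$2$2 * s)) < cmod (W$1$1 + W$2$1 * s)"
    if e: "\<epsilon> \<noteq> 0" and s: "cmod s < r" and t: "cmod t < r" for s t
  proof -
    have rM: "M * r \<le> cmod (W$1$1) / 4" using M[OF e] e by (auto simp: r_def min_def field_simps)
    have "cmod (W$2$1) * cmod s \<le> M * r" using s r by (intro mult_mono) (auto simp: M_def)
    hence 1: "cmod (W$2$1) * cmod s \<le> cmod (W$1$1) / 4" using rM by linarith
    thus "cmod (W$2$1) * cmod s < cmod (W$1$1)" using Wn[OF e] by linarith
    have 2: "3 / 4 * cmod (W$1$1) \<le> cmod (W$1$1 + W$2$1 * s)"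
      using 1 norm_diff_ineq[of "W$1$1" "W$2$1 * s"] by (simp add: norm_mult)
    thus "W$1$1 + W$2$1 * s \<noteq> 0" using Wn[OF e] by auto
    have "cmod (W$1$2 + W$2$2 * s) \<le> cmod (W$1$2) + cmod (W$2$2) * cmod s" by (metis norm_mult norm_triangle_ineq)
    also have "\<dots> \<le> cmod (W$1$2) + cmod (W$2$2) * 1" using s r by (intro add_left_mono mult_left_mono) auto
    also have "\<dots> \<le> M" by (simp add: M_def)
    finally have "cmod t * cmod (W$1$2 + W$2$2 * s) \<le> r * M" using t r by (intro mult_mono) auto
    thus "cmod (t * (W$1$2 + W$2$2 * s)) < cmod (W$1$1 + W$2$1 * s)"
      using rM 2 Wn[OF e] mult.commute[of r M] unfolding norm_mult by linarith
  qed
  define B where "B s j = \<epsilon> * det W powi k * Gser a j s W" for s j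
  have Bt: "(\<lambda>j. B s j * t ^ j) sums (\<epsilon> * (gfun s t a W * det W powi k))" if "cmod s < r" "cmod t < r" for s t
  proof (cases "\<epsilon> = 0")
    case False
    have "(\<lambda>j. (\<epsilon> * det W powi k) * (Gser a j s W * t ^ j)) sums ((\<epsilon> * det W powi k) * gfun s t a W)"
      unfolding gfun_def using small[OF False that] by (intro sums_mult Gser_sums)
    thus ?thesis by (simp add: B_def mult_ac)
  qed (simp add: B_def)
  have Bs: "(\<lambda>i. \<epsilon> * (Fc a (int i) (int j) W * det W powi k) * s ^ i) sums B s j" if "cmod s < r" for s j
  proof (cases "\<epsilon> = 0")
    case False
    have "(\<lambda>i. (\<epsilon> * det W powi k) * (Fc a (int i) (int j) W * s ^ i)) sums B s j"
      unfolding B_def using small[OF False that that] Wn[OF False] by (intro sums_mult Fc_sums) auto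
    thus ?thesis by (simp add: mult_ac)
  qed (simp add: B_def)
  have KW': "\<And>Z. Z \<in> UU \<Longrightarrow> cmod (kap W Z) \<le> Q * rq Z" using KW by (simp add: W_def)
  have Is: "(\<lambda>i. I i j * s ^ i) sums B s j" if s: "cmod s < r" for s j
  proof -
    define A where "A j = (\<Sum>i. I i j * s ^ i)" for j
    have A: "(\<lambda>i. I i j * s ^ i) sums A j" "cmod t < r \<Longrightarrow> (\<lambda>j. A j * t ^ j) sums (\<epsilon> * (gfun s t a W * det W powi k))" for j t
    proof -
      show 1: "(\<lambda>i. I i j * s ^ i) sums A j" for j
        using gfun_integral_series[OF a kap_measurable KW', of s 0 k] s r unfolding A_def I_def by (auto simp: sums_iff)
      assume t: "cmod t < r"
      obtain S where S: "\<And>j. (\<lambda>i. I i j * s ^ i) sums S j" "(\<lambda>j. S j * t ^ j) sums (\<integral>Z. gfun s t a Z * det Z powi k * kap W Z \<partial>haar)"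
        using gfun_integral_series[OF a kap_measurable KW', of s t k] s t r unfolding I_def by auto
      have "S = A" using sums_unique2[OF S(1) 1] by auto
      thus "(\<lambda>j. A j * t ^ j) sums (\<epsilon> * (gfun s t a W * det W powi k))" using S(2) main[of s t] s t r by simp
    qed
    have "A j = B s j" by (rule powser_unique[OF r(1) A(2) Bt[OF s]])
    thus ?thesis using A(1)[of j] by simp
  qed
  have "I i j = \<epsilon> * (Fc a (int i) (int j) W * det W powi k)"
    by (rule powser_unique[OF r(1) Is Bs])
  thus ?thesis unfolding I_def W_def .
qed

lemma conjg_diag_11:
  assumes g: "g \<in> SU11" and l: "cmod l2 < cmod l1"
  shows "conjg g (diag2 l1 l2) $ 1 $ 1 \<noteq> 0"
proof
  have e: "g$2$2 = cnj (g$1$1)" "g$2$1 = cnj (g$1$2)" using g by (simp_all add: SU11_def)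
  assume "conjg g (diag2 l1 l2) $ 1 $ 1 = 0"
  hence "l1 * (g$1$1 * cnj (g$1$1)) = l2 * (g$1$2 * cnj (g$1$2))"
    unfolding conjg_nth[OF g] SU11_inv[OF g] mat2_nth diag2_nth e by (simp add: algebra_simps)
  hence "cmod (l1 * (g$1$1 * cnj (g$1$1))) = cmod (l2 * (g$1$2 * cnj (g$1$2)))" by simp
  hence eq: "cmod l1 * (cmod (g$1$1))\<^sup>2 = cmod l2 * (cmod (g$1$2))\<^sup>2" by (simp add: norm_mult power2_eq_square)
  have "(cmod (g$1$2))\<^sup>2 \<le> (cmod (g$1$1))\<^sup>2" using SU11_less[OF g] by (intro power_mono) auto
  hence "cmod l2 * (cmod (g$1$2))\<^sup>2 \<le> cmod l2 * (cmod (g$1$1))\<^sup>2" by (intro mult_left_mono) auto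
  also have "\<dots> < cmod l1 * (cmod (g$1$1))\<^sup>2"
  proof (rule mult_strict_right_mono[OF l])
    have "cmod (g$1$1) > 0" using SU11_less[OF g] by (rule le_less_trans[OF norm_ge_zero])
    thus "0 < (cmod (g$1$1))\<^sup>2" by simp
  qed
  finally show False using eq by simp
qed

lemma kap_diag_conjg_bound:
  assumes g: "g \<in> SU11" and l: "l1 \<noteq> 0" "l2 \<noteq> 0" "(cmod l1 > 1 \<and> cmod l2 < 1) \<or> (cmod l1 < 1 \<and> cmod l2 > 1)"
  obtains Q where "\<And>Z. Z \<in> UU \<Longrightarrow> cmod (kap (diag2 l1 l2) Z) \<le> Q * rq Z"
    "\<And>Z. Z \<in> UU \<Longrightarrow> cmod (kap (conjg g (diag2 l1 l2)) Z) \<le> Q * rq Z"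
proof -
  define D where "D = (1 - 1 / max (cmod l1) (cmod l2)) * (1 - min (cmod l1) (cmod l2))"
  define c G where "c = 1 / D" and "G = (cmod (g$1$1) + cmod (g$1$2))\<^sup>2 / D"
  have "cmod (kap (diag2 l1 l2) Z) \<le> max c G * rq Z \<and> cmod (kap (conjg g (diag2 l1 l2)) Z) \<le> max c G * rq Z" if Z: "Z \<in> UU" for Z
  proof
    have m: "c * rq Z \<le> max c G * rq Z" "G * rq Z \<le> max c G * rq Z" by (rule mult_right_mono, simp, simp)+
    show "cmod (kap (diag2 l1 l2) Z) \<le> max c G * rq Z"
      by (rule order_trans[OF kap_diag_bound[OF Z l, folded D_def, folded c_def] m(1)])
    show "cmod (kap (conjg g (diag2 l1 l2)) Z) \<le> max c G * rq Z"
      by (rule order_trans[OF kap_conjg_bound[OF g Z l, folded D_def, folded G_def] m(2)])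
  qed
  thus ?thesis using that by blast
qed

lemma E_minus:
  assumes g: "g \<in> SU11" and d: "d \<ge> 1" and l: "cmod l1 > 1" "cmod l2 < 1" "l2 \<noteq> 0"
  defines "W \<equiv> conjg g (diag2 l1 l2)"
  shows "(\<integral>Z. fterm d i j k Z * kap W Z \<partial>haar)
    = (if k = 0 \<or> k = int d then - 1 / of_nat d else 0) * (fterm d i j k W)"
proof -
  have l1: "l1 \<noteq> 0" using l by auto
  have a: "Suc d \<ge> 2" using d by simp
  obtain Q where b: "\<And>Z. Z \<in> UU \<Longrightarrow> cmod (kap (diag2 l1 l2) Z) \<le> Q * rq Z"
    "\<And>Z. Z \<in> UU \<Longrightarrow> cmod (kap (conjg g (diag2 l1 l2)) Z) \<le> Q * rq Z"
    using kap_diag_conjg_bound[OF g l1 l(3)] l by blast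
  show ?thesis
    unfolding W_def using l l1 conjg_diag_11[OF g, of l2 l1]
    by (intro E_conj[OF g a b E_diag_minus[OF d l]]) auto
qed

lemma E_plus:
  assumes g: "g \<in> SU11" and d: "d \<ge> 1" and l: "cmod l1 < 1" "cmod l2 > 1" "l1 \<noteq> 0"
  shows "(\<integral>Z. fterm d i j k Z * kap (conjg g (diag2 l1 l2)) Z \<partial>haar) = 0"
proof -
  have l2: "l2 \<noteq> 0" using l by auto
  have a: "Suc d \<ge> 2" using d by simp
  obtain Q where b: "\<And>Z. Z \<in> UU \<Longrightarrow> cmod (kap (diag2 l1 l2) Z) \<le> Q * rq Z"
    "\<And>Z. Z \<in> UU \<Longrightarrow> cmod (kap (conjg g (diag2 l1 l2)) Z) \<le> Q * rq Z"
    using kap_diag_conjg_bound[OF g l(3) l2] l by blast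
  have z: "(\<integral>Z. fterm d i j k Z * kap (diag2 l1 l2) Z \<partial>haar) = 0 * (fterm d i j k (diag2 l1 l2))" for i j
    using E_diag_plus[OF d l] by simp
  show ?thesis using E_conj[OF g a b z, of i j] by simp
qed

lemma sigma_finite_haar: "sigma_finite_measure haar"
proof (unfold_locales)
  define A where "A n = {Z :: HC. 1 / real (Suc n) \<le> rq Z ^ 3} \<union> {Z. Z$1$1 = 0}" for n
  have A[measurable]: "A n \<in> sets borel" for n unfolding A_def by measurable
  have fin: "emeasure haar (A n) \<noteq> \<infinity>" for n
  proof -
    have "emeasure haar (A n) = (\<integral>\<^sup>+Z. indicator (A n) Z \<partial>haar)" by (simp add: sets_haar)
    also have "\<dots> \<le> (\<integral>\<^sup>+Z. ennreal (real (Suc n) * rq Z ^ 3) \<partial>haar)"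
    proof (rule nn_integral_mono_AE)
      show "AE Z in haar. indicator (A n) Z \<le> ennreal (real (Suc n) * rq Z ^ 3)"
        using AE_haar
      proof eventually_elim
        case (elim Z)
        show ?case
        proof (cases "Z \<in> A n")
          case True
          hence "1 / real (Suc n) \<le> rq Z ^ 3" using UU_D(10)[OF elim] by (simp add: A_def)
          hence "1 \<le> real (Suc n) * rq Z ^ 3" by (simp only: pos_divide_le_eq[of "real (Suc n)"] of_nat_0_less_iff zero_less_Suc mult.commute)
          thus ?thesis using True by (simp add: ennreal_leI flip: ennreal_1 del: of_nat_Suc power_divide)
        qed simp
      qed
    qed
    also have "\<dots> < \<infinity>"
    proof -
      have "integrable haar (\<lambda>Z. real (Suc n) * rq Z ^ 3)" using haar_majorant by (rule integrable_mult_right)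
      hence "(\<integral>\<^sup>+Z. ennreal (norm (real (Suc n) * rq Z ^ 3)) \<partial>haar) < \<infinity>" by (simp only: integrable_iff_bounded)
      thus ?thesis by (simp only: real_norm_def abs_mult power_abs abs_of_nonneg[OF of_nat_0_le_iff] abs_divide abs_one abs_norm_cancel)
    qed
    finally show ?thesis by simp
  qed
  have cov: "(\<Union>n. A n) = UNIV"
  proof -
    have "\<exists>n. Z \<in> A n" for Z
    proof (cases "Z$1$1 = 0")
      case False
      hence "0 < rq Z ^ 3" by simp
      then obtain n where "inverse (real (Suc n)) < rq Z ^ 3" using reals_Archimedean by blast
      thus ?thesis unfolding A_def by (intro exI[of _ n]) (auto simp: inverse_eq_divide simp del: of_nat_Suc)
    qed (auto simp: A_def)
    thus ?thesis by auto
  qed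
  show "\<exists>A. countable A \<and> A \<subseteq> sets haar \<and> \<Union> A = space haar \<and> (\<forall>a\<in>A. emeasure haar a \<noteq> \<infinity>)"
  proof (intro exI[of _ "range A"] conjI)
    show "range A \<subseteq> sets haar" using A by (auto simp: sets_haar)
    show "\<Union> (range A) = space haar" using cov sets_eq_imp_space_eq[OF sets_haar] by simp
  qed (use fin in auto)
qed

lemma Fubini_circle:
  fixes q :: "real \<Rightarrow> HC \<Rightarrow> complex"
  assumes q[measurable]: "(\<lambda>(t, Z). q t Z) \<in> borel_measurable (borel \<Otimes>\<^sub>M borel)"
    and b: "\<And>t Z. t \<in> {0..1} \<Longrightarrow> Z \<in> UU \<Longrightarrow> cmod (q t Z) \<le> B * rq Z ^ 3"
  shows "integrable haar (\<lambda>Z. LINT t:{0..1}|lborel. q t Z)"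
    "(\<integral>Z. (LINT t:{0..1}|lborel. q t Z) \<partial>haar) = (LINT t:{0..1}|lborel. (\<integral>Z. q t Z \<partial>haar))"
proof -
  interpret h: sigma_finite_measure haar by (rule sigma_finite_haar)
  interpret p: pair_sigma_finite lborel haar by unfold_locales
  have sets[measurable_cong]: "sets haar = sets borel" by (rule sets_haar)
  define f where "f t Z = indicator {0..1} t *\<^sub>R q t Z" for t :: real and Z
  have fm[measurable]: "case_prod f \<in> borel_measurable (lborel \<Otimes>\<^sub>M haar)" unfolding f_def by measurable
  have fm2: "(\<lambda>Z. f t Z) \<in> borel_measurable haar" for t by measurable
  have B: "integrable haar (\<lambda>Z. B * rq Z ^ 3)" using haar_majorant by (rule integrable_mult_right)
  have fb: "AE Z in haar. norm (f t Z) \<le> indicator {0..1} t * (B * rq Z ^ 3)" for t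
    using AE_haar by eventually_elim (use b in \<open>auto simp: f_def indicator_def\<close>)
  have i2: "integrable haar (f t)" for t
  proof (rule Bochner_Integration.integrable_bound[OF _ fm2])
    show "integrable haar (\<lambda>Z. indicator {0..1} t * (B * rq Z ^ 3))" using B by (rule integrable_mult_right)
    show "AE Z in haar. norm (f t Z) \<le> norm (indicator {0..1} t * (B * rq Z ^ 3))"
      using fb[of t] by eventually_elim (auto intro: order_trans[OF _ abs_ge_self])
  qed
  have i1: "integrable lborel (\<lambda>t. \<integral>Z. norm (f t Z) \<partial>haar)"
  proof (rule Bochner_Integration.integrable_bound)
    show "integrable lborel (\<lambda>t. indicator {0..1::real} t * (\<integral>Z. B * rq Z ^ 3 \<partial>haar))"
      by (intro integrable_mult_left) simp
    show "AE t in lborel. norm (\<integral>Z. norm (f t Z) \<partial>haar) \<le> norm (indicator {0..1} t * (\<integral>Z. B * rq Z ^ 3 \<partial>haar))"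
    proof (rule AE_I2)
      fix t
      have "(\<integral>Z. norm (f t Z) \<partial>haar) \<le> (\<integral>Z. indicator {0..1} t * (B * rq Z ^ 3) \<partial>haar)"
        by (rule integral_mono_AE[OF integrable_norm[OF i2] integrable_mult_right[OF B] fb])
      also have "\<dots> = indicator {0..1} t * (\<integral>Z. B * rq Z ^ 3 \<partial>haar)" by (rule integral_mult_right_zero)
      finally show "norm (\<integral>Z. norm (f t Z) \<partial>haar) \<le> norm (indicator {0..1} t * (\<integral>Z. B * rq Z ^ 3 \<partial>haar))"
        by (simp add: integral_nonneg_AE)
    qed
  qed measurable
  have I: "integrable (lborel \<Otimes>\<^sub>M haar) (case_prod f)"
    by (rule p.Fubini_integrable) (use i1 i2 fm in auto)
  show "integrable haar (\<lambda>Z. LINT t:{0..1}|lborel. q t Z)"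
    using p.integrable_snd[OF I] unfolding f_def set_lebesgue_integral_def .
  have "(\<integral>Z. (\<integral>t. f t Z \<partial>lborel) \<partial>haar) = (\<integral>t. (\<integral>Z. f t Z \<partial>haar) \<partial>lborel)" by (rule p.Fubini_integral[OF I])
  thus "(\<integral>Z. (LINT t:{0..1}|lborel. q t Z) \<partial>haar) = (LINT t:{0..1}|lborel. (\<integral>Z. q t Z \<partial>haar))"
    unfolding set_lebesgue_integral_def f_def by simp
qed

definition circ :: "real \<Rightarrow> real \<Rightarrow> complex" where "circ r t = of_real r * exp (2 * of_real pi * \<i> * of_real t)"

lemma norm_circ: "r > 0 \<Longrightarrow> cmod (circ r t) = r"
  by (simp add: circ_def norm_mult)

lemma circ_measurable [measurable]: "circ r \<in> borel_measurable borel"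
  unfolding circ_def by (intro borel_measurable_continuous_onI continuous_intros)

lemma continuous_circ: "continuous_on A (circ r)"
  unfolding circ_def by (intro continuous_intros)

lemma circle_mean:
  assumes r: "r > 0" and h: "(h has_contour_integral (2 * of_real pi * \<i> * I)) (circlepath 0 r)"
    and c: "continuous_on (sphere 0 r) h"
  shows "(LINT t:{0..1}|lborel. h (circ r t) * circ r t) = I"
proof -
  have cc: "continuous_on {0..1} (\<lambda>t. h (circ r t) * circ r t)"
    by (intro continuous_intros continuous_circ continuous_on_compose2[OF c]) (auto simp: norm_circ r)
  have "((\<lambda>t. h (circlepath 0 r t) * vector_derivative (circlepath 0 r) (at t)) has_integral (2 * of_real pi * \<i> * I)) {0..1}"
    using h unfolding has_contour_integral .
  hence "((\<lambda>t. (2 * of_real pi * \<i>) * (h (circ r t) * circ r t)) has_integral (2 * of_real pi * \<i> * I)) {0..1}"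
    unfolding vector_derivative_circlepath by (simp add: circlepath circ_def mult_ac)
  hence "((\<lambda>t. inverse (2 * of_real pi * \<i>) * ((2 * of_real pi * \<i>) * (h (circ r t) * circ r t))) has_integral (inverse (2 * of_real pi * \<i>) * (2 * of_real pi * \<i> * I))) {0..1}"
    by (rule has_integral_mult_right)
  moreover have "inverse (2 * of_real pi * \<i>) * ((2 * of_real pi * \<i>) * x) = x" for x :: complex by (simp add: field_simps)
  ultimately have "((\<lambda>t. h (circ r t) * circ r t) has_integral I) {0..1}" by simp
  thus ?thesis
    using set_borel_integral_eq_integral(2)[OF borel_integrable_atLeastAtMost'[OF cc]] by (simp add: integral_unique)
qed

lemma circle_mean_pole:
  assumes r: "r > 0" and f: "f holomorphic_on S" "open S" "cball 0 r \<subseteq> S" and p: "cmod p < r"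
  shows "(LINT t:{0..1}|lborel. f (circ r t) * circ r t / (circ r t - p)) = f p"
proof -
  have c: "continuous_on S f" using f(1) by (rule holomorphic_on_imp_continuous_on)
  have "((\<lambda>u. f u / (u - p)) has_contour_integral (2 * of_real pi * \<i> * f p)) (circlepath 0 r)"
    using Cauchy_integral_circlepath[OF continuous_on_subset[OF c f(3)] holomorphic_on_subset[OF f(1) order_trans[OF ball_subset_cball f(3)]], of p] p by simp
  moreover have "continuous_on (sphere 0 r) (\<lambda>u. f u / (u - p))"
    by (intro continuous_intros continuous_on_subset[OF c]) (use f p in auto)
  ultimately show ?thesis using circle_mean[OF r, of "\<lambda>u. f u / (u - p)" "f p"] by simp
qed

lemma circle_mean_weight:
  assumes r: "0 < r" "r < 1"
  shows "e \<ge> 1 \<Longrightarrow> (LINT t:{0..1}|lborel. circ r t powi e / (1 - circ r t)\<^sup>2) = 0"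
    "n \<ge> 1 \<Longrightarrow> (LINT t:{0..1}|lborel. circ r t powi (1 - int n) / (1 - circ r t)\<^sup>2) = of_nat n"
proof -
  define S where "S = - {1 :: complex}"
  have S: "open S" "cball 0 r \<subseteq> S" using r by (auto simp: S_def)
  have nz: "circ r t \<noteq> 0" for t using norm_circ[OF r(1), of t] r by auto
  define f where "f z = inverse (1 + (- 1) * z :: complex) ^ Suc 1" for z
  have fh: "f holomorphic_on S" unfolding f_def by (intro holomorphic_intros) (auto simp: S_def)
  have f: "f z = 1 / (1 - z)\<^sup>2" for z by (simp add: f_def power2_eq_square field_simps)
  show "(LINT t:{0..1}|lborel. circ r t powi e / (1 - circ r t)\<^sup>2) = 0" if e: "e \<ge> 1"
  proof -
    obtain m where m: "e = int (Suc m)" using e by (intro that[of "nat (e - 1)"]) simp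
    have "(LINT t:{0..1}|lborel. (circ r t ^ Suc m * f (circ r t)) * circ r t / (circ r t - 0)) = 0 ^ Suc m * f 0"
      by (rule circle_mean_pole[OF r(1) _ S]) (use r in \<open>auto intro!: holomorphic_intros fh\<close>)
    thus ?thesis using nz unfolding m power_int_of_nat by (simp add: f)
  qed
  show "(LINT t:{0..1}|lborel. circ r t powi (1 - int n) / (1 - circ r t)\<^sup>2) = of_nat n" if n: "n \<ge> 1"
  proof -
    obtain m where m: "n = Suc m" using n by (cases n) auto
    have fe: "f has_fps_expansion inverse (fps_const 1 + fps_const (-1) * fps_X) ^ Suc 1"
      unfolding f_def by (intro fps_expansion_intros) auto
    have co: "(deriv ^^ m) f 0 / fact m = of_nat n"
      using fps_nth_fps_expansion[OF fe, of m] inverse_linear_power_nth[of 1 "-1" 1 m] m by simp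
    have c: "continuous_on S f" using fh by (rule holomorphic_on_imp_continuous_on)
    have "((\<lambda>u. f u / (u - 0) ^ Suc m) has_contour_integral ((2 * pi * \<i>) / fact m * (deriv ^^ m) f 0)) (circlepath 0 r)"
      by (rule Cauchy_has_contour_integral_higher_derivative_circlepath[OF continuous_on_subset[OF c S(2)] holomorphic_on_subset[OF fh order_trans[OF ball_subset_cball S(2)]]])
        (use r in simp)
    hence "((\<lambda>u. f u / u ^ Suc m) has_contour_integral (2 * of_real pi * \<i> * of_nat n)) (circlepath 0 r)"
      unfolding co[symmetric] by (simp add: field_simps)
    moreover have "continuous_on (sphere 0 r) (\<lambda>u. f u / u ^ Suc m)"
      by (intro continuous_intros continuous_on_subset[OF c]) (use S r in auto)
    ultimately have "(LINT t:{0..1}|lborel. f (circ r t) / circ r t ^ Suc m * circ r t) = of_nat n"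
      by (rule circle_mean[OF r(1)])
    moreover have "f (circ r t) / circ r t ^ Suc m * circ r t = circ r t powi (1 - int n) / (1 - circ r t)\<^sup>2" for t
    proof -
      have "1 - int n = - int m" using m by simp
      thus ?thesis using nz[of t] by (simp only: f power_int_minus power_int_of_nat) (simp add: field_simps)
    qed
    ultimately show ?thesis by simp
  qed
qed

section \<open>The kernels\<close>

definition cs :: "complex \<Rightarrow> HC \<Rightarrow> HC" where "cs c W = mat2 (c * W$1$1) (c * W$1$2) (c * W$2$1) (c * W$2$2)"

lemma cs_nth [simp]: "cs c W $ 1 $ 1 = c * W$1$1" "cs c W $ 1 $ 2 = c * W$1$2" "cs c W $ 2 $ 1 = c * W$2$1" "cs c W $ 2 $ 2 = c * W$2$2"
  by (simp_all add: cs_def)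

lemma cs_1 [simp]: "cs 1 W = W" by (simp add: HC_eq_iff)

lemma det_cs: "det (cs c W) = c\<^sup>2 * det W" by (simp add: det_2 power2_eq_square algebra_simps)

lemma conjg_cs: "g \<in> SU11 \<Longrightarrow> conjg g (diag2 (c * l1) (c * l2)) = cs c (conjg g (diag2 l1 l2))"
  by (simp add: HC_eq_iff conjg_nth algebra_simps)

lemma Fc_cs: "W$1$1 \<noteq> 0 \<Longrightarrow> c \<noteq> 0 \<Longrightarrow> Fc a i j (cs c W) = c powi (- int a) * Fc a i j W"
  using Fc_homogeneous[of W c 1 1 "cs c W" a i j] by simp

definition mtr :: "HC \<Rightarrow> HC \<Rightarrow> complex" where "mtr W Z = (W$1$1 * Z$2$2 - W$1$2 * Z$2$1 - W$2$1 * Z$1$2 + W$2$2 * Z$1$1) / det Z"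

lemma kap_cs:
  assumes "det Z \<noteq> 0"
  shows "kap (cs c W) Z = 1 / (1 - c * mtr W Z + c\<^sup>2 * (det W / det Z))"
proof -
  have "det (Z - cs c W) = det Z - c * (W$1$1 * Z$2$2 - W$1$2 * Z$2$1 - W$2$1 * Z$1$2 + W$2$2 * Z$1$1) + c\<^sup>2 * det W"
    unfolding det_diff cs_nth by (simp add: det_2 power2_eq_square algebra_simps)
  also have "\<dots> = det Z - c * (det Z * mtr W Z) + c\<^sup>2 * (det Z * (det W / det Z))"
    using assms by (simp add: mtr_def)
  also have "\<dots> = det Z * (1 - c * mtr W Z + c\<^sup>2 * (det W / det Z))"
    by (simp only: algebra_simps mult_1_left mult_1_right)
  finally show ?thesis unfolding kap_def using assms by simp
qed

lemma quadratic_roots: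
  fixes T N :: complex
  obtains x y where "T = x + y" "N = x * y" "cmod y \<le> cmod x"
proof -
  define s where "s = csqrt (T\<^sup>2 - 4 * N)"
  define x y where "x = (T + s) / 2" and "y = (T - s) / 2"
  have s: "s * s = T\<^sup>2 - 4 * N" unfolding s_def by (simp flip: power2_eq_square)
  have "x * y = (T * T - s * s) / 4" by (simp add: x_def y_def field_simps)
  hence "T = x + y" "N = x * y" unfolding s by (simp_all add: x_def y_def power2_eq_square field_simps)
  thus ?thesis using that[of x y] that[of y x] by (cases "cmod y \<le> cmod x") (auto simp: add.commute mult.commute)
qed

lemma norm_lint_le:
  fixes q :: "real \<Rightarrow> complex"
  assumes "\<And>t. t \<in> {0..1} \<Longrightarrow> cmod (q t) \<le> B"
  shows "cmod (LINT t:{0..1}|lborel. q t) \<le> B"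
proof -
  have B: "0 \<le> B" using order_trans[OF norm_ge_zero assms[of 0]] by simp
  have "cmod (LINT t:{0..1}|lborel. q t) \<le> (\<integral>t. norm (indicator {0..1} t *\<^sub>R q t) \<partial>lborel)"
    unfolding set_lebesgue_integral_def by (rule integral_norm_bound)
  also have "\<dots> \<le> (\<integral>t. indicator {0..1::real} t * B \<partial>lborel)"
  proof (rule integral_mono')
    show "integrable lborel (\<lambda>t. indicator {0..1::real} t * B)" by (intro integrable_mult_left) simp
  qed (use assms B in \<open>auto simp: indicator_def\<close>)
  also have "\<dots> = B" unfolding integral_mult_left_zero by simp
  finally show ?thesis .
qed

definition bfun :: "bool \<Rightarrow> nat \<Rightarrow> int \<Rightarrow> int \<Rightarrow> HC \<Rightarrow> complex" where
  "bfun \<sigma> a i j Z = (if \<sigma> then Fc a i j Z else Fc a i j (swp Z))"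

lemma bfun_measurable [measurable]: "bfun \<sigma> a i j \<in> borel_measurable borel"
  unfolding bfun_def by (cases \<sigma>) simp_all

abbreviation (input) bterm :: "bool \<Rightarrow> nat \<Rightarrow> nat \<Rightarrow> nat \<Rightarrow> int \<Rightarrow> HC \<Rightarrow> complex" where
  "bterm \<sigma> d i j k Z \<equiv> bfun \<sigma> (Suc d) (int i) (int j) Z * det Z powi k"

lemma rq_swp: "Z \<in> UU \<Longrightarrow> rq (swp Z) = rq Z"
  using UU_D(6)[of Z] by simp

lemma bfun_bound:
  assumes "d \<ge> 1"
  shows "\<exists>C\<ge>0. \<forall>Z\<in>UU. cmod (bfun \<sigma> (Suc d) i j Z) \<le> C * rq Z ^ 2"
proof -
  obtain C where C: "C \<ge> 0" "\<And>Z. Z \<in> UU \<Longrightarrow> cmod (Fc (Suc d) i j Z * det Z powi 0) \<le> C * rq Z ^ 2"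
    using phi_UU_bound[OF assms] by blast
  have "cmod (bfun \<sigma> (Suc d) i j Z) \<le> C * rq Z ^ 2" if "Z \<in> UU" for Z
    using C(2)[OF that] C(2)[OF swp_UU[OF that]] rq_swp[OF that] by (auto simp: bfun_def)
  thus ?thesis using C(1) by blast
qed

lemma kap_swp: "kap W (swp Z) = kap (swp W) Z"
  unfolding kap_def det_diff by (simp add: mult_ac)

lemma swp_matrix_inv: "g \<in> SU11 \<Longrightarrow> swp (matrix_inv g) = matrix_inv (swp g)"
proof -
  assume g: "g \<in> SU11"
  have s: "matrix_inv (swp g) = mat2 (swp g$2$2 / det (swp g)) (- swp g$1$2 / det (swp g)) (- swp g$2$1 / det (swp g)) (swp g$1$1 / det (swp g))"
    by (rule matrix_inv_22) (simp add: SU11_D(3)[OF g])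
  show ?thesis unfolding s SU11_inv[OF g] by (simp add: HC_eq_iff SU11_D(3)[OF g])
qed

lemma swp_SU11: "g \<in> SU11 \<Longrightarrow> swp g \<in> SU11"
  by (simp add: SU11_def) 

lemma swp_conjg_diag: "g \<in> SU11 \<Longrightarrow> swp (conjg g (diag2 l1 l2)) = conjg (swp g) (diag2 l2 l1)"
proof -
  assume g: "g \<in> SU11"
  have "swp (diag2 l1 l2) = diag2 l2 l1" by (simp add: HC_eq_iff)
  thus ?thesis unfolding conjg_def by (simp add: swp_mult swp_matrix_inv[OF g])
qed

locale minus_point =
  fixes g :: HC and l1 l2 :: complex and W :: HC
  assumes g: "g \<in> SU11" and l: "cmod l1 > 1" "cmod l2 < 1" "l2 \<noteq> 0" and W: "W = conjg g (diag2 l1 l2)"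
begin

lemma l1_nonzero: "l1 \<noteq> 0" using l by auto

lemma det_W: "det W = l1 * l2" unfolding W det_conjg[OF g] by simp

lemma W_nonzero: "W$1$1 \<noteq> 0" "det W \<noteq> 0"
  using conjg_diag_11[OF g, of l2 l1] l l1_nonzero by (auto simp: W det_conjg[OF g])

lemma kap_cs_bound:
  assumes c: "c \<noteq> 0" "lo \<le> cmod c" "cmod c \<le> hi" "lo * cmod l1 > 1" "hi * cmod l2 < 1" and Z: "Z \<in> UU"
  shows "cmod (kap (cs c W) Z) \<le> (cmod (g$1$1) + cmod (g$1$2))\<^sup>2 / ((1 - 1 / (lo * cmod l1)) * (1 - hi * cmod l2)) * rq Z"
proof -
  have 1: "lo * cmod l1 \<le> cmod (c * l1)" "cmod (c * l2) \<le> hi * cmod l2"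
    unfolding norm_mult using c by (auto intro!: mult_right_mono)
  hence 2: "cmod (c * l1) > 1" "cmod (c * l2) < 1" using c by linarith+
  hence m: "max (cmod (c * l1)) (cmod (c * l2)) = cmod (c * l1)" "min (cmod (c * l1)) (cmod (c * l2)) = cmod (c * l2)" by auto
  have "cmod (kap (conjg g (diag2 (c * l1) (c * l2))) Z) \<le> (cmod (g$1$1) + cmod (g$1$2))\<^sup>2 /
      ((1 - 1 / max (cmod (c * l1)) (cmod (c * l2))) * (1 - min (cmod (c * l1)) (cmod (c * l2)))) * rq Z"
    by (rule kap_conjg_bound[OF g Z]) (use c l l1_nonzero 2 in auto)
  hence "cmod (kap (cs c W) Z) \<le> (cmod (g$1$1) + cmod (g$1$2))\<^sup>2 / ((1 - 1 / cmod (c * l1)) * (1 - cmod (c * l2))) * rq Z"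
    unfolding m conjg_cs[OF g] W[symmetric] .
  also have "\<dots> \<le> (cmod (g$1$1) + cmod (g$1$2))\<^sup>2 / ((1 - 1 / (lo * cmod l1)) * (1 - hi * cmod l2)) * rq Z"
  proof -
    have "1 / v \<le> 1 / u \<and> 1 / u < 1" if "1 < u" "u \<le> v" for u v :: real using that by (simp add: frac_le)
    from this[OF c(4) 1(1)] have u: "1 / cmod (c * l1) \<le> 1 / (lo * cmod l1)" "1 / (lo * cmod l1) < 1" by auto
    have p: "(1 - 1 / (lo * cmod l1)) * (1 - hi * cmod l2) \<le> (1 - 1 / cmod (c * l1)) * (1 - cmod (c * l2))"
      by (rule mult_mono) (use u 1(2) c(5) in linarith)+
    moreover have "0 < (1 - 1 / (lo * cmod l1)) * (1 - hi * cmod l2)" by (rule mult_pos_pos) (use u c(5) in linarith)+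
    ultimately show ?thesis using rq_UU[OF Z] by (intro mult_right_mono frac_le) auto
  qed
  finally show ?thesis .
qed

lemma kap_cs_nonzero:
  assumes c: "c \<noteq> 0" "cmod c * cmod l1 > 1" "cmod c * cmod l2 < 1" and Z: "Z \<in> UU"
  shows "kap (cs c W) Z \<noteq> 0"
proof -
  define Y where "Y = conjg (matrix_inv g) Z"
  have Y: "Y \<in> UU" "conjg g Y = Z" using conjg_UU[OF SU11_matrix_inv[OF g] Z] conjg_inv[OF g] by (simp_all add: Y_def)
  define q where "q = complex_of_real (rq Y)"
  define X V where "X = Y$1$1 * q / (c * l1)" and "V = c * l2 / (Y$2$2 * q)"
  have e: "kap (cs c W) Z = - (q * X) / (1 - q * X - q * V + X * V)"
    unfolding W conjg_cs[OF g, symmetric] Y(2)[symmetric] kap_conjg[OF g] X_def V_def q_def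
    by (rule kap_diag_minus[OF Y(1)]) (use c l l1_nonzero in auto)
  have n: "cmod X = 1 / (cmod c * cmod l1)" "cmod V = cmod c * cmod l2"
    unfolding X_def V_def q_def norm_divide norm_entry_rq[OF Y(1)] by (simp_all add: norm_mult)
  have X1: "1 / (cmod c * cmod l1) < 1" using c by simp
  have "(1 - 1 / (cmod c * cmod l1)) * (1 - cmod c * cmod l2) \<le> cmod (1 - q * X - q * V + X * V)"
    unfolding q_def by (rule kernel_denom_bound(1)[OF n(1) X1 n(2) c(3)]) (use rq_UU[OF Y(1)] in auto)
  moreover have "0 < (1 - 1 / (cmod c * cmod l1)) * (1 - cmod c * cmod l2)" using X1 c(3) by simp
  ultimately have "1 - q * X - q * V + X * V \<noteq> 0" by auto
  moreover have "q * X \<noteq> 0" using UU_D(10)[OF Y(1)] c l1_nonzero by (simp add: X_def q_def)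
  ultimately show ?thesis unfolding e by simp
qed

lemma eigenvalue_split:
  assumes Z: "Z \<in> UU"
  obtains x y where "mtr W Z = x + y" "det W / det Z = x * y" "cmod l1 \<le> cmod x" "cmod y \<le> cmod l2"
proof -
  obtain x y where xy: "mtr W Z = x + y" "det W / det Z = x * y" "cmod y \<le> cmod x" by (rule quadratic_roots)
  have nz: "kap (cs c W) Z = 1 / ((1 - c * x) * (1 - c * y))" for c
    unfolding kap_cs[OF UU_D(2)[OF Z]] xy by (simp add: power2_eq_square algebra_simps)
  have out: "\<not> (cmod l2 < cmod u \<and> cmod u < cmod l1)" if "u = x \<or> u = y" for u
  proof
    assume u: "cmod l2 < cmod u \<and> cmod u < cmod l1"
    hence "u \<noteq> 0" by auto
    hence "kap (cs (1 / u) W) Z \<noteq> 0" using u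
      by (intro kap_cs_nonzero[OF _ _ _ Z]) (auto simp: norm_divide)
    thus False unfolding nz using that \<open>u \<noteq> 0\<close> by auto
  qed
  have p: "cmod x * cmod y = cmod l1 * cmod l2"
  proof -
    have "cmod (x * y) = cmod (det W)" unfolding xy(2)[symmetric] norm_divide UU_D(1)[OF Z] by simp
    thus ?thesis by (simp add: det_W norm_mult)
  qed
  have l2: "0 < cmod l2" "cmod l2 < cmod l1" using l by auto
  have x: "cmod l1 \<le> cmod x"
  proof (rule ccontr)
    assume "\<not> cmod l1 \<le> cmod x"
    hence "cmod x \<le> cmod l2" using out[of x] by auto
    hence "cmod x * cmod y \<le> cmod l2 * cmod l2" using xy(3) by (intro mult_mono) auto
    also have "\<dots> < cmod l1 * cmod l2" using l2 by simp
    finally show False using p by simp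
  qed
  have "cmod l1 * cmod y \<le> cmod x * cmod y" using x by (intro mult_right_mono) auto
  hence "cmod l1 * cmod y \<le> cmod l1 * cmod l2" using p by simp
  hence "cmod y \<le> cmod l2" using l1_nonzero by simp
  with xy x show ?thesis using that by blast
qed

definition rad :: real where "rad = (SOME r. 1 / cmod l1 < r \<and> cmod l2 < r \<and> r < 1)"

lemma rad: "1 / cmod l1 < rad" "cmod l2 < rad" "rad < 1" "0 < rad"
proof -
  have "max (1 / cmod l1) (cmod l2) < 1" using l l1_nonzero by simp
  then obtain r where "max (1 / cmod l1) (cmod l2) < r" "r < 1" using dense by blast
  hence "1 / cmod l1 < r \<and> cmod l2 < r \<and> r < 1" by simp
  hence r: "1 / cmod l1 < rad \<and> cmod l2 < rad \<and> rad < 1" unfolding rad_def by (rule someI)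
  thus "1 / cmod l1 < rad" "cmod l2 < rad" "rad < 1" by auto
  show "0 < rad" using r norm_ge_zero[of l2] by linarith
qed

lemma circ_nonzero: "circ rad t \<noteq> 0" "circ rad t \<noteq> 1"
  using norm_circ[OF rad(4), of t] rad by auto

text \<open>
  If \<open>\<mu>\<^sub>1\<close>, \<open>\<mu>\<^sub>2\<close> are the eigenvalues of \<open>W Z\<^sup>-\<^sup>1\<close>, then \<open>kap (cs c W) Z = 1 / ((1 - c \<mu>\<^sub>1) (1 - c \<mu>\<^sub>2))\<close>, and the
  two circle means below pick the residues at \<open>1 / \<mu>\<^sub>1\<close> and \<open>\<mu>\<^sub>2\<close>.
\<close>

definition kapA :: "HC \<Rightarrow> complex" where
  "kapA Z = - (LINT t:{0..1}|lborel. (circ rad t)\<^sup>2 / (1 - circ rad t)\<^sup>2 * kap (cs (circ rad t) W) Z)"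

definition kapB :: "HC \<Rightarrow> complex" where
  "kapB Z = - (LINT t:{0..1}|lborel. 1 / (1 - circ rad t)\<^sup>2 * kap (cs (1 / circ rad t) W) Z)"

lemma kapA_eq:
  assumes Z: "Z \<in> UU" and xy: "mtr W Z = x + y" "det W / det Z = x * y" "cmod l1 \<le> cmod x" "cmod y \<le> cmod l2"
  shows "kapA Z = x / ((x - y) * (1 - x)\<^sup>2)"
proof -
  have x: "cmod x > 1" "x \<noteq> 0" "cmod y < 1" using xy l by auto
  have p: "cmod (1 / x) < rad"
  proof -
    have "1 / cmod x \<le> 1 / cmod l1" using xy(3) x(1) l by (intro divide_left_mono mult_pos_pos) auto
    thus ?thesis using rad(1) by (simp add: norm_divide)
  qed
  define f where "f z = z / ((1 - z)\<^sup>2 * (- x) * (1 - z * y))" for z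
  have ny: "1 - z * y \<noteq> 0" if "cmod z < 1" for z
  proof
    assume "1 - z * y = 0"
    hence "cmod (z * y) = 1" by (metis eq_iff_diff_eq_0 norm_one)
    moreover have "cmod z * cmod y \<le> 1 * cmod y" using that by (intro mult_right_mono) auto
    ultimately show False using x by (simp add: norm_mult)
  qed
  have "(LINT t:{0..1}|lborel. f (circ rad t) * circ rad t / (circ rad t - 1 / x)) = f (1 / x)"
  proof (rule circle_mean_pole[OF rad(4) _ _ _ p])
    show "f holomorphic_on ball 0 1" unfolding f_def by (intro holomorphic_intros) (use ny x in auto)
  qed (use rad in auto)
  moreover have "f (circ rad t) * circ rad t / (circ rad t - 1 / x) = (circ rad t)\<^sup>2 / (1 - circ rad t)\<^sup>2 * kap (cs (circ rad t) W) Z" for t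
  proof -
    have "kap (cs (circ rad t) W) Z = 1 / ((1 - circ rad t * x) * (1 - circ rad t * y))"
      unfolding kap_cs[OF UU_D(2)[OF Z]] xy by (simp add: power2_eq_square algebra_simps)
    moreover have e: "circ rad t - 1 / x = - (1 - circ rad t * x) / x" using x by (simp add: field_simps)
    moreover have "c / ((1 - c)\<^sup>2 * (- x) * v) * c / (- u / x) = c\<^sup>2 / (1 - c)\<^sup>2 * (1 / (u * v))" for c u v :: complex
    proof -
      have "c / ((1 - c)\<^sup>2 * (- x) * v) * c / (- u / x) = c * c / ((1 - c)\<^sup>2 * (- x) * v * (- u / x))" by simp
      also have "(1 - c)\<^sup>2 * (- x) * v * (- u / x) = (1 - c)\<^sup>2 * (u * v)" using x(2) by simp
      finally show ?thesis by (simp add: power2_eq_square)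
    qed
    ultimately show ?thesis unfolding f_def by (simp only:)
  qed
  moreover have "f (1 / x) = - (x / ((x - y) * (1 - x)\<^sup>2))"
  proof -
    have "x - y \<noteq> 0" "x \<noteq> 1" using x by auto
    moreover have "1 - 1 / x = - ((1 - x) / x)" "1 - 1 / x * y = (x - y) / x" using x by (simp_all add: field_simps)
    ultimately show ?thesis using x unfolding f_def by (simp add: power2_eq_square)
  qed
  ultimately show ?thesis unfolding kapA_def by simp
qed

lemma kapB_eq:
  assumes Z: "Z \<in> UU" and xy: "mtr W Z = x + y" "det W / det Z = x * y" "cmod l1 \<le> cmod x" "cmod y \<le> cmod l2"
  shows "kapB Z = y / ((x - y) * (1 - y)\<^sup>2)"
proof -
  have x: "cmod x > 1" "x \<noteq> 0" "cmod y < 1" using xy l by auto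
  have p: "cmod y < rad" using xy(4) rad by linarith
  define f where "f z = z / ((1 - z)\<^sup>2 * (z - x))" for z
  have "(LINT t:{0..1}|lborel. f (circ rad t) * circ rad t / (circ rad t - y)) = f y"
  proof (rule circle_mean_pole[OF rad(4) _ _ _ p])
    show "f holomorphic_on ball 0 1" unfolding f_def by (intro holomorphic_intros) (use x in auto)
  qed (use rad in auto)
  moreover have "f (circ rad t) * circ rad t / (circ rad t - y) = 1 / (1 - circ rad t)\<^sup>2 * kap (cs (1 / circ rad t) W) Z" for t
  proof -
    define c where "c = circ rad t"
    have c: "c \<noteq> 0" using circ_nonzero by (simp add: c_def)
    have "kap (cs (1 / c) W) Z = 1 / ((1 - 1 / c * x) * (1 - 1 / c * y))"
      unfolding kap_cs[OF UU_D(2)[OF Z]] xy by (simp add: power2_eq_square algebra_simps add_divide_distrib)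
    moreover have "1 - 1 / c * u = (c - u) / c" for u using c by (simp add: field_simps)
    ultimately show ?thesis using c unfolding c_def[symmetric] by (simp add: f_def power2_eq_square)
  qed
  moreover have "f y = - (y / ((x - y) * (1 - y)\<^sup>2))"
  proof -
    have "y - x = - (x - y)" by simp
    thus ?thesis unfolding f_def by (simp only: mult_minus_right mult_minus_left minus_divide_right mult.commute)
  qed
  ultimately show ?thesis unfolding kapB_def by simp
qed

lemma rad_bounds:
  "rad * cmod l1 > 1" "rad * cmod l2 < 1" "1 / rad * cmod l1 > 1" "1 / rad * cmod l2 < 1"
proof -
  show "rad * cmod l1 > 1" using rad(1) l1_nonzero by (simp add: field_simps)
  have "rad * cmod l2 \<le> 1 * cmod l2" using rad by (intro mult_right_mono) auto
  thus "rad * cmod l2 < 1" using l by linarith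
  show "1 / rad * cmod l1 > 1" using rad l by (simp add: field_simps)
  show "1 / rad * cmod l2 < 1" using rad by (simp add: field_simps)
qed

lemma weight_bound: "cmod (1 / (1 - circ rad t)\<^sup>2) \<le> 1 / (1 - rad)\<^sup>2"
  proof -
    have "1 - rad \<le> cmod (1 - circ rad t)" using norm_triangle_ineq2[of 1 "circ rad t"] norm_circ[OF rad(4), of t] by simp
    thus ?thesis unfolding norm_divide norm_power norm_one using rad by (intro divide_left_mono power_mono mult_pos_pos) auto
  qed

lemma weight_bound2: "cmod ((circ rad t)\<^sup>2 / (1 - circ rad t)\<^sup>2) \<le> 1 / (1 - rad)\<^sup>2"
  proof -
    have "cmod ((circ rad t)\<^sup>2 / (1 - circ rad t)\<^sup>2) = rad\<^sup>2 * cmod (1 / (1 - circ rad t)\<^sup>2)"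
      by (simp add: norm_divide norm_power norm_circ[OF rad(4)])
    also have "\<dots> \<le> 1 * (1 / (1 - rad)\<^sup>2)" using rad weight_bound by (intro mult_mono power_le_one) auto
    finally show ?thesis by simp
  qed

lemma kapAB_bound: "\<exists>Q. \<forall>Z\<in>UU. cmod (kapA Z) \<le> Q * rq Z \<and> cmod (kapB Z) \<le> Q * rq Z"
proof -
  define M1 M2 where "M1 = (cmod (g$1$1) + cmod (g$1$2))\<^sup>2 / ((1 - 1 / (rad * cmod l1)) * (1 - rad * cmod l2))"
    and "M2 = (cmod (g$1$1) + cmod (g$1$2))\<^sup>2 / ((1 - 1 / (1 / rad * cmod l1)) * (1 - 1 / rad * cmod l2))"
  have "cmod (kapA Z) \<le> (1 / (1 - rad)\<^sup>2 * max M1 M2) * rq Z \<and> cmod (kapB Z) \<le> (1 / (1 - rad)\<^sup>2 * max M1 M2) * rq Z" if Z: "Z \<in> UU" for Z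
  proof
    have 1: "cmod (kap (cs (circ rad t) W) Z) \<le> max M1 M2 * rq Z" for t
    proof -
      have "cmod (kap (cs (circ rad t) W) Z) \<le> M1 * rq Z"
        unfolding M1_def by (rule kap_cs_bound[OF circ_nonzero(1) _ _ rad_bounds(1,2) Z]) (simp_all add: norm_circ[OF rad(4)])
      also have "\<dots> \<le> max M1 M2 * rq Z" using rq_UU[OF Z] by (intro mult_right_mono) auto
      finally show ?thesis .
    qed
    have 2: "cmod (kap (cs (1 / circ rad t) W) Z) \<le> max M1 M2 * rq Z" for t
    proof -
      have "cmod (kap (cs (1 / circ rad t) W) Z) \<le> M2 * rq Z"
        unfolding M2_def by (rule kap_cs_bound[OF _ _ _ rad_bounds(3,4) Z]) (simp_all add: norm_circ[OF rad(4)] norm_divide circ_nonzero)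
      also have "\<dots> \<le> max M1 M2 * rq Z" using rq_UU[OF Z] by (intro mult_right_mono) auto
      finally show ?thesis .
    qed
    have 0: "0 \<le> max M1 M2 * rq Z" using order_trans[OF norm_ge_zero 1] .
    show "cmod (kapA Z) \<le> (1 / (1 - rad)\<^sup>2 * max M1 M2) * rq Z"
      unfolding kapA_def norm_minus_cancel
    proof (rule norm_lint_le)
      fix t
      have "cmod ((circ rad t)\<^sup>2 / (1 - circ rad t)\<^sup>2) * cmod (kap (cs (circ rad t) W) Z) \<le> 1 / (1 - rad)\<^sup>2 * (max M1 M2 * rq Z)"
        using weight_bound2 1 0 by (intro mult_mono) auto
      thus "cmod ((circ rad t)\<^sup>2 / (1 - circ rad t)\<^sup>2 * kap (cs (circ rad t) W) Z) \<le> (1 / (1 - rad)\<^sup>2 * max M1 M2) * rq Z"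
        by (simp only: norm_mult mult.assoc)
    qed
    show "cmod (kapB Z) \<le> (1 / (1 - rad)\<^sup>2 * max M1 M2) * rq Z"
      unfolding kapB_def norm_minus_cancel
    proof (rule norm_lint_le)
      fix t
      have "cmod (1 / (1 - circ rad t)\<^sup>2) * cmod (kap (cs (1 / circ rad t) W) Z) \<le> 1 / (1 - rad)\<^sup>2 * (max M1 M2 * rq Z)"
        using weight_bound 2 0 by (intro mult_mono) auto
      thus "cmod (1 / (1 - circ rad t)\<^sup>2 * kap (cs (1 / circ rad t) W) Z) \<le> (1 / (1 - rad)\<^sup>2 * max M1 M2) * rq Z"
        by (simp only: norm_mult mult.assoc)
    qed
  qed
  thus ?thesis by blast
qed

lemma E_cs:
  assumes d: "d \<ge> 1" and c: "c \<noteq> 0" "cmod c * cmod l1 > 1" "cmod c * cmod l2 < 1"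
  shows "(\<integral>Z. bterm \<sigma> d i j k Z * kap (cs c W) Z \<partial>haar)
    = (if \<sigma> \<and> (k = 0 \<or> k = int d) then - 1 / of_nat d else 0) * c powi (2 * k - int (Suc d)) * (bterm \<sigma> d i j k W)"
proof (cases \<sigma>)
  case True
  have "(\<integral>Z. Fc (Suc d) (int i) (int j) Z * det Z powi k * kap (cs c W) Z \<partial>haar)
    = (if k = 0 \<or> k = int d then - 1 / of_nat d else 0) * (Fc (Suc d) (int i) (int j) (cs c W) * det (cs c W) powi k)"
    unfolding W conjg_cs[OF g, symmetric]
    by (rule E_minus[OF g d]) (use c l in \<open>auto simp: norm_mult\<close>)
  moreover have "Fc (Suc d) (int i) (int j) (cs c W) * det (cs c W) powi k = c powi (2 * k - int (Suc d)) * (Fc (Suc d) (int i) (int j) W * det W powi k)"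
  proof -
    have "(c\<^sup>2) powi k = c powi (2 * k)" by (simp only: power_int_mult power2_eq_square power_int_numeral[symmetric])
    moreover have "c powi (2 * k - int (Suc d)) = c powi (2 * k) * c powi (- int (Suc d))"
      by (simp only: diff_conv_add_uminus power_int_add c(1) simp_thms)
    ultimately show ?thesis unfolding Fc_cs[OF W_nonzero(1) c(1)] det_cs power_int_mult_distrib by simp
  qed
  ultimately show ?thesis using True by (simp add: bfun_def)
next
  case False
  define f where "f Z = Fc (Suc d) (int i) (int j) Z * det Z powi k * kap (swp (cs c W)) Z" for Z
  have fm: "f \<in> borel_measurable borel" unfolding f_def by measurable
  have "(\<integral>Z. bterm \<sigma> d i j k Z * kap (cs c W) Z \<partial>haar) = (\<integral>Z. f (swp Z) \<partial>haar)"
    using False by (simp add: f_def bfun_def kap_swp)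
  also have "\<dots> = (\<integral>Z. f Z \<partial>haar)" by (rule haar_transform(2)[OF haar_swp swp_measurable fm])
  also have "\<dots> = 0" unfolding f_def W conjg_cs[OF g, symmetric] swp_conjg_diag[OF g]
    by (rule E_plus[OF swp_SU11[OF g] d]) (use c l in \<open>auto simp: norm_mult\<close>)
  finally show ?thesis using False by simp
qed

end

lemma cs_conj_measurable [measurable]:
  assumes [measurable]: "c \<in> borel_measurable borel"
  shows "(\<lambda>p. kap (cs (c (fst p)) W) (snd p)) \<in> borel_measurable (borel \<Otimes>\<^sub>M borel)"
    "(\<lambda>p. kap (cs (c (snd p)) W) (fst p)) \<in> borel_measurable (borel \<Otimes>\<^sub>M borel)"
  unfolding kap_def det_diff cs_nth by measurable

lemmas haar_measurable_cong = measurable_cong_sets[OF sets_haar refl]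

lemma lint_measurable:
  assumes [measurable]: "(\<lambda>p. q (snd p) (fst p)) \<in> borel_measurable (borel \<Otimes>\<^sub>M borel)"
  shows "(\<lambda>Z::HC. LINT t:{0..1::real}|lborel. (q t Z :: complex)) \<in> borel_measurable borel"
proof -
  have "(\<lambda>p. indicator {0..1::real} (snd p) *\<^sub>R q (snd p) (fst p)) \<in> borel_measurable (borel \<Otimes>\<^sub>M lborel)" by measurable
  hence "(\<lambda>(Z, t). indicator {0..1::real} t *\<^sub>R q t Z) \<in> borel_measurable (borel \<Otimes>\<^sub>M lborel)" by (simp add: split_beta')
  thus ?thesis unfolding set_lebesgue_integral_def by (rule lborel.borel_measurable_lebesgue_integral)
qed

context minus_point
begin

lemma kapA_measurable [measurable]: "kapA \<in> borel_measurable borel"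
proof -
  have "(\<lambda>Z. LINT t:{0..1}|lborel. (circ rad t)\<^sup>2 / (1 - circ rad t)\<^sup>2 * kap (cs (circ rad t) W) Z) \<in> borel_measurable borel"
    by (rule lint_measurable) measurable
  thus ?thesis unfolding kapA_def[abs_def] by measurable
qed

lemma kapB_measurable [measurable]: "kapB \<in> borel_measurable borel"
proof -
  have "(\<lambda>Z. LINT t:{0..1}|lborel. 1 / (1 - circ rad t)\<^sup>2 * kap (cs (1 / circ rad t) W) Z) \<in> borel_measurable borel"
    by (rule lint_measurable) measurable
  thus ?thesis unfolding kapB_def[abs_def] by measurable
qed

lemma mean_op:
  fixes w c :: "real \<Rightarrow> complex"
  assumes d: "d \<ge> 1" and [measurable]: "w \<in> borel_measurable borel" "c \<in> borel_measurable borel"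
    and w: "\<And>t. cmod (w t) \<le> B" and c: "\<And>t. c t \<noteq> 0" "\<And>t. cmod (c t) = lo" "lo * cmod l1 > 1" "lo * cmod l2 < 1"
  shows "(\<integral>Z. bterm \<sigma> d i j k Z * (LINT t:{0..1}|lborel. w t * kap (cs (c t) W) Z) \<partial>haar)
    = (if \<sigma> \<and> (k = 0 \<or> k = int d) then - 1 / of_nat d else 0) * (bterm \<sigma> d i j k W)
      * (LINT t:{0..1}|lborel. w t * c t powi (2 * k - int (Suc d)))"
proof -
  define f where "f Z = bterm \<sigma> d i j k Z" for Z
  have [measurable]: "f \<in> borel_measurable borel" unfolding f_def by measurable
  obtain C where C: "C \<ge> 0" "\<And>Z. Z \<in> UU \<Longrightarrow> cmod (bfun \<sigma> (Suc d) (int i) (int j) Z) \<le> C * rq Z ^ 2" using bfun_bound[OF d] by blast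
  define M where "M = (cmod (g$1$1) + cmod (g$1$2))\<^sup>2 / ((1 - 1 / (lo * cmod l1)) * (1 - lo * cmod l2))"
  define \<theta> where "\<theta> = (if \<sigma> \<and> (k = 0 \<or> k = int d) then - 1 / of_nat d else 0 :: complex) * (bterm \<sigma> d i j k W)"
  have B: "0 \<le> B" using order_trans[OF norm_ge_zero w[of 0]] .
  have "(\<integral>Z. f Z * (LINT t:{0..1}|lborel. w t * kap (cs (c t) W) Z) \<partial>haar)
    = (\<integral>Z. (LINT t:{0..1}|lborel. f Z * (w t * kap (cs (c t) W) Z)) \<partial>haar)" by simp
  also have "\<dots> = (LINT t:{0..1}|lborel. (\<integral>Z. f Z * (w t * kap (cs (c t) W) Z) \<partial>haar))"
  proof (rule Fubini_circle(2)[where B = "C * (B * M)" and q = "\<lambda>t Z. f Z * (w t * kap (cs (c t) W) Z)"])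
    show "(\<lambda>(t, Z). f Z * (w t * kap (cs (c t) W) Z)) \<in> borel_measurable (borel \<Otimes>\<^sub>M borel)"
      unfolding split_beta' by measurable
    fix t Z assume Z: "Z \<in> UU"
    have k: "cmod (kap (cs (c t) W) Z) \<le> M * rq Z" unfolding M_def by (rule kap_cs_bound[OF c(1) _ _ c(3,4) Z]) (simp_all add: c(2))
    have "cmod (f Z) \<le> C * rq Z ^ 2" using C(2)[OF Z] by (simp add: f_def norm_mult norm_det_powi[OF Z])
    hence "cmod (f Z) * (cmod (w t) * cmod (kap (cs (c t) W) Z)) \<le> (C * rq Z ^ 2) * (B * (M * rq Z))"
      using k w[of t] B C(1) by (intro mult_mono) auto
    also have "\<dots> = C * (B * M) * rq Z ^ 3" by (simp only: power3_eq_cube power2_eq_square mult_ac)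
    finally show "cmod (f Z * (w t * kap (cs (c t) W) Z)) \<le> C * (B * M) * rq Z ^ 3" by (simp only: norm_mult)
  qed
  also have "\<dots> = (LINT t:{0..1}|lborel. \<theta> * (w t * c t powi (2 * k - int (Suc d))))"
  proof -
    have "(\<integral>Z. f Z * (w t * kap (cs (c t) W) Z) \<partial>haar) = \<theta> * (w t * c t powi (2 * k - int (Suc d)))" for t
    proof -
      have "(\<integral>Z. f Z * (w t * kap (cs (c t) W) Z) \<partial>haar) = w t * (\<integral>Z. f Z * kap (cs (c t) W) Z \<partial>haar)"
        by (subst integral_mult_right_zero[symmetric]) (simp only: mult_ac)
      also have "(\<integral>Z. f Z * kap (cs (c t) W) Z \<partial>haar) = (if \<sigma> \<and> (k = 0 \<or> k = int d) then - 1 / of_nat d else 0) * c t powi (2 * k - int (Suc d)) * (bterm \<sigma> d i j k W)"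
        unfolding f_def by (rule E_cs[OF d c(1)]) (simp_all add: c(2) c(3,4))
      finally show ?thesis unfolding \<theta>_def by (simp only: mult_ac)
    qed
    thus ?thesis by simp
  qed
  also have "\<dots> = \<theta> * (LINT t:{0..1}|lborel. w t * c t powi (2 * k - int (Suc d)))" by (rule set_integral_mult_right)
  finally show ?thesis unfolding f_def \<theta>_def .
qed

lemma opA:
  assumes d: "d \<ge> 1"
  shows "(\<integral>Z. bterm \<sigma> d i j k Z * kapA Z \<partial>haar)
    = (if \<sigma> \<and> k = 0 then bterm \<sigma> d i j k W else 0)"
proof -
  have m: "(\<lambda>t. (circ rad t)\<^sup>2 / (1 - circ rad t)\<^sup>2) \<in> borel_measurable borel" by measurable
  have w: "(circ rad t)\<^sup>2 / (1 - circ rad t)\<^sup>2 * circ rad t powi (2 * k - int (Suc d)) = circ rad t powi (2 * k + 1 - int d) / (1 - circ rad t)\<^sup>2" for t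
  proof -
    have e: "2 * k + 1 - int d = 2 + (2 * k - int (Suc d))" by simp
    show ?thesis by (simp only: e power_int_add circ_nonzero(1) simp_thms power_int_numeral times_divide_eq_left)
  qed
  have "(\<integral>Z. bterm \<sigma> d i j k Z * kapA Z \<partial>haar)
    = - (\<integral>Z. bterm \<sigma> d i j k Z * (LINT t:{0..1}|lborel. (circ rad t)\<^sup>2 / (1 - circ rad t)\<^sup>2 * kap (cs (circ rad t) W) Z) \<partial>haar)"
    unfolding kapA_def by (simp only: mult_minus_right integral_minus)
  also have "\<dots> = - ((if \<sigma> \<and> (k = 0 \<or> k = int d) then - 1 / of_nat d else 0) * (bterm \<sigma> d i j k W)
      * (LINT t:{0..1}|lborel. circ rad t powi (2 * k + 1 - int d) / (1 - circ rad t)\<^sup>2))"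
    unfolding mean_op[OF d m circ_measurable weight_bound2 circ_nonzero(1) norm_circ[OF rad(4)] rad_bounds(1,2)] w ..
  also have "\<dots> = (if \<sigma> \<and> k = 0 then bterm \<sigma> d i j k W else 0)"
  proof (cases "k = 0")
    case True
    have e: "2 * k + 1 - int d = 1 - int d" using True by simp
    show ?thesis unfolding e circle_mean_weight(2)[OF rad(4,3) d] using True d by simp
  next
    case False
    thus ?thesis using circle_mean_weight(1)[OF rad(4,3), of "2 * k + 1 - int d"] by auto
  qed
  finally show ?thesis .
qed

lemma opB:
  assumes d: "d \<ge> 1"
  shows "(\<integral>Z. bterm \<sigma> d i j k Z * kapB Z \<partial>haar)
    = (if \<sigma> \<and> k = int d then bterm \<sigma> d i j k W else 0)"
proof -
  have m: "(\<lambda>t. 1 / (1 - circ rad t)\<^sup>2) \<in> borel_measurable borel" "(\<lambda>t. 1 / circ rad t) \<in> borel_measurable borel" by measurable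
  have w: "1 / (1 - circ rad t)\<^sup>2 * (1 / circ rad t) powi (2 * k - int (Suc d)) = circ rad t powi (int (Suc d) - 2 * k) / (1 - circ rad t)\<^sup>2" for t
  proof -
    have "int (Suc d) - 2 * k = - (2 * k - int (Suc d))" by simp
    thus ?thesis by (simp only: power_int_minus power_int_divide_distrib power_int_1_left) (simp add: field_simps)
  qed
  have n: "1 / circ rad t \<noteq> 0" "cmod (1 / circ rad t) = 1 / rad" for t
    using circ_nonzero(1) by (simp_all add: norm_divide norm_circ[OF rad(4)])
  have "(\<integral>Z. bterm \<sigma> d i j k Z * kapB Z \<partial>haar)
    = - (\<integral>Z. bterm \<sigma> d i j k Z * (LINT t:{0..1}|lborel. 1 / (1 - circ rad t)\<^sup>2 * kap (cs (1 / circ rad t) W) Z) \<partial>haar)"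
    unfolding kapB_def by (simp only: mult_minus_right integral_minus)
  also have "\<dots> = - ((if \<sigma> \<and> (k = 0 \<or> k = int d) then - 1 / of_nat d else 0) * (bterm \<sigma> d i j k W)
      * (LINT t:{0..1}|lborel. circ rad t powi (int (Suc d) - 2 * k) / (1 - circ rad t)\<^sup>2))"
    unfolding mean_op[OF d m weight_bound n rad_bounds(3,4)] w ..
  also have "\<dots> = (if \<sigma> \<and> k = int d then bterm \<sigma> d i j k W else 0)"
  proof (cases "k = int d")
    case True
    have e: "int (Suc d) - 2 * k = 1 - int d" using True by simp
    show ?thesis unfolding e circle_mean_weight(2)[OF rad(4,3) d] using True d by simp
  next
    case False
    thus ?thesis using circle_mean_weight(1)[OF rad(4,3), of "int (Suc d) - 2 * k"] by auto
  qed
  finally show ?thesis .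
qed

lemma bfun_det_bound:
  assumes "d \<ge> 1"
  shows "\<exists>C\<ge>0. \<forall>Z\<in>UU. cmod (bfun \<sigma> (Suc d) i j Z * det Z powi k) \<le> C * rq Z ^ 2"
proof -
  obtain C where C: "C \<ge> 0" "\<And>Z. Z \<in> UU \<Longrightarrow> cmod (bfun \<sigma> (Suc d) i j Z) \<le> C * rq Z ^ 2" using bfun_bound[OF assms] by blast
  hence "cmod (bfun \<sigma> (Suc d) i j Z * det Z powi k) \<le> C * rq Z ^ 2" if "Z \<in> UU" for Z
    using C(2)[OF that] by (simp only: norm_mult norm_det_powi[OF that] mult_1_right)
  thus ?thesis using C(1) by blast
qed

text \<open>Multiplying a kernel by \<open>(det W / det Z) ^ n\<close> shifts the power of the determinant it picks out.\<close>

lemma op_geometric: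
  fixes k :: int
  assumes d: "d \<ge> 1" and H[measurable]: "H \<in> borel_measurable borel" and HQ: "\<And>Z. Z \<in> UU \<Longrightarrow> cmod (H Z) \<le> Q * rq Z"
    and op: "\<And>k. (\<integral>Z. bterm \<sigma> d i j k Z * H Z \<partial>haar)
      = (if \<sigma> \<and> k = e then bterm \<sigma> d i j k W else 0)"
  defines "F \<equiv> \<lambda>Z. bterm \<sigma> d i j k Z * (H Z / (1 - det W / det Z))"
  shows "cmod (det W) > 1 \<Longrightarrow> integrable haar F \<and> integral\<^sup>L haar F = - (if \<sigma> \<and> k < e then bterm \<sigma> d i j k W else 0)"
    and "cmod (det W) < 1 \<Longrightarrow> integrable haar F \<and> integral\<^sup>L haar F = (if \<sigma> \<and> e \<le> k then bterm \<sigma> d i j k W else 0)"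
proof -
  define f where "f k Z = bterm \<sigma> d i j k Z" for k and Z
  have [measurable]: "f k \<in> borel_measurable borel" for k unfolding f_def by measurable
  define v where "v = bfun \<sigma> (Suc d) (int i) (int j) W"
  obtain C where C: "C \<ge> 0" "\<And>Z. Z \<in> UU \<Longrightarrow> cmod (f k Z) \<le> C * rq Z ^ 2" using bfun_det_bound[OF d] unfolding f_def by blast
  have w0: "det W \<noteq> 0" by (rule W_nonzero(2))
  have bd: "cmod (f k Z * H Z) \<le> C * Q * rq Z ^ 3" if Z: "Z \<in> UU" for Z
  proof -
    have "cmod (f k Z) * cmod (H Z) \<le> (C * rq Z ^ 2) * (Q * rq Z)" using C(2)[OF Z] HQ[OF Z] C(1) by (intro mult_mono) auto
    also have "\<dots> = C * Q * rq Z ^ 3" by (simp only: power3_eq_cube power2_eq_square mult_ac)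
    finally show ?thesis by (simp only: norm_mult)
  qed
  have I: "integrable haar (\<lambda>Z. C * Q * rq Z ^ 3)" using haar_majorant by (rule integrable_mult_right)
  have gen: "integrable haar F \<and> integral\<^sup>L haar F = S"
    if r: "r > 0" "r < 1" and p: "p = 1 \<or> p = -1" and rW: "cmod (det W) powi p = r"
      and F: "\<And>Z. Z \<in> UU \<Longrightarrow> (\<lambda>n. s * ((det W / det Z) powi p) ^ (n + m) * (f k Z * H Z)) sums F Z"
      and S: "(\<lambda>n. s * (if \<sigma> \<and> k - p * int (n + m) = e then v * det W powi k else 0)) sums S" and s1: "cmod s = 1" and m: "m \<le> 1" for r p S s m
  proof -
    define h where "h n Z = s * ((det W / det Z) powi p) ^ (n + m) * (f k Z * H Z)" for n and Z
    have hm[measurable]: "h n \<in> borel_measurable borel" for n unfolding h_def by measurable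
    have Fm: "F \<in> borel_measurable borel" unfolding F_def by measurable
    have b: "AE Z in haar. \<forall>n. cmod (h n Z) \<le> r ^ n * (C * Q * rq Z ^ 3)"
      using AE_haar
    proof eventually_elim
      case (elim Z)
      have n1: "cmod ((det W / det Z) powi p) = r"
        by (simp only: norm_power_int norm_divide UU_D(1)[OF elim] div_by_1 rW)
      show ?case
      proof
        fix n
        have "cmod (h n Z) = r ^ (n + m) * cmod (f k Z * H Z)" by (simp only: h_def norm_mult norm_power n1 s1 mult_1_left)
        also have "\<dots> \<le> r ^ n * (C * Q * rq Z ^ 3)" using r bd[OF elim] by (intro mult_mono power_decreasing) auto
        finally show "cmod (h n Z) \<le> r ^ n * (C * Q * rq Z ^ 3)" .
      qed
    qed
    have s: "AE Z in haar. (\<lambda>n. h n Z) sums F Z" using AE_haar by eventually_elim (use F in \<open>simp add: h_def\<close>)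
    have B: "summable (\<lambda>n. r ^ n)" using r by simp
    note hmH = hm[folded haar_measurable_cong] Fm[folded haar_measurable_cong]
    have "(\<lambda>n. integral\<^sup>L haar (h n)) sums integral\<^sup>L haar F" by (rule integral_sums(2)[OF hmH I B b s])
    moreover have "integral\<^sup>L haar (h n) = s * (if \<sigma> \<and> k - p * int (n + m) = e then v * det W powi k else 0)" for n
    proof -
      define q where "q = p * int (n + m)"
      have pw: "((det W / x) powi p) ^ (n + m) = det W powi q * x powi (- q)" for x
      proof -
        have "((det W / x) powi p) ^ (n + m) = (det W / x) powi q" unfolding q_def by (simp only: power_int_mult power_int_of_nat)
        thus ?thesis by (simp only: power_int_divide_distrib power_int_minus) (simp only: divide_inverse)
      qed
      have "integral\<^sup>L haar (h n) = (\<integral>Z. (s * det W powi q) * (bfun \<sigma> (Suc d) (int i) (int j) Z * det Z powi (k - q) * H Z) \<partial>haar)"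
      proof (rule integral_cong_AE)
        show "AE Z in haar. h n Z = (s * det W powi q) * (bfun \<sigma> (Suc d) (int i) (int j) Z * det Z powi (k - q) * H Z)"
          using AE_haar
        proof eventually_elim
          case (elim Z)
          have "det Z powi (k - q) = det Z powi k * det Z powi (- q)" by (simp only: diff_conv_add_uminus power_int_add UU_D(2)[OF elim] simp_thms)
          thus ?case unfolding h_def f_def pw by (simp only: mult_ac)
        qed
      qed (auto simp: haar_measurable_cong)
      also have "\<dots> = (s * det W powi q) * (if \<sigma> \<and> k - q = e then v * det W powi (k - q) else 0)"
        unfolding integral_mult_right_zero op v_def ..
      also have "\<dots> = s * (if \<sigma> \<and> k - q = e then v * det W powi k else 0)"
      proof -
        have "det W powi k = det W powi q * det W powi (k - q)" using power_int_add[of "det W" q "k - q"] w0 by simp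
        thus ?thesis by simp
      qed
      finally show ?thesis unfolding q_def .
    qed
    ultimately have "integral\<^sup>L haar F = S" using S sums_unique2 by fastforce
    thus ?thesis using integral_sums(1)[OF hmH I B b s] by blast
  qed
  have one: "(\<lambda>n. s * (if \<sigma> \<and> k - p * int (n + m) = e then v * det W powi k else 0)) sums
    (s * (if \<sigma> \<and> p * (k - e) \<ge> int m then v * det W powi k else 0))" if "p = 1 \<or> p = -1" for p s m
  proof (cases "\<sigma> \<and> p * (k - e) \<ge> int m")
    case True
    define n0 where "n0 = nat (p * (k - e) - int m)"
    have "(k - p * int (n + m) = e) = (n = n0)" for n using True that by (auto simp: n0_def)
    thus ?thesis using True sums_single[of n0 "\<lambda>_. s * (v * det W powi k)"] by (simp add: if_distrib cong: if_cong)
  next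
    case False
    have "\<not> (\<sigma> \<and> k - p * int (n + m) = e)" for n using False that by auto
    hence e: "(if \<sigma> \<and> k - p * int (n + m) = e then v * det W powi k else 0) = 0" for n by (rule if_not_P)
    show ?thesis unfolding e if_not_P[OF False] by simp
  qed
  show "integrable haar F \<and> integral\<^sup>L haar F = - (if \<sigma> \<and> k < e then bterm \<sigma> d i j k W else 0)"
    if W1: "cmod (det W) > 1"
  proof -
    have "integrable haar F \<and> integral\<^sup>L haar F = (- 1) * (if \<sigma> \<and> -1 * (k - e) \<ge> int 1 then v * det W powi k else 0)"
    proof (rule gen[where r = "1 / cmod (det W)" and p = "-1" and s = "-1" and m = 1, OF _ _ _ _ _ one])
      fix Z assume Z: "Z \<in> UU"
      define N where "N = det W / det Z"
      have N: "cmod N > 1" using W1 by (simp add: N_def norm_divide UU_D(1)[OF Z])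
      hence N0: "N \<noteq> 0" "N \<noteq> 1" by auto
      have "(\<lambda>n. inverse N ^ n) sums (1 / (1 - inverse N))" by (rule geometric_sums) (use N in \<open>simp add: norm_inverse inverse_less_1_iff\<close>)
      hence "(\<lambda>n. (- (inverse N) * (f k Z * H Z)) * inverse N ^ n) sums ((- (inverse N) * (f k Z * H Z)) * (1 / (1 - inverse N)))" by (rule sums_mult)
      moreover have "(- (inverse N) * (f k Z * H Z)) * (1 / (1 - inverse N)) = F Z"
      proof -
        have "- (inverse N) * (1 / (1 - inverse N)) = 1 / (1 - N)" using N0 by (simp add: field_simps)
        hence "(- (inverse N) * (f k Z * H Z)) * (1 / (1 - inverse N)) = (f k Z * H Z) * (1 / (1 - N))" by (metis mult.assoc mult.commute)
        thus ?thesis unfolding F_def f_def N_def by simp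
      qed
      moreover have "(- (inverse N) * (f k Z * H Z)) * inverse N ^ n = - 1 * (N powi -1) ^ (n + 1) * (f k Z * H Z)" for n
        by (simp add: power_int_minus)
      ultimately show "(\<lambda>n. - 1 * ((det W / det Z) powi -1) ^ (n + 1) * (f k Z * H Z)) sums F Z" unfolding N_def[symmetric] by (simp only:)
    qed (use W1 w0 in \<open>simp_all add: power_int_minus divide_inverse inverse_less_1_iff\<close>)
    thus ?thesis by (simp add: v_def)
  qed
  show "integrable haar F \<and> integral\<^sup>L haar F = (if \<sigma> \<and> e \<le> k then bterm \<sigma> d i j k W else 0)"
    if W1: "cmod (det W) < 1"
  proof -
    have "integrable haar F \<and> integral\<^sup>L haar F = 1 * (if \<sigma> \<and> 1 * (k - e) \<ge> int 0 then v * det W powi k else 0)"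
    proof (rule gen[where r = "cmod (det W)" and p = "1" and s = "1" and m = 0, OF _ _ _ _ _ one])
      fix Z assume Z: "Z \<in> UU"
      define N where "N = det W / det Z"
      have N: "cmod N < 1" using W1 by (simp add: N_def norm_divide UU_D(1)[OF Z])
      have "(\<lambda>n. N ^ n * (f k Z * H Z)) sums (1 / (1 - N) * (f k Z * H Z))" by (rule sums_mult2[OF geometric_sums[OF N]])
      thus "(\<lambda>n. 1 * ((det W / det Z) powi 1) ^ (n + 0) * (f k Z * H Z)) sums F Z"
        unfolding F_def f_def N_def by simp
    qed (use W1 w0 in simp_all)
    thus ?thesis by (simp add: v_def)
  qed
qed

lemma kernel_less:
  fixes \<sigma> :: bool and i j :: nat and k :: int
  assumes d: "d \<ge> 1" and W1: "cmod (det W) > 1"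
  defines "F \<equiv> \<lambda>Z. bterm \<sigma> d i j k Z * (kapA Z / (1 - det W / det Z))"
  shows "integrable haar F \<and> integral\<^sup>L haar F = - (if \<sigma> \<and> k < 0 then bterm \<sigma> d i j k W else 0)"
proof -
  obtain Q where Q: "\<And>Z. Z \<in> UU \<Longrightarrow> cmod (kapA Z) \<le> Q * rq Z" using kapAB_bound by blast
  show ?thesis unfolding F_def by (rule op_geometric(1)[OF d kapA_measurable Q opA[OF d] W1])
qed

lemma kernel_greater:
  fixes \<sigma> :: bool and i j :: nat and k :: int
  assumes d: "d \<ge> 1" and W1: "cmod (det W) < 1"
  defines "F \<equiv> \<lambda>Z. bterm \<sigma> d i j k Z * (kapB Z / (1 - det W / det Z))"
  shows "integrable haar F \<and> integral\<^sup>L haar F = (if \<sigma> \<and> int d \<le> k then bterm \<sigma> d i j k W else 0)"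
proof -
  obtain Q where Q: "\<And>Z. Z \<in> UU \<Longrightarrow> cmod (kapB Z) \<le> Q * rq Z" using kapAB_bound by blast
  show ?thesis unfolding F_def by (rule op_geometric(2)[OF d kapB_measurable Q opB[OF d] W1])
qed

lemma kernel_square_off:
  assumes d: "d \<ge> 1" and W1: "cmod (det W) \<noteq> 1"
  shows "(\<integral>Z. bterm \<sigma> d i j k Z * (kap W Z)\<^sup>2 \<partial>haar)
    = (if \<sigma> \<and> 0 \<le> k \<and> k < int d then bterm \<sigma> d i j k W else 0)"
proof -
  define f where "f Z = bterm \<sigma> d i j k Z" for Z
  define FA FB where "FA Z = f Z * (kapA Z / (1 - det W / det Z))" and "FB Z = f Z * (kapB Z / (1 - det W / det Z))" for Z
  obtain Q where Q: "\<And>Z. Z \<in> UU \<Longrightarrow> cmod (kapA Z) \<le> Q * rq Z" "\<And>Z. Z \<in> UU \<Longrightarrow> cmod (kapB Z) \<le> Q * rq Z" using kapAB_bound by blast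
  note ga = op_geometric[OF d kapA_measurable Q(1) opA[OF d], of \<sigma> i j k, folded f_def, folded FA_def]
    and gb = op_geometric[OF d kapB_measurable Q(2) opB[OF d], of \<sigma> i j k, folded f_def, folded FB_def]
  have I: "integrable haar FA" "integrable haar FB" using ga gb W1 by (cases "cmod (det W) < 1"; force)+
  have "(\<integral>Z. f Z * (kap W Z)\<^sup>2 \<partial>haar) = (\<integral>Z. FA Z - FB Z \<partial>haar)"
  proof (rule integral_cong_AE)
    show "AE Z in haar. f Z * (kap W Z)\<^sup>2 = FA Z - FB Z"
      using AE_haar
    proof eventually_elim
      case (elim Z)
      obtain x y where xy: "mtr W Z = x + y" "det W / det Z = x * y" "cmod l1 \<le> cmod x" "cmod y \<le> cmod l2"
        using eigenvalue_split[OF elim] by blast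
      have n: "x \<noteq> y" "x \<noteq> 1" "y \<noteq> 1" using xy l by auto
      have N: "x * y \<noteq> 1"
      proof
        assume "x * y = 1"
        hence "cmod (det W / det Z) = 1" unfolding xy by simp
        thus False using W1 by (simp add: norm_divide UU_D(1)[OF elim])
      qed
      have "kap W Z = 1 / ((1 - x) * (1 - y))"
        using kap_cs[OF UU_D(2)[OF elim], of 1 W] unfolding cs_1 xy by (simp add: algebra_simps)
      moreover have "(1 / ((1 - x) * (1 - y)))\<^sup>2 = x / ((x - y) * (1 - x)\<^sup>2) / (1 - x * y) - y / ((x - y) * (1 - y)\<^sup>2) / (1 - x * y)"
      proof -
        define u v w z where "u = 1 - x" and "v = 1 - y" and "w = x - y" and "z = 1 - x * y"
        have nz: "u \<noteq> 0" "v \<noteq> 0" "w \<noteq> 0" "z \<noteq> 0" using n N by (auto simp: u_def v_def w_def z_def)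
        have "x / (w * u\<^sup>2) / z - y / (w * v\<^sup>2) / z = (x * v\<^sup>2 - y * u\<^sup>2) / (w * z * u\<^sup>2 * v\<^sup>2)"
          using nz by (simp add: field_simps)
        also have "x * v\<^sup>2 - y * u\<^sup>2 = w * z" by (simp add: u_def v_def w_def z_def power2_eq_square algebra_simps)
        also have "w * z / (w * z * u\<^sup>2 * v\<^sup>2) = (1 / (u * v))\<^sup>2" using nz by (simp add: power2_eq_square)
        finally show ?thesis unfolding u_def v_def w_def z_def ..
      qed
      ultimately show ?case unfolding FA_def FB_def kapA_eq[OF elim xy] kapB_eq[OF elim xy] xy(2) by (simp only: right_diff_distrib)
    qed
  qed (auto simp: f_def FA_def FB_def haar_measurable_cong)
  also have "\<dots> = integral\<^sup>L haar FA - integral\<^sup>L haar FB" by (rule Bochner_Integration.integral_diff[OF I])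
  also have "\<dots> = (if \<sigma> \<and> 0 \<le> k \<and> k < int d then bterm \<sigma> d i j k W else 0)"
    using ga gb W1 by (cases "cmod (det W) < 1") (auto simp: f_def)
  finally show ?thesis unfolding f_def .
qed

lemma minus_point_cs:
  assumes "c \<noteq> 0" "cmod c * cmod l1 > 1" "cmod c * cmod l2 < 1"
  shows "minus_point g (c * l1) (c * l2) (cs c W)"
  using assms g l by unfold_locales (auto simp: norm_mult W conjg_cs)

lemma kernel_square:
  fixes \<sigma> :: bool and i j :: nat and k :: int
  assumes d: "d \<ge> 1"
  defines "F \<equiv> \<lambda>Z. bterm \<sigma> d i j k Z * (kap W Z)\<^sup>2"
  shows "integrable haar F \<and> integral\<^sup>L haar F = (if \<sigma> \<and> 0 \<le> k \<and> k < int d then bterm \<sigma> d i j k W else 0)"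
proof -
  define f where "f Z = bterm \<sigma> d i j k Z" for Z
  have [measurable]: "f \<in> borel_measurable borel" unfolding f_def by measurable
  obtain C where C: "C \<ge> 0" "\<And>Z. Z \<in> UU \<Longrightarrow> cmod (f Z) \<le> C * rq Z ^ 2" using bfun_det_bound[OF d] unfolding f_def by blast
  obtain hi where hi: "1 < hi" "hi * cmod l2 < 1"
  proof -
    have "1 < 1 / cmod l2" using l by simp
    then obtain h where "1 < h" "h < 1 / cmod l2" using dense by blast
    thus ?thesis using l that[of h] by (simp add: field_simps)
  qed
  define M where "M = (cmod (g$1$1) + cmod (g$1$2))\<^sup>2 / ((1 - 1 / (1 * cmod l1)) * (1 - hi * cmod l2))"
  define \<rho> where "\<rho> n = 1 + (hi - 1) / real (Suc n)" for n
  have \<rho>: "1 < \<rho> n" "\<rho> n \<le> hi" for n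
  proof -
    show "1 < \<rho> n" using hi by (simp add: \<rho>_def del: of_nat_Suc)
    have "(hi - 1) / real (Suc n) \<le> (hi - 1) / 1" using hi by (intro divide_left_mono) auto
    thus "\<rho> n \<le> hi" by (simp add: \<rho>_def del: of_nat_Suc)
  qed
  have lim: "\<rho> \<longlonglongrightarrow> 1"
  proof -
    have "(\<lambda>n. 1 + (hi - 1) * inverse (real (Suc n))) \<longlonglongrightarrow> 1 + (hi - 1) * 0"
      by (intro tendsto_intros LIMSEQ_inverse_real_of_nat)
    thus ?thesis unfolding \<rho>_def by (simp add: divide_inverse del: of_nat_Suc)
  qed
  define c where "c n = complex_of_real (\<rho> n)" for n
  have c: "cmod (c n) = \<rho> n" "c n \<noteq> 0" for n using \<rho>[of n] by (auto simp: c_def)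
  have clim: "c \<longlonglongrightarrow> 1" unfolding c_def using tendsto_of_real[OF lim, where ?'a=complex] by simp
  have kb: "cmod (kap (cs z W) Z) \<le> M * rq Z" if "Z \<in> UU" "1 \<le> cmod z" "cmod z \<le> hi" for z Z
    unfolding M_def using that hi l by (intro kap_cs_bound) auto
  have b: "cmod (f Z * (kap (cs z W) Z)\<^sup>2) \<le> C * M\<^sup>2 * rq Z ^ 3" if Z: "Z \<in> UU" and z: "1 \<le> cmod z" "cmod z \<le> hi" for z Z
  proof -
    have "cmod (f Z) * (cmod (kap (cs z W) Z))\<^sup>2 \<le> (C * rq Z ^ 2) * (M * rq Z)\<^sup>2"
      using C(1) C(2)[OF Z] kb[OF that] by (intro mult_mono power_mono) auto
    also have "\<dots> = C * M\<^sup>2 * rq Z ^ 4" by (simp only: power_mult_distrib power4_eq_xxxx power2_eq_square mult_ac)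
    also have "\<dots> \<le> C * M\<^sup>2 * rq Z ^ 3" using C(1) rq_UU[OF Z] by (intro mult_left_mono power_decreasing) auto
    finally show ?thesis by (simp only: norm_mult norm_power)
  qed
  have I: "integrable haar (\<lambda>Z. C * M\<^sup>2 * rq Z ^ 3)" using haar_majorant by (rule integrable_mult_right)
  define G where "G n Z = f Z * (kap (cs (c n) W) Z)\<^sup>2" for n Z
  have Gm: "G n \<in> borel_measurable haar" for n unfolding G_def haar_measurable_cong by measurable
  have Fm: "F \<in> borel_measurable haar" unfolding F_def haar_measurable_cong by measurable
  have F: "F Z = f Z * (kap (cs 1 W) Z)\<^sup>2" for Z by (simp add: F_def f_def)
  have pt: "AE Z in haar. (\<lambda>n. G n Z) \<longlonglongrightarrow> F Z"
    using AE_haar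
  proof eventually_elim
    case (elim Z)
    have "kap (cs 1 W) Z \<noteq> 0" by (rule kap_cs_nonzero[OF _ _ _ elim]) (use l in auto)
    hence "1 - 1 * mtr W Z + 1\<^sup>2 * (det W / det Z) \<noteq> 0" unfolding kap_cs[OF UU_D(2)[OF elim]] by auto
    thus ?case unfolding G_def F kap_cs[OF UU_D(2)[OF elim]] by (intro tendsto_intros clim)
  qed
  have Gb: "AE Z in haar. norm (G n Z) \<le> C * M\<^sup>2 * rq Z ^ 3" for n
    using AE_haar
  proof eventually_elim
    case (elim Z)
    show ?case unfolding G_def by (rule b[OF elim]) (use \<rho>[of n] c in auto)
  qed
  have "(\<lambda>n. integral\<^sup>L haar (G n)) \<longlonglongrightarrow> integral\<^sup>L haar F" by (rule integral_dominated_convergence[OF Fm Gm I pt Gb])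
  moreover have "(\<lambda>n. integral\<^sup>L haar (G n)) \<longlonglongrightarrow> (if \<sigma> \<and> 0 \<le> k \<and> k < int d then bterm \<sigma> d i j k W else 0)"
    if W1: "cmod (det W) = 1"
  proof -
    have "integral\<^sup>L haar (G n) = (if \<sigma> \<and> 0 \<le> k \<and> k < int d then bfun \<sigma> (Suc d) (int i) (int j) (cs (c n) W) * det (cs (c n) W) powi k else 0)" for n
      unfolding G_def f_def
    proof (rule minus_point.kernel_square_off[OF minus_point_cs d])
      have "1 * cmod l1 \<le> \<rho> n * cmod l1" by (rule mult_right_mono) (use \<rho>(1)[of n] in auto)
      moreover have "\<rho> n * cmod l2 \<le> hi * cmod l2" by (rule mult_right_mono) (use \<rho>(2)[of n] in auto)
      ultimately show "cmod (c n) * cmod l1 > 1" "cmod (c n) * cmod l2 < 1" using l hi unfolding c by linarith+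
      have "1 < (\<rho> n)\<^sup>2" using \<rho>(1)[of n] by (simp add: one_less_power)
      thus "cmod (det (cs (c n) W)) \<noteq> 1" by (simp add: det_cs norm_mult norm_power c W1)
    qed (rule c)
    moreover have "(\<lambda>n. bfun \<sigma> (Suc d) (int i) (int j) (cs (c n) W) * det (cs (c n) W) powi k) \<longlonglongrightarrow> bterm \<sigma> d i j k W" if \<sigma>
    proof -
      have "(\<lambda>n. c n powi (- int (Suc d)) * Fc (Suc d) (int i) (int j) W * ((c n)\<^sup>2 * det W) powi k) \<longlonglongrightarrow> 1 powi (- int (Suc d)) * Fc (Suc d) (int i) (int j) W * (1\<^sup>2 * det W) powi k"
        by (intro tendsto_intros clim) (use W_nonzero in auto)
      thus ?thesis using that by (simp add: bfun_def Fc_cs[OF W_nonzero(1) c(2)] det_cs del: power_int_minus)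
    qed
    ultimately show ?thesis by (cases "\<sigma> \<and> 0 \<le> k \<and> k < int d") auto
  qed
  ultimately have "integral\<^sup>L haar F = (if \<sigma> \<and> 0 \<le> k \<and> k < int d then bterm \<sigma> d i j k W else 0)"
    using kernel_square_off[OF d, of \<sigma> i j k] LIMSEQ_unique unfolding F_def by (cases "cmod (det W) = 1") blast+
  moreover have "integrable haar F"
  proof (rule Bochner_Integration.integrable_bound[OF I Fm])
    show "AE Z in haar. norm (F Z) \<le> norm (C * M\<^sup>2 * rq Z ^ 3)"
      using AE_haar
    proof eventually_elim
      case (elim Z)
      have "norm (F Z) \<le> C * M\<^sup>2 * rq Z ^ 3" unfolding F by (rule b[OF elim]) (use hi in auto)
      thus ?case by simp
    qed
  qed
  ultimately show ?thesis by blast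
qed

end

lemma matrix_inv_mult_22:
  fixes g :: HC
  assumes "det g \<noteq> 0"
  shows "g ** matrix_inv g = mat 1" "det g * det (matrix_inv g) = 1"
proof -
  have D: "det g = g$1$1 * g$2$2 - g$1$2 * g$2$1" by (rule det_2)
  have e: "a * (b / c) + x * (- y / c) = (a * b - x * y) / c" "a * (- b / c) + x * (y / c) = (x * y - a * b) / c" for a b c x y :: complex
    by (simp_all add: diff_divide_distrib)
  show 1: "g ** matrix_inv g = mat 1"
    unfolding matrix_inv_22[OF assms] HC_eq_iff mat_mult_nth mat2_nth e
    using assms by (simp add: mat_def D[symmetric] mult.commute)
  have "det (g ** matrix_inv g) = det (mat 1 :: HC)" unfolding 1 ..
  thus "det g * det (matrix_inv g) = 1" by (simp add: det_mul)
qed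

lemma conj_diagI:
  fixes g :: HC
  assumes "det g \<noteq> 0" "X ** g = g ** diag2 x y"
  shows "conj_diag X x y"
  unfolding conj_diag_def
proof (intro exI[of _ g] conjI)
  show "invertible g" using assms(1) by (simp add: invertible_det_nz)
  have "g ** diag2 x y ** matrix_inv g = X ** (g ** matrix_inv g)" unfolding assms(2)[symmetric] by (simp only: matrix_mul_assoc)
  thus "X = g ** diag2 x y ** matrix_inv g" unfolding matrix_inv_mult_22(1)[OF assms(1)] by simp
qed

lemma conj_diag_exists:
  fixes X :: HC
  assumes t: "X$1$1 + X$2$2 = x + y" and d: "det X = x * y" and xy: "x \<noteq> y"
  shows "conj_diag X x y"
proof -
  have p: "X$1$2 * X$2$1 = - (x - X$1$1) * (y - X$1$1)"
    and p2: "X$1$2 * X$2$1 = - (x - X$2$2) * (y - X$2$2)"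
  proof -
    have D: "X$1$1 * X$2$2 - X$1$2 * X$2$1 = x * y" using d by (simp add: det_2)
    have e: "X$2$2 = x + y - X$1$1" using t by (simp add: algebra_simps)
    show "X$1$2 * X$2$1 = - (x - X$1$1) * (y - X$1$1)" using D unfolding e by (simp add: algebra_simps)
    show "X$1$2 * X$2$1 = - (x - X$2$2) * (y - X$2$2)" using D unfolding e by (simp add: algebra_simps)
  qed
  have c: "X$2$2 = x + y - X$1$1" using t by (simp add: algebra_simps)
  consider "X$1$2 \<noteq> 0" | "X$1$2 = 0" "X$2$1 \<noteq> 0" | "X$1$2 = 0" "X$2$1 = 0" by blast
  thus ?thesis
  proof cases
    case 1
    show ?thesis
    proof (rule conj_diagI[of "mat2 (X$1$2) (X$1$2) (x - X$1$1) (y - X$1$1)"])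
      show "det (mat2 (X$1$2) (X$1$2) (x - X$1$1) (y - X$1$1)) \<noteq> 0"
        using 1 xy by (simp add: det_2 algebra_simps)
      have q: "X$2$1 * X$1$2 = - (x - X$1$1) * (y - X$1$1)" using p by (simp only: mult.commute)
      show "X ** mat2 (X$1$2) (X$1$2) (x - X$1$1) (y - X$1$1) = mat2 (X$1$2) (X$1$2) (x - X$1$1) (y - X$1$1) ** diag2 x y"
        unfolding HC_eq_iff mat_mult_nth mat2_nth diag2_nth q c by (simp add: algebra_simps)
    qed
  next
    case 2
    show ?thesis
    proof (rule conj_diagI[of "mat2 (x - X$2$2) (y - X$2$2) (X$2$1) (X$2$1)"])
      show "det (mat2 (x - X$2$2) (y - X$2$2) (X$2$1) (X$2$1)) \<noteq> 0"
        using 2 xy by (simp add: det_2 algebra_simps)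
      have e: "X$1$1 = x + y - X$2$2" using t by (simp add: algebra_simps)
      show "X ** mat2 (x - X$2$2) (y - X$2$2) (X$2$1) (X$2$1) = mat2 (x - X$2$2) (y - X$2$2) (X$2$1) (X$2$1) ** diag2 x y"
        unfolding HC_eq_iff mat_mult_nth mat2_nth diag2_nth p2 e by (simp add: algebra_simps)
    qed
  next
    case 3
    have "(x - X$1$1) * (y - X$1$1) = - (X$1$2 * X$2$1)" unfolding p by (simp only: mult_minus_left minus_minus)
    also have "\<dots> = 0" using 3 by simp
    finally have "(x - X$1$1) * (y - X$1$1) = 0" .
    hence "x - X$1$1 = 0 \<or> y - X$1$1 = 0" by (simp only: mult_eq_0_iff)
    then consider "x = X$1$1" | "y = X$1$1" unfolding right_minus_eq by blast
    thus ?thesis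
    proof cases
      case 1
      hence "X$2$2 = y" using c by simp
      with 1 3 show ?thesis by (intro conj_diagI[of "mat 1"]) (simp_all add: HC_eq_iff det_I)
    next
      case 2
      hence "X$2$2 = x" using c by simp
      with 2 3 show ?thesis by (intro conj_diagI[of "mat2 0 1 1 0"]) (simp_all add: HC_eq_iff det_2)
    qed
  qed
qed

lemma conj_diag_trace:
  assumes "conj_diag X x y"
  shows "X$1$1 + X$2$2 = x + y" "det X = x * y"
proof -
  obtain g where g: "invertible g" "X = g ** diag2 x y ** matrix_inv g" using assms unfolding conj_diag_def by blast
  have d: "det g \<noteq> 0" using g(1) by (simp add: invertible_det_nz)
  show "det X = x * y" using matrix_inv_mult_22(2)[OF d] unfolding g(2) by (simp add: det_mul)
  have "X$1$1 + X$2$2 = (x + y) * (g$1$1 * g$2$2 - g$1$2 * g$2$1) / det g"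
    unfolding g(2) matrix_inv_22[OF d] mat_mult_nth mat2_nth diag2_nth by (simp add: add_divide_distrib diff_divide_distrib algebra_simps)
  also have "g$1$1 * g$2$2 - g$1$2 * g$2$1 = det g" by (simp add: det_2)
  finally show "X$1$1 + X$2$2 = x + y" using d by simp
qed

lemma root_pair_unique:
  fixes x y u v :: complex
  assumes "u + v = x + y" "u * v = x * y" "cmod x > 1" "cmod y < 1" "cmod u > 1" "cmod v < 1"
  shows "u = x \<and> v = y"
proof -
  have v: "v = x + y - u" using assms(1) by (simp add: algebra_simps)
  have "(u - x) * (u - y) = 0" using assms(2) unfolding v by (simp add: algebra_simps)
  hence "u = x" using assms by auto
  thus ?thesis using v by simp
qed

lemma eigs_eq:
  assumes t: "X$1$1 + X$2$2 = x + y" "det X = x * y" and xy: "cmod x > 1" "cmod y < 1"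
  shows "eigs_minus X = (x, y)" "eigs_plus X = (y, x)"
proof -
  have n: "x \<noteq> y" using xy by auto
  show "eigs_minus X = (x, y)"
    unfolding eigs_minus_def
  proof (rule the_equality)
    show "case (x, y) of (l1, l2) \<Rightarrow> conj_diag X l1 l2 \<and> 1 < cmod l1 \<and> cmod l2 < 1"
      using conj_diag_exists[OF t n] xy by simp
    fix p assume "case p of (l1, l2) \<Rightarrow> conj_diag X l1 l2 \<and> 1 < cmod l1 \<and> cmod l2 < 1"
    then obtain u v where p: "p = (u, v)" "conj_diag X u v" "1 < cmod u" "cmod v < 1" by (cases p) auto
    show "p = (x, y)" using root_pair_unique[of u v x y] conj_diag_trace[OF p(2)] t xy p by simp
  qed
  show "eigs_plus X = (y, x)"
    unfolding eigs_plus_def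
  proof (rule the_equality)
    show "case (y, x) of (l1, l2) \<Rightarrow> conj_diag X l1 l2 \<and> 1 < cmod l2 \<and> cmod l1 < 1"
      using conj_diag_exists[of X y x] t n xy by (simp add: add.commute mult.commute)
    fix p assume "case p of (l1, l2) \<Rightarrow> conj_diag X l1 l2 \<and> 1 < cmod l2 \<and> cmod l1 < 1"
    then obtain u v where p: "p = (v, u)" "conj_diag X v u" "1 < cmod u" "cmod v < 1" by (cases p) auto
    show "p = (y, x)" using root_pair_unique[of u v x y] conj_diag_trace[OF p(2)] t xy p by (simp add: add.commute mult.commute)
  qed
qed

lemma mult_inv_trace:
  fixes W Z :: HC
  assumes "det Z \<noteq> 0"
  shows "(W ** matrix_inv Z)$1$1 + (W ** matrix_inv Z)$2$2 = mtr W Z" "det (W ** matrix_inv Z) = det W / det Z"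
proof -
  show "(W ** matrix_inv Z)$1$1 + (W ** matrix_inv Z)$2$2 = mtr W Z"
    unfolding matrix_inv_22[OF assms] mat_mult_nth mat2_nth mtr_def by (simp add: add_divide_distrib diff_divide_distrib)
  show "det (W ** matrix_inv Z) = det W / det Z"
    using matrix_inv_mult_22(2)[OF assms] assms by (simp add: det_mul field_simps)
qed

lemma det_scaleR: "det (R *\<^sub>R Z :: HC) = of_real (R\<^sup>2) * det Z"
  unfolding det_2 vector_scaleR_component by (simp add: scaleR_conv_of_real power2_eq_square algebra_simps)

lemma mtr_scaleR: "R \<noteq> 0 \<Longrightarrow> mtr (R *\<^sub>R W) (R *\<^sub>R Z) = mtr W Z"
proof -
  assume R: "R \<noteq> 0"
  have "mtr (R *\<^sub>R W) (R *\<^sub>R Z) = (of_real (R\<^sup>2) * (W$1$1 * Z$2$2 - W$1$2 * Z$2$1 - W$2$1 * Z$1$2 + W$2$2 * Z$1$1)) / (of_real (R\<^sup>2) * det Z)"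
    unfolding mtr_def det_scaleR vector_scaleR_component by (simp add: scaleR_conv_of_real power2_eq_square algebra_simps)
  thus ?thesis using R by (simp add: mtr_def)
qed

lemma mtr_swp: "mtr (swp W) (swp Z) = mtr W Z"
  by (simp add: mtr_def algebra_simps)

lemma eigs_scaled:
  assumes R: "R > 0" and Z: "det Z \<noteq> 0" and xy: "mtr W Z = x + y" "det W / det Z = x * y" "cmod x > 1" "cmod y < 1"
  shows "eigs_minus ((R *\<^sub>R W) ** matrix_inv (R *\<^sub>R Z)) = (x, y)" "eigs_plus ((R *\<^sub>R W) ** matrix_inv (R *\<^sub>R Z)) = (y, x)"
proof -
  have d: "det (R *\<^sub>R Z) \<noteq> 0" using R Z by (simp add: det_scaleR)
  have t: "((R *\<^sub>R W) ** matrix_inv (R *\<^sub>R Z))$1$1 + ((R *\<^sub>R W) ** matrix_inv (R *\<^sub>R Z))$2$2 = x + y"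
    "det ((R *\<^sub>R W) ** matrix_inv (R *\<^sub>R Z)) = x * y"
    unfolding mult_inv_trace[OF d] using R xy by (simp_all add: mtr_scaleR det_scaleR)
  show "eigs_minus ((R *\<^sub>R W) ** matrix_inv (R *\<^sub>R Z)) = (x, y)" "eigs_plus ((R *\<^sub>R W) ** matrix_inv (R *\<^sub>R Z)) = (y, x)"
    using eigs_eq[OF t xy(3,4)] by simp_all
qed

definition reproduces :: "bool \<Rightarrow> (HC \<Rightarrow> complex) \<Rightarrow> HC \<Rightarrow> (nat \<Rightarrow> int \<Rightarrow> bool) \<Rightarrow> bool" where
  "reproduces \<tau> K W T \<longleftrightarrow> K \<in> borel_measurable borel \<and> (\<forall>\<sigma> d i j k. d \<ge> 1 \<longrightarrow>
     integrable haar (\<lambda>Z. bterm \<sigma> d i j k Z * K Z) \<and>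
     (\<integral>Z. bterm \<sigma> d i j k Z * K Z \<partial>haar) =
       (if \<sigma> = \<tau> \<and> T d k then bterm \<sigma> d i j k W else 0))"

lemma reproduces_swp:
  assumes "reproduces True K W T"
  shows "reproduces False (\<lambda>Z. K (swp Z)) (swp W) T"
  unfolding reproduces_def
proof (intro conjI allI impI)
  have K[measurable]: "K \<in> borel_measurable borel" using assms by (simp add: reproduces_def)
  show "(\<lambda>Z. K (swp Z)) \<in> borel_measurable borel" by measurable
  fix \<sigma> and d i j :: nat and k :: int assume d: "d \<ge> 1"
  define F where "F Z = bfun (\<not> \<sigma>) (Suc d) (int i) (int j) Z * det Z powi k * K Z" for Z
  have Fm: "F \<in> borel_measurable borel" unfolding F_def by measurable
  have e: "(\<lambda>Z. bterm \<sigma> d i j k Z * K (swp Z)) = (\<lambda>Z. F (swp Z))"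
    by (auto simp: F_def bfun_def)
  have F: "integrable haar F" "integral\<^sup>L haar F = (if (\<not> \<sigma>) = True \<and> T d k then bfun (\<not> \<sigma>) (Suc d) (int i) (int j) W * det W powi k else 0)"
    using assms d unfolding reproduces_def F_def by blast+
  show "integrable haar (\<lambda>Z. bterm \<sigma> d i j k Z * K (swp Z))"
    unfolding e using haar_transform(1)[OF haar_swp swp_measurable Fm] F(1) by simp
  show "(\<integral>Z. bterm \<sigma> d i j k Z * K (swp Z) \<partial>haar) =
       (if \<sigma> = False \<and> T d k then bfun \<sigma> (Suc d) (int i) (int j) (swp W) * det (swp W) powi k else 0)"
    unfolding e using haar_transform(2)[OF haar_swp swp_measurable Fm] F(2) by (auto simp: bfun_def)
qed

lemma dV_reproduces:
  assumes K: "reproduces \<tau> K W T" and R: "R > 0" and d: "d \<ge> 1"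
    and kern: "\<And>Z. Z \<in> UU \<Longrightarrow> of_real (R ^ 4) * det Z ^ 2 * kern (R *\<^sub>R Z) = K Z"
    and f: "\<And>Z. Z \<in> UU \<Longrightarrow> f (R *\<^sub>R Z) = c * (bterm \<sigma> d i j k Z)"
  shows "dV_integrable R (\<lambda>Z. kern Z * f Z)"
    "\<i> / (2 * pi ^ 3) * dV_integral R (\<lambda>Z. kern Z * f Z) = c * (if \<sigma> = \<tau> \<and> T d k then bterm \<sigma> d i j k W else 0)"
proof -
  define h where "h Z = c * (bterm \<sigma> d i j k Z * K Z)" for Z
  have Km[measurable]: "K \<in> borel_measurable borel" using K by (simp add: reproduces_def)
  have hm: "h \<in> borel_measurable borel" unfolding h_def by measurable
  have I: "integrable haar (\<lambda>Z. bterm \<sigma> d i j k Z * K Z)"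
    "(\<integral>Z. bterm \<sigma> d i j k Z * K Z \<partial>haar) =
       (if \<sigma> = \<tau> \<and> T d k then bterm \<sigma> d i j k W else 0)"
    using K d unfolding reproduces_def by blast+
  have hi: "integrable haar h" unfolding h_def using I(1) by (rule integrable_mult_right)
  have eq: "of_real (R ^ 4) * det Z ^ 2 * (kern (R *\<^sub>R Z) * f (R *\<^sub>R Z)) = h Z" if "Z \<in> UU" for Z
    unfolding f[OF that] h_def kern[OF that, symmetric] by (simp only: mult_ac)
  show "dV_integrable R (\<lambda>Z. kern Z * f Z)" by (rule dV_haar(1)[OF hm hi R eq])
  show "\<i> / (2 * pi ^ 3) * dV_integral R (\<lambda>Z. kern Z * f Z) = c * (if \<sigma> = \<tau> \<and> T d k then bterm \<sigma> d i j k W else 0)"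
  proof -
    have "\<i> / (2 * pi ^ 3) * dV_integral R (\<lambda>Z. kern Z * f Z) = integral\<^sup>L haar h" by (rule dV_haar(2)[OF hm hi R eq])
    also have "\<dots> = c * (\<integral>Z. bterm \<sigma> d i j k Z * K Z \<partial>haar)" unfolding h_def by (rule integral_mult_right_zero)
    finally show ?thesis unfolding I(2) .
  qed
qed

lemma Gamma_minusE:
  assumes "W \<in> Gamma_minus"
  obtains g l1 l2 where "minus_point g l1 l2 W"
  using assms unfolding Gamma_minus_def minus_point_def conjg_def by auto

lemma Gamma_plus_swp: "W \<in> Gamma_plus \<Longrightarrow> swp W \<in> Gamma_minus"
proof -
  assume "W \<in> Gamma_plus"
  then obtain g l1 l2 where g: "W = conjg g (diag2 l1 l2)" "g \<in> SU11" "cmod l2 > 1" "1 > cmod l1" "cmod l1 > 0"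
    unfolding Gamma_plus_def conjg_def by blast
  have "swp W = conjg (swp g) (diag2 l2 l1)" unfolding g(1) by (rule swp_conjg_diag[OF g(2)])
  thus ?thesis using swp_SU11[OF g(2)] g unfolding Gamma_minus_def conjg_def by blast
qed

lemma powi_minus_2: "z powi (-2) = 1 / (z::complex)\<^sup>2"
  by (simp add: power_int_minus inverse_eq_divide)

lemma kernel_form_square:
  assumes "R > 0" "Z \<in> UU"
  shows "of_real (R ^ 4) * det Z ^ 2 * det (R *\<^sub>R Z - R *\<^sub>R W) powi (-2) = (kap W Z)\<^sup>2"
proof -
  have "R *\<^sub>R Z - R *\<^sub>R W = R *\<^sub>R (Z - W)" by (simp add: scaleR_diff_right)
  thus ?thesis using assms(1) unfolding kap_def powi_minus_2
    by (simp add: det_scaleR power_divide power_mult_distrib flip: power_mult)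
qed

context minus_point
begin

lemma reproduces_square: "reproduces True (\<lambda>Z. (kap W Z)\<^sup>2) W (\<lambda>d k. 0 \<le> k \<and> k < int d)"
  unfolding reproduces_def using kernel_square by auto

lemma reproduces_less: "cmod (det W) > 1 \<Longrightarrow> reproduces True (\<lambda>Z. - (kapA Z / (1 - det W / det Z))) W (\<lambda>d k. k < 0)"
  unfolding reproduces_def mult_minus_right integral_minus using kernel_less by auto

lemma reproduces_greater: "cmod (det W) < 1 \<Longrightarrow> reproduces True (\<lambda>Z. kapB Z / (1 - det W / det Z)) W (\<lambda>d k. int d \<le> k)"
  unfolding reproduces_def using kernel_greater by auto

lemma kernel_form:
  assumes R: "R > 0" and Z: "Z \<in> UU"
  shows "of_real (R ^ 4) * det Z ^ 2 * (let (l1, l2) = eigs_minus ((R *\<^sub>R W) ** matrix_inv (R *\<^sub>R Z))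
      in - (det (R *\<^sub>R Z) powi (-2)) * l1 / ((l1 - l2) * (1 - l1 * l2) * (1 - l1)\<^sup>2)) = - (kapA Z / (1 - det W / det Z))" (is ?A)
    "of_real (R ^ 4) * det Z ^ 2 * (let (l1, l2) = eigs_minus ((R *\<^sub>R W) ** matrix_inv (R *\<^sub>R Z))
      in det (R *\<^sub>R Z) powi (-2) * l2 / ((l1 - l2) * (1 - l1 * l2) * (1 - l2)\<^sup>2)) = kapB Z / (1 - det W / det Z)" (is ?B)
    "of_real (R ^ 4) * det Z ^ 2 * (let (l1, l2) = eigs_plus ((R *\<^sub>R swp W) ** matrix_inv (R *\<^sub>R swp Z))
      in det (R *\<^sub>R swp Z) powi (-2) * l2 / ((l1 - l2) * (1 - l1 * l2) * (1 - l2)\<^sup>2)) = - (kapA Z / (1 - det W / det Z))" (is ?C)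
    "of_real (R ^ 4) * det Z ^ 2 * (let (l1, l2) = eigs_plus ((R *\<^sub>R swp W) ** matrix_inv (R *\<^sub>R swp Z))
      in - (det (R *\<^sub>R swp Z) powi (-2)) * l1 / ((l1 - l2) * (1 - l1 * l2) * (1 - l1)\<^sup>2)) = kapB Z / (1 - det W / det Z)" (is ?D)
proof -
  obtain x y where xy: "mtr W Z = x + y" "det W / det Z = x * y" "cmod l1 \<le> cmod x" "cmod y \<le> cmod l2"
    using eigenvalue_split[OF Z] by blast
  have b: "cmod x > 1" "cmod y < 1" using xy l by linarith+
  have Z0: "det Z \<noteq> 0" "det (swp Z) \<noteq> 0" using UU_D(2)[OF Z] by simp_all
  note em = eigs_scaled(1)[OF R Z0(1) xy(1,2) b]
  have xy': "mtr (swp W) (swp Z) = x + y" "det (swp W) / det (swp Z) = x * y" using xy by (simp_all add: mtr_swp)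
  note ep = eigs_scaled(2)[OF R Z0(2) xy' b]
  have P: "of_real (R ^ 4) * det Z ^ 2 * det (R *\<^sub>R Z) powi (-2) = 1"
    "of_real (R ^ 4) * det Z ^ 2 * det (R *\<^sub>R swp Z) powi (-2) = 1"
    using R Z0(1) unfolding powi_minus_2 det_scaleR det_swp by (simp_all add: power_mult_distrib flip: power_mult)
  have q: "K * (p * u / D) = (K * p) * u / D" "K * (- p * u / D) = - ((K * p) * u / D)" for K p u D :: complex by simp_all
  have e: "u / ((y - x) * (1 - y * x) * v) = - (u / ((x - y) * (1 - x * y) * v))" for u v
  proof -
    have "(y - x) * (1 - y * x) * v = - ((x - y) * (1 - x * y) * v)" by (simp add: algebra_simps)
    thus ?thesis by (simp only: minus_divide_right)
  qed
  have A: "kapA Z / (1 - det W / det Z) = x / ((x - y) * (1 - x * y) * (1 - x)\<^sup>2)"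
    unfolding kapA_eq[OF Z xy] xy(2) by (simp add: mult_ac)
  have B: "kapB Z / (1 - det W / det Z) = y / ((x - y) * (1 - x * y) * (1 - y)\<^sup>2)"
    unfolding kapB_eq[OF Z xy] xy(2) by (simp add: mult_ac)
  show ?A unfolding em Let_def prod.case A q(2) P by simp
  show ?B unfolding em Let_def prod.case B q(1) P by simp
  show ?C unfolding ep Let_def prod.case A q(1) P unfolding e by simp
  show ?D unfolding ep Let_def prod.case B q(2) P unfolding e by simp
qed

end

section \<open>The coefficients and the action \<open>rho1\<close>\<close>

lemma higher_deriv_powers_sum:
  fixes c :: "'b \<Rightarrow> complex"
  assumes "finite H"
  shows "(deriv ^^ n) (\<lambda>w. \<Sum>h\<in>H. c h * w ^ e h) z = (\<Sum>h\<in>H. c h * (of_nat (e h choose n) * fact n * z ^ (e h - n)))"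
  using assms
proof (induction H rule: finite_induct)
  case empty
  thus ?case by simp
next
  case (insert x H)
  have p: "(deriv ^^ n) (\<lambda>w. w ^ m) z = of_nat (m choose n) * fact n * z ^ (m - n)" for m
  proof (cases "n \<le> m")
    case True
    have "(fact m :: complex) = fact (m - n) * pochhammer (of_nat (m - n) + 1) n"
    proof -
      have "(fact (m - n + n) :: complex) = fact (m - n) * pochhammer (of_nat (m - n) + 1) n"
        by (simp only: pochhammer_fact pochhammer_product' add.commute[of 1])
      thus ?thesis using True by simp
    qed
    moreover have "of_nat (Suc m - n) = (of_nat (m - n) + 1 :: complex)" using True by (simp add: Suc_diff_le)
    ultimately show ?thesis
      using higher_deriv_power[of n 0 m z] binomial_fact[OF True, where ?'a=complex] by simp
  next
    case False
    thus ?thesis using higher_deriv_power[of n 0 m z] by (simp add: binomial_eq_0 pochhammer_0_left)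
  qed
  have "(deriv ^^ n) (\<lambda>w. \<Sum>h\<in>insert x H. c h * w ^ e h) z = (deriv ^^ n) (\<lambda>w. c x * w ^ e x + (\<Sum>h\<in>H. c h * w ^ e h)) z"
    using insert by simp
  also have "\<dots> = (deriv ^^ n) (\<lambda>w. c x * w ^ e x) z + (deriv ^^ n) (\<lambda>w. \<Sum>h\<in>H. c h * w ^ e h) z"
    by (rule higher_deriv_add[of _ UNIV]) (auto intro!: holomorphic_intros)
  also have "(deriv ^^ n) (\<lambda>w. c x * w ^ e x) z = c x * (deriv ^^ n) (\<lambda>w. w ^ e x) z"
    by (rule higher_deriv_cmult[of _ UNIV]) (auto intro!: holomorphic_intros)
  finally show ?case using insert by (simp add: p)
qed

lemma gchoose_neg_nonzero: "a \<ge> 1 \<Longrightarrow> ((- of_nat a :: complex) gchoose j) \<noteq> 0"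
proof -
  assume "a \<ge> 1"
  have "(- of_nat a :: complex) gchoose j = (-1) ^ j * ((of_nat (a + j - 1)) gchoose j)"
    using gbinomial_minus[of "of_nat a :: complex" j] \<open>a \<ge> 1\<close> by (simp add: of_nat_diff)
  also have "\<dots> = (-1) ^ j * of_nat ((a + j - 1) choose j)"
    by (simp only: binomial_gbinomial)
  finally show ?thesis using \<open>a \<ge> 1\<close> by simp
qed

lemma tau_hol_eq:
  assumes a: "a \<ge> 1" and z: "Z$1$1 \<noteq> 0"
  shows "tau (- real a / 2) (real i + real a / 2) (real j + real a / 2) Z = Fc a (int i) (int j) Z / ((- of_nat a) gchoose j)"
proof -
  define M where "M = a + j - 1"
  have M: "a + j = Suc M" using a by (simp add: M_def)
  define s0 where "s0 = - Z$2$1 / Z$1$1"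
  define c e where "c h = of_nat (j choose h) * Z$2$2 ^ h * Z$1$2 ^ (j - h) / Z$1$1 ^ Suc M" and "e h = j - h + (a + i - 1)" for h
  have fl: "\<lfloor>- real a / 2 - (real j + real a / 2)\<rfloor> = - int (Suc M)" "\<lfloor>- real a / 2 + (real j + real a / 2)\<rfloor> = int j"
    "\<lfloor>- (- real a / 2) + (real i + real a / 2)\<rfloor> = int (a + i)"
  proof -
    have "- real a / 2 - (real j + real a / 2) = of_int (- int (Suc M))" unfolding M[symmetric] by simp
    thus "\<lfloor>- real a / 2 - (real j + real a / 2)\<rfloor> = - int (Suc M)" by (simp only: floor_of_int)
    have "- real a / 2 + (real j + real a / 2) = of_int (int j)" by simp
    thus "\<lfloor>- real a / 2 + (real j + real a / 2)\<rfloor> = int j" by (simp only: floor_of_int)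
    have "- (- real a / 2) + (real i + real a / 2) = of_int (int (a + i))" by simp
    thus "\<lfloor>- (- real a / 2) + (real i + real a / 2)\<rfloor> = int (a + i)" by (simp only: floor_of_int)
  qed
  have s: "s * Z$1$1 + Z$2$1 = Z$1$1 * (s - s0)" for s using z by (simp add: s0_def field_simps)
  have "tau (- real a / 2) (real i + real a / 2) (real j + real a / 2) Z = residue (tau_integrand (- real a / 2) (real i + real a / 2) (real j + real a / 2) Z) s0"
    by (simp add: tau_def s0_def)
  also have "\<dots> = residue (\<lambda>s. (\<Sum>h\<in>{..j}. c h * s ^ e h) / (s - s0) ^ Suc M) s0"
  proof (rule residue_cong)
    have "eventually (\<lambda>s::complex. s \<noteq> 0) (at s0)" by (rule eventually_neq_at_within)
    thus "eventually (\<lambda>s. tau_integrand (- real a / 2) (real i + real a / 2) (real j + real a / 2) Z s = (\<Sum>h\<in>{..j}. c h * s ^ e h) / (s - s0) ^ Suc M) (at s0)"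
    proof eventually_elim
      case (elim s)
      have "s powi int (a + i) / s = s ^ (a + i - 1)"
        using elim a unfolding power_int_of_nat by (cases "a + i") auto
      moreover have "(s * Z$1$1 + Z$2$1) powi (- int (Suc M)) = 1 / (Z$1$1 ^ Suc M * (s - s0) ^ Suc M)"
        unfolding s by (simp only: power_int_minus power_int_of_nat power_mult_distrib inverse_eq_divide)
      moreover have "(s * Z$1$2 + Z$2$2) powi int j = (\<Sum>h\<le>j. of_nat (j choose h) * Z$2$2 ^ h * (s * Z$1$2) ^ (j - h))"
        by (simp only: power_int_of_nat) (subst add.commute, rule binomial_ring)
      ultimately have "tau_integrand (- real a / 2) (real i + real a / 2) (real j + real a / 2) Z s =
        1 / (Z$1$1 ^ Suc M * (s - s0) ^ Suc M) * (\<Sum>h\<le>j. of_nat (j choose h) * Z$2$2 ^ h * (s * Z$1$2) ^ (j - h)) * s ^ (a + i - 1)"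
        unfolding tau_integrand_def fl by (simp only: times_divide_eq_right[symmetric])
      also have "\<dots> = (\<Sum>h\<le>j. (of_nat (j choose h) * Z$2$2 ^ h * (s * Z$1$2) ^ (j - h)) * s ^ (a + i - 1) / Z$1$1 ^ Suc M) / (s - s0) ^ Suc M"
        by (simp add: sum_distrib_right sum_divide_distrib)
      also have "(\<Sum>h\<le>j. (of_nat (j choose h) * Z$2$2 ^ h * (s * Z$1$2) ^ (j - h)) * s ^ (a + i - 1) / Z$1$1 ^ Suc M) = (\<Sum>h\<le>j. c h * s ^ e h)"
        unfolding c_def e_def power_add by (intro sum.cong refl) (simp add: power_mult_distrib)
      finally show ?case .
    qed
  qed simp
  also have "\<dots> = (deriv ^^ M) (\<lambda>s. \<Sum>h\<in>{..j}. c h * s ^ e h) s0 / fact M"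
    by (rule residue_holomorphic_over_power[of UNIV]) (auto intro!: holomorphic_intros)
  also have "\<dots> = (\<Sum>h\<le>j. c h * (of_nat (e h choose M) * s0 ^ (e h - M)))"
    by (subst higher_deriv_powers_sum) (simp_all add: sum_divide_distrib)
  also have "\<dots> = (\<Sum>h\<in>{..min i j}. c h * (of_nat (e h choose M) * s0 ^ (e h - M)))"
  proof (rule sum.mono_neutral_right)
    show "\<forall>h\<in>{..j} - {..min i j}. c h * (of_nat (e h choose M) * s0 ^ (e h - M)) = 0"
    proof
      fix h assume "h \<in> {..j} - {..min i j}"
      hence "e h < M" using a by (auto simp: e_def M_def)
      thus "c h * (of_nat (e h choose M) * s0 ^ (e h - M)) = 0" by (simp add: binomial_eq_0)
    qed
  qed auto
  also have "\<dots> = (\<Sum>k\<in>{..min i j}. of_nat (j choose k) * Z$2$2 ^ k * Z$1$2 ^ (j - k) *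
    (of_nat ((a + j - 1 + (i - k)) choose (i - k)) * (- Z$2$1) ^ (i - k) / Z$1$1 ^ (a + j + (i - k))))"
  proof (intro sum.cong refl)
    fix k assume "k \<in> {..min i j}"
    hence k: "k \<le> i" "k \<le> j" by auto
    have 1: "e k = M + (i - k)" using k a by (simp add: e_def M_def)
    have 2: "(M + (i - k)) choose M = (a + j - 1 + (i - k)) choose (i - k)"
      using binomial_symmetric[of "i - k" "a + j - 1 + (i - k)"] by (simp add: M_def)
    have 3: "(- Z$2$1 / Z$1$1) ^ (i - k) = (- Z$2$1) ^ (i - k) / Z$1$1 ^ (i - k)" by (rule power_divide)
    show "c k * (of_nat (e k choose M) * s0 ^ (e k - M)) = of_nat (j choose k) * Z$2$2 ^ k * Z$1$2 ^ (j - k) *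
      (of_nat ((a + j - 1 + (i - k)) choose (i - k)) * (- Z$2$1) ^ (i - k) / Z$1$1 ^ (a + j + (i - k)))"
      unfolding 1 2 diff_add_inverse c_def M[symmetric] s0_def 3 by (simp add: power_add)
  qed
  also have "\<dots> = (\<Sum>k\<le>i. of_nat (j choose k) * Z$2$2 ^ k * Z$1$2 ^ (j - k) *
    (of_nat ((a + j - 1 + (i - k)) choose (i - k)) * (- Z$2$1) ^ (i - k) / Z$1$1 ^ (a + j + (i - k))))"
    by (rule sum.mono_neutral_left) (auto simp: binomial_eq_0)
  finally show ?thesis
    using gchoose_neg_nonzero[OF a, of j] by (simp add: Fc_explicit[OF z a])
qed

lemma tau_antihol_eq:
  assumes a: "a \<ge> 1" and z: "Z$2$2 \<noteq> 0"
  shows "tau (- real a / 2) (- (real i + real a / 2)) (- (real j + real a / 2)) Z = Fc a (int i) (int j) (swp Z) / ((- of_nat a) gchoose j)"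
proof -
  have fl: "\<lfloor>- real a / 2 - (- (real j + real a / 2))\<rfloor> = int j" "\<lfloor>- real a / 2 + (- (real j + real a / 2))\<rfloor> = - int (a + j)"
    "\<lfloor>- (- real a / 2) + (- (real i + real a / 2))\<rfloor> = - int i"
  proof -
    have "- real a / 2 - (- (real j + real a / 2)) = of_int (int j)" by simp
    thus "\<lfloor>- real a / 2 - (- (real j + real a / 2))\<rfloor> = int j" by (simp only: floor_of_int)
    have "- real a / 2 + (- (real j + real a / 2)) = of_int (- int (a + j))" by simp
    thus "\<lfloor>- real a / 2 + (- (real j + real a / 2))\<rfloor> = - int (a + j)" by (simp only: floor_of_int)
    have "- (- real a / 2) + (- (real i + real a / 2)) = of_int (- int i)" by simp
    thus "\<lfloor>- (- real a / 2) + (- (real i + real a / 2))\<rfloor> = - int i" by (simp only: floor_of_int)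
  qed
  define f where "f s = (Z$2$1 + Z$1$1 * s) ^ j * inverse (Z$2$2 + Z$1$2 * s) ^ (a + j)" for s
  have fexp: "f has_fps_expansion (pol2 (swp Z) ^ j * inverse (pol1 (swp Z)) ^ (a + j))"
    unfolding f_def pol1_def pol2_def swp_nth
    by (intro fps_expansion_intros) (use z in auto)
  obtain S where S: "open S" "0 \<in> S" "f holomorphic_on S"
  proof -
    have "f holomorphic_on {s. Z$2$2 + Z$1$2 * s \<noteq> 0}"
      unfolding f_def by (intro holomorphic_intros) auto
    moreover have "open {s. Z$2$2 + Z$1$2 * s \<noteq> 0}"
      by (intro open_Collect_neq continuous_intros)
    ultimately show ?thesis using z by (intro that[of "{s. Z$2$2 + Z$1$2 * s \<noteq> 0}"]) auto
  qed
  have "tau (- real a / 2) (- (real i + real a / 2)) (- (real j + real a / 2)) Z =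
    residue (tau_integrand (- real a / 2) (- (real i + real a / 2)) (- (real j + real a / 2)) Z) 0"
    using a by (simp add: tau_def)
  also have "tau_integrand (- real a / 2) (- (real i + real a / 2)) (- (real j + real a / 2)) Z = (\<lambda>s. f s / (s - 0) ^ Suc i)"
    unfolding tau_integrand_def fl f_def
  proof (rule ext)
    fix s
    have e: "s * Z$1$1 + Z$2$1 = Z$2$1 + Z$1$1 * s" "s * Z$1$2 + Z$2$2 = Z$2$2 + Z$1$2 * s" by simp_all
    show "(s * Z$1$1 + Z$2$1) powi int j * (s * Z$1$2 + Z$2$2) powi - int (a + j) * s powi - int i / s =
      (Z$2$1 + Z$1$1 * s) ^ j * inverse (Z$2$2 + Z$1$2 * s) ^ (a + j) / (s - 0) ^ Suc i"
      unfolding e power_int_minus power_int_of_nat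
      by (simp only: power_inverse divide_inverse diff_0_right power_Suc inverse_mult_distrib mult_ac)
  qed
  also have "residue (\<lambda>s. f s / (s - 0) ^ Suc i) 0 = (deriv ^^ i) f 0 / fact i"
    by (rule residue_holomorphic_over_power[OF S])
  also have "\<dots> = fps_nth (pol2 (swp Z) ^ j * inverse (pol1 (swp Z)) ^ (a + j)) i"
    using fps_nth_fps_expansion[OF fexp, of i] by simp
  also have "\<dots> = Fc a (int i) (int j) (swp Z) / ((- of_nat a) gchoose j)"
    using gchoose_neg_nonzero[OF a, of j] by (simp add: Fc_def Fg_def)
  finally show ?thesis .
qed


lemma Fc_Zd:
  assumes z: "Z$1$1 \<noteq> 0" and a: "a \<noteq> 0"
  shows "Z$1$1 * Fc (Suc a) i j Z + Z$1$2 * Fc (Suc a) i (j - 1) Z = (1 + of_int i / of_nat a) * Fc a i j Z"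
proof -
  have s: "of_int i * Fc a i j Z = - of_nat a * (Z$2$1 * Fc (Suc a) (i - 1) j Z + Z$2$2 * Fc (Suc a) (i - 1) (j - 1) Z)"
    using Fc_S[OF z, of "i - 1" a j] by simp
  have "of_nat a * (Z$1$1 * Fc (Suc a) i j Z + Z$1$2 * Fc (Suc a) i (j - 1) Z)
    = of_nat a * Fc a i j Z - of_nat a * (Z$2$1 * Fc (Suc a) (i - 1) j Z + Z$2$2 * Fc (Suc a) (i - 1) (j - 1) Z)"
    by (subst Fc_rec[OF z, symmetric]) (simp add: algebra_simps)
  also have "\<dots> = of_nat a * Fc a i j Z + of_int i * Fc a i j Z" unfolding s by simp
  finally show ?thesis using a by (simp add: field_simps)
qed

lemma Fc_dZ:
  assumes z: "Z$1$1 \<noteq> 0" and a: "a \<noteq> 0"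
  shows "Z$1$1 * Fc (Suc a) i j Z + Z$2$1 * Fc (Suc a) (i - 1) j Z = (1 + of_int j / of_nat a) * Fc a i j Z"
proof -
  have s: "of_int j * Fc a i j Z = - of_nat a * (Z$1$2 * Fc (Suc a) i (j - 1) Z + Z$2$2 * Fc (Suc a) (i - 1) (j - 1) Z)"
    using Fc_T[OF z, of "j - 1" a i] by simp
  have "of_nat a * (Z$1$1 * Fc (Suc a) i j Z + Z$2$1 * Fc (Suc a) (i - 1) j Z)
    = of_nat a * Fc a i j Z - of_nat a * (Z$1$2 * Fc (Suc a) i (j - 1) Z + Z$2$2 * Fc (Suc a) (i - 1) (j - 1) Z)"
    by (subst Fc_rec[OF z, symmetric]) (simp add: algebra_simps)
  also have "\<dots> = of_nat a * Fc a i j Z + of_int j * Fc a i j Z" unfolding s by simp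
  finally show ?thesis using a by (simp add: field_simps)
qed

definition phi :: "nat \<Rightarrow> int \<Rightarrow> int \<Rightarrow> int \<Rightarrow> HC \<Rightarrow> complex" where
  "phi a i j k Z = Fc a i j Z * det Z powi k"

definition unit2 :: "2 \<Rightarrow> 2 \<Rightarrow> HC" where "unit2 p q = (\<chi> a b. if a = p \<and> b = q then 1 else 0)"

lemma phi_deriv:
  assumes z: "Z$1$1 \<noteq> 0" and N: "det Z \<noteq> 0"
  shows "((\<lambda>t. phi a i j k (Z + (\<chi> x y. if x = p \<and> y = q then t else 0))) has_field_derivative
    - of_nat a * (unit2 p q$1$1 * Fc (Suc a) i j Z + unit2 p q$2$1 * Fc (Suc a) (i - 1) j Z + unit2 p q$1$2 * Fc (Suc a) i (j - 1) Z
      + unit2 p q$2$2 * Fc (Suc a) (i - 1) (j - 1) Z) * det Z powi k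
    + of_int k * det Z powi (k - 1) * (unit2 p q$1$1 * Z$2$2 + unit2 p q$2$2 * Z$1$1 - unit2 p q$1$2 * Z$2$1 - unit2 p q$2$1 * Z$1$2) * Fc a i j Z) (at 0)"
proof -
  define Zf where "Zf t = Z + (\<chi> x y. if x = p \<and> y = q then t else (0::complex))" for t
  have Zf0: "Zf 0 = Z" by (simp add: Zf_def vec_eq_iff)
  have e: "((\<lambda>t. Zf t $ x $ y) has_field_derivative unit2 p q $ x $ y) (at t)" for x y t
    by (auto simp: Zf_def unit2_def intro!: derivative_eq_intros)
  have F: "((\<lambda>t. Fc a i j (Zf t)) has_field_derivative - of_nat a * (unit2 p q$1$1 * Fc (Suc a) i j (Zf 0) + unit2 p q$2$1 * Fc (Suc a) (i - 1) j (Zf 0) + unit2 p q$1$2 * Fc (Suc a) i (j - 1) (Zf 0)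
      + unit2 p q$2$2 * Fc (Suc a) (i - 1) (j - 1) (Zf 0))) (at 0)"
    by (rule Fc_has_derivative[OF e]) (simp add: Zf0 z)
  have D: "((\<lambda>t. det (Zf t)) has_field_derivative (unit2 p q$1$1 * Z$2$2 + unit2 p q$2$2 * Z$1$1 - unit2 p q$1$2 * Z$2$1 - unit2 p q$2$1 * Z$1$2)) (at 0)"
    unfolding det_2 by (auto intro!: derivative_eq_intros e simp: Zf0)
  have P: "((\<lambda>t. det (Zf t) powi k) has_field_derivative
     of_int k * det Z powi (k - 1) * (unit2 p q$1$1 * Z$2$2 + unit2 p q$2$2 * Z$1$1 - unit2 p q$1$2 * Z$2$1 - unit2 p q$2$1 * Z$1$2)) (at 0)"
    using DERIV_power_int[OF D, of k] N by (simp add: Zf0)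
  show ?thesis
    unfolding phi_def Zf_def[symmetric]
    by (rule DERIV_cong[OF DERIV_mult[OF F P]]) (simp add: Zf0 algebra_simps)
qed

lemma unit2_nth [simp]:
  "unit2 1 1 $ 1 $ 1 = 1" "unit2 1 1 $ 1 $ 2 = 0" "unit2 1 1 $ 2 $ 1 = 0" "unit2 1 1 $ 2 $ 2 = 0"
  "unit2 1 2 $ 1 $ 1 = 0" "unit2 1 2 $ 1 $ 2 = 1" "unit2 1 2 $ 2 $ 1 = 0" "unit2 1 2 $ 2 $ 2 = 0"
  "unit2 2 1 $ 1 $ 1 = 0" "unit2 2 1 $ 1 $ 2 = 0" "unit2 2 1 $ 2 $ 1 = 1" "unit2 2 1 $ 2 $ 2 = 0"
  "unit2 2 2 $ 1 $ 1 = 0" "unit2 2 2 $ 1 $ 2 = 0" "unit2 2 2 $ 2 $ 1 = 0" "unit2 2 2 $ 2 $ 2 = 1"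
  by (simp_all add: unit2_def)

context
  fixes Z :: HC and i j k :: int and d :: nat
  assumes z: "Z$1$1 \<noteq> 0" and N: "det Z \<noteq> 0" and d: "d \<noteq> 0"
begin

abbreviation (input) "ph \<equiv> phi (Suc d) i j k"
abbreviation (input) "Zd \<equiv> Z ** dmat ph Z"
abbreviation (input) "dZ \<equiv> dmat ph Z ** Z"
abbreviation (input) "ZdZ \<equiv> Z ** dmat ph Z ** Z + mat (2 * ph Z) ** Z"

lemma powi_N: "det Z powi (k - 1) = det Z powi k / det Z" "det Z powi (k + 1) = det Z powi k * det Z"
  using N by (simp_all add: power_int_diff power_int_add)

lemma pd_raw:
  "pd 1 1 ph Z = (- of_nat (Suc d) * Fc (Suc (Suc d)) i j Z + of_int k * (Z$2$2 * Fc (Suc d) i j Z) / det Z) * det Z powi k"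
  "pd 2 1 ph Z = (- of_nat (Suc d) * Fc (Suc (Suc d)) (i - 1) j Z - of_int k * (Z$1$2 * Fc (Suc d) i j Z) / det Z) * det Z powi k"
  "pd 1 2 ph Z = (- of_nat (Suc d) * Fc (Suc (Suc d)) i (j - 1) Z - of_int k * (Z$2$1 * Fc (Suc d) i j Z) / det Z) * det Z powi k"
  "pd 2 2 ph Z = (- of_nat (Suc d) * Fc (Suc (Suc d)) (i - 1) (j - 1) Z + of_int k * (Z$1$1 * Fc (Suc d) i j Z) / det Z) * det Z powi k"
  unfolding pd_def phi_deriv[OF z N, THEN DERIV_imp_deriv] unit2_nth powi_N using N
  by (simp_all add: field_simps)

lemma pd_phi:
  "pd 1 1 ph Z = (of_nat d + 1) * (of_int k - of_nat d) / of_nat d * phi (Suc (Suc d)) i j k Z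
     + of_int k * (of_int i + 1) * (of_int j + 1) / of_nat d ^ 2 * phi d (i + 1) (j + 1) (k - 1) Z"
  "pd 2 1 ph Z = (of_nat d + 1) * (of_int k - of_nat d) / of_nat d * phi (Suc (Suc d)) (i - 1) j k Z
     + of_int k * (of_int j + 1) * (of_int i + of_nat d) / of_nat d ^ 2 * phi d i (j + 1) (k - 1) Z"
  "pd 1 2 ph Z = (of_nat d + 1) * (of_int k - of_nat d) / of_nat d * phi (Suc (Suc d)) i (j - 1) k Z
     + of_int k * (of_int i + 1) * (of_int j + of_nat d) / of_nat d ^ 2 * phi d (i + 1) j (k - 1) Z"
  "pd 2 2 ph Z = (of_nat d + 1) * (of_int k - of_nat d) / of_nat d * phi (Suc (Suc d)) (i - 1) (j - 1) k Z
     + of_int k * (of_int i + of_nat d) * (of_int j + of_nat d) / of_nat d ^ 2 * phi d i j (k - 1) Z"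
  unfolding pd_raw phi_def powi_N Fc_M22[OF z d] Fc_M12[OF z d] Fc_M21[OF z d] Fc_M11[OF z d]
  using N d by (simp_all add: field_simps power2_eq_square)

lemma Zd_phi:
  "(Z ** dmat (ph) Z) $ 1 $ 1 = (- (of_nat d + 1 + of_int i) + of_int k) * ph Z"
  "(Z ** dmat (ph) Z) $ 1 $ 2 = - (of_nat d + of_int i) * phi (Suc d) (i - 1) j k Z"
  "(Z ** dmat (ph) Z) $ 2 $ 1 = (of_int i + 1) * phi (Suc d) (i + 1) j k Z"
  "(Z ** dmat (ph) Z) $ 2 $ 2 = (of_int i + of_int k) * ph Z"
proof -
  have D: "det Z = Z$1$1 * Z$2$2 - Z$1$2 * Z$2$1" by (rule det_2)
  have S: "Suc d \<noteq> 0" by simp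
  have e1: "Z$1$1 * Fc (Suc (Suc d)) i j Z + Z$1$2 * Fc (Suc (Suc d)) i (j - 1) Z = (1 + of_int i / of_nat (Suc d)) * Fc (Suc d) i j Z" for i
    by (rule Fc_Zd[OF z S])
  have e2: "(of_int i + 1) * Fc (Suc d) (i + 1) j Z = - of_nat (Suc d) * (Z$2$1 * Fc (Suc (Suc d)) i j Z + Z$2$2 * Fc (Suc (Suc d)) i (j - 1) Z)" for i
    by (rule Fc_S[OF z])
  have c: "of_nat (Suc d) * (1 + x / of_nat (Suc d)) = of_nat d + 1 + (x::complex)" for x
  proof -
    have "(of_nat (Suc d) :: complex) \<noteq> 0" by (simp only: of_nat_eq_0_iff)
    thus ?thesis by (simp add: distrib_left del: of_nat_Suc) (simp add: add_ac)
  qed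
  have "(Z ** dmat (ph) Z) $ 1 $ 1 = (- of_nat (Suc d) * (Z$1$1 * Fc (Suc (Suc d)) i j Z + Z$1$2 * Fc (Suc (Suc d)) i (j - 1) Z)
     + of_int k * (det Z * Fc (Suc d) i j Z) / det Z) * det Z powi k"
    unfolding mat_mult_nth dmat_def mat2_nth pd_raw D by (simp add: algebra_simps add_divide_distrib diff_divide_distrib)
  thus "(Z ** dmat (ph) Z) $ 1 $ 1 = (- (of_nat d + 1 + of_int i) + of_int k) * ph Z"
    unfolding e1 using c[of "of_int i"] N by (simp add: phi_def algebra_simps del: of_nat_Suc)
  have "(Z ** dmat (ph) Z) $ 1 $ 2 = (- of_nat (Suc d) * (Z$1$1 * Fc (Suc (Suc d)) (i - 1) j Z + Z$1$2 * Fc (Suc (Suc d)) (i - 1) (j - 1) Z)) * det Z powi k"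
    unfolding mat_mult_nth dmat_def mat2_nth pd_raw by (simp add: algebra_simps)
  also have "\<dots> = - (of_nat (Suc d) * (1 + of_int (i - 1) / of_nat (Suc d))) * (Fc (Suc d) (i - 1) j Z * det Z powi k)"
    unfolding e1 by (simp only: mult_minus_left mult.assoc)
  also have "\<dots> = - (of_nat d + of_int i) * phi (Suc d) (i - 1) j k Z"
    unfolding c phi_def by simp
  finally show "(Z ** dmat (ph) Z) $ 1 $ 2 = - (of_nat d + of_int i) * phi (Suc d) (i - 1) j k Z" .
  have "(Z ** dmat (ph) Z) $ 2 $ 1 = (- of_nat (Suc d) * (Z$2$1 * Fc (Suc (Suc d)) i j Z + Z$2$2 * Fc (Suc (Suc d)) i (j - 1) Z)) * det Z powi k"
    unfolding mat_mult_nth dmat_def mat2_nth pd_raw by (simp add: algebra_simps)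
  thus "(Z ** dmat (ph) Z) $ 2 $ 1 = (of_int i + 1) * phi (Suc d) (i + 1) j k Z"
    unfolding e2[symmetric] by (simp add: phi_def)
  have "(Z ** dmat (ph) Z) $ 2 $ 2 = (- of_nat (Suc d) * (Z$2$1 * Fc (Suc (Suc d)) (i - 1) j Z + Z$2$2 * Fc (Suc (Suc d)) (i - 1) (j - 1) Z)
     + of_int k * (det Z * Fc (Suc d) i j Z) / det Z) * det Z powi k"
    unfolding mat_mult_nth dmat_def mat2_nth pd_raw D by (simp add: algebra_simps add_divide_distrib diff_divide_distrib)
  thus "(Z ** dmat (ph) Z) $ 2 $ 2 = (of_int i + of_int k) * ph Z"
    unfolding e2[symmetric] using N by (simp add: phi_def algebra_simps)
qed

lemma dZ_phi:
  "(dmat (ph) Z ** Z) $ 1 $ 1 = (- (of_nat d + 1 + of_int j) + of_int k) * ph Z"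
  "(dmat (ph) Z ** Z) $ 1 $ 2 = (of_int j + 1) * phi (Suc d) i (j + 1) k Z"
  "(dmat (ph) Z ** Z) $ 2 $ 1 = - (of_nat d + of_int j) * phi (Suc d) i (j - 1) k Z"
  "(dmat (ph) Z ** Z) $ 2 $ 2 = (of_int j + of_int k) * ph Z"
proof -
  have D: "det Z = Z$1$1 * Z$2$2 - Z$1$2 * Z$2$1" by (rule det_2)
  have S: "Suc d \<noteq> 0" by simp
  have e1: "Z$1$1 * Fc (Suc (Suc d)) i j Z + Z$2$1 * Fc (Suc (Suc d)) (i - 1) j Z = (1 + of_int j / of_nat (Suc d)) * Fc (Suc d) i j Z" for j
    by (rule Fc_dZ[OF z S])
  have e2: "(of_int j + 1) * Fc (Suc d) i (j + 1) Z = - of_nat (Suc d) * (Z$1$2 * Fc (Suc (Suc d)) i j Z + Z$2$2 * Fc (Suc (Suc d)) (i - 1) j Z)" for j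
    by (rule Fc_T[OF z])
  have c: "of_nat (Suc d) * (1 + x / of_nat (Suc d)) = of_nat d + 1 + (x::complex)" for x
  proof -
    have "(of_nat (Suc d) :: complex) \<noteq> 0" by (simp only: of_nat_eq_0_iff)
    thus ?thesis by (simp add: distrib_left del: of_nat_Suc) (simp add: add_ac)
  qed
  have "(dmat (ph) Z ** Z) $ 1 $ 1 = (- of_nat (Suc d) * (Z$1$1 * Fc (Suc (Suc d)) i j Z + Z$2$1 * Fc (Suc (Suc d)) (i - 1) j Z)
     + of_int k * (det Z * Fc (Suc d) i j Z) / det Z) * det Z powi k"
    unfolding mat_mult_nth dmat_def mat2_nth pd_raw D by (simp add: algebra_simps add_divide_distrib diff_divide_distrib)
  thus "(dmat (ph) Z ** Z) $ 1 $ 1 = (- (of_nat d + 1 + of_int j) + of_int k) * ph Z"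
    unfolding e1 using c[of "of_int j"] N by (simp add: phi_def algebra_simps del: of_nat_Suc)
  have "(dmat (ph) Z ** Z) $ 2 $ 1 = (- of_nat (Suc d) * (Z$1$1 * Fc (Suc (Suc d)) i (j - 1) Z + Z$2$1 * Fc (Suc (Suc d)) (i - 1) (j - 1) Z)) * det Z powi k"
    unfolding mat_mult_nth dmat_def mat2_nth pd_raw by (simp add: algebra_simps)
  also have "\<dots> = - (of_nat (Suc d) * (1 + of_int (j - 1) / of_nat (Suc d))) * (Fc (Suc d) i (j - 1) Z * det Z powi k)"
    unfolding e1 by (simp only: mult_minus_left mult.assoc)
  also have "\<dots> = - (of_nat d + of_int j) * phi (Suc d) i (j - 1) k Z"
    unfolding c phi_def by simp
  finally show "(dmat (ph) Z ** Z) $ 2 $ 1 = - (of_nat d + of_int j) * phi (Suc d) i (j - 1) k Z" .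
  have "(dmat (ph) Z ** Z) $ 1 $ 2 = (- of_nat (Suc d) * (Z$1$2 * Fc (Suc (Suc d)) i j Z + Z$2$2 * Fc (Suc (Suc d)) (i - 1) j Z)) * det Z powi k"
    unfolding mat_mult_nth dmat_def mat2_nth pd_raw by (simp add: algebra_simps)
  thus "(dmat (ph) Z ** Z) $ 1 $ 2 = (of_int j + 1) * phi (Suc d) i (j + 1) k Z"
    unfolding e2[symmetric] by (simp add: phi_def)
  have "(dmat (ph) Z ** Z) $ 2 $ 2 = (- of_nat (Suc d) * (Z$1$2 * Fc (Suc (Suc d)) i (j - 1) Z + Z$2$2 * Fc (Suc (Suc d)) (i - 1) (j - 1) Z)
     + of_int k * (det Z * Fc (Suc d) i j Z) / det Z) * det Z powi k"
    unfolding mat_mult_nth dmat_def mat2_nth pd_raw D by (simp add: algebra_simps add_divide_distrib diff_divide_distrib)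
  also have "\<dots> = (of_int j * Fc (Suc d) i j Z + of_int k * Fc (Suc d) i j Z) * det Z powi k"
  proof -
    have "of_int j * Fc (Suc d) i j Z = - of_nat (Suc d) * (Z$1$2 * Fc (Suc (Suc d)) i (j - 1) Z + Z$2$2 * Fc (Suc (Suc d)) (i - 1) (j - 1) Z)"
    using e2[of "j - 1"] by simp
    thus ?thesis using N by simp
  qed
  finally show "(dmat (ph) Z ** Z) $ 2 $ 2 = (of_int j + of_int k) * ph Z"
    by (simp add: phi_def algebra_simps)
qed

lemma ZdZ_phi:
  "(Z ** dmat (ph) Z ** Z + mat (2 * ph Z) ** Z) $ 1 $ 1 =
     (of_int k + 1 - of_nat d) * (of_int i + of_nat d) * (of_int j + of_nat d) / of_nat d ^ 2 * phi d i j k Z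
     + (of_nat d + 1) / of_nat d * (of_int k + 1) * phi (Suc (Suc d)) (i - 1) (j - 1) (k + 1) Z"
  "(Z ** dmat (ph) Z ** Z + mat (2 * ph Z) ** Z) $ 1 $ 2 =
     - (of_int k + 1 - of_nat d) * (of_int i + of_nat d) * (of_int j + 1) / of_nat d ^ 2 * phi d i (j + 1) k Z
     - (of_nat d + 1) / of_nat d * (of_int k + 1) * phi (Suc (Suc d)) (i - 1) j (k + 1) Z"
  "(Z ** dmat (ph) Z ** Z + mat (2 * ph Z) ** Z) $ 2 $ 1 =
     - (of_int k + 1 - of_nat d) * (of_int i + 1) * (of_int j + of_nat d) / of_nat d ^ 2 * phi d (i + 1) j k Z
     - (of_nat d + 1) / of_nat d * (of_int k + 1) * phi (Suc (Suc d)) i (j - 1) (k + 1) Z"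
  "(Z ** dmat (ph) Z ** Z + mat (2 * ph Z) ** Z) $ 2 $ 2 =
     (of_int k + 1 - of_nat d) * (of_int i + 1) * (of_int j + 1) / of_nat d ^ 2 * phi d (i + 1) (j + 1) k Z
     + (of_nat d + 1) / of_nat d * (of_int k + 1) * phi (Suc (Suc d)) i j (k + 1) Z"
proof -
  note M = Fc_M22[OF z d] Fc_M12[OF z d] Fc_M21[OF z d] Fc_M11[OF z d]
  have e: "(Z ** dmat (ph) Z ** Z + mat (2 * ph Z) ** Z) $ p $ q =
    (Z ** dmat (ph) Z) $ p $ 1 * Z $ 1 $ q + (Z ** dmat (ph) Z) $ p $ 2 * Z $ 2 $ q + 2 * ph Z * Z $ p $ q" for p q
    using exhaust_2[of p] by (auto simp: mat_mult_nth[of "Z ** dmat (ph) Z" Z])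
  show "(Z ** dmat (ph) Z ** Z + mat (2 * ph Z) ** Z) $ 1 $ 1 =
     (of_int k + 1 - of_nat d) * (of_int i + of_nat d) * (of_int j + of_nat d) / of_nat d ^ 2 * phi d i j k Z
     + (of_nat d + 1) / of_nat d * (of_int k + 1) * phi (Suc (Suc d)) (i - 1) (j - 1) (k + 1) Z"
  proof -
    have "(Z ** dmat (ph) Z ** Z + mat (2 * ph Z) ** Z) $ 1 $ 1 =
      ((of_int k + 1 - of_nat d - of_int i) * (Z$1$1 * Fc (Suc d) i j Z) - (of_nat d + of_int i) * (Z$2$1 * Fc (Suc d) (i - 1) j Z)) * det Z powi k"
      unfolding e Zd_phi by (simp add: phi_def algebra_simps)
    also have "\<dots> = (of_int k + 1 - of_nat d) * (of_int i + of_nat d) * (of_int j + of_nat d) / of_nat d ^ 2 * phi d i j k Z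
     + (of_nat d + 1) / of_nat d * (of_int k + 1) * phi (Suc (Suc d)) (i - 1) (j - 1) (k + 1) Z"
      unfolding M phi_def powi_N using d by (simp add: field_simps power2_eq_square)
    finally show ?thesis .
  qed
  show "(Z ** dmat (ph) Z ** Z + mat (2 * ph Z) ** Z) $ 1 $ 2 =
     - (of_int k + 1 - of_nat d) * (of_int i + of_nat d) * (of_int j + 1) / of_nat d ^ 2 * phi d i (j + 1) k Z
     - (of_nat d + 1) / of_nat d * (of_int k + 1) * phi (Suc (Suc d)) (i - 1) j (k + 1) Z"
  proof -
    have "(Z ** dmat (ph) Z ** Z + mat (2 * ph Z) ** Z) $ 1 $ 2 =
      ((of_int k + 1 - of_nat d - of_int i) * (Z$1$2 * Fc (Suc d) i j Z) - (of_nat d + of_int i) * (Z$2$2 * Fc (Suc d) (i - 1) j Z)) * det Z powi k"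
      unfolding e Zd_phi by (simp add: phi_def algebra_simps)
    also have "\<dots> = - (of_int k + 1 - of_nat d) * (of_int i + of_nat d) * (of_int j + 1) / of_nat d ^ 2 * phi d i (j + 1) k Z
     - (of_nat d + 1) / of_nat d * (of_int k + 1) * phi (Suc (Suc d)) (i - 1) j (k + 1) Z"
      unfolding M phi_def powi_N using d by (simp add: field_simps power2_eq_square)
    finally show ?thesis .
  qed
  show "(Z ** dmat (ph) Z ** Z + mat (2 * ph Z) ** Z) $ 2 $ 1 =
     - (of_int k + 1 - of_nat d) * (of_int i + 1) * (of_int j + of_nat d) / of_nat d ^ 2 * phi d (i + 1) j k Z
     - (of_nat d + 1) / of_nat d * (of_int k + 1) * phi (Suc (Suc d)) i (j - 1) (k + 1) Z"
  proof -
    have "(Z ** dmat (ph) Z ** Z + mat (2 * ph Z) ** Z) $ 2 $ 1 =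
      ((of_int i + 1) * (Z$1$1 * Fc (Suc d) (i + 1) j Z) + (of_int i + of_int k + 2) * (Z$2$1 * Fc (Suc d) i j Z)) * det Z powi k"
      unfolding e Zd_phi by (simp add: phi_def algebra_simps)
    also have "\<dots> = - (of_int k + 1 - of_nat d) * (of_int i + 1) * (of_int j + of_nat d) / of_nat d ^ 2 * phi d (i + 1) j k Z
     - (of_nat d + 1) / of_nat d * (of_int k + 1) * phi (Suc (Suc d)) i (j - 1) (k + 1) Z"
      unfolding M phi_def powi_N using d by (simp add: field_simps power2_eq_square)
    finally show ?thesis .
  qed
  show "(Z ** dmat (ph) Z ** Z + mat (2 * ph Z) ** Z) $ 2 $ 2 =
     (of_int k + 1 - of_nat d) * (of_int i + 1) * (of_int j + 1) / of_nat d ^ 2 * phi d (i + 1) (j + 1) k Z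
     + (of_nat d + 1) / of_nat d * (of_int k + 1) * phi (Suc (Suc d)) i j (k + 1) Z"
  proof -
    have "(Z ** dmat (ph) Z ** Z + mat (2 * ph Z) ** Z) $ 2 $ 2 =
      ((of_int i + 1) * (Z$1$2 * Fc (Suc d) (i + 1) j Z) + (of_int i + of_int k + 2) * (Z$2$2 * Fc (Suc d) i j Z)) * det Z powi k"
      unfolding e Zd_phi by (simp add: phi_def algebra_simps)
    also have "\<dots> = (of_int k + 1 - of_nat d) * (of_int i + 1) * (of_int j + 1) / of_nat d ^ 2 * phi d (i + 1) (j + 1) k Z
     + (of_nat d + 1) / of_nat d * (of_int k + 1) * phi (Suc (Suc d)) i j (k + 1) Z"
      unfolding M phi_def powi_N using d by (simp add: field_simps power2_eq_square)
    finally show ?thesis .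
  qed
qed

end

type_synonym bidx = "bool \<times> nat \<times> nat \<times> nat \<times> int"

definition eb :: "bidx \<Rightarrow> HC \<Rightarrow> complex" where
  "eb = (\<lambda>(\<sigma>, a, i, j, k) Z. (if \<sigma> then phi a (int i) (int j) k Z else phi a (int i) (int j) k (swp Z)))"

definition expo :: "nat \<Rightarrow> bidx \<Rightarrow> int" where
  "expo n = (\<lambda>(\<sigma>, a, i, j, k). if n = 1 then 2 * k - int a
     else if n = 2 then (if \<sigma> then int i + k else k - int a - int i)
     else if n = 3 then (if \<sigma> then int j + k else k - int a - int j) else - k)"

definition test_mat :: "bool \<Rightarrow> complex \<Rightarrow> HC" where
  "test_mat \<sigma> u = (if \<sigma> then mat2 1 1 1 (1 + u) else mat2 (1 + u) 1 1 1)"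

definition gfac :: "bidx \<Rightarrow> complex \<Rightarrow> complex" where
  "gfac = (\<lambda>(\<sigma>, a, i, j, k) u. Fc a (int i) (int j) (test_mat \<sigma> u))"

definition test_point :: "complex \<Rightarrow> complex \<Rightarrow> complex \<Rightarrow> complex \<Rightarrow> HC" where
  "test_point p q r u = mat2 p (p * r) (p * q) (p * q * r * (1 + u))"

lemma det_test_point: "det (test_point p q r u) = p * p * q * r * u"
  by (simp add: test_point_def det_2 algebra_simps)

lemma eb_test_point:
  assumes "p \<noteq> 0" "q \<noteq> 0" "r \<noteq> 0" "1 + u \<noteq> 0"
  shows "eb x (test_point p q r u) = p powi expo 1 x * q powi expo 2 x * r powi expo 3 x * u powi (- expo 4 x) * gfac x u"
proof -
  obtain \<sigma> a i j k where x: "x = (\<sigma>, a, i, j, k)" by (cases x)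
  define e1 where "e1 = 2 * k - int a"
  have pk: "p powi e1 = p powi (- int a) * (p powi k * p powi k)"
  proof -
    have "e1 = - int a + (k + k)" by (simp add: e1_def)
    thus ?thesis by (simp only: power_int_add assms simp_thms)
  qed
  show ?thesis
  proof (cases \<sigma>)
    case True
    have "Fc a (int i) (int j) (test_point p q r u) = p powi (- int a) * q powi int i * r powi int j * Fc a (int i) (int j) (test_mat True u)"
      by (rule Fc_homogeneous) (use assms in \<open>auto simp: test_mat_def test_point_def\<close>)
    moreover have "q powi (int i + k) = q powi int i * q powi k" "r powi (int j + k) = r powi int j * r powi k"
      by (simp_all only: power_int_add assms simp_thms)
    ultimately have "eb x (test_point p q r u) = p powi e1 * q powi (int i + k) * r powi (int j + k) * u powi k * Fc a (int i) (int j) (test_mat True u)"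
      using True by (simp only: x eb_def phi_def prod.case if_True det_test_point power_int_mult_distrib pk mult_ac)
    thus ?thesis using True by (simp add: x expo_def gfac_def e1_def)
  next
    case False
    have "Fc a (int i) (int j) (swp (test_point p q r u)) = (p * q * r) powi (- int a) * (1 / q) powi int i * (1 / r) powi int j * Fc a (int i) (int j) (test_mat False u)"
      by (rule Fc_homogeneous) (use assms in \<open>auto simp: test_mat_def test_point_def\<close>)
    moreover have "q powi (k - int a - int i) = q powi k * q powi (- int a) * (1 / q) powi int i"
      "r powi (k - int a - int j) = r powi k * r powi (- int a) * (1 / r) powi int j"
    proof -
      have e: "k - int a - int n = k + - int a + - int n" for n by simp
      have i: "(1 / z) powi int n = z powi (- int n)" for z :: complex and n by (simp add: power_int_minus power_int_divide_distrib inverse_eq_divide power_one_over)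
      show "q powi (k - int a - int i) = q powi k * q powi (- int a) * (1 / q) powi int i"
        "r powi (k - int a - int j) = r powi k * r powi (- int a) * (1 / r) powi int j"
        unfolding e i by (simp_all only: power_int_add assms simp_thms)
    qed
    ultimately have "eb x (test_point p q r u) = p powi e1 * q powi (k - int a - int i) * r powi (k - int a - int j) * u powi k * Fc a (int i) (int j) (test_mat False u)"
      using False by (simp only: x eb_def phi_def prod.case if_False det_swp det_test_point power_int_mult_distrib pk mult_ac)
    thus ?thesis using False by (simp add: x expo_def gfac_def e1_def)
  qed
qed

lemma gfac_0_nonzero:
  assumes "fst (snd x) \<ge> 1"
  shows "gfac x 0 \<noteq> 0"
proof -
  obtain \<sigma> a i j k where x: "x = (\<sigma>, a, i, j, k)" by (cases x)
  have a: "a \<ge> 1" using assms by (simp add: x)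
  then obtain b where b: "a = Suc b" by (cases a) auto
  define Z :: HC where "Z = mat2 1 1 1 1"
  have t: "test_mat \<sigma> 0 = Z" by (simp add: test_mat_def Z_def)
  have "fps_nth (pol2 Z ^ j * inverse (pol1 Z) ^ (a + j)) i = fps_nth (inverse (pol1 Z) ^ a) i"
  proof -
    have "pol2 Z = pol1 Z" by (simp add: pol1_def pol2_def Z_def)
    moreover have "pol1 Z ^ j * inverse (pol1 Z) ^ j = 1"
      unfolding power_mult_distrib[symmetric] using pol1_inverse[of Z] by (simp add: Z_def)
    ultimately have "pol2 Z ^ j * inverse (pol1 Z) ^ (a + j) = inverse (pol1 Z) ^ a"
      by (simp add: power_add mult_ac) 
    thus ?thesis by simp
  qed
  also have "\<dots> \<noteq> 0" unfolding pol1_def b Z_def mat2_nth by (subst inverse_linear_power_nth) simp_all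
  finally show ?thesis
    using gchoose_neg_nonzero[OF a, of j] by (simp add: x gfac_def t Fc_def Fg_def)
qed

lemma gfac_tendsto:
  assumes "u \<longlonglongrightarrow> 0"
  shows "(\<lambda>n. gfac x (u n)) \<longlonglongrightarrow> gfac x 0"
proof -
  obtain \<sigma> a i j k where x: "x = (\<sigma>, a, i, j, k)" by (cases x)
  define E :: HC where "E = (if \<sigma> then mat2 0 0 0 1 else mat2 1 0 0 0)"
  have d: "((\<lambda>t. test_mat \<sigma> t $ p $ q) has_field_derivative E $ p $ q) (at 0)" for p q
    using exhaust_2[of p] exhaust_2[of q] by (auto simp: test_mat_def E_def intro!: derivative_eq_intros)
  have "isCont (\<lambda>t. Fc a (int i) (int j) (test_mat \<sigma> t)) 0"
    by (rule DERIV_isCont[OF Fc_has_derivative[OF d]]) (simp add: test_mat_def)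
  thus ?thesis using isCont_tendsto_compose[OF _ assms] by (simp add: x gfac_def)
qed

lemma digits_unique:
  fixes X Y e f M :: int
  assumes "X * (2 * M + 1) + e = Y * (2 * M + 1) + f" "\<bar>e\<bar> \<le> M" "\<bar>f\<bar> \<le> M"
  shows "X = Y \<and> e = f"
proof -
  have "(X - Y) * (2 * M + 1) = f - e" using assms(1) by (simp add: algebra_simps)
  hence "\<bar>X - Y\<bar> * (2 * M + 1) = \<bar>f - e\<bar>" using assms(2) by (simp add: abs_mult flip: \<open>(X - Y) * (2 * M + 1) = f - e\<close>)
  moreover have "\<bar>f - e\<bar> < 1 * (2 * M + 1)"
    by (rule le_less_trans[OF order_trans[OF abs_triangle_ineq4 add_mono[OF assms(3) assms(2)]]]) simp
  ultimately have "\<bar>X - Y\<bar> * (2 * M + 1) < 1 * (2 * M + 1)" by simp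
  hence "\<bar>X - Y\<bar> < 1" using assms(2) by (subst (asm) mult_less_cancel_right_pos) auto
  hence "X = Y" by simp
  thus ?thesis using assms(1) by simp
qed

lemma expo_inj:
  assumes "expo 1 x = expo 1 y" "expo 2 x = expo 2 y" "expo 3 x = expo 3 y" "expo 4 x = expo 4 y" "fst (snd x) \<ge> 1" "fst (snd y) \<ge> 1"
  shows "x = y"
  using assms by (cases x; cases y) (auto simp: expo_def split: if_splits)

definition regular_idx :: "bidx set" where "regular_idx = {x. fst (snd x) \<ge> 1}"

text \<open>
  Along the curve below each basis function is asymptotic to a constant times a power of the parameter,
  and for a large base \<open>B\<close> these powers are pairwise different.
\<close>

lemma eb_independent:
  assumes F: "finite F" "F \<subseteq> regular_idx" and z: "\<And>Z. Z \<in> regular_set \<Longrightarrow> (\<Sum>x\<in>F. v x * eb x Z) = 0" and "y \<in> F"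
  shows "v y = 0"
proof (rule ccontr)
  assume "v y \<noteq> 0"
  define F' where "F' = {x\<in>F. v x \<noteq> 0}"
  have "y \<in> F'" using \<open>y \<in> F\<close> \<open>v y \<noteq> 0\<close> by (simp add: F'_def)
  hence F': "finite F'" "F' \<noteq> {}" "F' \<subseteq> F" using F(1) unfolding F'_def by (simp, blast, blast)
  define M where "M = Max ((\<lambda>x. \<bar>expo 1 x\<bar> + \<bar>expo 2 x\<bar> + \<bar>expo 3 x\<bar> + \<bar>expo 4 x\<bar>) ` F')"
  have M: "\<bar>expo 1 x\<bar> + \<bar>expo 2 x\<bar> + \<bar>expo 3 x\<bar> + \<bar>expo 4 x\<bar> \<le> M" if "x \<in> F'" for x
    unfolding M_def using F' that by (intro Max_ge) auto
  define B where "B = 2 * M + 1"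
  define w where "w x = ((expo 1 x * B + expo 2 x) * B + expo 3 x) * B + expo 4 x" for x
  have w: "inj_on w F'"
  proof (rule inj_onI)
    fix x y assume xy: "x \<in> F'" "y \<in> F'" "w x = w y"
    have b: "\<bar>expo 2 x\<bar> \<le> M" "\<bar>expo 2 y\<bar> \<le> M" "\<bar>expo 3 x\<bar> \<le> M" "\<bar>expo 3 y\<bar> \<le> M" "\<bar>expo 4 x\<bar> \<le> M" "\<bar>expo 4 y\<bar> \<le> M"
    proof -
      have "p \<le> M \<and> q \<le> M \<and> r \<le> M" if "n + p + q + r \<le> M" "0 \<le> n" "0 \<le> p" "0 \<le> q" "0 \<le> r" for n p q r
        using that by linarith
      from this[OF M[OF xy(1)] abs_ge_zero abs_ge_zero abs_ge_zero abs_ge_zero] this[OF M[OF xy(2)] abs_ge_zero abs_ge_zero abs_ge_zero abs_ge_zero]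
      show "\<bar>expo 2 x\<bar> \<le> M" "\<bar>expo 2 y\<bar> \<le> M" "\<bar>expo 3 x\<bar> \<le> M" "\<bar>expo 3 y\<bar> \<le> M" "\<bar>expo 4 x\<bar> \<le> M" "\<bar>expo 4 y\<bar> \<le> M" by blast+
    qed
    note d = digits_unique[where M = M, folded B_def]
    have 1: "(expo 1 x * B + expo 2 x) * B + expo 3 x = (expo 1 y * B + expo 2 y) * B + expo 3 y \<and> expo 4 x = expo 4 y"
      using d[OF xy(3)[unfolded w_def] b(5,6)] .
    hence 2: "expo 1 x * B + expo 2 x = expo 1 y * B + expo 2 y \<and> expo 3 x = expo 3 y" using d b(3,4) by blast
    hence "expo 1 x = expo 1 y \<and> expo 2 x = expo 2 y" using d b(1,2) by blast
    moreover have "x \<in> regular_idx" "y \<in> regular_idx" using xy F' F(2) by blast+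
    ultimately show "x = y" using 1 2 by (intro expo_inj) (simp_all add: regular_idx_def)
  qed
  have "Max (w ` F') \<in> w ` F'" using F'(1,2) by (intro Max_in) simp_all
  then obtain mx where "Max (w ` F') = w mx" "mx \<in> F'" by (rule imageE)
  note mx = this(2) this(1)[symmetric]
  have less: "w x < w mx" if "x \<in> F'" "x \<noteq> mx" for x
  proof -
    have "w x \<le> w mx" unfolding mx(2) using F' that by (intro Max_ge) auto
    moreover have "w x \<noteq> w mx" using w that mx(1) by (auto dest: inj_onD)
    ultimately show ?thesis by simp
  qed
  define T where "T n = complex_of_nat (Suc (Suc n))" for n
  have T: "T n \<noteq> 0" for n unfolding T_def by (simp only: of_nat_eq_0_iff)
  have Tinv: "(\<lambda>n. inverse (T n)) \<longlonglongrightarrow> 0"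
  proof -
    have "(\<lambda>n. of_real (inverse (real (Suc n)))) \<longlonglongrightarrow> (of_real 0 :: complex)" by (intro tendsto_of_real LIMSEQ_inverse_real_of_nat)
    from LIMSEQ_Suc[OF this] show ?thesis by (simp add: T_def)
  qed
  have Tpow: "(\<lambda>n. T n powi e) \<longlonglongrightarrow> 0" if "e < 0" for e
  proof -
    have e: "e = - int (nat (- e))" using that by simp
    have "(\<lambda>n. inverse (T n) ^ nat (- e)) \<longlonglongrightarrow> 0 ^ nat (- e)" by (intro tendsto_power Tinv)
    thus ?thesis using that by (subst e) (simp only: power_int_minus power_int_of_nat power_inverse, simp add: power_0_left)
  qed
  define u where "u n = inverse (T n)" for n
  define P where "P n = test_point (T n powi (B ^ 3)) (T n powi (B ^ 2)) (T n powi B) (u n)" for n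
  have u1: "1 + u n \<noteq> 0" for n
  proof -
    have "1 + u n = of_nat (Suc (Suc (Suc n))) / T n" using T[of n] by (simp add: u_def T_def field_simps)
    thus ?thesis using T[of n] by (simp only: divide_eq_0_iff of_nat_eq_0_iff) simp
  qed
  have eb: "eb x (P n) = T n powi w x * gfac x (u n)" for x n
  proof -
    have "eb x (P n) = (T n powi (B ^ 3)) powi expo 1 x * (T n powi (B ^ 2)) powi expo 2 x * (T n powi B) powi expo 3 x * u n powi (- expo 4 x) * gfac x (u n)"
      unfolding P_def using T[of n] u1[of n] by (intro eb_test_point) auto
    also have "u n powi (- expo 4 x) = T n powi expo 4 x"
      unfolding u_def by (simp only: power_int_minus power_int_inverse inverse_inverse_eq)
    also have "(T n powi (B ^ 3)) powi expo 1 x * (T n powi (B ^ 2)) powi expo 2 x * (T n powi B) powi expo 3 x * T n powi expo 4 x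
      = T n powi (B ^ 3 * expo 1 x + B ^ 2 * expo 2 x + B * expo 3 x + expo 4 x)"
      by (simp only: power_int_add power_int_mult T simp_thms)
    also have "B ^ 3 * expo 1 x + B ^ 2 * expo 2 x + B * expo 3 x + expo 4 x = w x"
      by (simp add: w_def power2_eq_square power3_eq_cube algebra_simps)
    finally show ?thesis .
  qed
  have reg: "P n \<in> regular_set" for n
    using T[of n] u1[of n] unfolding regular_set_def P_def mem_Collect_eq det_test_point by (simp add: test_point_def u_def)
  have "(\<Sum>x\<in>F'. v x * (T n powi (w x - w mx) * gfac x (u n))) = 0" for n
  proof -
    have "(\<Sum>x\<in>F'. v x * (T n powi (w x - w mx) * gfac x (u n))) = T n powi (- w mx) * (\<Sum>x\<in>F'. v x * eb x (P n))"
      unfolding sum_distrib_left by (intro sum.cong refl) (simp only: eb diff_conv_add_uminus power_int_add T simp_thms mult_ac)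
    also have "(\<Sum>x\<in>F'. v x * eb x (P n)) = (\<Sum>x\<in>F. v x * eb x (P n))"
      by (rule sum.mono_neutral_left) (use F in \<open>auto simp: F'_def\<close>)
    finally show ?thesis using z[OF reg] by simp
  qed
  moreover have "(\<lambda>n. \<Sum>x\<in>F'. v x * (T n powi (w x - w mx) * gfac x (u n))) \<longlonglongrightarrow> (\<Sum>x\<in>F'. v x * ((if x = mx then 1 else 0) * gfac x 0))"
  proof (intro tendsto_intros gfac_tendsto)
    show "u \<longlonglongrightarrow> 0" using Tinv by (simp add: u_def[abs_def])
    fix x assume x: "x \<in> F'"
    show "(\<lambda>n. T n powi (w x - w mx)) \<longlonglongrightarrow> (if x = mx then 1 else 0)"
      using less[OF x] Tpow[of "w x - w mx"] by (cases "x = mx") auto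
  qed
  ultimately have "(\<Sum>x\<in>F'. v x * ((if x = mx then 1 else 0) * gfac x 0)) = 0"
    using LIMSEQ_unique[OF tendsto_const] by fastforce
  moreover have "(\<Sum>x\<in>F'. v x * ((if x = mx then 1 else 0) * gfac x 0)) = (\<Sum>x\<in>F'. if x = mx then v x * gfac x 0 else 0)"
    by (rule sum.cong) simp_all
  ultimately have "v mx * gfac mx 0 = 0" using F'(1) mx(1) by (simp add: sum.delta)
  moreover have "gfac mx 0 \<noteq> 0" using mx F' F by (intro gfac_0_nonzero) (auto simp: regular_idx_def)
  ultimately show False using mx by (simp add: F'_def)
qed

definition det_type :: "nat \<Rightarrow> int \<Rightarrow> nat" where "det_type a k = (if k < 0 then 0 else if k < int a - 1 then 1 else 2)"

definition cls :: "bidx \<Rightarrow> nat" where "cls = (\<lambda>(\<sigma>, a, i, j, k). (if \<sigma> then 0 else 3) + det_type a k)"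

lemma cls_less: "cls x < 6" by (cases x) (auto simp: cls_def det_type_def)

lemma sum_fun_apply: "(\<Sum>a\<in>t. f a) Z = (\<Sum>a\<in>t. f a Z :: complex)"
  by (induction t rule: infinite_finite_induct) simp_all

lemma cfun_span_image:
  fixes g :: "bidx \<Rightarrow> HC \<Rightarrow> complex"
  assumes "h \<in> cfun.span (g ` A)"
  obtains F v where "finite F" "F \<subseteq> A" "h = (\<lambda>Z. \<Sum>x\<in>F. v x * g x Z)"
proof -
  obtain t r where t: "finite t" "t \<subseteq> g ` A" "h = (\<Sum>a\<in>t. (\<lambda>Z. r a * a Z))"
    using assms unfolding cfun.span_explicit by blast
  obtain F where F: "F \<subseteq> A" "inj_on g F" "t = g ` F" using t(2) subset_image_inj by metis
  have "finite F" using t(1) F finite_image_iff by metis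
  moreover have "h = (\<lambda>Z. \<Sum>x\<in>F. r (g x) * g x Z)"
    unfolding t(3) F(3) sum.reindex[OF F(2)] by (auto simp: fun_eq_iff sum_fun_apply)
  ultimately show ?thesis using that[of F "r \<circ> g"] F by simp
qed

lemma cfun_sum_in_span:
  fixes g :: "bidx \<Rightarrow> HC \<Rightarrow> complex"
  assumes "F \<subseteq> A"
  shows "(\<lambda>Z. \<Sum>x\<in>F. v x * g x Z) \<in> cfun.span (g ` A)"
proof -
  have "(\<Sum>x\<in>F. (\<lambda>Z. v x * g x Z)) \<in> cfun.span (g ` A)"
    using assms by (intro cfun.span_sum cfun.span_scale cfun.span_base) auto
  moreover have "(\<Sum>x\<in>F. (\<lambda>Z. v x * g x Z)) = (\<lambda>Z. \<Sum>x\<in>F. v x * g x Z)" by (auto simp: fun_eq_iff sum_fun_apply)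
  ultimately show ?thesis by simp
qed

definition in_class :: "nat \<Rightarrow> (HC \<Rightarrow> complex) \<Rightarrow> bool" where
  "in_class c h \<longleftrightarrow> (\<exists>h'\<in>cfun.span (eb ` {x\<in>regular_idx. cls x = c}). \<forall>Z\<in>regular_set. h Z = h' Z)"

lemma in_class_zero: "(\<And>Z. Z \<in> regular_set \<Longrightarrow> h Z = 0) \<Longrightarrow> in_class c h"
  unfolding in_class_def by (rule bexI[OF _ cfun.span_zero]) simp

lemma in_class_add: "in_class c f \<Longrightarrow> in_class c g \<Longrightarrow> in_class c (\<lambda>Z. f Z + g Z)"
proof -
  assume "in_class c f" "in_class c g"
  then obtain f' g' where fg: "f' \<in> cfun.span (eb ` {x\<in>regular_idx. cls x = c})" "g' \<in> cfun.span (eb ` {x\<in>regular_idx. cls x = c})"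
    "\<And>Z. Z \<in> regular_set \<Longrightarrow> f Z = f' Z" "\<And>Z. Z \<in> regular_set \<Longrightarrow> g Z = g' Z" unfolding in_class_def by blast
  thus ?thesis unfolding in_class_def by (intro bexI[OF _ cfun.span_add[OF fg(1,2)]]) simp
qed

lemma in_class_scale: "in_class c f \<Longrightarrow> in_class c (\<lambda>Z. r * f Z)"
proof -
  assume "in_class c f"
  then obtain f' where f: "f' \<in> cfun.span (eb ` {x\<in>regular_idx. cls x = c})" "\<And>Z. Z \<in> regular_set \<Longrightarrow> f Z = f' Z" unfolding in_class_def by blast
  thus ?thesis unfolding in_class_def by (intro bexI[OF _ cfun.span_scale[OF f(1), of r]]) simp
qed

lemma in_class_cong: "in_class c f \<Longrightarrow> (\<And>Z. Z \<in> regular_set \<Longrightarrow> f Z = g Z) \<Longrightarrow> in_class c g"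
  unfolding in_class_def by auto

lemma in_class_sum: "(\<And>x. x \<in> F \<Longrightarrow> in_class c (f x)) \<Longrightarrow> in_class c (\<lambda>Z. \<Sum>x\<in>F. f x Z)"
  by (induction F rule: infinite_finite_induct) (auto intro: in_class_zero in_class_add)

lemma in_class_eb: "x \<in> regular_idx \<Longrightarrow> cls x = c \<Longrightarrow> in_class c (eb x)"
  unfolding in_class_def by (intro bexI[of _ "eb x"] cfun.span_base) auto

lemma in_class_direct:
  assumes h: "\<And>c. c < 6 \<Longrightarrow> in_class c (h c)" and z: "\<And>Z. Z \<in> regular_set \<Longrightarrow> (\<Sum>c<6::nat. h c Z) = 0"
    and c: "c < 6" and Z: "Z \<in> regular_set"
  shows "h c Z = 0"
proof -
  have ex: "\<exists>F v. finite F \<and> F \<subseteq> {x\<in>regular_idx. cls x = c} \<and> (\<forall>Z\<in>regular_set. h c Z = (\<Sum>x\<in>F. v x * eb x Z))" if "c < 6" for c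
  proof -
    have "in_class c (h c)" by (rule h[OF that])
    then obtain h' where h': "h' \<in> cfun.span (eb ` {x\<in>regular_idx. cls x = c})" "\<forall>Z\<in>regular_set. h c Z = h' Z"
      unfolding in_class_def by blast
    obtain F v where "finite F" "F \<subseteq> {x\<in>regular_idx. cls x = c}" "h' = (\<lambda>Z. \<Sum>x\<in>F. v x * eb x Z)" using cfun_span_image[OF h'(1)] .
    thus ?thesis using h'(2) by auto
  qed
  have "\<forall>c. \<exists>p. c < 6 \<longrightarrow> finite (fst p) \<and> fst p \<subseteq> {x\<in>regular_idx. cls x = c} \<and> (\<forall>Z\<in>regular_set. h c Z = (\<Sum>x\<in>fst p. snd p x * eb x Z))"
  proof
    fix c
    show "\<exists>p. c < 6 \<longrightarrow> finite (fst p) \<and> fst p \<subseteq> {x\<in>regular_idx. cls x = c} \<and> (\<forall>Z\<in>regular_set. h c Z = (\<Sum>x\<in>fst p. snd p x * eb x Z))"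
    proof (cases "c < 6")
      case True
      from ex[OF True] obtain F v where "finite F \<and> F \<subseteq> {x\<in>regular_idx. cls x = c} \<and> (\<forall>Z\<in>regular_set. h c Z = (\<Sum>x\<in>F. v x * eb x Z))"
        by blast
      hence "c < 6 \<longrightarrow> finite (fst (F, v)) \<and> fst (F, v) \<subseteq> {x\<in>regular_idx. cls x = c} \<and> (\<forall>Z\<in>regular_set. h c Z = (\<Sum>x\<in>fst (F, v). snd (F, v) x * eb x Z))"
        by simp
      thus ?thesis by (rule exI)
    qed simp
  qed
  from choice[OF this] obtain p where p: "\<forall>c<6. finite (fst (p c)) \<and> fst (p c) \<subseteq> {x\<in>regular_idx. cls x = c} \<and> (\<forall>Z\<in>regular_set. h c Z = (\<Sum>x\<in>fst (p c). snd (p c) x * eb x Z))"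
    by blast
  define F v where "F c = fst (p c)" and "v c = snd (p c)" for c
  have F: "finite (F c)" "F c \<subseteq> {x\<in>regular_idx. cls x = c}" "Z \<in> regular_set \<Longrightarrow> h c Z = (\<Sum>x\<in>F c. v c x * eb x Z)" if "c < 6" for c Z
    using p that unfolding F_def v_def by blast+
  have dj: "F b \<inter> F c = {}" if "b < 6" "c < 6" "b \<noteq> c" for b c
    using F(2)[OF that(1)] F(2)[OF that(2)] that(3) by blast
  define G where "G = (\<Union>c<6. F c)"
  have s: "(\<Sum>x\<in>G. v (cls x) x * eb x Z) = 0" if Z: "Z \<in> regular_set" for Z
  proof -
    have "(\<Sum>x\<in>G. v (cls x) x * eb x Z) = (\<Sum>c<6. \<Sum>x\<in>F c. v (cls x) x * eb x Z)"
      unfolding G_def by (rule sum.UNION_disjoint) (simp_all add: F(1) dj)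
    also have "\<dots> = (\<Sum>c<6. h c Z)"
      by (intro sum.cong refl) (use F Z in \<open>auto intro!: sum.cong\<close>)
    finally show ?thesis using z[OF Z] by simp
  qed
  have "v c x = 0" if "x \<in> F c" for x
    using eb_independent[of G "\<lambda>x. v (cls x) x" x] s F c that unfolding G_def by auto
  thus ?thesis using F(3)[OF c Z] by simp
qed

lemma in_class_phi:
  assumes "a \<ge> 1" "\<mu> = 0 \<or> det_type a k = c"
  shows "in_class c (\<lambda>Z. \<mu> * phi a i j k Z)"
proof (cases "\<mu> = 0 \<or> i < 0 \<or> j < 0")
  case True
  thus ?thesis by (intro in_class_zero) (auto simp: phi_def Fc_neg)
next
  case False
  have "in_class c (eb (True, a, nat i, nat j, k))"
    by (rule in_class_eb) (use assms False in \<open>auto simp: regular_idx_def cls_def\<close>)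
  from in_class_scale[OF this, of \<mu>] show ?thesis using False by (simp add: eb_def)
qed

lemma regular_swp: "Z \<in> regular_set \<Longrightarrow> swp Z \<in> regular_set"
  by (auto simp: regular_set_def)

lemma in_class_swp:
  assumes "in_class c h" "c < 3"
  shows "in_class (3 + c) (\<lambda>Z. h (swp Z))"
proof -
  obtain h' where h': "h' \<in> cfun.span (eb ` {x\<in>regular_idx. cls x = c})" "\<forall>Z\<in>regular_set. h Z = h' Z"
    using assms unfolding in_class_def by blast
  obtain F v where F: "finite F" "F \<subseteq> {x\<in>regular_idx. cls x = c}" "h' = (\<lambda>Z. \<Sum>x\<in>F. v x * eb x Z)" using cfun_span_image[OF h'(1)] .
  have "in_class (3 + c) (\<lambda>Z. \<Sum>x\<in>F. v x * eb x (swp Z))"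
  proof (intro in_class_sum in_class_scale)
    fix x assume "x \<in> F"
    hence x: "x \<in> regular_idx" "cls x = c" using F by auto
    obtain \<sigma> a i j k where e: "x = (\<sigma>, a, i, j, k)" by (cases x)
    have "\<sigma>" using x assms(2) by (auto simp: e cls_def split: if_splits)
    hence "(\<lambda>Z. eb x (swp Z)) = eb (False, a, i, j, k)" by (auto simp: eb_def e fun_eq_iff)
    moreover have "in_class (3 + c) (eb (False, a, i, j, k))"
      by (rule in_class_eb) (use x \<open>\<sigma>\<close> in \<open>auto simp: e regular_idx_def cls_def\<close>)
    ultimately show "in_class (3 + c) (\<lambda>Z. eb x (swp Z))" by simp
  qed
  thus ?thesis by (rule in_class_cong) (use h'(2) F(3) regular_swp in auto)
qed

definition rho_entries :: "(HC \<Rightarrow> complex) \<Rightarrow> (HC \<Rightarrow> complex) set" where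
  "rho_entries f = {f} \<union> (\<Union>p. \<Union>q. {\<lambda>Z. (Z ** dmat f Z) $ p $ q, \<lambda>Z. dmat f Z $ p $ q,
     \<lambda>Z. (Z ** dmat f Z ** Z + mat (2 * f Z) ** Z) $ p $ q, \<lambda>Z. (dmat f Z ** Z) $ p $ q})"

lemma rho_entries_phi:
  assumes d: "d \<ge> 1" and h: "h \<in> rho_entries (phi (Suc d) i j k)"
  shows "in_class (det_type (Suc d) k) h"
proof -
  have S: "in_class (det_type (Suc d) k) (\<lambda>Z. \<mu> * phi (Suc d) i j k Z)" for \<mu> i j by (rule in_class_phi) auto
  have U: "in_class (det_type (Suc d) k) (\<lambda>Z. \<mu> * phi (Suc (Suc d)) i j k Z)" if "k = int d \<Longrightarrow> \<mu> = 0" for \<mu> i j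
    by (rule in_class_phi) (use that in \<open>auto simp: det_type_def\<close>)
  have D: "in_class (det_type (Suc d) k) (\<lambda>Z. \<mu> * phi d i j (k - 1) Z)" if "k = 0 \<Longrightarrow> \<mu> = 0" for \<mu> i j
    by (rule in_class_phi) (use d that in \<open>auto simp: det_type_def\<close>)
  have D': "in_class (det_type (Suc d) k) (\<lambda>Z. \<mu> * phi d i j k Z)" if "k + 1 = int d \<Longrightarrow> \<mu> = 0" for \<mu> i j
    by (rule in_class_phi) (use d that in \<open>auto simp: det_type_def\<close>)
  have U': "in_class (det_type (Suc d) k) (\<lambda>Z. \<mu> * phi (Suc (Suc d)) i j (k + 1) Z)" if "k + 1 = 0 \<Longrightarrow> \<mu> = 0" for \<mu> i j
    by (rule in_class_phi) (use that in \<open>auto simp: det_type_def\<close>)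
  have d0: "d \<noteq> 0" using d by simp
  have dm: "in_class (det_type (Suc d) k) (\<lambda>Z. pd p q (phi (Suc d) i j k) Z)" for p q
  proof -
    have *: "in_class (det_type (Suc d) k) (\<lambda>Z. pd p q (phi (Suc d) i j k) Z)"
      if e: "\<And>Z. Z$1$1 \<noteq> 0 \<Longrightarrow> det Z \<noteq> 0 \<Longrightarrow> pd p q (phi (Suc d) i j k) Z = \<mu> * phi (Suc (Suc d)) i' j' k Z + \<nu> * phi d i'' j'' (k - 1) Z"
        and z: "k = int d \<Longrightarrow> \<mu> = 0" "k = 0 \<Longrightarrow> \<nu> = 0" for p q \<mu> \<nu> i' j' i'' j''
      by (rule in_class_cong[OF in_class_add[OF U D]]) (use e z in \<open>auto simp: regular_set_def\<close>)
    have "(p = 1 \<or> p = 2) \<and> (q = 1 \<or> q = 2)" using exhaust_2 by blast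
    thus ?thesis
    proof (elim conjE disjE)
      assume "p = 1" "q = 1" thus ?thesis by (auto intro!: *[OF pd_phi(1)[OF _ _ d0]])
    next
      assume "p = 1" "q = 2" thus ?thesis by (auto intro!: *[OF pd_phi(3)[OF _ _ d0]])
    next
      assume "p = 2" "q = 1" thus ?thesis by (auto intro!: *[OF pd_phi(2)[OF _ _ d0]])
    next
      assume "p = 2" "q = 2" thus ?thesis by (auto intro!: *[OF pd_phi(4)[OF _ _ d0]])
    qed
  qed
  have 1: "in_class (det_type (Suc d) k) (\<lambda>Z. dmat (phi (Suc d) i j k) Z $ p $ q)" for p q
  proof -
    have "(p = 1 \<or> p = 2) \<and> (q = 1 \<or> q = 2)" using exhaust_2 by blast
    thus ?thesis using dm by (auto simp: dmat_def)
  qed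
  have *: "in_class (det_type (Suc d) k) f" if "\<And>Z. Z$1$1 \<noteq> 0 \<Longrightarrow> det Z \<noteq> 0 \<Longrightarrow> f Z = \<mu> * phi (Suc d) i' j' k Z" for f \<mu> i' j'
    by (rule in_class_cong[OF S]) (use that in \<open>auto simp: regular_set_def\<close>)
  have 2: "in_class (det_type (Suc d) k) (\<lambda>Z. (Z ** dmat (phi (Suc d) i j k) Z) $ p $ q)" for p q
  proof -
    have "(p = 1 \<or> p = 2) \<and> (q = 1 \<or> q = 2)" using exhaust_2 by blast
    thus ?thesis
      by (elim conjE disjE; simp only:) (rule *[OF Zd_phi(1)[OF _ _ d0]] *[OF Zd_phi(2)[OF _ _ d0]] *[OF Zd_phi(3)[OF _ _ d0]] *[OF Zd_phi(4)[OF _ _ d0]]; assumption)+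
  qed
  have 3: "in_class (det_type (Suc d) k) (\<lambda>Z. (dmat (phi (Suc d) i j k) Z ** Z) $ p $ q)" for p q
  proof -
    have "(p = 1 \<or> p = 2) \<and> (q = 1 \<or> q = 2)" using exhaust_2 by blast
    thus ?thesis
      by (elim conjE disjE; simp only:) (rule *[OF dZ_phi(1)[OF _ _ d0]] *[OF dZ_phi(2)[OF _ _ d0]] *[OF dZ_phi(3)[OF _ _ d0]] *[OF dZ_phi(4)[OF _ _ d0]]; assumption)+
  qed
  have **: "in_class (det_type (Suc d) k) f"
    if e: "\<And>Z. Z$1$1 \<noteq> 0 \<Longrightarrow> det Z \<noteq> 0 \<Longrightarrow> f Z = \<mu> * phi d i' j' k Z + \<nu> * phi (Suc (Suc d)) i'' j'' (k + 1) Z"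
      and z: "k + 1 = int d \<Longrightarrow> \<mu> = 0" "k + 1 = 0 \<Longrightarrow> \<nu> = 0" for f \<mu> \<nu> i' j' i'' j''
    by (rule in_class_cong[OF in_class_add[OF D' U']]) (use e z in \<open>auto simp: regular_set_def\<close>)
  have kk: "k + 1 = int d \<Longrightarrow> of_int k + 1 - of_nat d = (0::complex)" "k + 1 = 0 \<Longrightarrow> of_int k + 1 = (0::complex)"
  proof -
    show "of_int k + 1 - of_nat d = (0::complex)" if "k + 1 = int d"
    proof -
      have "k = int d - 1" using that by simp
      thus ?thesis by simp
    qed
    show "of_int k + 1 = (0::complex)" if "k + 1 = 0"
    proof -
      have "k = - 1" using that by simp
      thus ?thesis by simp
    qed
  qed
  have 4: "in_class (det_type (Suc d) k) (\<lambda>Z. (Z ** dmat (phi (Suc d) i j k) Z ** Z + mat (2 * phi (Suc d) i j k Z) ** Z) $ p $ q)" for p q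
  proof -
    have "(p = 1 \<or> p = 2) \<and> (q = 1 \<or> q = 2)" using exhaust_2 by blast
    thus ?thesis
    proof (elim conjE disjE)
      assume "p = 1" "q = 1"
      thus ?thesis using ZdZ_phi(1)[OF _ _ d0] kk
        by (intro **[where \<mu> = "(of_int k + 1 - of_nat d) * (of_int i + of_nat d) * (of_int j + of_nat d) / of_nat d ^ 2" and \<nu> = "(of_nat d + 1) / of_nat d * (of_int k + 1)"]) auto
    next
      assume pq: "p = 1" "q = 2"
      have "(Z ** dmat (phi (Suc d) i j k) Z ** Z + mat (2 * phi (Suc d) i j k Z) ** Z) $ p $ q
        = (- (of_int k + 1 - of_nat d) * (of_int i + of_nat d) * (of_int j + 1) / of_nat d ^ 2) * phi d (i) (j + 1) k Z + (- ((of_nat d + 1) / of_nat d * (of_int k + 1))) * phi (Suc (Suc d)) (i - 1) (j) (k + 1) Z"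
        if "Z$1$1 \<noteq> 0" "det Z \<noteq> 0" for Z
        unfolding pq ZdZ_phi(2)[OF that d0] by (simp only: diff_conv_add_uminus mult_minus_left)
      from **[OF this] show ?thesis using kk by simp
    next
      assume pq: "p = 2" "q = 1"
      have "(Z ** dmat (phi (Suc d) i j k) Z ** Z + mat (2 * phi (Suc d) i j k Z) ** Z) $ p $ q
        = (- (of_int k + 1 - of_nat d) * (of_int i + 1) * (of_int j + of_nat d) / of_nat d ^ 2) * phi d (i + 1) (j) k Z + (- ((of_nat d + 1) / of_nat d * (of_int k + 1))) * phi (Suc (Suc d)) (i) (j - 1) (k + 1) Z"
        if "Z$1$1 \<noteq> 0" "det Z \<noteq> 0" for Z
        unfolding pq ZdZ_phi(3)[OF that d0] by (simp only: diff_conv_add_uminus mult_minus_left)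
      from **[OF this] show ?thesis using kk by simp
    next
      assume "p = 2" "q = 2"
      thus ?thesis using ZdZ_phi(4)[OF _ _ d0] kk
        by (intro **[where \<mu> = "(of_int k + 1 - of_nat d) * (of_int i + 1) * (of_int j + 1) / of_nat d ^ 2" and \<nu> = "(of_nat d + 1) / of_nat d * (of_int k + 1)"]) auto
    qed
  qed
  show ?thesis using h 1 2 3 4 S[of 1 i j] unfolding rho_entries_def by auto
qed

lemma dmat_swp: "dmat (\<lambda>Z. f (swp Z)) Z = swp (dmat f (swp Z))"
proof -
  define sw :: "2 \<Rightarrow> 2" where "sw p = (if p = 1 then 2 else 1)" for p
  have sw: "sw 1 = 2" "sw 2 = 1" by (simp_all add: sw_def)
  have "pd p q (\<lambda>Z. f (swp Z)) Z = pd (sw p) (sw q) f (swp Z)" for p q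
  proof -
    have "swp (Z + (\<chi> a b. if a = p \<and> b = q then t else 0)) = swp Z + (\<chi> a b. if a = sw p \<and> b = sw q then t else 0)" for t
      using exhaust_2[of p] exhaust_2[of q] by (auto simp: HC_eq_iff sw)
    thus ?thesis unfolding pd_def by simp
  qed
  thus ?thesis by (simp add: dmat_def HC_eq_iff sw)
qed

lemma rho_entries_phi_swp:
  assumes d: "d \<ge> 1" and h: "h \<in> rho_entries (\<lambda>Z. phi (Suc d) i j k (swp Z))"
  shows "in_class (3 + det_type (Suc d) k) h"
proof -
  define f where "f = phi (Suc d) i j k"
  have c3: "det_type (Suc d) k < 3" by (simp add: det_type_def)
  define sw :: "2 \<Rightarrow> 2" where "sw p = (if p = 1 then 2 else 1)" for p
  have sn: "swp A $ p $ q = A $ sw p $ sw q" for A p q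
    using exhaust_2[of p] exhaust_2[of q] by (auto simp: sw_def)
  have swl: "swp (A + B) = swp A + swp B" "swp (mat c) = mat c" for A B :: HC and c by (simp_all add: HC_eq_iff mat_def)
  have m: "Z ** dmat (\<lambda>Z. f (swp Z)) Z = swp (swp Z ** dmat f (swp Z))"
    "dmat (\<lambda>Z. f (swp Z)) Z ** Z = swp (dmat f (swp Z) ** swp Z)"
    "Z ** dmat (\<lambda>Z. f (swp Z)) Z ** Z + mat (2 * f (swp Z)) ** Z = swp (swp Z ** dmat f (swp Z) ** swp Z + mat (2 * f (swp Z)) ** swp Z)" for Z
    by (simp_all only: dmat_swp swl swp_mult swp_swp)
  have R: "in_class (3 + det_type (Suc d) k) (\<lambda>Z. g (swp Z))" if "g \<in> rho_entries f" for g
    by (rule in_class_swp[OF rho_entries_phi[OF d] c3]) (use that in \<open>simp add: f_def\<close>)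
  have g: "f \<in> rho_entries f" "(\<lambda>Z. (Z ** dmat f Z) $ p $ q) \<in> rho_entries f" "(\<lambda>Z. dmat f Z $ p $ q) \<in> rho_entries f"
    "(\<lambda>Z. (Z ** dmat f Z ** Z + mat (2 * f Z) ** Z) $ p $ q) \<in> rho_entries f" "(\<lambda>Z. (dmat f Z ** Z) $ p $ q) \<in> rho_entries f" for p q
    unfolding rho_entries_def by blast+
  obtain p q where "h = (\<lambda>Z. f (swp Z)) \<or> h = (\<lambda>Z. (Z ** dmat (\<lambda>Z. f (swp Z)) Z) $ p $ q) \<or> h = (\<lambda>Z. dmat (\<lambda>Z. f (swp Z)) Z $ p $ q)
    \<or> h = (\<lambda>Z. (Z ** dmat (\<lambda>Z. f (swp Z)) Z ** Z + mat (2 * f (swp Z)) ** Z) $ p $ q) \<or> h = (\<lambda>Z. (dmat (\<lambda>Z. f (swp Z)) Z ** Z) $ p $ q)"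
    using h unfolding rho_entries_def f_def[symmetric] by blast
  hence "h = (\<lambda>Z. f (swp Z)) \<or> h = (\<lambda>Z. (swp Z ** dmat f (swp Z)) $ sw p $ sw q) \<or> h = (\<lambda>Z. dmat f (swp Z) $ sw p $ sw q)
    \<or> h = (\<lambda>Z. (swp Z ** dmat f (swp Z) ** swp Z + mat (2 * f (swp Z)) ** swp Z) $ sw p $ sw q) \<or> h = (\<lambda>Z. (dmat f (swp Z) ** swp Z) $ sw p $ sw q)"
    unfolding m(3) unfolding m(1,2) unfolding dmat_swp sn .
  thus ?thesis
    using R[OF g(1)] R[OF g(2), of "sw p" "sw q"] R[OF g(3), of "sw p" "sw q"] R[OF g(4), of "sw p" "sw q"] R[OF g(5), of "sw p" "sw q"]
    by (elim disjE) simp_all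
qed

lemma in_class_rho1:
  assumes "\<And>h. h \<in> rho_entries f \<Longrightarrow> in_class c h"
  shows "in_class c (rho1 X f)"
proof -
  have g: "f \<in> rho_entries f" "(\<lambda>Z. (Z ** dmat f Z) $ p $ q) \<in> rho_entries f" "(\<lambda>Z. dmat f Z $ p $ q) \<in> rho_entries f"
    "(\<lambda>Z. (Z ** dmat f Z ** Z + mat (2 * f Z) ** Z) $ p $ q) \<in> rho_entries f" "(\<lambda>Z. (dmat f Z ** Z) $ p $ q) \<in> rho_entries f" for p q
    unfolding rho_entries_def by blast+
  have tr: "trace (A ** B) = A$1$1 * B$1$1 + A$1$2 * B$2$1 + (A$2$1 * B$1$2 + A$2$2 * B$2$2)" for A B :: HC
    by (simp add: trace_def sum_2)
  have T: "in_class c (\<lambda>Z. trace (A ** B Z))" if "\<And>p q. in_class c (\<lambda>Z. B Z $ p $ q)" for A :: HC and B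
    unfolding tr by (intro in_class_add in_class_scale that)
  have n: "in_class c (\<lambda>Z. - h Z)" if "in_class c h" for h using in_class_scale[OF that, of "-1"] by simp
  have m: "in_class c (\<lambda>Z. (mat (f Z) :: HC) $ p $ q)" for p q
    using assms[OF g(1)] by (cases "p = q") (auto simp: mat_def intro: in_class_zero)
  have "in_class c (\<lambda>Z. trace (X$1$1 ** (- (Z ** dmat f Z) - mat (f Z))) + trace (X$1$2 ** (- dmat f Z))
    + trace (X$2$1 ** (Z ** dmat f Z ** Z + mat (2 * f Z) ** Z)) + trace (X$2$2 ** (dmat f Z ** Z + mat (f Z))))"
  proof (intro in_class_add T)
    fix p q
    show "in_class c (\<lambda>Z. (- (Z ** dmat f Z) - mat (f Z)) $ p $ q)"
      using in_class_add[OF n[OF assms[OF g(2)]] n[OF m], of p q p q] by simp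
    show "in_class c (\<lambda>Z. (- dmat f Z) $ p $ q)" using n[OF assms[OF g(3)], of p q] by simp
    show "in_class c (\<lambda>Z. (Z ** dmat f Z ** Z + mat (2 * f Z) ** Z) $ p $ q)" by (rule assms[OF g(4)])
    show "in_class c (\<lambda>Z. (dmat f Z ** Z + mat (f Z)) $ p $ q)"
      using in_class_add[OF assms[OF g(5)] m, of p q p q] by simp
  qed
  thus ?thesis unfolding rho1_def[abs_def] .
qed

definition tb :: "bidx \<Rightarrow> HC \<Rightarrow> complex" where
  "tb = (\<lambda>(\<sigma>, a, i, j, k). if \<sigma> then tauN (- real a / 2) (real i + real a / 2) (real j + real a / 2) k
     else tauN (- real a / 2) (- (real i + real a / 2)) (- (real j + real a / 2)) k)"

definition tau_norm :: "bidx \<Rightarrow> complex" where "tau_norm = (\<lambda>(\<sigma>, a, i, j, k). inverse ((- of_nat a) gchoose j))"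

definition IX :: "bidx set" where "IX = {x. fst (snd x) \<ge> 2}"

lemma tb_eq:
  assumes "x \<in> IX" "if fst x then Z$1$1 \<noteq> 0 else Z$2$2 \<noteq> 0"
  shows "tb x Z = tau_norm x * eb x Z"
proof -
  obtain \<sigma> a i j k where x: "x = (\<sigma>, a, i, j, k)" by (cases x)
  have a: "a \<ge> 1" using assms by (simp add: x IX_def)
  show ?thesis
  proof (cases \<sigma>)
    case True
    hence z: "Z$1$1 \<noteq> 0" using assms(2) by (simp add: x)
    show ?thesis using True
      by (simp only: x tb_def tau_norm_def eb_def phi_def tauN_def prod.case if_True tau_hol_eq[OF a z]) (simp only: divide_inverse mult_ac)
  next
    case False
    hence z: "Z$2$2 \<noteq> 0" using assms(2) by (simp add: x)
    show ?thesis using False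
      by (simp only: x tb_def tau_norm_def eb_def phi_def tauN_def prod.case if_False det_swp tau_antihol_eq[OF a z]) (simp only: divide_inverse mult_ac)
  qed
qed

lemma tb_regular: "x \<in> IX \<Longrightarrow> Z \<in> regular_set \<Longrightarrow> tb x Z = tau_norm x * eb x Z"
  by (rule tb_eq) (auto simp: regular_set_def)

lemma tau_norm_nonzero: "x \<in> IX \<Longrightarrow> tau_norm x \<noteq> 0"
  using gchoose_neg_nonzero by (cases x) (auto simp: IX_def tau_norm_def)

lemma IX_regular: "x \<in> IX \<Longrightarrow> x \<in> regular_idx" by (auto simp: IX_def regular_idx_def)

lemma in_class_tb: "x \<in> IX \<Longrightarrow> cls x = c \<Longrightarrow> in_class c (tb x)"
  by (rule in_class_cong[OF in_class_scale[OF in_class_eb[OF IX_regular]]]) (auto simp: tb_regular)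

lemma in_class_rho1_eb:
  assumes "x \<in> IX"
  shows "in_class (cls x) (rho1 X (eb x))"
proof -
  obtain \<sigma> a i j k where x: "x = (\<sigma>, a, i, j, k)" by (cases x)
  obtain d where d: "a = Suc d" "d \<ge> 1" using assms by (cases a) (auto simp: x IX_def)
  show ?thesis
  proof (rule in_class_rho1)
    fix h assume h: "h \<in> rho_entries (eb x)"
    show "in_class (cls x) h"
    proof (cases \<sigma>)
      case True
      hence "eb x = phi (Suc d) (int i) (int j) k" by (simp add: eb_def x d fun_eq_iff)
      thus ?thesis using rho_entries_phi[OF d(2)] h True by (simp add: cls_def x d)
    next
      case False
      hence "eb x = (\<lambda>Z. phi (Suc d) (int i) (int j) k (swp Z))" by (simp add: eb_def x d fun_eq_iff)
      thus ?thesis using rho_entries_phi_swp[OF d(2)] h False by (simp add: cls_def x d)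
    qed
  qed
qed

lemma eb_line_deriv:
  assumes "x \<in> IX" "Z \<in> regular_set"
  shows "(\<lambda>t. eb x (Z + (\<chi> a b. if a = p \<and> b = q then t else 0))) field_differentiable at 0"
proof -
  obtain \<sigma> a i j k where x: "x = (\<sigma>, a, i, j, k)" by (cases x)
  show ?thesis
  proof (cases \<sigma>)
    case True
    thus ?thesis using phi_deriv[of Z a "int i" "int j" k p q] assms(2) unfolding field_differentiable_def
      by (auto simp: eb_def x regular_set_def)
  next
    case False
    define sw :: "2 \<Rightarrow> 2" where "sw p = (if p = 1 then 2 else 1)" for p
    have "swp (Z + (\<chi> a b. if a = p \<and> b = q then t else 0)) = swp Z + (\<chi> a b. if a = sw p \<and> b = sw q then t else 0)" for t
      using exhaust_2[of p] exhaust_2[of q] by (auto simp: HC_eq_iff sw_def)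
    thus ?thesis using phi_deriv[of "swp Z" a "int i" "int j" k "sw p" "sw q"] assms(2) False unfolding field_differentiable_def
      by (auto simp: eb_def x regular_set_def)
  qed
qed

lemma rho1_tb_sum:
  assumes F: "F \<subseteq> IX" and Z: "Z \<in> regular_set"
  shows "rho1 X (\<lambda>Z. \<Sum>x\<in>F. v x * tb x Z) Z = (\<Sum>x\<in>F. v x * tau_norm x * rho1 X (eb x) Z)"
proof -
  define f where "f = (\<lambda>Z. \<Sum>x\<in>F. v x * tb x Z)"
  have fZ: "f Z = (\<Sum>x\<in>F. v x * tau_norm x * eb x Z)"
    unfolding f_def using F Z by (intro sum.cong refl) (auto simp: tb_regular)
  have pd: "pd p q f Z = (\<Sum>x\<in>F. v x * tau_norm x * pd p q (eb x) Z)" for p q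
  proof -
    define L where "L t = Z + (\<chi> a b. if a = p \<and> b = q then t else (0::complex))" for t
    have L: "(\<lambda>t. L t $ a $ b) \<midarrow>0\<rightarrow> Z $ a $ b" for a b
    proof -
      have "(\<lambda>t. Z $ a $ b + (if a = p \<and> b = q then t else 0)) \<midarrow>0\<rightarrow> Z $ a $ b + (if a = p \<and> b = q then 0 else 0)"
      proof (intro tendsto_add tendsto_const)
        show "(\<lambda>t. if a = p \<and> b = q then t else 0) \<midarrow>0\<rightarrow> (if a = p \<and> b = q then 0 else 0)"
          by (cases "a = p \<and> b = q") (simp_all only: if_True if_False simp_thms tendsto_ident_at tendsto_const)
      qed
      thus ?thesis by (simp add: L_def)
    qed
    have "eventually (\<lambda>t. L t $ 1 $ 1 \<noteq> 0 \<and> L t $ 2 $ 2 \<noteq> 0) (at 0)"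
      using Z by (intro eventually_conj tendsto_imp_eventually_ne[OF L]) (auto simp: regular_set_def)
    hence "eventually (\<lambda>t. f (L t) = (\<Sum>x\<in>F. v x * tau_norm x * eb x (L t))) (at 0)"
    proof eventually_elim
      case (elim t)
      thus ?case unfolding f_def using F by (intro sum.cong refl) (auto simp: tb_eq)
    qed
    moreover have L0: "L 0 = Z" by (simp add: L_def vec_eq_iff)
    ultimately have "eventually (\<lambda>t. f (L t) = (\<Sum>x\<in>F. v x * tau_norm x * eb x (L t))) (nhds 0)"
      using fZ by (simp add: eventually_nhds_conv_at)
    hence "deriv (\<lambda>t. f (L t)) 0 = deriv (\<lambda>t. \<Sum>x\<in>F. v x * tau_norm x * eb x (L t)) 0"
      by (rule deriv_cong_ev) simp
    also have "\<dots> = (\<Sum>x\<in>F. v x * tau_norm x * deriv (\<lambda>t. eb x (L t)) 0)"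
    proof (rule DERIV_imp_deriv, rule DERIV_sum, rule DERIV_cmult)
      fix x assume "x \<in> F"
      thus "((\<lambda>t. eb x (L t)) has_field_derivative deriv (\<lambda>t. eb x (L t)) 0) (at 0)"
        using eb_line_deriv[of x Z p q] F Z unfolding L_def by (auto simp: field_differentiable_derivI)
    qed
    finally show ?thesis unfolding pd_def L_def .
  qed
  define D where "D x = dmat (eb x) Z" for x
  have dm: "dmat f Z $ p $ q = (\<Sum>x\<in>F. v x * tau_norm x * D x $ p $ q)" for p q
    using exhaust_2[of p] exhaust_2[of q] by (auto simp: D_def dmat_def pd)
  have "rho1 X f Z = (\<Sum>x\<in>F. v x * tau_norm x * rho1 X (eb x) Z)"
    unfolding rho1_def trace_def sum_2 mat_mult_nth vector_add_component vector_minus_component vector_uminus_component mat_def vec_lambda_beta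
    unfolding dm D_def[symmetric] fZ
    by (simp add: sum_distrib_left sum_distrib_right sum.distrib sum_subtractf sum_negf algebra_simps)
  thus ?thesis unfolding f_def .
qed

section \<open>The projectors\<close>

lemma hol_index_iff:
  "hol_index l n m \<longleftrightarrow> (\<exists>a i j. a \<ge> 2 \<and> l = - real a / 2 \<and> n = real i + real a / 2 \<and> m = real j + real a / 2)"
proof
  assume h: "hol_index l n m"
  obtain z where z: "2 * l = of_int z" using h by (auto simp: hol_index_def elim: Ints_cases)
  obtain p where p: "m - l = of_int p" using h by (auto simp: hol_index_def elim: Ints_cases)
  obtain q where q: "n - l = of_int q" using h by (auto simp: hol_index_def elim: Ints_cases)
  have b: "l \<le> -1" "m \<ge> - l" "n \<ge> - l" using h by (auto simp: hol_index_def)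
  have "real_of_int z \<le> of_int (-2)" using z b by simp
  hence z2: "z \<le> -2" by (simp only: of_int_le_iff)
  have "real_of_int 0 \<le> of_int (p + z)" "real_of_int 0 \<le> of_int (q + z)" using z p q b by simp_all
  hence pz: "0 \<le> p + z" "0 \<le> q + z" by (simp_all only: of_int_le_iff)
  have "real (nat (- z)) = - of_int z" "real (nat (p + z)) = of_int (p + z)" "real (nat (q + z)) = of_int (q + z)" using z2 pz by simp_all
  thus "\<exists>a i j. a \<ge> 2 \<and> l = - real a / 2 \<and> n = real i + real a / 2 \<and> m = real j + real a / 2"
    using z p q z2 by (intro exI[of _ "nat (- z)"] exI[of _ "nat (q + z)"] exI[of _ "nat (p + z)"]) auto
next
  assume "\<exists>a i j. a \<ge> 2 \<and> l = - real a / 2 \<and> n = real i + real a / 2 \<and> m = real j + real a / 2"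
  then obtain a i j where a: "a \<ge> 2" "l = - real a / 2" "n = real i + real a / 2" "m = real j + real a / 2" by blast
  have "2 * l = of_int (- int a)" "m - l = of_int (int j + int a)" "n - l = of_int (int i + int a)" using a by simp_all
  hence "2 * l \<in> \<int>" "m - l \<in> \<int>" "n - l \<in> \<int>" by (metis Ints_of_int)+
  thus "hol_index l n m" using a by (simp add: hol_index_def)
qed

lemma antihol_index_iff:
  "antihol_index l n m \<longleftrightarrow> (\<exists>a i j. a \<ge> 2 \<and> l = - real a / 2 \<and> n = - (real i + real a / 2) \<and> m = - (real j + real a / 2))"
proof -
  have "(- x - l \<in> \<int>) = (x - l \<in> \<int>)" if "2 * l \<in> \<int>" for x
  proof -
    have "- x - l = - (x - l) - 2 * l" "x - l = - (- x - l) - 2 * l" by simp_all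
    thus ?thesis using that by (metis Ints_diff Ints_minus)
  qed
  hence "antihol_index l n m \<longleftrightarrow> hol_index l (- n) (- m)" by (auto simp: antihol_index_def hol_index_def)
  moreover have "(- u = v) = (u = - v)" for u v :: real by auto
  ultimately show ?thesis by (simp only: hol_index_iff)
qed

lemma hol_generators:
  "{tauN l n m k | l n m k. hol_index l n m \<and> P l k} = tb ` {x\<in>IX. fst x \<and> (case x of (\<sigma>, a, i, j, k) \<Rightarrow> P (- real a / 2) k)}"
proof (intro equalityI subsetI)
  fix f assume "f \<in> {tauN l n m k | l n m k. hol_index l n m \<and> P l k}"
  then obtain a i j k where f: "f = tauN (- real a / 2) (real i + real a / 2) (real j + real a / 2) k" "a \<ge> 2" "P (- real a / 2) k"
    unfolding hol_index_iff by blast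
  hence "f = tb (True, a, i, j, k)" by (simp add: tb_def)
  thus "f \<in> tb ` {x\<in>IX. fst x \<and> (case x of (\<sigma>, a, i, j, k) \<Rightarrow> P (- real a / 2) k)}" using f by (auto simp: IX_def)
next
  fix f assume "f \<in> tb ` {x\<in>IX. fst x \<and> (case x of (\<sigma>, a, i, j, k) \<Rightarrow> P (- real a / 2) k)}"
  then obtain a i j k where f: "f = tb (True, a, i, j, k)" "a \<ge> 2" "P (- real a / 2) k" by (auto simp: IX_def)
  have "f = tauN (- real a / 2) (real i + real a / 2) (real j + real a / 2) k" using f by (simp add: tb_def)
  moreover have "hol_index (- real a / 2) (real i + real a / 2) (real j + real a / 2)" using f(2) unfolding hol_index_iff by blast
  ultimately show "f \<in> {tauN l n m k | l n m k. hol_index l n m \<and> P l k}" using f(3) by blast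
qed

lemma antihol_generators:
  "{tauN l n m k | l n m k. antihol_index l n m \<and> P l k} = tb ` {x\<in>IX. \<not> fst x \<and> (case x of (\<sigma>, a, i, j, k) \<Rightarrow> P (- real a / 2) k)}"
proof (intro equalityI subsetI)
  fix f assume "f \<in> {tauN l n m k | l n m k. antihol_index l n m \<and> P l k}"
  then obtain a i j k where f: "f = tauN (- real a / 2) (- (real i + real a / 2)) (- (real j + real a / 2)) k" "a \<ge> 2" "P (- real a / 2) k"
    unfolding antihol_index_iff by blast
  hence "f = tb (False, a, i, j, k)" by (simp add: tb_def)
  thus "f \<in> tb ` {x\<in>IX. \<not> fst x \<and> (case x of (\<sigma>, a, i, j, k) \<Rightarrow> P (- real a / 2) k)}" using f by (auto simp: IX_def)
next
  fix f assume "f \<in> tb ` {x\<in>IX. \<not> fst x \<and> (case x of (\<sigma>, a, i, j, k) \<Rightarrow> P (- real a / 2) k)}"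
  then obtain a i j k where f: "f = tb (False, a, i, j, k)" "a \<ge> 2" "P (- real a / 2) k" by (auto simp: IX_def)
  have "f = tauN (- real a / 2) (- (real i + real a / 2)) (- (real j + real a / 2)) k" using f by (simp add: tb_def)
  moreover have "antihol_index (- real a / 2) (- (real i + real a / 2)) (- (real j + real a / 2))" using f(2) unfolding antihol_index_iff by blast
  ultimately show "f \<in> {tauN l n m k | l n m k. antihol_index l n m \<and> P l k}" using f(3) by blast
qed

definition Dc :: "nat \<Rightarrow> (HC \<Rightarrow> complex) set" where
  "Dc c = [Dh_less, D_minus_minus, Dh_greater, Da_less, D_plus_plus, Da_greater] ! c"

lemma less_6: "c < 6 \<longleftrightarrow> c = 0 \<or> c = 1 \<or> c = 2 \<or> c = 3 \<or> c = 4 \<or> c = (5::nat)"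
  by auto

lemma Dc_eq:
  assumes "c < 6"
  shows "Dc c = cfun.span (tb ` {x\<in>IX. cls x = c})"
proof -
  have b: "real_of_int k \<le> - (2 * (- real a / 2) + 2) \<longleftrightarrow> k \<le> int a - 2" "real_of_int k \<ge> - (2 * (- real a / 2) + 1) \<longleftrightarrow> k \<ge> int a - 1" for k a
  proof -
    have "- (2 * (- real a / 2) + 2) = of_int (int a - 2)" "- (2 * (- real a / 2) + 1) = of_int (int a - 1)" by simp_all
    thus "real_of_int k \<le> - (2 * (- real a / 2) + 2) \<longleftrightarrow> k \<le> int a - 2" "real_of_int k \<ge> - (2 * (- real a / 2) + 1) \<longleftrightarrow> k \<ge> int a - 1"
      by (simp_all only: of_int_le_iff)
  qed
  note defs = Dh_less_def D_minus_minus_def Dh_greater_def Da_less_def D_plus_plus_def Da_greater_def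
  note gens = hol_generators[where P = "\<lambda>l k. k \<le> -1"] hol_generators[where P = "\<lambda>l k. 0 \<le> k \<and> of_int k \<le> - (2 * l + 2)"]
    hol_generators[where P = "\<lambda>l k. of_int k \<ge> - (2 * l + 1)"]
    antihol_generators[where P = "\<lambda>l k. k \<le> -1"] antihol_generators[where P = "\<lambda>l k. 0 \<le> k \<and> of_int k \<le> - (2 * l + 2)"]
    antihol_generators[where P = "\<lambda>l k. of_int k \<ge> - (2 * l + 1)"]
  have s: "{x\<in>IX. fst x \<and> (case x of (\<sigma>, a, i, j, k) \<Rightarrow> k \<le> -1)} = {x\<in>IX. cls x = 0}"
    "{x\<in>IX. fst x \<and> (case x of (\<sigma>, a, i, j, k) \<Rightarrow> 0 \<le> k \<and> k \<le> int a - 2)} = {x\<in>IX. cls x = 1}"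
    "{x\<in>IX. fst x \<and> (case x of (\<sigma>, a, i, j, k) \<Rightarrow> k \<ge> int a - 1)} = {x\<in>IX. cls x = 2}"
    "{x\<in>IX. \<not> fst x \<and> (case x of (\<sigma>, a, i, j, k) \<Rightarrow> k \<le> -1)} = {x\<in>IX. cls x = 3}"
    "{x\<in>IX. \<not> fst x \<and> (case x of (\<sigma>, a, i, j, k) \<Rightarrow> 0 \<le> k \<and> k \<le> int a - 2)} = {x\<in>IX. cls x = 4}"
    "{x\<in>IX. \<not> fst x \<and> (case x of (\<sigma>, a, i, j, k) \<Rightarrow> k \<ge> int a - 1)} = {x\<in>IX. cls x = 5}"
    by (auto simp: cls_def det_type_def IX_def split: if_splits)
  show ?thesis
    using assms unfolding less_6
    by (elim disjE) (simp_all only: Dc_def defs gens b s nth_Cons_0 nth_Cons_numeral One_nat_def nth_Cons_Suc numeral_eq_Suc pred_numeral_simps BitM.simps arith_simps)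
qed

lemma D_total_eq: "D_total = cfun.span (tb ` IX)"
proof -
  have h: "Dh = cfun.span (tb ` {x\<in>IX. fst x})" "Da = cfun.span (tb ` {x\<in>IX. \<not> fst x})"
    using hol_generators[where P = "\<lambda>l k. True"] antihol_generators[where P = "\<lambda>l k. True"] unfolding Dh_def Da_def
    by (simp_all add: case_prod_beta)
  have "tb ` IX = tb ` {x\<in>IX. fst x} \<union> tb ` {x\<in>IX. \<not> fst x}" by blast
  thus ?thesis unfolding D_total_def h by (simp only: cfun.span_Un)
qed

lemma components_eq: "components = Dc ` {..<6}"
proof -
  have "{..<6::nat} = {0, 1, 2, 3, 4, 5}" by auto
  thus ?thesis by (simp add: components_def Dc_def)
qed

lemma tb_independent:
  assumes F: "finite F" "F \<subseteq> IX" and z: "\<And>Z. Z \<in> regular_set \<Longrightarrow> (\<Sum>x\<in>F. v x * tb x Z) = 0" and x: "x \<in> F"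
  shows "v x = 0"
proof -
  have "v x * tau_norm x = 0"
  proof (rule eb_independent[OF F(1) _ _ x])
    show "F \<subseteq> regular_idx" using F IX_regular by blast
    fix Z assume Z: "Z \<in> regular_set"
    have "(\<Sum>x\<in>F. v x * tau_norm x * eb x Z) = (\<Sum>x\<in>F. v x * tb x Z)"
      using F Z by (intro sum.cong refl) (auto simp: tb_regular)
    thus "(\<Sum>x\<in>F. v x * tau_norm x * eb x Z) = 0" using z[OF Z] by simp
  qed
  moreover have "x \<in> IX" using F x by blast
  ultimately show ?thesis using tau_norm_nonzero[of x] by simp
qed

lemma tb_span_disjoint:
  assumes h: "h \<in> cfun.span (tb ` {x\<in>IX. cls x = c})" "h \<in> cfun.span (tb ` {x\<in>IX. cls x \<noteq> c})"
  shows "h = (\<lambda>Z. 0)"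
proof -
  obtain F v where F: "finite F" "F \<subseteq> {x\<in>IX. cls x = c}" "h = (\<lambda>Z. \<Sum>x\<in>F. v x * tb x Z)" using cfun_span_image[OF h(1)] .
  obtain G w where G: "finite G" "G \<subseteq> {x\<in>IX. cls x \<noteq> c}" "h = (\<lambda>Z. \<Sum>x\<in>G. w x * tb x Z)" using cfun_span_image[OF h(2)] .
  define u where "u x = (if x \<in> F then v x else - w x)" for x
  have dj: "F \<inter> G = {}" using F G by auto
  have "(\<Sum>x\<in>F \<union> G. u x * tb x Z) = 0" for Z
  proof -
    have "(\<Sum>x\<in>F \<union> G. u x * tb x Z) = (\<Sum>x\<in>F. u x * tb x Z) + (\<Sum>x\<in>G. u x * tb x Z)"
      using F G dj by (intro sum.union_disjoint) auto
    also have "(\<Sum>x\<in>F. u x * tb x Z) = h Z" unfolding F(3) by (intro sum.cong) (auto simp: u_def)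
    also have "(\<Sum>x\<in>G. u x * tb x Z) = (\<Sum>x\<in>G. - (w x * tb x Z))" using dj by (intro sum.cong) (auto simp: u_def)
    also have "\<dots> = - h Z" unfolding G(3) by (simp add: sum_negf)
    finally show ?thesis by simp
  qed
  hence "u x = 0" if "x \<in> F" for x
    using tb_independent[of "F \<union> G" u x] F G that by auto
  hence "v x = 0" if "x \<in> F" for x using that by (auto simp: u_def)
  thus ?thesis unfolding F(3) by (simp add: fun_eq_iff)
qed

lemma span_other_components:
  assumes c: "c < 6"
  shows "cfun.span (\<Union> (components - {Dc c})) = cfun.span (tb ` {x\<in>IX. cls x \<noteq> c})"
proof (rule antisym)
  show "cfun.span (\<Union> (components - {Dc c})) \<subseteq> cfun.span (tb ` {x\<in>IX. cls x \<noteq> c})"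
  proof (rule cfun.span_minimal[OF _ cfun.subspace_span])
    show "\<Union> (components - {Dc c}) \<subseteq> cfun.span (tb ` {x\<in>IX. cls x \<noteq> c})"
    proof
      fix h assume "h \<in> \<Union> (components - {Dc c})"
      then obtain b where b: "b < 6" "b \<noteq> c" "h \<in> Dc b" unfolding components_eq by auto
      have "cfun.span (tb ` {x\<in>IX. cls x = b}) \<subseteq> cfun.span (tb ` {x\<in>IX. cls x \<noteq> c})"
        using b by (intro cfun.span_mono) auto
      thus "h \<in> cfun.span (tb ` {x\<in>IX. cls x \<noteq> c})" using b Dc_eq by blast
    qed
  qed
  show "cfun.span (tb ` {x\<in>IX. cls x \<noteq> c}) \<subseteq> cfun.span (\<Union> (components - {Dc c}))"
  proof (rule cfun.span_mono)
    show "tb ` {x\<in>IX. cls x \<noteq> c} \<subseteq> \<Union> (components - {Dc c})"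
    proof
      fix h assume "h \<in> tb ` {x\<in>IX. cls x \<noteq> c}"
      then obtain x where x: "h = tb x" "x \<in> IX" "cls x \<noteq> c" by blast
      have 1: "h \<in> Dc (cls x)" unfolding Dc_eq[OF cls_less] using x by (auto intro: cfun.span_base)
      have "h \<notin> Dc c"
      proof
        assume "h \<in> Dc c"
        hence "h = (\<lambda>Z. 0)"
          unfolding Dc_eq[OF c] by (rule tb_span_disjoint) (use x in \<open>blast intro: cfun.span_base\<close>)
        hence "tb x = (\<lambda>Z. 0)" using x(1) by simp
        hence "(1::complex) = 0" using x(2) by (intro tb_independent[of "{x}" "\<lambda>_. 1" x]) simp_all
        thus False by simp
      qed
      hence "Dc (cls x) \<noteq> Dc c" using 1 by blast
      hence "Dc (cls x) \<in> components - {Dc c}" unfolding components_eq using cls_less by blast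
      thus "h \<in> \<Union> (components - {Dc c})" using 1 by blast
    qed
  qed
qed

lemma projector_eq:
  assumes c: "c < 6" and F: "finite F" "F \<subseteq> IX"
  shows "projector (Dc c) (\<lambda>Z. \<Sum>x\<in>F. v x * tb x Z) = (\<lambda>Z. \<Sum>x\<in>{x\<in>F. cls x = c}. v x * tb x Z)"
proof -
  define f p where "f = (\<lambda>Z. \<Sum>x\<in>F. v x * tb x Z)" and "p = (\<lambda>Z. \<Sum>x\<in>{x\<in>F. cls x = c}. v x * tb x Z)"
  have p: "p \<in> Dc c" unfolding Dc_eq[OF c] p_def using F by (intro cfun_sum_in_span) auto
  have fp: "f - p \<in> cfun.span (tb ` {x\<in>IX. cls x \<noteq> c})"
  proof -
    have "f - p = (\<lambda>Z. \<Sum>x\<in>{x\<in>F. cls x \<noteq> c}. v x * tb x Z)"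
    proof
      fix Z
      have "{x\<in>F. cls x = c} \<union> {x\<in>F. cls x \<noteq> c} = F" by blast
      hence "f Z = p Z + (\<Sum>x\<in>{x\<in>F. cls x \<noteq> c}. v x * tb x Z)"
        unfolding f_def p_def using sum.union_disjoint[of "{x\<in>F. cls x = c}" "{x\<in>F. cls x \<noteq> c}" "\<lambda>x. v x * tb x Z"] F by auto
      thus "(f - p) Z = (\<Sum>x\<in>{x\<in>F. cls x \<noteq> c}. v x * tb x Z)" by simp
    qed
    moreover have "(\<lambda>Z. \<Sum>x\<in>{x\<in>F. cls x \<noteq> c}. v x * tb x Z) \<in> cfun.span (tb ` {x\<in>IX. cls x \<noteq> c})"
      using F by (intro cfun_sum_in_span) auto
    ultimately show ?thesis by simp
  qed
  have "projector (Dc c) f = p"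
    unfolding projector_def span_other_components[OF c]
  proof (rule the_equality)
    show "p \<in> Dc c \<and> f - p \<in> cfun.span (tb ` {x\<in>IX. cls x \<noteq> c})" using p fp by blast
    fix q assume q: "q \<in> Dc c \<and> f - q \<in> cfun.span (tb ` {x\<in>IX. cls x \<noteq> c})"
    have "q \<in> cfun.span (tb ` {x\<in>IX. cls x = c})" "p \<in> cfun.span (tb ` {x\<in>IX. cls x = c})" using q p unfolding Dc_eq[OF c] by simp_all
    hence "q - p \<in> cfun.span (tb ` {x\<in>IX. cls x = c})" by (rule cfun.span_diff)
    moreover have "q - p \<in> cfun.span (tb ` {x\<in>IX. cls x \<noteq> c})"
    proof -
      have "(f - p) - (f - q) \<in> cfun.span (tb ` {x\<in>IX. cls x \<noteq> c})" by (rule cfun.span_diff[OF fp conjunct2[OF q]])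
      moreover have "(f - p) - (f - q) = q - p" by (simp add: fun_eq_iff)
      ultimately show ?thesis by simp
    qed
    ultimately have "q - p = (\<lambda>Z. 0)" by (rule tb_span_disjoint)
    thus "q = p" by (simp add: fun_eq_iff)
  qed
  thus ?thesis unfolding f_def p_def .
qed

lemma sum_over_classes:
  fixes h :: "bidx \<Rightarrow> complex"
  assumes "finite F"
  shows "(\<Sum>c<6. \<Sum>x\<in>{x\<in>F. cls x = c}. h x) = (\<Sum>x\<in>F. h x)"
proof (rule sum.group[OF assms])
  show "cls ` F \<subseteq> {..<6}" using cls_less by blast
qed simp

lemma equivariant_projector:
  assumes c: "c < 6"
  shows "rho1_equivariant (projector (Dc c))"
  unfolding rho1_equivariant_def
proof (intro allI ballI impI)
  fix X f g Z
  assume f: "f \<in> D_total" and g: "g \<in> D_total" and eq: "\<forall>Z\<in>regular_set. g Z = rho1 X f Z" and Z: "Z \<in> regular_set"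
  obtain F v where F: "finite F" "F \<subseteq> IX" "f = (\<lambda>Z. \<Sum>x\<in>F. v x * tb x Z)" using cfun_span_image[OF f[unfolded D_total_eq]] .
  obtain G w where G: "finite G" "G \<subseteq> IX" "g = (\<lambda>Z. \<Sum>x\<in>G. w x * tb x Z)" using cfun_span_image[OF g[unfolded D_total_eq]] .
  define fc gc where "fc c = (\<lambda>Z. \<Sum>x\<in>{x\<in>F. cls x = c}. v x * tb x Z)" and "gc c = (\<lambda>Z. \<Sum>x\<in>{x\<in>G. cls x = c}. w x * tb x Z)" for c
  have r: "rho1 X (fc c) Z = (\<Sum>x\<in>{x\<in>F. cls x = c}. v x * tau_norm x * rho1 X (eb x) Z)" if "Z \<in> regular_set" for c Z
    unfolding fc_def by (rule rho1_tb_sum) (use F that in auto)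
  have "gc c Z + - 1 * rho1 X (fc c) Z = 0"
  proof (rule in_class_direct[where h = "\<lambda>c Z. gc c Z + - 1 * rho1 X (fc c) Z", OF _ _ c Z])
    fix c :: nat
    show "in_class c (\<lambda>Z. gc c Z + - 1 * rho1 X (fc c) Z)"
    proof (intro in_class_add in_class_scale)
      show "in_class c (gc c)" unfolding gc_def
        using G by (intro in_class_sum in_class_scale in_class_tb) auto
      have "in_class c (\<lambda>Z. \<Sum>x\<in>{x\<in>F. cls x = c}. v x * tau_norm x * rho1 X (eb x) Z)"
      proof (intro in_class_sum in_class_scale)
        fix x assume "x \<in> {x\<in>F. cls x = c}"
        thus "in_class c (rho1 X (eb x))" using in_class_rho1_eb[of x X] F by auto
      qed
      thus "in_class c (rho1 X (fc c))" by (rule in_class_cong) (simp add: r)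
    qed
  next
    fix Z assume Z: "Z \<in> regular_set"
    have "(\<Sum>c<6. gc c Z + - 1 * rho1 X (fc c) Z) = (\<Sum>c<6. gc c Z) - (\<Sum>c<6. rho1 X (fc c) Z)"
      by (simp add: sum_subtractf)
    also have "(\<Sum>c<6. gc c Z) = g Z" unfolding gc_def G(3) by (rule sum_over_classes[OF G(1)])
    also have "(\<Sum>c<6. rho1 X (fc c) Z) = (\<Sum>x\<in>F. v x * tau_norm x * rho1 X (eb x) Z)" unfolding r[OF Z] by (rule sum_over_classes[OF F(1)])
    also have "\<dots> = rho1 X f Z" unfolding F(3) by (rule rho1_tb_sum[OF F(2) Z, symmetric])
    finally show "(\<Sum>c<6. gc c Z + - 1 * rho1 X (fc c) Z) = 0" using eq Z by simp
  qed
  moreover have "projector (Dc c) f = fc c" "projector (Dc c) g = gc c"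
    unfolding F(3) G(3) fc_def gc_def using projector_eq[OF c] F G by auto
  ultimately show "projector (Dc c) g Z = rho1 X (projector (Dc c) f) Z" by simp
qed

lemma dV_sum:
  assumes "\<And>x. x \<in> F \<Longrightarrow> dV_integrable R (\<lambda>Z. kern Z * h x Z)"
  shows "dV_integrable R (\<lambda>Z. kern Z * (\<Sum>x\<in>F. v x * h x Z))"
    "dV_integral R (\<lambda>Z. kern Z * (\<Sum>x\<in>F. v x * h x Z)) = (\<Sum>x\<in>F. v x * dV_integral R (\<lambda>Z. kern Z * h x Z))"
proof -
  define q where "q x u = indicator chart_domain u *\<^sub>R (kern (chart R u) * h x (chart R u) * dV (partials (chart R) u))" for x u
  have i: "integrable lborel (q x)" if "x \<in> F" for x
    using assms[OF that] unfolding dV_integrable_def set_integrable_def q_def .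
  have e: "(\<lambda>u. indicator chart_domain u *\<^sub>R (kern (chart R u) * (\<Sum>x\<in>F. v x * h x (chart R u)) * dV (partials (chart R) u))) = (\<lambda>u. \<Sum>x\<in>F. v x * q x u)"
    unfolding q_def by (auto simp: fun_eq_iff sum_distrib_left sum_distrib_right scaleR_sum_right mult_ac intro!: sum.cong)
  show "dV_integrable R (\<lambda>Z. kern Z * (\<Sum>x\<in>F. v x * h x Z))"
    unfolding dV_integrable_def set_integrable_def e using i by (intro Bochner_Integration.integrable_sum integrable_mult_right)
  have "(\<integral>u. (\<Sum>x\<in>F. v x * q x u) \<partial>lborel) = (\<Sum>x\<in>F. v x * (\<integral>u. q x u \<partial>lborel))"
    using i by (subst Bochner_Integration.integral_sum) (auto intro: integrable_mult_right)
  thus "dV_integral R (\<lambda>Z. kern Z * (\<Sum>x\<in>F. v x * h x Z)) = (\<Sum>x\<in>F. v x * dV_integral R (\<lambda>Z. kern Z * h x Z))"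
    unfolding dV_integral_def set_lebesgue_integral_def e unfolding q_def .
qed

lemma provides_projectorI:
  assumes c: "c < 6"
    and k: "\<And>W x. W \<in> S \<Longrightarrow> x \<in> IX \<Longrightarrow> dV_integrable R (\<lambda>Z. k Z W * tb x Z) \<and>
      kernel_operator R k (tb x) W = (if cls x = c then tb x W else 0)"
  shows "provides_projector R k S (Dc c)"
  unfolding provides_projector_def
proof (intro conjI ballI equivariant_projector[OF c])
  fix f W assume f: "f \<in> D_total" and W: "W \<in> S"
  obtain F v where F: "finite F" "F \<subseteq> IX" "f = (\<lambda>Z. \<Sum>x\<in>F. v x * tb x Z)" using cfun_span_image[OF f[unfolded D_total_eq]] .
  have i: "\<And>x. x \<in> F \<Longrightarrow> dV_integrable R (\<lambda>Z. k Z W * tb x Z)" using k[OF W] F by blast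
  show "dV_integrable R (\<lambda>Z. k Z W * f Z)" unfolding F(3) by (rule dV_sum(1)[OF i])
  have "kernel_operator R k f W = (\<Sum>x\<in>F. v x * kernel_operator R k (tb x) W)"
  proof -
    have "dV_integral R (\<lambda>Z. k Z W * f Z) = (\<Sum>x\<in>F. v x * dV_integral R (\<lambda>Z. k Z W * tb x Z))"
      unfolding F(3) by (rule dV_sum(2)[OF i])
    thus ?thesis unfolding kernel_operator_def by (simp only: sum_distrib_left mult.left_commute)
  qed
  also have "\<dots> = (\<Sum>x\<in>F. if cls x = c then v x * tb x W else 0)"
    by (intro sum.cong refl) (use k[OF W] F in auto)
  also have "\<dots> = (\<Sum>x\<in>{x\<in>F. cls x = c}. v x * tb x W)" using F(1) by (rule sum.inter_filter[symmetric])
  also have "\<dots> = projector (Dc c) f W" unfolding F(3) projector_eq[OF c F(1,2)] ..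
  finally show "kernel_operator R k f W = projector (Dc c) f W" .
qed

lemma scaleR_cs: "R *\<^sub>R Z = cs (of_real R) Z"
  unfolding HC_eq_iff vector_scaleR_component cs_nth by (simp add: scaleR_conv_of_real)

lemma tb_scaleR:
  assumes x: "(\<sigma>, a, i, j, k) \<in> IX" and R: "R > 0" and Z: "if \<sigma> then Z$1$1 \<noteq> 0 else Z$2$2 \<noteq> 0"
  shows "tb (\<sigma>, a, i, j, k) (R *\<^sub>R Z)
    = tau_norm (\<sigma>, a, i, j, k) * of_real R powi (2 * k - int a) * (bfun \<sigma> a (int i) (int j) Z * det Z powi k)"
proof -
  define r where "r = complex_of_real R"
  have r: "r \<noteq> 0" using R by (simp add: r_def)
  define n e where "n = 2 * k" and "e = 2 * k - int a"
  have d: "det (cs r Z) powi k = r powi n * det Z powi k"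
    unfolding det_cs n_def power_int_mult_distrib by (simp only: power_int_mult power2_eq_square power_int_numeral[symmetric])
  have p: "r powi e = r powi (- int a) * r powi n"
  proof -
    have "e = - int a + n" by (simp add: e_def n_def)
    thus ?thesis by (simp only: power_int_add r simp_thms)
  qed
  have "tb (\<sigma>, a, i, j, k) (cs r Z) = tau_norm (\<sigma>, a, i, j, k) * eb (\<sigma>, a, i, j, k) (cs r Z)"
    by (rule tb_eq[OF x]) (use Z r in simp)
  also have "eb (\<sigma>, a, i, j, k) (cs r Z) = r powi e * (bfun \<sigma> a (int i) (int j) Z * det Z powi k)"
  proof (cases \<sigma>)
    case True
    hence "Fc a (int i) (int j) (cs r Z) = r powi (- int a) * Fc a (int i) (int j) Z" using Z r by (intro Fc_cs) simp_all
    thus ?thesis using True by (simp only: eb_def prod.case if_True phi_def bfun_def d p mult_ac)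
  next
    case False
    have s: "swp (cs r Z) = cs r (swp Z)" by (simp add: HC_eq_iff)
    have "Fc a (int i) (int j) (cs r (swp Z)) = r powi (- int a) * Fc a (int i) (int j) (swp Z)" using Z r False by (intro Fc_cs) simp_all
    moreover have "det (cs r (swp Z)) = det (cs r Z)" by (simp only: det_cs det_swp)
    ultimately show ?thesis using False by (simp only: eb_def prod.case if_False phi_def bfun_def s d p mult_ac)
  qed
  finally show ?thesis unfolding scaleR_cs r_def[symmetric] e_def[symmetric] by (simp only: mult.assoc)
qed

lemma kernel_on_basis:
  assumes K: "reproduces \<tau> K W T" and R: "R > 0" and W: "if \<tau> then W$1$1 \<noteq> 0 else W$2$2 \<noteq> 0"
    and kern: "\<And>Z. Z \<in> UU \<Longrightarrow> of_real (R ^ 4) * det Z ^ 2 * kern (R *\<^sub>R Z) (R *\<^sub>R W) = K Z"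
    and T: "\<And>\<sigma> d i j k. cls (\<sigma>, Suc d, i, j, k) = c \<longleftrightarrow> \<sigma> = \<tau> \<and> T d k"
    and x: "x \<in> IX"
  shows "dV_integrable R (\<lambda>Z. kern Z (R *\<^sub>R W) * tb x Z) \<and>
    kernel_operator R kern (tb x) (R *\<^sub>R W) = (if cls x = c then tb x (R *\<^sub>R W) else 0)"
proof -
  obtain \<sigma> a i j k where xe: "x = (\<sigma>, a, i, j, k)" by (cases x)
  obtain d where d: "a = Suc d" "d \<ge> 1" using x by (cases a) (auto simp: xe IX_def)
  define \<mu> where "\<mu> = tau_norm x * of_real R powi (2 * k - int a)"
  have f: "tb x (R *\<^sub>R Z) = \<mu> * (bterm \<sigma> d i j k Z)" if "Z \<in> UU" for Z
    unfolding \<mu>_def xe d(1)[symmetric] using x UU_D(10,11)[OF that] by (intro tb_scaleR[OF _ R]) (simp_all add: xe)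
  note dr = dV_reproduces[where kern = "\<lambda>Z. kern Z (R *\<^sub>R W)" and f = "tb x", OF K R d(2) kern f]
  have "kernel_operator R kern (tb x) (R *\<^sub>R W) = \<mu> * (if \<sigma> = \<tau> \<and> T d k then bterm \<sigma> d i j k W else 0)"
    unfolding kernel_operator_def by (rule dr(2))
  also have "\<dots> = (if cls x = c then tb x (R *\<^sub>R W) else 0)"
  proof (cases "\<sigma> = \<tau> \<and> T d k")
    case True
    have "tb x (R *\<^sub>R W) = \<mu> * (bterm \<sigma> d i j k W)"
      unfolding \<mu>_def xe d(1)[symmetric] using x W True by (intro tb_scaleR[OF _ R]) (simp_all add: xe)
    moreover have "cls x = c" using T[of \<sigma> d i j k] True by (simp add: xe d)
    ultimately show ?thesis using True by simp
  next
    case False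
    hence n: "cls x \<noteq> c" using T[of \<sigma> d i j k] by (simp add: xe d)
    show ?thesis unfolding if_not_P[OF False] if_not_P[OF n] by simp
  qed
  finally show ?thesis using dr(1) by simp
qed

lemma cls_conditions:
  "cls (\<sigma>, Suc d, i, j, k) = 0 \<longleftrightarrow> \<sigma> = True \<and> k < 0"
  "cls (\<sigma>, Suc d, i, j, k) = 1 \<longleftrightarrow> \<sigma> = True \<and> (0 \<le> k \<and> k < int d)"
  "cls (\<sigma>, Suc d, i, j, k) = 2 \<longleftrightarrow> \<sigma> = True \<and> int d \<le> k"
  "cls (\<sigma>, Suc d, i, j, k) = 3 \<longleftrightarrow> \<sigma> = False \<and> k < 0"
  "cls (\<sigma>, Suc d, i, j, k) = 4 \<longleftrightarrow> \<sigma> = False \<and> (0 \<le> k \<and> k < int d)"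
  "cls (\<sigma>, Suc d, i, j, k) = 5 \<longleftrightarrow> \<sigma> = False \<and> int d \<le> k"
  by (auto simp: cls_def det_type_def)

lemma scaled_Gamma_minusE:
  assumes "W \<in> scaled R {X\<in>Gamma_minus. P X}"
  obtains g l1 l2 V where "minus_point g l1 l2 V" "W = R *\<^sub>R V" "P V" "V$1$1 \<noteq> 0"
proof -
  obtain V where V: "V \<in> Gamma_minus" "W = R *\<^sub>R V" "P V" using assms by (auto simp: scaled_def)
  obtain g l1 l2 where m: "minus_point g l1 l2 V" using Gamma_minusE[OF V(1)] .
  show ?thesis by (rule that[OF m V(2,3) minus_point.W_nonzero(1)[OF m]])
qed

lemma scaled_Gamma_plusE:
  assumes "W \<in> scaled R {X\<in>Gamma_plus. P X}"
  obtains g l1 l2 V where "minus_point g l1 l2 V" "W = R *\<^sub>R swp V" "P (swp V)" "swp V$2$2 \<noteq> 0"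
proof -
  obtain V where V: "V \<in> Gamma_plus" "W = R *\<^sub>R V" "P V" using assms by (auto simp: scaled_def)
  obtain g l1 l2 where m: "minus_point g l1 l2 (swp V)" using Gamma_minusE[OF Gamma_plus_swp[OF V(1)]] .
  show ?thesis by (rule that[OF m]) (use V minus_point.W_nonzero(1)[OF m] in simp_all)
qed

theorem theorem9:
  fixes R :: real
  assumes "R > 0"
  shows
    "provides_projector R (\<lambda>Z W. det (Z - W) powi (-2))
       (scaled R Gamma_minus) D_minus_minus
   \<and> provides_projector R (\<lambda>Z W. det (Z - W) powi (-2))
       (scaled R Gamma_plus) D_plus_plus
   \<and> provides_projector R
       (\<lambda>Z W. let (l1, l2) = eigs_minus (W ** matrix_inv Z)
               in - (det Z powi (-2)) * l1 / ((l1 - l2) * (1 - l1 * l2) * (1 - l1)\<^sup>2))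
       (scaled R {X \<in> Gamma_minus. cmod (det X) > 1}) Dh_less
   \<and> provides_projector R
       (\<lambda>Z W. let (l1, l2) = eigs_minus (W ** matrix_inv Z)
               in det Z powi (-2) * l2 / ((l1 - l2) * (1 - l1 * l2) * (1 - l2)\<^sup>2))
       (scaled R {X \<in> Gamma_minus. cmod (det X) < 1}) Dh_greater
   \<and> provides_projector R
       (\<lambda>Z W. let (l1, l2) = eigs_plus (W ** matrix_inv Z)
               in det Z powi (-2) * l2 / ((l1 - l2) * (1 - l1 * l2) * (1 - l2)\<^sup>2))
       (scaled R {X \<in> Gamma_plus. cmod (det X) > 1}) Da_less
   \<and> provides_projector R
       (\<lambda>Z W. let (l1, l2) = eigs_plus (W ** matrix_inv Z)
               in - (det Z powi (-2)) * l1 / ((l1 - l2) * (1 - l1 * l2) * (1 - l1)\<^sup>2))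
       (scaled R {X \<in> Gamma_plus. cmod (det X) < 1}) Da_greater"
proof -
  have D: "Dh_less = Dc 0" "D_minus_minus = Dc 1" "Dh_greater = Dc 2" "Da_less = Dc 3" "D_plus_plus = Dc 4" "Da_greater = Dc 5"
    by (simp_all add: Dc_def)
  have S: "scaled R Gamma_minus = scaled R {X\<in>Gamma_minus. True}" "scaled R Gamma_plus = scaled R {X\<in>Gamma_plus. True}" by simp_all
  let ?Q = "\<lambda>(Z :: HC) W. det (Z - W) powi (-2)"
  let ?A = "\<lambda>(Z :: HC) W. let (l1, l2) = eigs_minus (W ** matrix_inv Z) in - (det Z powi (-2)) * l1 / ((l1 - l2) * (1 - l1 * l2) * (1 - l1)\<^sup>2)"
  let ?B = "\<lambda>(Z :: HC) W. let (l1, l2) = eigs_minus (W ** matrix_inv Z) in det Z powi (-2) * l2 / ((l1 - l2) * (1 - l1 * l2) * (1 - l2)\<^sup>2)"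
  let ?C = "\<lambda>(Z :: HC) W. let (l1, l2) = eigs_plus (W ** matrix_inv Z) in det Z powi (-2) * l2 / ((l1 - l2) * (1 - l1 * l2) * (1 - l2)\<^sup>2)"
  let ?E = "\<lambda>(Z :: HC) W. let (l1, l2) = eigs_plus (W ** matrix_inv Z) in - (det Z powi (-2)) * l1 / ((l1 - l2) * (1 - l1 * l2) * (1 - l1)\<^sup>2)"
  have P1: "provides_projector R ?Q (scaled R {X\<in>Gamma_minus. True}) (Dc 1)"
  proof (rule provides_projectorI)
    fix W x assume W: "W \<in> scaled R {X\<in>Gamma_minus. True}" and x: "x \<in> IX"
    obtain g l1 l2 V where V: "minus_point g l1 l2 V" "W = R *\<^sub>R V" "True" "V$1$1 \<noteq> 0"
      using scaled_Gamma_minusE[OF W] .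
    show "dV_integrable R (\<lambda>Z. ?Q Z W * tb x Z) \<and> kernel_operator R ?Q (tb x) W = (if cls x = 1 then tb x W else 0)"
      unfolding V(2)
    proof (rule kernel_on_basis[where kern = "?Q", OF minus_point.reproduces_square[OF V(1)] assms _ _ cls_conditions(2) x])
      show "if True then V$1$1 \<noteq> 0 else V$2$2 \<noteq> 0" using V(4) by simp
    qed (rule kernel_form_square[OF assms])
  qed simp
  have P2: "provides_projector R ?Q (scaled R {X\<in>Gamma_plus. True}) (Dc 4)"
  proof (rule provides_projectorI)
    fix W x assume W: "W \<in> scaled R {X\<in>Gamma_plus. True}" and x: "x \<in> IX"
    obtain g l1 l2 V where V: "minus_point g l1 l2 V" "W = R *\<^sub>R swp V" "True" "swp V$2$2 \<noteq> 0"
      using scaled_Gamma_plusE[OF W] .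
    show "dV_integrable R (\<lambda>Z. ?Q Z W * tb x Z) \<and> kernel_operator R ?Q (tb x) W = (if cls x = 4 then tb x W else 0)"
      unfolding V(2)
    proof (rule kernel_on_basis[where kern = "?Q", OF reproduces_swp[OF minus_point.reproduces_square[OF V(1)]] assms _ _ cls_conditions(5) x])
      show "if False then swp V$1$1 \<noteq> 0 else swp V$2$2 \<noteq> 0" using V(4) by simp
    qed (unfold kap_swp, rule kernel_form_square[OF assms])
  qed simp
  have P3: "provides_projector R ?A (scaled R {X\<in>Gamma_minus. 1 < cmod (det X)}) (Dc 0)"
  proof (rule provides_projectorI)
    fix W x assume W: "W \<in> scaled R {X\<in>Gamma_minus. 1 < cmod (det X)}" and x: "x \<in> IX"
    obtain g l1 l2 V where V: "minus_point g l1 l2 V" "W = R *\<^sub>R V" "1 < cmod (det V)" "V$1$1 \<noteq> 0"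
      using scaled_Gamma_minusE[OF W] .
    show "dV_integrable R (\<lambda>Z. ?A Z W * tb x Z) \<and> kernel_operator R ?A (tb x) W = (if cls x = 0 then tb x W else 0)"
      unfolding V(2)
    proof (rule kernel_on_basis[where kern = "?A", OF minus_point.reproduces_less[OF V(1,3)] assms _ _ cls_conditions(1) x])
      show "if True then V$1$1 \<noteq> 0 else V$2$2 \<noteq> 0" using V(4) by simp
    qed (rule minus_point.kernel_form(1)[OF V(1) assms])
  qed simp
  have P4: "provides_projector R ?B (scaled R {X\<in>Gamma_minus. cmod (det X) < 1}) (Dc 2)"
  proof (rule provides_projectorI)
    fix W x assume W: "W \<in> scaled R {X\<in>Gamma_minus. cmod (det X) < 1}" and x: "x \<in> IX"
    obtain g l1 l2 V where V: "minus_point g l1 l2 V" "W = R *\<^sub>R V" "cmod (det V) < 1" "V$1$1 \<noteq> 0"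
      using scaled_Gamma_minusE[OF W] .
    show "dV_integrable R (\<lambda>Z. ?B Z W * tb x Z) \<and> kernel_operator R ?B (tb x) W = (if cls x = 2 then tb x W else 0)"
      unfolding V(2)
    proof (rule kernel_on_basis[where kern = "?B", OF minus_point.reproduces_greater[OF V(1,3)] assms _ _ cls_conditions(3) x])
      show "if True then V$1$1 \<noteq> 0 else V$2$2 \<noteq> 0" using V(4) by simp
    qed (rule minus_point.kernel_form(2)[OF V(1) assms])
  qed simp
  have P5: "provides_projector R ?C (scaled R {X\<in>Gamma_plus. 1 < cmod (det X)}) (Dc 3)"
  proof (rule provides_projectorI)
    fix W x assume W: "W \<in> scaled R {X\<in>Gamma_plus. 1 < cmod (det X)}" and x: "x \<in> IX"
    obtain g l1 l2 V where V: "minus_point g l1 l2 V" "W = R *\<^sub>R swp V" "1 < cmod (det (swp V))" "swp V$2$2 \<noteq> 0"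
      using scaled_Gamma_plusE[OF W] .
    have V3: "1 < cmod (det V)" using V(3) by simp
    show "dV_integrable R (\<lambda>Z. ?C Z W * tb x Z) \<and> kernel_operator R ?C (tb x) W = (if cls x = 3 then tb x W else 0)"
      unfolding V(2)
    proof (rule kernel_on_basis[where kern = "?C", OF reproduces_swp[OF minus_point.reproduces_less[OF V(1) V3]] assms _ _ cls_conditions(4) x])
      show "if False then swp V$1$1 \<noteq> 0 else swp V$2$2 \<noteq> 0" using V(4) by simp
    qed (unfold det_swp, rule minus_point.kernel_form(3)[OF V(1) assms swp_UU, unfolded swp_swp det_swp])
  qed simp
  have P6: "provides_projector R ?E (scaled R {X\<in>Gamma_plus. cmod (det X) < 1}) (Dc 5)"
  proof (rule provides_projectorI)
    fix W x assume W: "W \<in> scaled R {X\<in>Gamma_plus. cmod (det X) < 1}" and x: "x \<in> IX"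
    obtain g l1 l2 V where V: "minus_point g l1 l2 V" "W = R *\<^sub>R swp V" "cmod (det (swp V)) < 1" "swp V$2$2 \<noteq> 0"
      using scaled_Gamma_plusE[OF W] .
    have V3: "cmod (det V) < 1" using V(3) by simp
    show "dV_integrable R (\<lambda>Z. ?E Z W * tb x Z) \<and> kernel_operator R ?E (tb x) W = (if cls x = 5 then tb x W else 0)"
      unfolding V(2)
    proof (rule kernel_on_basis[where kern = "?E", OF reproduces_swp[OF minus_point.reproduces_greater[OF V(1) V3]] assms _ _ cls_conditions(6) x])
      show "if False then swp V$1$1 \<noteq> 0 else swp V$2$2 \<noteq> 0" using V(4) by simp
    qed (unfold det_swp, rule minus_point.kernel_form(4)[OF V(1) assms swp_UU, unfolded swp_swp det_swp])
  qed simp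
  show ?thesis unfolding D S by (intro conjI P1 P2 P3 P4 P5 P6)
qed

end
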